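(* Let $F$ be a non-discrete locally compact non-archimedean field of characteristic $\neq 2$, with residue field of characteristic $p$ and cardinality $q$. Let $R$ be an integral domain with $p\in R^\times$, containing a square root of $q$, and let $\chi:F\to R^\times$ be a non-trivial smooth character. Let $X$ be a finite-dimensional $F$-vector space, $W=X\times X^*$, and let $\mathrm{Mp}(W)$ be the metaplectic group attached to $R$ and $\chi$, with its short exact sequence $$1\longrightarrow R^\times\longrightarrow \mathrm{Mp}(W)\overset{\pi}{\longrightarrow}\mathrm{Sp}(W)\longrightarrow 1 .$$ Let $\mathrm{char}(R)\neq 2$. Then there exists a subgroup $\mathrm{Mp}_2(W)$ of $\mathrm{Mp}(W)$ such that this sequence restricts to a short exact sequence $$1\longrightarrow \{\pm 1\}\longrightarrow \mathrm{Mp}_2(W)\longrightarrow \mathrm{Sp}(W)\longrightarrow 1$$ that does not split.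
   Context: A smooth character of $F$ is a group homomorphism $F\to R^\times$ with open kernel. $X^*=\mathrm{Hom}_F(X,F)$; $[x,x^*]=x^*(x)$ and $\langle x,x^*\rangle=\chi([x,x^*])$. On $W=X\times X^*$ put $\mathcal B((x_1,x_1^* ),(x_2,x_2^* ))=[x_1,x_2^*]$ and $\mathcal F=\chi\circ\mathcal B$. $\mathrm{Sp}(W)$ is the group of $F$-linear automorphisms $\sigma$ of $W$ preserving the form $(w_1,w_2)\mapsto\mathcal B(w_1,w_2)-\mathcal B(w_2,w_1)$. For $\sigma\in\mathrm{Sp}(W)$ put $f_\sigma(w)=\frac12(\mathcal B(\sigma w,\sigma w)-\mathcal B(w,w))$. $A(W)$ is the set $W\times R^\times$ with group law $(w_1,t_1)(w_2,t_2)=(w_1+w_2,t_1t_2\mathcal F(w_1,w_2))$; its center is $Z=\{(0,t):t\in R^\times\}$. $B_0(W)$ is the group of group automorphisms of $A(W)$ acting trivially on $Z$. $\mathcal S(X)$ is the $R$-module of locally constant compactly supported functions $X\to R$, and $\mathrm{Aut}(\mathcal S(X))$ its group of $R$-linear automorphisms. For $w=(v,v^* )\in W$ and $t\in R^\times$, $U(w,t)\in\mathrm{Aut}(\mathcal S(X))$ is $(U(w,t)\Phi)(x)=t\,\Phi(x+v)\langle x,v^*\rangle$; the map $U$ is an isomorphism from $A(W)$ onto a subgroup $\mathbb A(W)$ of $\mathrm{Aut}(\mathcal S(X))$. $\mathbb B_0(W)$ is the normalizer of $\mathbb A(W)$ in $\mathrm{Aut}(\mathcal S(X))$. The homomorphism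 $\pi_0:\mathbb B_0(W)\to B_0(W)$ sends $\mathbf s$ to conjugation by $\mathbf s$ on $\mathbb A(W)\cong A(W)$ (identified via $U$). The homomorphism $\mu:\mathrm{Sp}(W)\to B_0(W)$ sends $\sigma$ to the automorphism $(w,t)\mapsto(\sigma(w),\chi(f_\sigma(w))t)$. The metaplectic group is $\mathrm{Mp}(W)=\{(\sigma,\mathbf s)\in\mathrm{Sp}(W)\times\mathbb B_0(W):\mu(\sigma)=\pi_0(\mathbf s)\}$, and $\pi(\sigma,\mathbf s)=\sigma$. The group $R^\times$ is embedded in $\mathrm{Mp}(W)$ by $t\mapsto(\mathrm{id},t\cdot\mathrm{id}_{\mathcal S(X)})$.
   Formalization: The space X is assumed to be non-zero: for X = 0 the group Sp(W) is trivial, so every extension of it by {±1} splits and the claim fails. *)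

theory Defs
  imports
    "HOL-Analysis.Analysis"
    "HOL-Algebra.Algebra"
    "HOL-Algebra.Algebraic_Closure_Type"
    "HOL-Library.Function_Algebras"
begin

section \<open>The base field\<close>

definition field_topology :: "('f::field \<Rightarrow> real) \<Rightarrow> 'f topology"
  where "field_topology absv = Metric_space.mtopology UNIV (\<lambda>x y. absv (x - y))"

locale nonarch_local_field =
  fixes absv :: "'f::field \<Rightarrow> real"
  assumes absv_nonneg: "0 \<le> absv x"
    and absv_eq_0_iff: "absv x = 0 \<longleftrightarrow> x = 0"
    and absv_mult: "absv (x * y) = absv x * absv y"
    and absv_ultrametric: "absv (x + y) \<le> max (absv x) (absv y)"
    and nondiscrete: "field_topology absv \<noteq> discrete_topology UNIV"
    and locally_compact: "locally_compact_space (field_topology absv)"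

definition valuation_ring :: "('f::field \<Rightarrow> real) \<Rightarrow> 'f ring"
  where "valuation_ring absv = ring_of_type_algebra \<lparr>carrier := {x. absv x \<le> 1}\<rparr>"

definition residue_field :: "('f::field \<Rightarrow> real) \<Rightarrow> 'f set ring"
  where "residue_field absv = valuation_ring absv Quot {x. absv x < 1}"

text \<open>The library's \<^const>\<open>group.ord\<close> of an element of infinite order is 0.\<close>

definition ring_characteristic :: "('a, 'b) ring_scheme \<Rightarrow> nat"
  where "ring_characteristic K = group.ord (add_monoid K) \<one>\<^bsub>K\<^esub>"


section \<open>Coefficients and smooth characters\<close>

definition unit_group :: "'r::idom monoid"
  where "unit_group = units_of ring_of_type_algebra"

definition sign_group :: "'r::idom monoid"
  where "sign_group = unit_group \<lparr>carrier := {1, -1}\<rparr>"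

definition smooth_character :: "('f::field \<Rightarrow> real) \<Rightarrow> ('f \<Rightarrow> 'r::idom) \<Rightarrow> bool"
  where "smooth_character absv chi \<longleftrightarrow>
    (\<forall>x. chi x \<in> carrier unit_group) \<and> (\<forall>x y. chi (x + y) = chi x * chi y) \<and>
    openin (field_topology absv) {x. chi x = 1}"


section \<open>The symplectic group\<close>

text \<open>
  The vector space \<open>X\<close> is a whole type with scalar multiplication \<open>smul\<close>. Its dual and \<open>W\<close>
  are subsets of types, with addition and zero given by the componentwise instances for functions
  and pairs. Automorphisms of such subsets are extensional functions, as in \<^const>\<open>Bij\<close>.
\<close>

definition dual_space :: "('f::field \<Rightarrow> 'x::ab_group_add \<Rightarrow> 'x) \<Rightarrow> ('x \<Rightarrow> 'f) set"
  where "dual_space smul = {f. Vector_Spaces.linear smul (*) f}"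

definition W_space :: "('f::field \<Rightarrow> 'x::ab_group_add \<Rightarrow> 'x) \<Rightarrow> ('x \<times> ('x \<Rightarrow> 'f)) set"
  where "W_space smul = UNIV \<times> dual_space smul"

definition W_smul ::
    "('f::field \<Rightarrow> 'x::ab_group_add \<Rightarrow> 'x) \<Rightarrow> 'f \<Rightarrow> 'x \<times> ('x \<Rightarrow> 'f) \<Rightarrow> 'x \<times> ('x \<Rightarrow> 'f)"
  where "W_smul smul c w = (smul c (fst w), \<lambda>x. c * snd w x)"

definition B_form :: "'x \<times> ('x \<Rightarrow> 'f) \<Rightarrow> 'x \<times> ('x \<Rightarrow> 'f) \<Rightarrow> 'f"
  where "B_form w\<^sub>1 w\<^sub>2 = snd w\<^sub>2 (fst w\<^sub>1)"

definition Sp :: "('f::field \<Rightarrow> 'x::ab_group_add \<Rightarrow> 'x) \<Rightarrow>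
    ('x \<times> ('x \<Rightarrow> 'f) \<Rightarrow> 'x \<times> ('x \<Rightarrow> 'f)) monoid"
  where "Sp smul = BijGroup (W_space smul) \<lparr>carrier := {\<sigma> \<in> Bij (W_space smul).
    (\<forall>w\<^sub>1\<in>W_space smul. \<forall>w\<^sub>2\<in>W_space smul. \<sigma> (w\<^sub>1 + w\<^sub>2) = \<sigma> w\<^sub>1 + \<sigma> w\<^sub>2) \<and>
    (\<forall>c. \<forall>w\<in>W_space smul. \<sigma> (W_smul smul c w) = W_smul smul c (\<sigma> w)) \<and>
    (\<forall>w\<^sub>1\<in>W_space smul. \<forall>w\<^sub>2\<in>W_space smul.
      B_form (\<sigma> w\<^sub>1) (\<sigma> w\<^sub>2) - B_form (\<sigma> w\<^sub>2) (\<sigma> w\<^sub>1) = B_form w\<^sub>1 w\<^sub>2 - B_form w\<^sub>2 w\<^sub>1)}\<rparr>"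

definition f_quad ::
    "('x \<times> ('x \<Rightarrow> 'f::field) \<Rightarrow> 'x \<times> ('x \<Rightarrow> 'f)) \<Rightarrow> 'x \<times> ('x \<Rightarrow> 'f) \<Rightarrow> 'f"
  where "f_quad \<sigma> w = 1 / 2 * (B_form (\<sigma> w) (\<sigma> w) - B_form w w)"


section \<open>The Heisenberg group and its automorphisms\<close>

definition A_group :: "('f::field \<Rightarrow> 'x::ab_group_add \<Rightarrow> 'x) \<Rightarrow> ('f \<Rightarrow> 'r::idom) \<Rightarrow>
    (('x \<times> ('x \<Rightarrow> 'f)) \<times> 'r) monoid"
  where "A_group smul chi =
    \<lparr>carrier = W_space smul \<times> carrier unit_group,
     mult = \<lambda>(w\<^sub>1, t\<^sub>1) (w\<^sub>2, t\<^sub>2). (w\<^sub>1 + w\<^sub>2, t\<^sub>1 * t\<^sub>2 * chi (B_form w\<^sub>1 w\<^sub>2)),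
     one = (0, 1)\<rparr>"

text \<open>\<open>B0_group\<close> is the codomain of \<open>mu\<close> and \<open>pi0\<close> below; equality in it is equality of functions.\<close>

definition B0_group :: "('f::field \<Rightarrow> 'x::ab_group_add \<Rightarrow> 'x) \<Rightarrow> ('f \<Rightarrow> 'r::idom) \<Rightarrow>
    (('x \<times> ('x \<Rightarrow> 'f)) \<times> 'r \<Rightarrow> ('x \<times> ('x \<Rightarrow> 'f)) \<times> 'r) monoid"
  where "B0_group smul chi = AutoGroup (A_group smul chi)
    \<lparr>carrier := {\<phi> \<in> auto (A_group smul chi). \<forall>t\<in>carrier unit_group. \<phi> (0, t) = (0, t)}\<rparr>"

definition mu :: "('f::field \<Rightarrow> 'x::ab_group_add \<Rightarrow> 'x) \<Rightarrow> ('f \<Rightarrow> 'r::idom) \<Rightarrow>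
    ('x \<times> ('x \<Rightarrow> 'f) \<Rightarrow> 'x \<times> ('x \<Rightarrow> 'f)) \<Rightarrow>
    ('x \<times> ('x \<Rightarrow> 'f)) \<times> 'r \<Rightarrow> ('x \<times> ('x \<Rightarrow> 'f)) \<times> 'r"
  where "mu smul chi \<sigma> = (\<lambda>(w, t)\<in>carrier (A_group smul chi). (\<sigma> w, chi (f_quad \<sigma> w) * t))"


section \<open>The Schwartz space and the operators \<open>U\<close>\<close>

text \<open>
  The topology of \<open>X\<close> is the coarsest one making all linear functionals continuous. Since \<open>X\<close> is
  finite-dimensional, it is the product topology in the coordinates of any basis.
\<close>

definition X_topology ::
    "('f::field \<Rightarrow> real) \<Rightarrow> ('f \<Rightarrow> 'x::ab_group_add \<Rightarrow> 'x) \<Rightarrow> 'x topology"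
  where "X_topology absv smul = topology_generated_by
    {f -` V |f V. f \<in> dual_space smul \<and> openin (field_topology absv) V}"

definition Schwartz_space ::
    "('f::field \<Rightarrow> real) \<Rightarrow> ('f \<Rightarrow> 'x::ab_group_add \<Rightarrow> 'x) \<Rightarrow> ('x \<Rightarrow> 'r::idom) set"
  where "Schwartz_space absv smul = {\<Phi>.
    (\<forall>x. \<exists>V. openin (X_topology absv smul) V \<and> x \<in> V \<and> (\<forall>y\<in>V. \<Phi> y = \<Phi> x)) \<and>
    compactin (X_topology absv smul) (X_topology absv smul closure_of {x. \<Phi> x \<noteq> 0})}"

definition Aut_Schwartz :: "('f::field \<Rightarrow> real) \<Rightarrow> ('f \<Rightarrow> 'x::ab_group_add \<Rightarrow> 'x) \<Rightarrow>
    (('x \<Rightarrow> 'r::idom) \<Rightarrow> 'x \<Rightarrow> 'r) monoid"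
  where "Aut_Schwartz absv smul = BijGroup (Schwartz_space absv smul)
    \<lparr>carrier := {T \<in> Bij (Schwartz_space absv smul).
      (\<forall>\<Phi>\<in>Schwartz_space absv smul. \<forall>\<Psi>\<in>Schwartz_space absv smul. T (\<Phi> + \<Psi>) = T \<Phi> + T \<Psi>) \<and>
      (\<forall>r. \<forall>\<Phi>\<in>Schwartz_space absv smul. T (\<lambda>x. r * \<Phi> x) = (\<lambda>x. r * T \<Phi> x))}\<rparr>"

definition U_op :: "('f::field \<Rightarrow> real) \<Rightarrow> ('f \<Rightarrow> 'x::ab_group_add \<Rightarrow> 'x) \<Rightarrow> ('f \<Rightarrow> 'r::idom) \<Rightarrow>
    ('x \<times> ('x \<Rightarrow> 'f)) \<times> 'r \<Rightarrow> ('x \<Rightarrow> 'r) \<Rightarrow> 'x \<Rightarrow> 'r"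
  where "U_op absv smul chi = (\<lambda>((v, v'), t).
    \<lambda>\<Phi>\<in>Schwartz_space absv smul. \<lambda>x. t * \<Phi> (x + v) * chi (v' x))"

definition BB0_group :: "('f::field \<Rightarrow> real) \<Rightarrow> ('f \<Rightarrow> 'x::ab_group_add \<Rightarrow> 'x) \<Rightarrow> ('f \<Rightarrow> 'r::idom) \<Rightarrow>
    (('x \<Rightarrow> 'r) \<Rightarrow> 'x \<Rightarrow> 'r) monoid"
  where "BB0_group absv smul chi = Aut_Schwartz absv smul
    \<lparr>carrier := normalizer (Aut_Schwartz absv smul)
      (U_op absv smul chi ` carrier (A_group smul chi))\<rparr>"

text \<open>
  Conjugation is \<open>a \<mapsto> s a s\<^sup>-\<^sup>1\<close>, which makes \<open>pi0\<close>, as well as \<open>mu\<close>, multiplicative for composition of maps.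
\<close>

definition pi0 :: "('f::field \<Rightarrow> real) \<Rightarrow> ('f \<Rightarrow> 'x::ab_group_add \<Rightarrow> 'x) \<Rightarrow> ('f \<Rightarrow> 'r::idom) \<Rightarrow>
    (('x \<Rightarrow> 'r) \<Rightarrow> 'x \<Rightarrow> 'r) \<Rightarrow> ('x \<times> ('x \<Rightarrow> 'f)) \<times> 'r \<Rightarrow> ('x \<times> ('x \<Rightarrow> 'f)) \<times> 'r"
  where "pi0 absv smul chi s = (\<lambda>a\<in>carrier (A_group smul chi).
    inv_into (carrier (A_group smul chi)) (U_op absv smul chi)
      (s \<otimes>\<^bsub>Aut_Schwartz absv smul\<^esub> U_op absv smul chi a
         \<otimes>\<^bsub>Aut_Schwartz absv smul\<^esub> inv\<^bsub>Aut_Schwartz absv smul\<^esub> s))"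


section \<open>The metaplectic group\<close>

definition Mp :: "('f::field \<Rightarrow> real) \<Rightarrow> ('f \<Rightarrow> 'x::ab_group_add \<Rightarrow> 'x) \<Rightarrow> ('f \<Rightarrow> 'r::idom) \<Rightarrow>
    (('x \<times> ('x \<Rightarrow> 'f) \<Rightarrow> 'x \<times> ('x \<Rightarrow> 'f)) \<times> (('x \<Rightarrow> 'r) \<Rightarrow> 'x \<Rightarrow> 'r)) monoid"
  where "Mp absv smul chi = (Sp smul \<times>\<times> BB0_group absv smul chi)
    \<lparr>carrier := {(\<sigma>, s). \<sigma> \<in> carrier (Sp smul) \<and> s \<in> carrier (BB0_group absv smul chi) \<and>
      mu smul chi \<sigma> = pi0 absv smul chi s}\<rparr>"

definition Mp_proj :: "('x \<times> ('x \<Rightarrow> 'f) \<Rightarrow> 'x \<times> ('x \<Rightarrow> 'f)) \<times> (('x \<Rightarrow> 'r) \<Rightarrow> 'x \<Rightarrow> 'r) \<Rightarrow>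
    'x \<times> ('x \<Rightarrow> 'f) \<Rightarrow> 'x \<times> ('x \<Rightarrow> 'f)"
  where "Mp_proj = fst"

definition Mp_incl :: "('f::field \<Rightarrow> real) \<Rightarrow> ('f \<Rightarrow> 'x::ab_group_add \<Rightarrow> 'x) \<Rightarrow> 'r::idom \<Rightarrow>
    ('x \<times> ('x \<Rightarrow> 'f) \<Rightarrow> 'x \<times> ('x \<Rightarrow> 'f)) \<times> (('x \<Rightarrow> 'r) \<Rightarrow> 'x \<Rightarrow> 'r)"
  where "Mp_incl absv smul t =
    (\<lambda>w\<in>W_space smul. w, \<lambda>\<Phi>\<in>Schwartz_space absv smul. \<lambda>x. t * \<Phi> x)"


section \<open>Short exact sequences\<close>

text \<open>
  The library's \<open>short_exact_sequence\<close> requires all groups to have elements of one type; this is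
  its characterisation \<open>short_exact_sequence_iff\<close> with three types, in the order
  \<open>1 \<rightarrow> A \<rightarrow> B \<rightarrow> C \<rightarrow> 1\<close>.
\<close>

definition short_exact ::
    "('a, 'm) monoid_scheme \<Rightarrow> ('b, 'n) monoid_scheme \<Rightarrow> ('c, 'k) monoid_scheme \<Rightarrow>
     ('a \<Rightarrow> 'b) \<Rightarrow> ('b \<Rightarrow> 'c) \<Rightarrow> bool"
  where "short_exact A B C f g \<longleftrightarrow> group A \<and> group B \<and> group C \<and>
    f \<in> mon A B \<and> g \<in> epi B C \<and> f ` carrier A = kernel B C g"

definition splits ::
    "('b, 'n) monoid_scheme \<Rightarrow> ('c, 'k) monoid_scheme \<Rightarrow> ('b \<Rightarrow> 'c) \<Rightarrow> bool"
  where "splits B C g \<longleftrightarrow> (\<exists>h\<in>hom C B. \<forall>c\<in>carrier C. g (h c) = c)"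

end

theory Submission
 imports Defs "Jordan_Normal_Form.Char_Poly"
begin

text \<open>
 The sequence is split by a character. On the big cell of the symplectic group, where
 \<open>f = n(b) m(\<beta>) w n(b')\<close>, put \<open>r f = N\<^sub>b M\<^sub>\<beta> F N\<^sub>b\<^sub>'\<close> with \<open>F\<close> the Fourier transform; then
 \<open>r f \<circ> r g = \<gamma>(b' + c) r (f \<circ> g)\<close>, where \<open>\<gamma>\<close> is the Gauss sum of a quadratic form. If \<open>H\<close> is the character
 \<open>a \<mapsto> |a| \<eta>(det a)\<close> of the general linear group with \<open>\<eta> d = |d| \<gamma>(d)\<^sup>2 / \<gamma>(1)\<^sup>2\<close>, then \<open>H B \<gamma>(B)\<^sup>2 = \<gamma>(1)\<^sup>2\<close> for symmetric
 \<open>B\<close>, so that \<open>t r f \<mapsto> t\<^sup>2 \<gamma>(1)\<^sup>2 H \<beta>\<close> is multiplicative on the big cell and extends to the metaplectic group. It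
 is \<open>t \<mapsto> t\<^sup>2\<close> on scalars, and its values are squares because symmetric maps generate the general linear group;
 its kernel is the required subgroup. That \<open>\<eta>\<close> is a quadratic character follows from the transformation law of
 \<open>\<gamma>\<close> once sums of two squares are known to have index at most two in the multiplicative group.

 In a splitting, \<open>n(b)\<close> must lift to \<open>N\<^sub>b\<close>, hence \<open>m(B)\<close> to \<open>\<gamma>(B) / \<gamma>(1) M\<^sub>B\<close> for symmetric \<open>B\<close>, which makes
 \<open>\<gamma>(a) / \<gamma>(1)\<close> multiplicative in \<open>a\<close>. This fails for forms over the residue field: in odd
 characteristic the Gauss sums of \<open>x\<^sup>2\<close> and \<open>e x\<^sup>2\<close> are opposite for a nonsquare unit \<open>e\<close>, and in characteristic 2 that of an
 anisotropic binary form has the wrong sign.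
\<close>

section \<open>Non-archimedean local fields\<close>

text \<open>The coefficients form a bare domain: there is no absolute value and no complex
  conjugation, so the usual unitary normalization, after which the cocycle is an eighth root of
  unity, cannot be invoked. Instead the scalar of an operator is recorded only through its square,
  so that only the square of the cocycle \<open>gauss B\<close> has to become a coboundary, and
  \<open>H\<close> does exactly this. A value of \<open>H\<close> need not have a square root for
  formal reasons, yet lifting a symplectic map into the kernel of the character requires one. For
  symmetric \<open>B\<close> the identity itself exhibits \<open>H B\<close> as the square of the
  quotient of \<open>gauss id\<close> by \<open>gauss B\<close>, and this is why symmetric
  generators are sought. Over the complex numbers \<open>eta d\<close> is the Hilbert symbol of -1
  and \<open>d\<close>, whose multiplicativity belongs to local class field theory. Only the algebra
  obtained by adjoining a root of \<open>x^2 + 1\<close> matters, and for it a count of square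
  classes, in the field and in the rotation group, already bounds the norm index.\<close>

lemma compactin_finite_index_cover:
 assumes "compactin T S" "\<And>i. i \<in> I \<Longrightarrow> openin T (V i)" "S \<subseteq> \<Union> (V ` I)"
 obtains J where "finite J" "J \<subseteq> I" "S \<subseteq> \<Union> (V ` J)"
proof -
 have "\<exists>\<F>. finite \<F> \<and> \<F> \<subseteq> V ` I \<and> S \<subseteq> \<Union>\<F>"
  using assms(2,3) by (intro compactinD[OF assms(1)]) auto
 then obtain \<F> where \<F>: "finite \<F>" "\<F> \<subseteq> V ` I" "S \<subseteq> \<Union>\<F>"
  by blast
 from finite_subset_image[OF \<F>(1,2)] obtain J where "J \<subseteq> I" "finite J" "\<F> = V ` J"
  by blast
 with \<F>(3) that[of J] show thesis
  by simp
qed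

context nonarch_local_field
begin

declare absv_nonneg [simp] absv_eq_0_iff [simp]

lemma absv_0 [simp]: "absv 0 = 0"
 by simp

lemma absv_pos_iff [simp]: "0 < absv x \<longleftrightarrow> x \<noteq> 0"
 using absv_nonneg[of x] absv_eq_0_iff[of x] by linarith

lemma absv_1 [simp]: "absv 1 = 1"
 using absv_mult[of 1 1] absv_eq_0_iff[of 1] by simp

lemma absv_minus_one: "absv (- 1) = 1"
proof -
 have "absv (- 1) * absv (- 1) = 1"
  by (simp flip: absv_mult)
 with absv_nonneg[of "- 1"] show ?thesis
  by (metis abs_of_nonneg abs_square_eq_1 power2_eq_square)
qed

lemma absv_minus [simp]: "absv (- x) = absv x"
 using absv_mult[of "- 1" x] absv_minus_one by simp

lemma absv_diff_commute: "absv (x - y) = absv (y - x)"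
 by (metis absv_minus minus_diff_eq)

lemma absv_diff_ultrametric: "absv (x - y) \<le> max (absv x) (absv y)"
 using absv_ultrametric[of x "- y"] by simp

lemma absv_power: "absv (x ^ n) = absv x ^ n"
 by (induction n) (simp_all add: absv_mult)

lemma absv_inverse: "absv (inverse x) = inverse (absv x)"
proof (cases "x = 0")
 case False
 have "absv x * absv (inverse x) = 1"
  using False by (simp flip: absv_mult)
 then show ?thesis
  by (simp add: inverse_unique)
qed simp

lemma absv_divide: "absv (x / y) = absv x / absv y"
 by (simp add: divide_inverse absv_mult absv_inverse)

lemma absv_powi: "absv (x powi n) = absv x powi n"
 by (simp add: power_int_def absv_power absv_inverse)

lemma absv_of_nat_le: "absv (of_nat n) \<le> 1"
proof (induction n)
 case (Suc n)
 then show ?case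
  using absv_ultrametric[of 1 "of_nat n"] by simp
qed simp

lemma absv_add_eq:
 assumes "absv y < absv x"
 shows "absv (x + y) = absv x"
proof (rule antisym)
 show "absv (x + y) \<le> absv x"
  using absv_ultrametric[of x y] assms by simp
 have "absv x \<le> max (absv (x + y)) (absv y)"
  using absv_diff_ultrametric[of "x + y" y] by simp
 then show "absv x \<le> absv (x + y)"
  using assms by (auto simp: max_def split: if_splits)
qed

lemma Metric_space_absv: "Metric_space UNIV (\<lambda>x y. absv (x - y))"
proof
 fix x y z :: 'f
 have "absv (x - z) \<le> max (absv (x - y)) (absv (y - z))"
  using absv_ultrametric[of "x - y" "y - z"] by simp
 also have "\<dots> \<le> absv (x - y) + absv (y - z)"
  using absv_nonneg by simp
 finally show "absv (x - z) \<le> absv (x - y) + absv (y - z)" .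
qed (auto simp: absv_nonneg absv_diff_commute absv_eq_0_iff)

lemma topspace_field_topology [simp]: "topspace (field_topology absv) = UNIV"
 by (simp add: field_topology_def Metric_space.topspace_mtopology[OF Metric_space_absv])

lemma openin_field_topology:
 "openin (field_topology absv) V \<longleftrightarrow> (\<forall>x\<in>V. \<exists>r>0. \<forall>y. absv (y - x) < r \<longrightarrow> y \<in> V)"
 unfolding field_topology_def Metric_space.openin_mtopology[OF Metric_space_absv]
  Metric_space.mball_def[OF Metric_space_absv]
 by (simp add: subset_eq Ball_def) (metis absv_diff_commute)

lemma openin_absv_less: "openin (field_topology absv) {x. absv (x - a) < r}"
 unfolding openin_field_topology
proof safe
 fix x assume x: "absv (x - a) < r"
 then have "0 < r"
  using absv_nonneg[of "x - a"] by linarith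
 moreover have "absv (y - a) < r" if "absv (y - x) < r" for y
  using absv_ultrametric[of "y - x" "x - a"] that x by simp
 ultimately show "\<exists>r'>0. \<forall>y. absv (y - x) < r' \<longrightarrow> y \<in> {x. absv (x - a) < r}"
  by auto
qed

lemma openin_absv_le:
 assumes "0 < r"
 shows "openin (field_topology absv) {x. absv (x - a) \<le> r}"
 unfolding openin_field_topology
proof safe
 fix x assume x: "absv (x - a) \<le> r"
 have "absv (y - a) \<le> r" if "absv (y - x) < r" for y
  using absv_ultrametric[of "y - x" "x - a"] that x by simp
 then show "\<exists>r'>0. \<forall>y. absv (y - x) < r' \<longrightarrow> y \<in> {x. absv (x - a) \<le> r}"
  using assms by auto
qed

lemma openin_absv_ge: "openin (field_topology absv) {x. r < absv (x - a)}"
 unfolding openin_field_topology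
proof safe
 fix x assume x: "r < absv (x - a)"
 have "r < absv (y - a)" if "absv (y - x) < absv (x - a)" for y
  using absv_add_eq[of "y - x" "x - a"] that x by simp
 moreover have "x \<noteq> a \<Longrightarrow> absv (x - a) > 0"
  by simp
 moreover have "\<exists>r'>0. \<forall>y. absv (y - x) < r' \<longrightarrow> r < absv (y - a)" if "x = a"
  using x that absv_nonneg by (intro exI[of _ 1]) (auto intro: less_le_trans)
 ultimately show "\<exists>r'>0. \<forall>y. absv (y - x) < r' \<longrightarrow> y \<in> {x. r < absv (x - a)}"
  by (cases "x = a") (auto intro!: exI[of _ "absv (x - a)"])
qed

lemma closedin_absv_le: "closedin (field_topology absv) {x. absv (x - a) \<le> r}"
proof -
 have "topspace (field_topology absv) - {x. absv (x - a) \<le> r} = {x. r < absv (x - a)}"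
  by auto
 then show ?thesis
  unfolding closedin_def using openin_absv_ge by simp
qed

lemma exists_absv_between_0_1: "\<exists>u. u \<noteq> 0 \<and> absv u < 1"
proof (rule ccontr)
 assume "\<not> ?thesis"
 then have *: "1 \<le> absv u" if "u \<noteq> 0" for u
  using that by force
 have "y = x" if "absv (y - x) < 1" for x y
 proof (rule ccontr)
  assume "y \<noteq> x"
  then have "1 \<le> absv (y - x)"
   by (intro *) simp
  with that show False
   by simp
 qed
 then have "openin (field_topology absv) V" for V
  unfolding openin_field_topology by (intro ballI exI[of _ 1] conjI allI impI) (simp, blast)
 then have "field_topology absv = discrete_topology UNIV"
  by (metis discrete_topology_unique topspace_field_topology)
 with nondiscrete show False ..
qed

text \<open>Local compactness yields a compact neighbourhood of 0, hence a small compact ball; a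
  power \<open>z\<close> of a small element shrinks the given ball into it, and division by
  \<open>z\<close> is continuous.\<close>

lemma compactin_absv_le: "compactin (field_topology absv) {x. absv x \<le> R}"
proof -
 obtain V K where V: "openin (field_topology absv) V" "0 \<in> V" "V \<subseteq> K"
  and K: "compactin (field_topology absv) K"
  using locally_compact unfolding locally_compact_space_def topspace_field_topology by blast
 then obtain r where r: "0 < r" "\<And>y. absv y < r \<Longrightarrow> y \<in> K"
  unfolding openin_field_topology by (metis diff_zero subsetD)
 obtain u where u: "u \<noteq> 0" "absv u < 1"
  using exists_absv_between_0_1 by blast
 have "\<exists>n. absv u ^ n < r / (\<bar>R\<bar> + 1)"
  using r(1) u by (intro real_arch_pow_inv) auto
 then obtain n where n: "absv u ^ n * (\<bar>R\<bar> + 1) < r"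
  by (auto simp: pos_less_divide_eq)
 define z where "z = u ^ n"
 have z: "z \<noteq> 0"
  using u by (simp add: z_def)
 have "0 \<le> absv u ^ n"
  by simp
 then have zR: "absv z * \<bar>R\<bar> < r"
  using n unfolding z_def absv_power distrib_left by linarith
 define A where "A = {x. absv x \<le> absv z * \<bar>R\<bar>}"
 have "A \<subseteq> K"
  using r(2) zR by (auto simp: A_def)
 moreover have "closedin (field_topology absv) A"
  using closedin_absv_le[of 0] by (simp add: A_def)
 ultimately have A: "compactin (field_topology absv) A"
  by (rule closed_compactin[OF K])
 have "continuous_map (field_topology absv) (field_topology absv) (\<lambda>x. x / z)"
  unfolding continuous_map_def openin_field_topology
 proof safe
  fix V x assume "\<forall>x\<in>V. \<exists>r>0. \<forall>y. absv (y - x) < r \<longrightarrow> y \<in> V" and "x / z \<in> V"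
  then obtain d where d: "d > 0" "\<And>y. absv (y - x / z) < d \<Longrightarrow> y \<in> V"
   by blast
  have "y / z \<in> V" if "absv (y - x) < d * absv z" for y
   using that z by (intro d(2)) (simp add: absv_divide pos_divide_less_eq flip: diff_divide_distrib)
  then show "\<exists>r>0. \<forall>y. absv (y - x) < r \<longrightarrow> y \<in> {x \<in> topspace (field_topology absv). x / z \<in> V}"
   using d(1) z by (intro exI[of _ "d * absv z"]) auto
 qed auto
 from image_compactin[OF A this] have "compactin (field_topology absv) ((\<lambda>x. x / z) ` A)" .
 moreover have "(\<lambda>x. x / z) ` A = {x. absv x \<le> \<bar>R\<bar>}"
 proof -
  have "x \<in> (\<lambda>x. x / z) ` A" if "absv x \<le> \<bar>R\<bar>" for x
   using that z by (intro image_eqI[of _ _ "x * z"]) (auto simp: A_def absv_mult mult.commute mult_left_mono absv_nonneg)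
  then show ?thesis
   using z by (auto simp: A_def absv_divide pos_divide_le_eq mult.commute)
 qed
 ultimately have "compactin (field_topology absv) {x. absv x \<le> \<bar>R\<bar>}"
  by simp
 then show ?thesis
  by (rule closed_compactin) (use closedin_absv_le[of 0 R] in auto)
qed

lemma compactin_absv_less: "compactin (field_topology absv) {x. absv x < R}"
proof (rule closed_compactin[OF compactin_absv_le[of R]])
 have "topspace (field_topology absv) - {x. absv x < R} = {x. R \<le> absv (x - 0)}"
  by auto
 moreover have "openin (field_topology absv) {x. R \<le> absv (x - 0)}"
  unfolding openin_field_topology
 proof safe
  fix x assume x: "R \<le> absv (x - 0)"
  show "\<exists>r>0. \<forall>y. absv (y - x) < r \<longrightarrow> y \<in> {x. R \<le> absv (x - 0)}"
  proof (cases "x = 0")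
   case True
   then have "R \<le> 0"
    using x by simp
   then have "R \<le> absv (y - 0)" for y
    using absv_nonneg[of "y - 0"] by linarith
   then show ?thesis
    by (intro exI[of _ 1]) simp
  next
   case False
   have "R \<le> absv (y - 0)" if "absv (y - x) < absv x" for y
    using absv_add_eq[OF that] x by simp
   moreover have "0 < absv x"
    using False by simp
   ultimately show ?thesis
    by blast
  qed
 qed
 ultimately show "closedin (field_topology absv) {x. absv x < R}"
  unfolding closedin_def by simp
qed auto

definition unif :: 'f
 where "unif = (SOME u. u \<noteq> 0 \<and> absv u < 1 \<and> (\<forall>x. absv x < 1 \<longrightarrow> absv x \<le> absv u))"

text \<open>By compactness of the open unit ball the largest value below 1 is attained: otherwise
  the smaller open balls of radius \<open>absv y\<close> cover it, but the element \<open>m\<close>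
  of largest value in a finite subfamily lies in none of its balls.\<close>

lemma unif: "unif \<noteq> 0" "absv unif < 1" "absv x < 1 \<Longrightarrow> absv x \<le> absv unif"
proof -
 obtain w where w: "w \<noteq> 0" "absv w < 1"
  using exists_absv_between_0_1 by blast
 have "\<exists>u. u \<noteq> 0 \<and> absv u < 1 \<and> (\<forall>x. absv x < 1 \<longrightarrow> absv x \<le> absv u)"
 proof (rule ccontr)
  assume neg: "\<not> ?thesis"
  have "\<exists>y. absv y < 1 \<and> absv x < absv y" if "absv x < 1" for x
  proof (cases "x = 0")
   case True
   then show ?thesis
    using w by (intro exI[of _ w]) simp
  next
   case False
   then show ?thesis
    using neg that by (auto simp: not_le)
  qed
  then have "{x. absv x < 1} \<subseteq> (\<Union>y\<in>{y. absv y < 1}. {x. absv (x - 0) < absv y})"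
   by auto
  then obtain Y where Y: "finite Y" "Y \<subseteq> {y. absv y < 1}"
    "{x. absv x < 1} \<subseteq> (\<Union>y\<in>Y. {x. absv (x - 0) < absv y})"
   by (rule compactin_finite_index_cover[OF compactin_absv_less openin_absv_less])
  have "Y \<noteq> {}"
   using Y(3) w by auto
  have "finite (absv ` Y)" "absv ` Y \<noteq> {}"
   using Y(1) \<open>Y \<noteq> {}\<close> by auto
  from Max_in[OF this] Max_ge[OF this(1)] obtain m
   where m: "m \<in> Y" "\<And>y. y \<in> Y \<Longrightarrow> absv y \<le> absv m"
   by auto
  then have "m \<in> (\<Union>y\<in>Y. {x. absv (x - 0) < absv y})"
   using Y by blast
  then obtain y where "y \<in> Y" "absv m < absv y"
   by auto
  with m(2)[of y] show False
   by simp
 qed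
 from someI_ex[OF this, folded unif_def]
 show "unif \<noteq> 0" "absv unif < 1" "absv x < 1 \<Longrightarrow> absv x \<le> absv unif"
  by simp_all
qed

declare unif(1) [simp]

lemma unif_powi_neq_0 [simp]: "unif powi k \<noteq> 0"
 using unif(1) by (simp add: power_int_eq_0_iff)

lemma absv_unif_pos: "0 < absv unif"
 using unif(1) by simp

lemma absv_unif_powi_less_iff: "absv unif powi j < absv unif powi k \<longleftrightarrow> k < j"
proof -
 have *: "absv unif powi j < absv unif powi k" if "k < j" for j k :: int
  using power_int_strict_decreasing[OF that absv_unif_pos unif(2)] .
 show ?thesis
  using *[of k j] *[of j k] by (cases j k rule: linorder_cases) auto
qed

lemma absv_unif_powi_le_iff: "absv unif powi j \<le> absv unif powi k \<longleftrightarrow> k \<le> j"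
 using absv_unif_powi_less_iff[of k j] by linarith

lemma absv_eq_unif_powi:
 assumes "x \<noteq> 0"
 obtains k where "absv x = absv unif powi k"
proof -
 let ?r = "absv unif"
 have r: "0 < ?r" "?r < 1"
  using absv_unif_pos unif by auto
 obtain n where n: "?r ^ n < absv x"
  using real_arch_pow_inv[of "absv x" ?r] assms r by auto
 obtain m where "?r ^ m < inverse (absv x)"
  using real_arch_pow_inv[of "inverse (absv x)" ?r] assms r by auto
 then have m: "absv x < ?r powi (- int m)"
  using r assms by (simp add: power_int_minus field_simps)
 \<comment> \<open>The shift by \<open>m\<close> makes the exponents in question natural numbers, so
   that a least one exists; at \<open>i = 0\<close> the power still exceeds
   \<open>absv x\<close>.\<close>
 define P where "P i \<longleftrightarrow> ?r powi (int i - int m) \<le> absv x" for i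
 have ex: "P (n + m)"
  using n by (simp add: P_def power_int_def)
 define i where "i = (LEAST i. P i)"
 have i: "P i"
  unfolding i_def using ex by (rule LeastI)
 have "i \<noteq> 0"
 proof
  assume "i = 0"
  then show False
   using i m by (simp add: P_def)
 qed
 then have "\<not> P (i - 1)"
  using not_less_Least[of "i - 1" P] by (simp flip: i_def)
 then have lt: "absv x < ?r powi (int i - int m - 1)"
  using \<open>i \<noteq> 0\<close> by (simp add: P_def of_nat_diff algebra_simps)
 define k where "k = int i - int m"
 have "absv (x * unif powi (1 - k)) < 1"
 proof -
  have "absv x * ?r powi (1 - k) < ?r powi (k - 1) * ?r powi (1 - k)"
   using lt r by (intro mult_strict_right_mono) (auto simp: k_def algebra_simps)
  also have "\<dots> = 1"
   using r by (simp flip: power_int_add)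
  finally show ?thesis
   by (simp add: absv_mult absv_powi)
 qed
 from unif(3)[OF this] have "absv x * ?r powi (1 - k) \<le> ?r"
  by (simp add: absv_mult absv_powi)
 then have "absv x * ?r powi (1 - k) * ?r powi (k - 1) \<le> ?r * ?r powi (k - 1)"
  using r by (intro mult_right_mono) auto
 moreover have "?r powi (1 - k) * ?r powi (k - 1) = 1" "?r * ?r powi (k - 1) = ?r powi k"
  using r by (simp_all flip: power_int_add power_int_add_1')
 ultimately have "absv x \<le> ?r powi k"
  by (simp add: mult.assoc)
 then show ?thesis
  using i that[of k] by (auto simp: P_def k_def)
qed

text \<open>The fractional ideals; \<open>fideal 0\<close> is the valuation ring.\<close>

definition fideal :: "int \<Rightarrow> 'f set"
 where "fideal k = {x. absv x \<le> absv unif powi k}"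

lemma fideal_0 [simp]: "0 \<in> fideal k"
 by (simp add: fideal_def zero_le_power_int)

lemma fideal_add: "x \<in> fideal k \<Longrightarrow> y \<in> fideal k \<Longrightarrow> x + y \<in> fideal k"
 unfolding fideal_def using absv_ultrametric[of x y] by auto

lemma fideal_uminus [simp]: "- x \<in> fideal k \<longleftrightarrow> x \<in> fideal k"
 unfolding fideal_def by simp

lemma fideal_diff: "x \<in> fideal k \<Longrightarrow> y \<in> fideal k \<Longrightarrow> x - y \<in> fideal k"
 using fideal_add[of x k "- y"] by simp

lemma fideal_mult: "x \<in> fideal j \<Longrightarrow> y \<in> fideal k \<Longrightarrow> x * y \<in> fideal (j + k)"
 unfolding fideal_def by (simp add: absv_mult power_int_add mult_mono)

lemma fideal_sum: "(\<And>i. i \<in> I \<Longrightarrow> f i \<in> fideal k) \<Longrightarrow> sum f I \<in> fideal k"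
 by (induction I rule: infinite_finite_induct) (simp_all add: fideal_add fideal_0)

lemma fideal_antimono: "j \<le> k \<Longrightarrow> fideal k \<subseteq> fideal j"
 unfolding fideal_def using absv_unif_powi_le_iff[of k j] by auto

lemma in_fideal_int_iff: "x \<noteq> 0 \<Longrightarrow> absv x = absv unif powi j \<Longrightarrow> x \<in> fideal k \<longleftrightarrow> k \<le> j"
 unfolding fideal_def by (simp add: absv_unif_powi_le_iff)

lemma fideal_0_iff: "x \<in> fideal 0 \<longleftrightarrow> absv x \<le> 1"
 unfolding fideal_def by simp

lemma fideal_1_iff: "x \<in> fideal 1 \<longleftrightarrow> absv x < 1"
 unfolding fideal_def using unif(2) unif(3)[of x] by auto

lemma exists_fideal: "\<exists>k. x \<in> fideal k"
proof (cases "x = 0")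
 case False
 then obtain k where "absv x = absv unif powi k"
  by (rule absv_eq_unif_powi)
 then show ?thesis
  by (auto simp: fideal_def)
qed auto

lemma exists_not_fideal:
 assumes "x \<noteq> 0"
 shows "\<exists>k. x \<notin> fideal k"
proof -
 obtain k where "absv x = absv unif powi k"
  using assms by (rule absv_eq_unif_powi)
 then have "x \<notin> fideal (k + 1)"
  using assms by (subst in_fideal_int_iff) auto
 then show ?thesis ..
qed

lemma unif_mult_fideal: "unif powi i * x \<in> fideal k \<longleftrightarrow> x \<in> fideal (k - i)"
proof -
 have "0 < absv unif powi i"
  using absv_unif_pos by simp
 then show ?thesis
  using unif(1) by (simp add: fideal_def absv_mult absv_powi power_int_diff pos_le_divide_eq mult.commute)
qed

lemma openin_fideal_coset: "openin (field_topology absv) {x. x - a \<in> fideal k}"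
 using openin_absv_le[of "absv unif powi k" a] absv_unif_pos by (simp add: fideal_def)

lemma compactin_fideal: "compactin (field_topology absv) (fideal k)"
 unfolding fideal_def by (rule compactin_absv_le)

lemma openin_field_fideal:
 assumes "openin (field_topology absv) V" "x \<in> V"
 obtains k where "0 \<le> k" "\<And>y. y - x \<in> fideal k \<Longrightarrow> y \<in> V"
proof -
 obtain r where r: "r > 0" "\<And>y. absv (y - x) < r \<Longrightarrow> y \<in> V"
  using assms unfolding openin_field_topology by blast
 obtain n where "absv unif ^ n < r"
  using real_arch_pow_inv[of r "absv unif"] r(1) unif by auto
 then have "y \<in> V" if "y - x \<in> fideal (int n)" for y
  using that by (intro r(2)) (simp add: fideal_def)
 then show ?thesis
  using that[of "int n"] by simp
qed

lemma exists_finite_coset_cover: "\<exists>T. finite T \<and> (\<forall>x\<in>fideal j. \<exists>t\<in>T. x - t \<in> fideal k)"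
proof -
 have "fideal j \<subseteq> (\<Union>a\<in>UNIV. {x. x - a \<in> fideal k})"
 proof
  fix x
  have "x \<in> {y. y - x \<in> fideal k}"
   by simp
  then show "x \<in> (\<Union>a\<in>UNIV. {x. x - a \<in> fideal k})"
   by blast
 qed
 then obtain T where "finite T" "fideal j \<subseteq> (\<Union>a\<in>T. {x. x - a \<in> fideal k})"
  by (rule compactin_finite_index_cover[OF compactin_fideal openin_fideal_coset])
 then show ?thesis
  by (intro exI[of _ T]) auto
qed

text \<open>Hensel's lemma for \<open>y\<^sup>2 + y = c\<close>: the iteration \<open>y \<mapsto> c - y\<^sup>2\<close> is a contraction of the maximal ideal.\<close>

lemma hensel_quadratic:
 assumes "absv c < 1"
 shows "\<exists>y. absv y < 1 \<and> y\<^sup>2 + y = c"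
proof (rule ccontr)
 assume neg: "\<not> ?thesis"
 let ?e = "\<lambda>y. y\<^sup>2 + y - c"
 have approx: "\<exists>y\<in>fideal 1. ?e y \<in> fideal (int n + 1)" for n
 proof (induction n)
  case 0
  then show ?case
   using assms by (intro bexI[of _ 0]) (auto simp: fideal_1_iff)
 next
  case (Suc n)
  then obtain y where y: "y \<in> fideal 1" "?e y \<in> fideal (int n + 1)"
   by blast
  define d where "d = ?e y"
  have d1: "d \<in> fideal 1"
   using y(2) fideal_antimono[of 1 "int n + 1"] by (auto simp: d_def)
  have "?e (y - d) = d * (d - y) - y * d"
   by (simp add: d_def algebra_simps power2_eq_square)
  also have "\<dots> = (d - y - y) * d"
   by (simp add: algebra_simps)
  also have "\<dots> \<in> fideal (1 + (int n + 1))"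
   using y d1 by (intro fideal_mult fideal_diff) (auto simp: d_def)
  finally show ?case
   using y(1) d1 fideal_diff by (intro bexI[of _ "y - d"]) (auto simp: add_ac)
 qed
 \<comment> \<open>Compactness replaces completeness: without an exact root the open sets
   \<open>V n\<close> cover the maximal ideal, and a finite subcover contradicts an approximate root
   of higher precision.\<close>
 define V where "V n = {y. ?e y \<notin> fideal (int n + 1)}" for n
 have cover: "fideal 1 \<subseteq> (\<Union>n\<in>UNIV. V n)"
 proof
  fix y assume "y \<in> fideal 1"
  then have "?e y \<noteq> 0"
   using neg by (auto simp: fideal_1_iff)
  then obtain k where k: "?e y \<notin> fideal k"
   using exists_not_fideal by blast
  then have "?e y \<notin> fideal (int (nat k) + 1)"
   using fideal_antimono[of k "int (nat k) + 1"] by auto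
  then show "y \<in> (\<Union>n\<in>UNIV. V n)"
   unfolding V_def by blast
 qed
 have openV: "openin (field_topology absv) (V n)" for n
 proof -
  show ?thesis
   unfolding openin_field_topology
  proof
   fix x assume x: "x \<in> V n"
   obtain k0 where k0: "x \<in> fideal k0"
    using exists_fideal by blast
   define k where "k = min k0 0"
   have k: "x \<in> fideal k" "1 \<in> fideal k"
    using k0 fideal_antimono[of k k0] fideal_antimono[of k 0] by (auto simp: k_def fideal_0_iff)
   define m where "m = int n + 1 - k"
   have mk: "k \<le> m"
    by (auto simp: m_def k_def)
   have "y \<in> V n" if y: "y - x \<in> fideal m" for y
   proof (rule ccontr)
    assume "y \<notin> V n"
    then have *: "?e y \<in> fideal (int n + 1)"
     by (simp add: V_def)
    have "(y - x) + x + x + 1 \<in> fideal k"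
     using k y fideal_antimono[OF mk] by (intro fideal_add) auto
    from fideal_mult[OF y this] have "(y - x) * (y + x + 1) \<in> fideal (int n + 1)"
     by (simp add: m_def add_ac)
    from fideal_diff[OF * this] have "?e x \<in> fideal (int n + 1)"
     by (simp add: algebra_simps power2_eq_square)
    then show False
     using x by (simp add: V_def)
   qed
   then show "\<exists>r>0. \<forall>y. absv (y - x) < r \<longrightarrow> y \<in> V n"
    using absv_unif_pos by (intro exI[of _ "absv unif powi m"]) (auto simp: fideal_def)
  qed
 qed
 from cover obtain N where N: "finite N" "fideal 1 \<subseteq> (\<Union>n\<in>N. V n)"
  by (rule compactin_finite_index_cover[OF compactin_fideal openV])
 obtain y where y: "y \<in> fideal 1" "?e y \<in> fideal (int (Max N) + 1)"
  using approx by blast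
 then obtain n where n: "n \<in> N" "?e y \<notin> fideal (int n + 1)"
  using N(2) by (auto simp: V_def)
 then have "int n \<le> int (Max N)"
  using N(1) by simp
 then show False
  using y(2) n(2) fideal_antimono[of "int n + 1" "int (Max N) + 1"] by auto
qed

text \<open>With \<open>z^2 + z = c\<close> the root is \<open>1 + 2 * z\<close>. The factor 4 makes
  the statement uniform in the residue characteristic. The distance of the root from 1 is recorded
  because \<open>rotation_square_classes\<close> needs it.\<close>

lemma one_plus_4_square:
 assumes "absv c < 1"
 obtains y where "1 + 4 * c = y\<^sup>2" "absv (y - 1) = absv (2 * c)"
proof -
 obtain z where z: "absv z < 1" "z\<^sup>2 + z = c"
  using hensel_quadratic[OF assms] by blast
 have "1 + 4 * c = (1 + 2 * z)\<^sup>2"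
  by (simp flip: z(2) add: power2_eq_square algebra_simps)
 moreover have "absv c = absv z"
 proof -
  have "c = z * (1 + z)"
   by (simp flip: z(2) add: power2_eq_square algebra_simps)
  then show ?thesis
   using absv_add_eq[of z 1] z(1) by (simp add: absv_mult)
 qed
 ultimately show ?thesis
  using that[of "1 + 2 * z"] by (simp add: absv_mult)
qed

end

section \<open>Integration on a chain of lattices\<close>

text \<open>Integration only sees the filtration and its constant finite index, so one theory serves
  every coordinate space as well as the ideals of the field.\<close>

locale lattice_chain =
 fixes L :: "int \<Rightarrow> 'x::ab_group_add set" and N :: nat
 assumes L_0 [simp]: "0 \<in> L k"
  and L_diff: "x \<in> L k \<Longrightarrow> y \<in> L k \<Longrightarrow> x - y \<in> L k"
  and L_antimono: "j \<le> k \<Longrightarrow> L k \<subseteq> L j"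
  and L_exhausts: "\<exists>k. x \<in> L k"
  and L_index: "\<exists>T. card T = N \<and> T \<subseteq> L k \<and> (\<forall>x\<in>L k. \<exists>!t. t \<in> T \<and> x - t \<in> L (k + 1))"
  and N_pos: "0 < N"
begin

lemma L_uminus [simp]: "- x \<in> L k \<longleftrightarrow> x \<in> L k"
 using L_diff[of 0 k x] L_diff[of 0 k "- x"] by auto

lemma L_add: "x \<in> L k \<Longrightarrow> y \<in> L k \<Longrightarrow> x + y \<in> L k"
 using L_diff[of x k "- y"] by simp

lemma L_diff_commute: "x - y \<in> L k \<longleftrightarrow> y - x \<in> L k"
 by (metis L_uminus minus_diff_eq)

lemma L_diff_trans: "x - y \<in> L k \<Longrightarrow> y - z \<in> L k \<Longrightarrow> x - z \<in> L k"
 using L_add[of "x - y" k "y - z"] by simp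

lemma L_add_cancel: "y \<in> L k \<Longrightarrow> x + y \<in> L k \<longleftrightarrow> x \<in> L k"
 by (metis L_add L_diff add_diff_cancel)

section \<open>Transversals of one lattice in another\<close>

definition transversal :: "int \<Rightarrow> int \<Rightarrow> 'x set \<Rightarrow> bool"
 where "transversal j k T \<longleftrightarrow>
  finite T \<and> T \<subseteq> L j \<and> (\<forall>x\<in>L j. \<exists>!t. t \<in> T \<and> x - t \<in> L k)"

lemma transversalD:
 assumes "transversal j k T"
 shows "finite T" "t \<in> T \<Longrightarrow> t \<in> L j" "x \<in> L j \<Longrightarrow> \<exists>!t. t \<in> T \<and> x - t \<in> L k"
 using assms unfolding transversal_def by auto

lemma transversal_unique:
 assumes "transversal j k T" "s \<in> T" "t \<in> T" "s - t \<in> L k"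
 shows "s = t"
 using transversalD[OF assms(1)] assms L_0[of k] by (metis diff_self)

lemma transversal_cover:
 assumes "transversal j k T" "x \<in> L j"
 obtains t where "t \<in> T" "x - t \<in> L k"
 using transversalD(3)[OF assms] by blast

lemma transversal_bij:
 assumes "transversal j k S" "transversal j k T"
 obtains h where "bij_betw h S T" "\<And>s. s \<in> S \<Longrightarrow> s - h s \<in> L k"
proof -
 have "\<exists>t. t \<in> T \<and> s - t \<in> L k" if "s \<in> S" for s
  using transversalD(2)[OF assms(1) that] transversalD(3)[OF assms(2)] by blast
 then obtain h where h: "\<And>s. s \<in> S \<Longrightarrow> h s \<in> T" "\<And>s. s \<in> S \<Longrightarrow> s - h s \<in> L k"
  by metis
 have "inj_on h S"
 proof (rule inj_onI)
  fix s t assume st: "s \<in> S" "t \<in> S" "h s = h t"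
  then have "s - t \<in> L k"
   using h(2)[of s] h(2)[of t] L_diff_trans L_diff_commute by metis
  then show "s = t"
   using transversal_unique[OF assms(1)] st by blast
 qed
 moreover have "t \<in> h ` S" if t: "t \<in> T" for t
 proof -
  obtain s where s: "s \<in> S" "t - s \<in> L k"
   using transversal_cover[OF assms(1) transversalD(2)[OF assms(2) t]] by blast
  then have "t - h s \<in> L k"
   using h(2)[of s] L_diff_trans by blast
  then have "t = h s"
   using transversal_unique[OF assms(2) t h(1)[OF s(1)]] by blast
  then show ?thesis
   using s(1) by blast
 qed
 ultimately have "bij_betw h S T"
  using h(1) by (auto simp: bij_betw_def)
 then show thesis
  using h(2) that by blast
qed

lemma transversal_sum_eq:
 fixes f :: "'x \<Rightarrow> 'b::comm_monoid_add"
 assumes "transversal j k S" "transversal j k T"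
  and "\<And>x y. x \<in> L j \<Longrightarrow> y \<in> L j \<Longrightarrow> x - y \<in> L k \<Longrightarrow> f x = f y"
 shows "sum f S = sum f T"
proof -
 obtain h where h: "bij_betw h S T" "\<And>s. s \<in> S \<Longrightarrow> s - h s \<in> L k"
  using transversal_bij[OF assms(1,2)] by blast
 have "sum f T = sum (\<lambda>s. f (h s)) S"
  using sum.reindex_bij_betw[OF h(1), of f] by simp
 also have "\<dots> = sum f S"
  using h transversalD(2)[OF assms(1)] transversalD(2)[OF assms(2)]
  by (intro sum.cong refl assms(3)[symmetric]) (auto dest: bij_betwE)
 finally show ?thesis ..
qed

lemma transversal_card_eq:
 assumes "transversal j k S" "transversal j k T"
 shows "card S = card T"
 using transversal_bij[OF assms] bij_betw_same_card by metis

lemma transversal_refl: "transversal k k {0}"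
 unfolding transversal_def by auto

lemma transversal_trans:
 assumes S: "transversal j k S" and T: "transversal k l T" and "j \<le> k" "k \<le> l"
 shows "transversal j l ((\<lambda>(s, t). s + t) ` (S \<times> T))" "inj_on (\<lambda>(s, t). s + t) (S \<times> T)"
proof -
 have eq: "s = s' \<and> t = t'"
  if "s \<in> S" "s' \<in> S" "t \<in> T" "t' \<in> T" "(s + t) - (s' + t') \<in> L l" for s s' t t'
 proof -
  have "t - t' \<in> L k"
   using transversalD(2)[OF T] that L_diff by blast
  moreover have "(s + t) - (s' + t') \<in> L k"
   using that(5) L_antimono[OF \<open>k \<le> l\<close>] by blast
  ultimately have "((s + t) - (s' + t')) - (t - t') \<in> L k"
   by (rule L_diff[rotated])
  then have "s - s' \<in> L k"
   by (simp add: algebra_simps)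
  then have "s = s'"
   using transversal_unique[OF S] that by blast
  then show ?thesis
   using transversal_unique[OF T, of t t'] that by simp
 qed
 show "inj_on (\<lambda>(s, t). s + t) (S \<times> T)"
 proof (rule inj_onI)
  fix a b assume "a \<in> S \<times> T" "b \<in> S \<times> T" "(\<lambda>(s, t). s + t) a = (\<lambda>(s, t). s + t) b"
  then show "a = b"
   using eq[of "fst a" "fst b" "snd a" "snd b"] by (auto simp: case_prod_beta)
 qed
 show "transversal j l ((\<lambda>(s, t). s + t) ` (S \<times> T))"
  unfolding transversal_def
 proof (intro conjI ballI)
  show "finite ((\<lambda>(s, t). s + t) ` (S \<times> T))"
   using transversalD(1)[OF S] transversalD(1)[OF T] by simp
  show "(\<lambda>(s, t). s + t) ` (S \<times> T) \<subseteq> L j"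
   using transversalD(2)[OF S] transversalD(2)[OF T] L_antimono[OF \<open>j \<le> k\<close>] by (auto intro: L_add)
  fix x assume "x \<in> L j"
  then obtain s where s: "s \<in> S" "x - s \<in> L k"
   using transversal_cover[OF S] by blast
  then obtain t where t: "t \<in> T" "x - s - t \<in> L l"
   using transversal_cover[OF T] by blast
  show "\<exists>!u. u \<in> (\<lambda>(s, t). s + t) ` (S \<times> T) \<and> x - u \<in> L l"
  proof (rule ex1I[of _ "s + t"])
   show "s + t \<in> (\<lambda>(s, t). s + t) ` (S \<times> T) \<and> x - (s + t) \<in> L l"
    using s t by (auto simp: diff_diff_eq)
   fix u assume u: "u \<in> (\<lambda>(s, t). s + t) ` (S \<times> T) \<and> x - u \<in> L l"
   then obtain s' t' where st': "s' \<in> S" "t' \<in> T" "u = s' + t'"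
    by auto
   have "(s' + t') - (s + t) \<in> L l"
    using u t(2) st'(3) L_diff_trans[of u x l "s + t"] L_diff_commute by (simp add: diff_diff_eq)
   then show "u = s + t"
    using eq[OF st'(1) s(1) st'(2) t(1)] st'(3) by simp
  qed
 qed
qed

lemma exists_transversal:
 assumes "j \<le> k"
 shows "\<exists>T. transversal j k T \<and> card T = N ^ nat (k - j)"
 using assms
proof (induction k rule: int_ge_induct)
 case base
 then show ?case
  using transversal_refl by (intro exI[of _ "{0}"]) simp
next
 case (step k)
 then obtain S where S: "transversal j k S" "card S = N ^ nat (k - j)"
  by blast
 obtain T where T: "card T = N" "T \<subseteq> L k" "\<forall>x\<in>L k. \<exists>!t. t \<in> T \<and> x - t \<in> L (k + 1)"
  using L_index by metis
 then have "transversal k (k + 1) T"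
  using N_pos by (auto simp: transversal_def intro: card_ge_0_finite)
 note ST = transversal_trans[OF S(1) this step(1)]
 have "nat (k + 1 - j) = Suc (nat (k - j))"
  using step(1) by simp
 then have "card ((\<lambda>(s, t). s + t) ` (S \<times> T)) = N ^ nat (k + 1 - j)"
  using S(2) T(1) card_image[OF ST(2)] by (simp add: card_cartesian_product)
 then show ?case
  using ST(1) by auto
qed

definition reps :: "int \<Rightarrow> int \<Rightarrow> 'x set"
 where "reps j k = (SOME T. transversal j k T)"

lemma transversal_reps: "j \<le> k \<Longrightarrow> transversal j k (reps j k)"
 unfolding reps_def by (rule someI_ex) (use exists_transversal in blast)

lemma card_transversal:
 assumes "transversal j k T" "j \<le> k"
 shows "card T = N ^ nat (k - j)"
 using exists_transversal[OF assms(2)] transversal_card_eq[OF assms(1)] by metis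

lemma transversal_translate:
 assumes T: "transversal j k T" and v: "v \<in> L j"
 shows "transversal j k ((\<lambda>t. t + v) ` T)"
 unfolding transversal_def
proof (intro conjI ballI)
 show "finite ((\<lambda>t. t + v) ` T)" "(\<lambda>t. t + v) ` T \<subseteq> L j"
  using transversalD[OF T] v by (auto intro: L_add)
 fix x assume "x \<in> L j"
 then have "\<exists>!t. t \<in> T \<and> x - v - t \<in> L k"
  by (intro transversalD(3)[OF T] L_diff v)
 then obtain t where t: "t \<in> T" "x - v - t \<in> L k" "\<And>s. s \<in> T \<Longrightarrow> x - v - s \<in> L k \<Longrightarrow> s = t"
  by (elim ex1E) blast
 have e: "x - (s + v) = x - v - s" for s
  by (simp add: algebra_simps)
 show "\<exists>!u. u \<in> (\<lambda>t. t + v) ` T \<and> x - u \<in> L k"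
 proof (rule ex1I[of _ "t + v"])
  show "t + v \<in> (\<lambda>t. t + v) ` T \<and> x - (t + v) \<in> L k"
   unfolding e using t by blast
  fix u assume "u \<in> (\<lambda>t. t + v) ` T \<and> x - u \<in> L k"
  then obtain s where "u = s + v" "s \<in> T" "x - (s + v) \<in> L k"
   by blast
  then show "u = t + v"
   using t(3)[of s] by (simp add: e)
 qed
qed

section \<open>Schwartz functions of a lattice chain\<close>

definition supp_in :: "int \<Rightarrow> ('x \<Rightarrow> 'b::zero) \<Rightarrow> bool"
 where "supp_in j \<Phi> \<longleftrightarrow> (\<forall>x. x \<notin> L j \<longrightarrow> \<Phi> x = 0)"

definition inv_under :: "int \<Rightarrow> ('x \<Rightarrow> 'b) \<Rightarrow> bool"
 where "inv_under k \<Phi> \<longleftrightarrow> (\<forall>x y. y \<in> L k \<longrightarrow> \<Phi> (x + y) = \<Phi> x)"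

text \<open>For a locally constant function of compact support one lattice of periods is enough;
  \<open>Schwartz_space_eq\<close> proves the agreement with the topological definition.\<close>

definition Sch :: "('x \<Rightarrow> 'b::zero) set"
 where "Sch = {\<Phi>. \<exists>j k. supp_in j \<Phi> \<and> inv_under k \<Phi>}"

lemma supp_in_mono: "supp_in j \<Phi> \<Longrightarrow> i \<le> j \<Longrightarrow> supp_in i \<Phi>"
 unfolding supp_in_def using L_antimono by blast

lemma inv_under_mono: "inv_under k \<Phi> \<Longrightarrow> k \<le> l \<Longrightarrow> inv_under l \<Phi>"
 unfolding inv_under_def using L_antimono by blast

lemma inv_underD: "inv_under k \<Phi> \<Longrightarrow> x - y \<in> L k \<Longrightarrow> \<Phi> x = \<Phi> y"
 unfolding inv_under_def by (metis add.commute diff_add_cancel)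

lemma inv_under_translate: "inv_under k \<Phi> \<Longrightarrow> inv_under k (\<lambda>x. \<Phi> (x + v))"
 unfolding inv_under_def by (metis add.assoc add.commute)

lemma SchI: "supp_in j \<Phi> \<Longrightarrow> inv_under k \<Phi> \<Longrightarrow> \<Phi> \<in> Sch"
 unfolding Sch_def by blast

text \<open>The bounds \<open>j0\<close> and \<open>k0\<close> are free: the support index may be
  lowered and the invariance index raised to meet a second requirement.\<close>

lemma SchE:
 assumes "\<Phi> \<in> Sch"
 obtains j k where "supp_in j \<Phi>" "inv_under k \<Phi>" "j \<le> j0" "k0 \<le> k" "j \<le> k"
proof -
 obtain j k where jk: "supp_in j \<Phi>" "inv_under k \<Phi>"
  using assms unfolding Sch_def by blast
 show thesis
  by (rule that[of "min j j0" "max (max k k0) (min j j0)"])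
   (auto intro: supp_in_mono[OF jk(1)] inv_under_mono[OF jk(2)])
qed

lemma SchE2:
 assumes "\<Phi> \<in> Sch" "\<Psi> \<in> Sch"
 obtains j k where "supp_in j \<Phi>" "inv_under k \<Phi>" "supp_in j \<Psi>" "inv_under k \<Psi>" "j \<le> k"
proof -
 obtain j k where jk: "supp_in j \<Phi>" "inv_under k \<Phi>" "j \<le> k"
  using SchE[OF assms(1)] by metis
 obtain j' k' where jk': "supp_in j' \<Psi>" "inv_under k' \<Psi>" "j' \<le> j" "k \<le> k'" "j' \<le> k'"
  using SchE[OF assms(2), of j k] by metis
 show thesis
  using that[of j' k'] jk' supp_in_mono[OF jk(1)] inv_under_mono[OF jk(2)] by blast
qed

definition ind :: "int \<Rightarrow> 'x \<Rightarrow> 'b::zero_neq_one"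
 where "ind k x = (if x \<in> L k then 1 else 0)"

lemma supp_in_ind: "supp_in k (ind k)"
 by (simp add: supp_in_def ind_def)

lemma inv_under_ind: "inv_under k (ind k)"
 by (simp add: inv_under_def ind_def L_add_cancel)

lemma ind_Sch [simp]: "ind k \<in> Sch"
 by (rule SchI[OF supp_in_ind inv_under_ind])

lemma zero_Sch [simp]: "(\<lambda>x. 0) \<in> Sch"
 by (rule SchI[of 0 _ 0]) (auto simp: supp_in_def inv_under_def)

lemma add_Sch:
 fixes \<Phi> \<Psi> :: "'x \<Rightarrow> 'b::monoid_add"
 assumes "\<Phi> \<in> Sch" "\<Psi> \<in> Sch"
 shows "(\<lambda>x. \<Phi> x + \<Psi> x) \<in> Sch"
proof -
 obtain j k where "supp_in j \<Phi>" "inv_under k \<Phi>" "supp_in j \<Psi>" "inv_under k \<Psi>"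
  using SchE2[OF assms] by metis
 then show ?thesis
  by (intro SchI[of j _ k]) (auto simp: supp_in_def inv_under_def)
qed

text \<open>The multiplier need not be periodic; it suffices that on each lattice it is uniformly
  locally constant. This covers additive characters and quadratic phases.\<close>

lemma mult_Sch:
 fixes \<Phi> \<Psi> :: "'x \<Rightarrow> 'b::semiring_0"
 assumes "\<Phi> \<in> Sch" "\<And>j. \<exists>k. \<forall>x\<in>L j. \<forall>y\<in>L k. \<Psi> (x + y) = \<Psi> x"
 shows "(\<lambda>x. \<Psi> x * \<Phi> x) \<in> Sch"
proof -
 obtain j k where jk: "supp_in j \<Phi>" "inv_under k \<Phi>" "j \<le> k"
  using SchE[OF assms(1)] by metis
 obtain l where l: "\<And>x y. x \<in> L j \<Longrightarrow> y \<in> L l \<Longrightarrow> \<Psi> (x + y) = \<Psi> x"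
  using assms(2)[of j] by blast
 have "inv_under (max k l) (\<lambda>x. \<Psi> x * \<Phi> x)"
  unfolding inv_under_def
 proof (intro allI impI)
  fix x y assume y: "y \<in> L (max k l)"
  then have y': "y \<in> L k" "y \<in> L l" "y \<in> L j"
   using L_antimono[of k "max k l"] L_antimono[of l "max k l"] L_antimono[of j "max k l"] jk(3)
   by (auto simp: max_def split: if_splits)
  show "\<Psi> (x + y) * \<Phi> (x + y) = \<Psi> x * \<Phi> x"
  proof (cases "x \<in> L j")
   case True
   then show ?thesis
    using l y' jk(2) by (simp add: inv_under_def)
  next
   case False
   then have "x + y \<notin> L j"
    using L_add_cancel[OF y'(3)] by simp
   then show ?thesis
    using False jk(1) by (simp add: supp_in_def)
  qed
 qed
 moreover have "supp_in j (\<lambda>x. \<Psi> x * \<Phi> x)"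
  using jk(1) by (simp add: supp_in_def)
 ultimately show ?thesis
  by (rule SchI[rotated])
qed

lemma scale_Sch:
 fixes \<Phi> :: "'x \<Rightarrow> 'b::semiring_0"
 assumes "\<Phi> \<in> Sch"
 shows "(\<lambda>x. c * \<Phi> x) \<in> Sch"
 by (rule mult_Sch[OF assms]) auto

lemma translate_Sch:
 assumes "\<Phi> \<in> Sch"
 shows "(\<lambda>x. \<Phi> (x + v)) \<in> Sch"
proof -
 obtain i where i: "v \<in> L i"
  using L_exhausts by blast
 obtain j k where jk: "supp_in j \<Phi>" "inv_under k \<Phi>" "j \<le> i"
  using SchE[OF assms, of i] by metis
 have "v \<in> L j"
  using i L_antimono[OF jk(3)] by blast
 then have "supp_in j (\<lambda>x. \<Phi> (x + v))"
  using jk(1) L_add_cancel by (simp add: supp_in_def)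
 then show ?thesis
  using inv_under_translate[OF jk(2)] by (rule SchI)
qed

lemma sum_Sch:
 fixes f :: "'i \<Rightarrow> 'x \<Rightarrow> 'b::comm_monoid_add"
 assumes "\<And>i. i \<in> I \<Longrightarrow> f i \<in> Sch"
 shows "(\<lambda>x. \<Sum>i\<in>I. f i x) \<in> Sch"
 using assms by (induction I rule: infinite_finite_induct) (auto intro: add_Sch)

lemma Sch_decompose:
 fixes \<Phi> :: "'x \<Rightarrow> 'b::comm_semiring_1"
 assumes "supp_in j \<Phi>" "inv_under k \<Phi>" "j \<le> k" "transversal j k T"
 shows "\<Phi> = (\<lambda>x. \<Sum>t\<in>T. \<Phi> t * ind k (x - t))"
proof
 fix x
 have T: "finite T"
  using transversalD(1)[OF assms(4)] .
 show "\<Phi> x = (\<Sum>t\<in>T. \<Phi> t * ind k (x - t))"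
 proof (cases "x \<in> L j")
  case True
  then obtain s where s: "s \<in> T" "x - s \<in> L k" "\<And>t. t \<in> T \<Longrightarrow> x - t \<in> L k \<Longrightarrow> t = s"
   using transversalD(3)[OF assms(4)] by blast
  have "(\<Sum>t\<in>T. \<Phi> t * ind k (x - t)) = (\<Sum>t\<in>T. if t = s then \<Phi> s else 0)"
  proof (intro sum.cong refl)
   fix t assume t: "t \<in> T"
   show "\<Phi> t * ind k (x - t) = (if t = s then \<Phi> s else 0)"
    using s(2) s(3)[OF t] by (cases "x - t \<in> L k") (simp_all add: ind_def, blast)
  qed
  also have "\<dots> = \<Phi> s"
   using T s(1) by simp
  finally show ?thesis
   using inv_underD[OF assms(2) s(2)] by simp
 next
  case False
  have "\<Phi> t * ind k (x - t) = 0" if "t \<in> T" for t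
  proof -
   have "x - t \<notin> L k"
    using False transversalD(2)[OF assms(4) that] L_antimono[OF assms(3)] L_add_cancel[of t j "x - t"]
    by auto
   then show ?thesis
    by (simp add: ind_def)
  qed
  then show ?thesis
   using False assms(1) by (simp add: supp_in_def)
 qed
qed

text \<open>Translates of lattice indicators span the Schwartz functions, so a property stable under
  translation and linear combination has only to be checked on \<open>ind k\<close>.\<close>

lemma Sch_induct [consumes 1, case_names ind translate scale add]:
 fixes \<Phi> :: "'x \<Rightarrow> 'b::comm_semiring_1"
 assumes "\<Phi> \<in> Sch"
  and ind: "\<And>k. P (ind k)"
  and translate: "\<And>\<Phi> v. \<Phi> \<in> Sch \<Longrightarrow> P \<Phi> \<Longrightarrow> P (\<lambda>x. \<Phi> (x + v))"
  and scale: "\<And>\<Phi> c. \<Phi> \<in> Sch \<Longrightarrow> P \<Phi> \<Longrightarrow> P (\<lambda>x. c * \<Phi> x)"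
  and add: "\<And>\<Phi> \<Psi>. \<Phi> \<in> Sch \<Longrightarrow> P \<Phi> \<Longrightarrow> \<Psi> \<in> Sch \<Longrightarrow> P \<Psi> \<Longrightarrow> P (\<lambda>x. \<Phi> x + \<Psi> x)"
 shows "P \<Phi>"
proof -
 obtain j k where jk: "supp_in j \<Phi>" "inv_under k \<Phi>" "j \<le> k"
  using SchE[OF assms(1)] by metis
 have P0: "P (\<lambda>x. 0)"
  using scale[OF ind_Sch ind, of 0 0] by simp
 have P1: "P (\<lambda>x. \<Phi> t * ind k (x - t))" for t
  using scale[OF translate_Sch[OF ind_Sch] translate[OF ind_Sch ind], of "\<Phi> t" k "- t"] by simp
 have S1: "(\<lambda>x. \<Phi> t * ind k (x - t)) \<in> Sch" for t
  using scale_Sch[OF translate_Sch[OF ind_Sch], of "\<Phi> t" k "- t"] by simp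
 have "P (\<lambda>x. \<Sum>t\<in>T. \<Phi> t * ind k (x - t))" for T
 proof (induction T rule: infinite_finite_induct)
  case (insert t T)
  then show ?case
   using add[OF S1[of t] P1[of t] sum_Sch[OF S1] insert(3)] insert(1,2) by simp
 qed (auto simp: P0)
 from this[of "reps j k"] show ?thesis
  by (simp flip: Sch_decompose[OF jk transversal_reps[OF jk(3)]])
qed

end

text \<open>The second parameter \<open>iN\<close> is the inverse of the index \<open>N\<close> in the ring of coefficients.\<close>

locale lattice_integral = lattice_chain L N
 for L :: "int \<Rightarrow> 'x::ab_group_add set" and N :: nat +
 fixes iN :: "'r::idom"
 assumes iN: "of_nat N * iN = 1"
begin

text \<open>The power of \<open>N\<close> with exponent \<open>- k\<close>, which normalizes the
  measure by volume 1 for \<open>L 0\<close>. The case distinction is there because \<open>N\<close>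
  is only known to have the inverse \<open>iN\<close> in a domain.\<close>

definition vol :: "int \<Rightarrow> 'r"
 where "vol k = (if 0 \<le> k then iN ^ nat k else of_nat N ^ nat (- k))"

lemma vol_0 [simp]: "vol 0 = 1"
 by (simp add: vol_def)

lemma vol_Suc: "of_nat N * vol (k + 1) = vol k"
proof (cases "0 \<le> k")
 case True
 then have "nat (k + 1) = Suc (nat k)"
  by simp
 then show ?thesis
  using True iN by (simp add: vol_def flip: mult.assoc)
next
 case False
 then have "nat (- k) = Suc (nat (- (k + 1)))"
  by simp
 then show ?thesis
  using False by (cases "k = - 1") (auto simp: vol_def)
qed

lemma vol_diff: "j \<le> k \<Longrightarrow> of_nat N ^ nat (k - j) * vol k = vol j"
proof (induction k rule: int_ge_induct)
 case (step k)
 have "nat (k + 1 - j) = Suc (nat (k - j))"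
  using step by simp
 then have "of_nat N ^ nat (k + 1 - j) * vol (k + 1) = of_nat N ^ nat (k - j) * (of_nat N * vol (k + 1))"
  by (simp add: mult_ac)
 then show ?case
  using step vol_Suc[of k] by simp
qed simp

lemma vol_inverse: "vol k * vol (- k) = 1"
proof -
 have *: "iN ^ n * of_nat N ^ n = 1" "of_nat N ^ n * iN ^ n = 1" for n
  using iN by (simp_all add: mult.commute flip: power_mult_distrib)
 show ?thesis
  by (cases "k = 0") (auto simp: vol_def *)
qed

lemma vol_neq_0 [simp]: "vol k \<noteq> 0"
 using vol_inverse[of k] by auto

definition integ_at :: "int \<Rightarrow> int \<Rightarrow> ('x \<Rightarrow> 'r) \<Rightarrow> 'r"
 where "integ_at j k \<Phi> = vol k * sum \<Phi> (reps j k)"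

lemma integ_at_transversal:
 assumes "transversal j k T" "j \<le> k" "inv_under k \<Phi>"
 shows "integ_at j k \<Phi> = vol k * sum \<Phi> T"
 unfolding integ_at_def
 using transversal_sum_eq[OF transversal_reps[OF assms(2)] assms(1), of \<Phi>] inv_underD[OF assms(3)] by metis

lemma integ_at_extend:
 assumes "i \<le> j" "j \<le> k" "supp_in j \<Phi>" "inv_under k \<Phi>"
 shows "integ_at i k \<Phi> = integ_at j k \<Phi>"
proof -
 let ?S = "reps i j" and ?T = "reps j k"
 have S: "transversal i j ?S" and T: "transversal j k ?T"
  using transversal_reps assms by auto
 have "transversal j k {x \<in> (\<lambda>(s, t). s + t) ` (?S \<times> ?T). x \<in> L j}" (is "transversal j k ?U")
  unfolding transversal_def
 proof (intro conjI ballI)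
  show "finite ?U" "?U \<subseteq> L j"
   using transversalD(1)[OF S] transversalD(1)[OF T] by auto
  fix x assume x: "x \<in> L j"
  then have xi: "x \<in> L i"
   using L_antimono[OF assms(1)] by blast
  have "u \<in> L j" if "x - u \<in> L k" for u
   using that x L_antimono[OF assms(2)] L_add_cancel[of "x - u" j u] by auto
  then show "\<exists>!t. t \<in> ?U \<and> x - t \<in> L k"
   using transversalD(3)[OF transversal_trans(1)[OF S T assms(1,2)] xi] by blast
 qed
 then have "integ_at j k \<Phi> = vol k * sum \<Phi> ?U"
  using integ_at_transversal assms by blast
 also have "sum \<Phi> ?U = sum \<Phi> ((\<lambda>(s, t). s + t) ` (?S \<times> ?T))"
  using transversalD(1)[OF S] transversalD(1)[OF T] assms(3)
  by (intro sum.mono_neutral_left) (auto simp: supp_in_def)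
 also have "vol k * \<dots> = integ_at i k \<Phi>"
  using integ_at_transversal[OF transversal_trans(1)[OF S T assms(1,2)]] assms by simp
 finally show ?thesis ..
qed

lemma integ_at_refine:
 assumes "j \<le> k" "k \<le> l" "inv_under k \<Phi>"
 shows "integ_at j l \<Phi> = integ_at j k \<Phi>"
proof -
 let ?S = "reps j k" and ?T = "reps k l"
 have S: "transversal j k ?S" and T: "transversal k l ?T"
  using transversal_reps assms by auto
 have "integ_at j l \<Phi> = vol l * sum \<Phi> ((\<lambda>(s, t). s + t) ` (?S \<times> ?T))"
  using assms by (intro integ_at_transversal[OF transversal_trans(1)[OF S T assms(1,2)]] inv_under_mono[OF assms(3)]) auto
 also have "sum \<Phi> ((\<lambda>(s, t). s + t) ` (?S \<times> ?T)) = (\<Sum>s\<in>?S. \<Sum>t\<in>?T. \<Phi> (s + t))"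
  by (subst sum.reindex[OF transversal_trans(2)[OF S T assms(1,2)]])
   (simp add: case_prod_beta comp_def sum.cartesian_product)
 also have "\<dots> = (\<Sum>s\<in>?S. \<Sum>t\<in>?T. \<Phi> s)"
  using transversalD(2)[OF T] assms(3) by (intro sum.cong refl) (simp add: inv_under_def)
 also have "\<dots> = of_nat N ^ nat (l - k) * sum \<Phi> ?S"
  using card_transversal[OF T assms(2)] by (simp add: sum_distrib_left)
 also have "vol l * \<dots> = integ_at j k \<Phi>"
  by (simp add: integ_at_def mult_ac flip: vol_diff[OF assms(2)])
 finally show ?thesis .
qed

definition integ :: "('x \<Rightarrow> 'r) \<Rightarrow> 'r"
 where "integ \<Phi> = (THE v. \<exists>j k. j \<le> k \<and> supp_in j \<Phi> \<and> inv_under k \<Phi> \<and> v = integ_at j k \<Phi>)"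

text \<open>Any two admissible pairs of indices are compared through the smaller support index and
  the larger invariance index.\<close>

lemma integ_eq_integ_at:
 assumes "j \<le> k" "supp_in j \<Phi>" "inv_under k \<Phi>"
 shows "integ \<Phi> = integ_at j k \<Phi>"
 unfolding integ_def
proof (rule the_equality)
 show "\<exists>j' k'. j' \<le> k' \<and> supp_in j' \<Phi> \<and> inv_under k' \<Phi> \<and> integ_at j k \<Phi> = integ_at j' k' \<Phi>"
  using assms by blast
 have *: "integ_at a b \<Phi> = integ_at (min a c) (max b d) \<Phi>"
  if "a \<le> b" "supp_in a \<Phi>" "inv_under b \<Phi>" for a b c d
 proof -
  have "integ_at (min a c) (max b d) \<Phi> = integ_at a (max b d) \<Phi>"
   using that inv_under_mono[OF that(3)] by (intro integ_at_extend) auto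
  also have "\<dots> = integ_at a b \<Phi>"
   using that by (intro integ_at_refine) auto
  finally show ?thesis ..
 qed
 fix v assume "\<exists>j k. j \<le> k \<and> supp_in j \<Phi> \<and> inv_under k \<Phi> \<and> v = integ_at j k \<Phi>"
 then obtain j' k' where jk': "j' \<le> k'" "supp_in j' \<Phi>" "inv_under k' \<Phi>" "v = integ_at j' k' \<Phi>"
  by blast
 show "v = integ_at j k \<Phi>"
  using *[OF assms, of j' k'] *[OF jk'(1-3), of j k] jk'(4) by (simp add: min.commute max.commute)
qed

lemma integ_transversal:
 assumes "transversal j k T" "j \<le> k" "supp_in j \<Phi>" "inv_under k \<Phi>"
 shows "integ \<Phi> = vol k * sum \<Phi> T"
 using integ_eq_integ_at[OF assms(2-4)] integ_at_transversal[OF assms(1,2,4)] by simp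

lemma integ_add:
 assumes "\<Phi> \<in> Sch" "\<Psi> \<in> Sch"
 shows "integ (\<lambda>x. \<Phi> x + \<Psi> x) = integ \<Phi> + integ \<Psi>"
proof -
 obtain j k where jk: "supp_in j \<Phi>" "inv_under k \<Phi>" "supp_in j \<Psi>" "inv_under k \<Psi>" "j \<le> k"
  using SchE2[OF assms] by metis
 then have "supp_in j (\<lambda>x. \<Phi> x + \<Psi> x)" "inv_under k (\<lambda>x. \<Phi> x + \<Psi> x)"
  by (auto simp: supp_in_def inv_under_def)
 then show ?thesis
  using jk integ_transversal[OF transversal_reps, of j k] by (simp add: sum.distrib distrib_left)
qed

lemma integ_scale:
 assumes "\<Phi> \<in> Sch"
 shows "integ (\<lambda>x. c * \<Phi> x) = c * integ \<Phi>"
proof -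
 obtain j k where jk: "supp_in j \<Phi>" "inv_under k \<Phi>" "j \<le> k"
  using SchE[OF assms] by metis
 then have "supp_in j (\<lambda>x. c * \<Phi> x)" "inv_under k (\<lambda>x. c * \<Phi> x)"
  by (auto simp: supp_in_def inv_under_def)
 then show ?thesis
  using jk integ_transversal[OF transversal_reps, of j k] by (simp add: mult_ac flip: sum_distrib_left)
qed

lemma integ_translate:
 assumes "\<Phi> \<in> Sch"
 shows "integ (\<lambda>x. \<Phi> (x + v)) = integ \<Phi>"
proof -
 obtain i where i: "v \<in> L i"
  using L_exhausts by blast
 obtain j k where jk: "supp_in j \<Phi>" "inv_under k \<Phi>" "j \<le> i" "j \<le> k"
  using SchE[OF assms, of i] by metis
 have v: "v \<in> L j"
  using i L_antimono[OF jk(3)] by blast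
 have T: "transversal j k (reps j k)"
  using transversal_reps jk by blast
 have "integ \<Phi> = vol k * sum \<Phi> ((\<lambda>t. t + v) ` reps j k)"
  using integ_transversal[OF transversal_translate[OF T v]] jk by blast
 also have "\<dots> = vol k * sum (\<lambda>x. \<Phi> (x + v)) (reps j k)"
  by (subst sum.reindex) (auto simp: inj_on_def)
 also have "\<dots> = integ (\<lambda>x. \<Phi> (x + v))"
  using jk L_add_cancel[OF v] inv_under_translate
  by (intro integ_transversal[OF T, symmetric]) (auto simp: supp_in_def)
 finally show ?thesis ..
qed

lemma integ_ind: "integ (ind k) = vol k"
 using integ_transversal[OF transversal_refl _ supp_in_ind inv_under_ind, of k] by (simp add: ind_def)

text \<open>Translation by \<open>v\<close> preserves the integral and multiplies it by
  \<open>\<psi> v\<close>, which differs from 1.\<close>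

lemma integ_character_eq_0:
 assumes "(\<lambda>x. ind j x * \<psi> x) \<in> Sch" "\<And>x y. \<psi> (x + y) = \<psi> x * \<psi> y" "v \<in> L j" "\<psi> v \<noteq> 1"
 shows "integ (\<lambda>x. ind j x * \<psi> x) = 0"
proof -
 have "integ (\<lambda>x. ind j x * \<psi> x) = integ (\<lambda>x. ind j (x + v) * \<psi> (x + v))"
  using integ_translate[OF assms(1), of v] by simp
 also have "\<dots> = integ (\<lambda>x. \<psi> v * (ind j x * \<psi> x))"
  using assms(2,3) by (simp add: ind_def L_add_cancel mult_ac)
 also have "\<dots> = \<psi> v * integ (\<lambda>x. ind j x * \<psi> x)"
  by (rule integ_scale[OF assms(1)])
 finally have "(\<psi> v - 1) * integ (\<lambda>x. ind j x * \<psi> x) = 0"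
  by (simp add: algebra_simps)
 then show ?thesis
  using assms(4) by simp
qed

end

section \<open>Coordinates\<close>

locale coordinates =
 fixes smul :: "'f::field \<Rightarrow> 'x::ab_group_add \<Rightarrow> 'x"
  and n :: nat
  and co :: "nat \<Rightarrow> 'x \<Rightarrow> 'f"
  and bv :: "nat \<Rightarrow> 'x"
 assumes co_add [simp]: "co i (x + y) = co i x + co i y"
  and co_smul [simp]: "co i (smul c x) = c * co i x"
  and co_bv: "i < n \<Longrightarrow> j < n \<Longrightarrow> co i (bv j) = (if i = j then 1 else 0)"
  and coordinate_expansion: "x = (\<Sum>i<n. smul (co i x) (bv i))"
begin

lemma co_0 [simp]: "co i 0 = 0"
 using co_smul[of i 0 0] co_add[of i 0 0] by (metis add_cancel_right_right)

lemma co_uminus [simp]: "co i (- x) = - co i x"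
 using co_add[of i x "- x"] by (simp add: eq_neg_iff_add_eq_0 add.commute)

lemma co_diff [simp]: "co i (x - y) = co i x - co i y"
 using co_add[of i x "- y"] by simp

lemma co_sum [simp]: "co i (sum f A) = (\<Sum>a\<in>A. co i (f a))"
 by (induction A rule: infinite_finite_induct) auto

lemma co_eqI: "(\<And>i. i < n \<Longrightarrow> co i x = co i y) \<Longrightarrow> x = y"
 by (subst coordinate_expansion[of x], subst coordinate_expansion[of y]) simp

definition vec :: "(nat \<Rightarrow> 'f) \<Rightarrow> 'x"
 where "vec c = (\<Sum>i<n. smul (c i) (bv i))"

lemma co_vec [simp]: "i < n \<Longrightarrow> co i (vec c) = c i"
 by (simp add: vec_def co_bv if_distrib[of "(*) _"] cong: if_cong)

lemma smul_simps [simp]: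
 "smul 0 x = 0" "smul c 0 = 0" "smul 1 x = x" "smul (- c) x = - smul c x" "smul c (- x) = - smul c x"
 by (rule co_eqI; simp)+

lemma smul_smul: "smul c (smul d x) = smul (c * d) x"
 by (rule co_eqI) (simp add: mult.assoc)

lemma smul_distrib:
 "smul (c + d) x = smul c x + smul d x" "smul c (x + y) = smul c x + smul c y"
 "smul (c - d) x = smul c x - smul d x" "smul c (x - y) = smul c x - smul c y"
 by (rule co_eqI; simp add: algebra_simps)+

text \<open>A fixed basis identifies the dual space with the space itself, so that points of the
  symplectic space become pairs of vectors and transposes become maps of the same type.\<close>

definition dot :: "'x \<Rightarrow> 'x \<Rightarrow> 'f"
 where "dot x y = (\<Sum>i<n. co i x * co i y)"

lemma dot_commute: "dot x y = dot y x"
 by (simp add: dot_def mult.commute)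

lemma dot_simps [simp]:
 "dot (x + x') y = dot x y + dot x' y" "dot x (y + y') = dot x y + dot x y'"
 "dot (x - x') y = dot x y - dot x' y" "dot x (y - y') = dot x y - dot x y'"
 "dot (- x) y = - dot x y" "dot x (- y) = - dot x y"
 "dot 0 y = 0" "dot x 0 = 0"
 "dot (smul c x) y = c * dot x y" "dot x (smul c y) = c * dot x y"
 by (simp_all add: dot_def algebra_simps sum.distrib sum_subtractf sum_negf sum_distrib_left)

lemma dot_bv [simp]: "i < n \<Longrightarrow> dot (bv i) y = co i y" "i < n \<Longrightarrow> dot y (bv i) = co i y"
proof -
 assume i: "i < n"
 have "dot (bv i) y = (\<Sum>j<n. if j = i then co j y else 0)"
  unfolding dot_def by (rule sum.cong) (auto simp: co_bv i)
 with i show "dot (bv i) y = co i y"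
  by simp
 then show "dot y (bv i) = co i y"
  by (simp add: dot_commute)
qed

lemma dot_eqI: "(\<And>x. dot x y = dot x z) \<Longrightarrow> y = z"
 by (rule co_eqI) (metis dot_bv(1))

definition lin :: "('x \<Rightarrow> 'x) \<Rightarrow> bool"
 where "lin a \<longleftrightarrow> (\<forall>x y. a (x + y) = a x + a y) \<and> (\<forall>c x. a (smul c x) = smul c (a x))"

lemma lin_simps:
 assumes "lin a"
 shows "a (x + y) = a x + a y" "a (smul c x) = smul c (a x)" "a 0 = 0" "a (- x) = - a x"
  "a (x - y) = a x - a y" "a (sum f A) = (\<Sum>i\<in>A. a (f i))"
proof -
 show add: "a (x + y) = a x + a y" for x y
  using assms by (simp add: lin_def)
 show smul: "a (smul c x) = smul c (a x)" for c x
  using assms by (simp add: lin_def)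
 show zero: "a 0 = 0"
  using smul[of 0 0] by simp
 show uminus: "a (- x) = - a x" for x
  using smul[of "- 1" x] by simp
 show "a (x - y) = a x - a y"
  using add[of x "- y"] uminus by simp
 show "a (sum f A) = (\<Sum>i\<in>A. a (f i))"
  by (induction A rule: infinite_finite_induct) (auto simp: zero add)
qed

lemma linI: "(\<And>x y. a (x + y) = a x + a y) \<Longrightarrow> (\<And>c x. a (smul c x) = smul c (a x)) \<Longrightarrow> lin a"
 by (simp add: lin_def)

lemma lin_expand: "lin a \<Longrightarrow> a x = (\<Sum>i<n. smul (co i x) (a (bv i)))"
 by (subst coordinate_expansion[of x]) (simp add: lin_simps)

lemma functional_eq_dot:
 assumes "\<And>x y. f (x + y) = f x + f y" "\<And>c x. f (smul c x) = c * f x"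
 shows "f x = dot x (vec (\<lambda>i. f (bv i)))"
proof -
 have f0: "f 0 = 0"
  using assms(2)[of 0 0] by simp
 have "f (sum g A) = (\<Sum>i\<in>A. f (g i))" for g and A :: "nat set"
  by (induction A rule: infinite_finite_induct) (auto simp: f0 assms)
 then have "f x = (\<Sum>i<n. co i x * f (bv i))"
  by (subst coordinate_expansion[of x]) (simp add: assms)
 then show ?thesis
  by (simp add: dot_def)
qed

definition adj :: "('x \<Rightarrow> 'x) \<Rightarrow> 'x \<Rightarrow> 'x"
 where "adj a y = vec (\<lambda>i. dot (a (bv i)) y)"

lemma dot_adj:
 assumes "lin a"
 shows "dot (a x) y = dot x (adj a y)" "dot y (a x) = dot (adj a y) x"
proof -
 show "dot (a x) y = dot x (adj a y)"
  unfolding adj_def by (rule functional_eq_dot) (simp_all add: lin_simps[OF assms])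
 then show "dot y (a x) = dot (adj a y) x"
  by (simp add: dot_commute)
qed

lemma adj_unique: "lin a \<Longrightarrow> (\<And>x y. dot (a x) y = dot x (a' y)) \<Longrightarrow> adj a = a'"
 by (rule ext, rule dot_eqI) (simp flip: dot_adj)

lemma lin_adj [simp]: "lin a \<Longrightarrow> lin (adj a)"
 by (rule linI; rule dot_eqI; simp flip: dot_adj)

lemma adj_adj [simp]: "lin a \<Longrightarrow> adj (adj a) = a"
 by (rule adj_unique) (auto simp: dot_adj)

definition GL :: "('x \<Rightarrow> 'x) set"
 where "GL = {a. lin a \<and> bij a}"

lemma GL_lin: "a \<in> GL \<Longrightarrow> lin a"
 by (simp add: GL_def)

definition ginv :: "('x \<Rightarrow> 'x) \<Rightarrow> 'x \<Rightarrow> 'x"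
 where "ginv a = inv_into UNIV a"

lemma GL_inv [simp]:
 assumes "a \<in> GL"
 shows "ginv a (a x) = x" "a (ginv a x) = x"
 using assms by (simp_all add: ginv_def GL_def bij_is_inj bij_is_surj surj_f_inv_f)

lemma GL_I:
 assumes "lin a" "\<And>x. a (b x) = x" "\<And>x. b (a x) = x"
 shows "a \<in> GL" "ginv a = b"
proof -
 show "a \<in> GL"
  using assms unfolding GL_def by (auto intro: o_bij[of b] simp: fun_eq_iff)
 show "ginv a = b"
  unfolding ginv_def using assms(3,2) by (rule inv_equality)
qed

lemma GL_inv_in [simp]: "a \<in> GL \<Longrightarrow> ginv a \<in> GL"
proof -
 assume a: "a \<in> GL"
 have "lin (ginv a)"
  by (rule linI; rule injD[of a]) (use a GL_lin[OF a] in \<open>simp_all add: lin_simps bij_is_inj GL_def\<close>)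
 then show "ginv a \<in> GL"
  by (rule GL_I(1)[of _ a]) (simp_all add: a)
qed

lemma GL_inv_inv [simp]: "a \<in> GL \<Longrightarrow> ginv (ginv a) = a"
 by (simp add: ginv_def GL_def inv_inv_eq)

lemma GL_comp [simp]: "a \<in> GL \<Longrightarrow> b \<in> GL \<Longrightarrow> a \<circ> b \<in> GL"
 unfolding GL_def by (auto simp: bij_comp lin_def)

lemma GL_inv_comp: "a \<in> GL \<Longrightarrow> b \<in> GL \<Longrightarrow> ginv (a \<circ> b) = ginv b \<circ> ginv a"
 by (simp add: ginv_def GL_def o_inv_distrib)

lemma GL_id [simp]: "id \<in> GL"
 by (simp add: GL_def lin_def)

lemma GL_uminus [simp]: "uminus \<in> GL" "ginv uminus = (uminus :: 'x \<Rightarrow> 'x)"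
 by (rule GL_I[of uminus uminus]; simp add: lin_def)+

lemma adj_id [simp]: "adj id = id"
 by (rule adj_unique) (auto simp: lin_def)

lemma adj_comp: "lin a \<Longrightarrow> lin b \<Longrightarrow> adj (a \<circ> b) = adj b \<circ> adj a"
 by (rule adj_unique) (auto simp: dot_adj lin_def)

lemma GL_adj [simp]: "a \<in> GL \<Longrightarrow> adj a \<in> GL" and inv_adj: "a \<in> GL \<Longrightarrow> ginv (adj a) = adj (ginv a)"
proof -
 assume a: "a \<in> GL"
 then have l: "lin a" "lin (ginv a)"
  using GL_lin GL_inv_in by auto
 have "adj a (adj (ginv a) x) = x" "adj (ginv a) (adj a x) = x" for x
  by (rule dot_eqI; simp add: a flip: dot_adj[OF l(1)] dot_adj[OF l(2)])+
 then show "adj a \<in> GL" "ginv (adj a) = adj (ginv a)"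
  using GL_I[of "adj a" "adj (ginv a)"] l by auto
qed

definition sym :: "('x \<Rightarrow> 'x) \<Rightarrow> bool"
 where "sym b \<longleftrightarrow> lin b \<and> adj b = b"

lemma sym_lin: "sym b \<Longrightarrow> lin b"
 by (simp add: sym_def)

lemma symI: "lin b \<Longrightarrow> (\<And>x y. dot (b x) y = dot x (b y)) \<Longrightarrow> sym b"
 by (simp add: sym_def adj_unique)

lemma sym_dot: "sym b \<Longrightarrow> dot (b x) y = dot x (b y)"
 using dot_adj(1)[of b] by (simp add: sym_def)

lemma sym_inv: "b \<in> GL \<Longrightarrow> sym b \<Longrightarrow> sym (ginv b)"
 by (simp add: sym_def GL_lin flip: inv_adj)

end

section \<open>The index of the maximal ideal\<close>

context nonarch_local_field
begin

text \<open>Counted by cosets so that it is literally the cardinality of the residue field in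
  \<open>card_residue_field\<close>.\<close>

definition resq :: nat
 where "resq = card ((\<lambda>x. {y. y - x \<in> fideal 1}) ` fideal 0)"

lemma coset_eq_iff: "{y. y - x \<in> fideal k} = {y. y - x' \<in> fideal k} \<longleftrightarrow> x - x' \<in> fideal k"
proof
 assume "{y. y - x \<in> fideal k} = {y. y - x' \<in> fideal k}"
 then have "x \<in> {y. y - x' \<in> fideal k}"
  by (metis diff_self fideal_0 mem_Collect_eq)
 then show "x - x' \<in> fideal k"
  by simp
next
 assume x: "x - x' \<in> fideal k"
 show "{y. y - x \<in> fideal k} = {y. y - x' \<in> fideal k}"
 proof (intro Collect_cong iffI)
  fix y
  have e: "(y - x) + (x - x') = y - x'" "(y - x') - (x - x') = y - x"
   by simp_all
  show "y - x' \<in> fideal k" if "y - x \<in> fideal k"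
   using fideal_add[OF that x] unfolding e .
  show "y - x \<in> fideal k" if "y - x' \<in> fideal k"
   using fideal_diff[OF that x] unfolding e .
 qed
qed

lemma finite_cosets: "finite ((\<lambda>x. {y. y - x \<in> fideal k}) ` fideal j)"
proof -
 obtain T where T: "finite T" "\<forall>x\<in>fideal j. \<exists>t\<in>T. x - t \<in> fideal k"
  using exists_finite_coset_cover[of j k] by (elim exE conjE)
 have "(\<lambda>x. {y. y - x \<in> fideal k}) ` fideal j \<subseteq> (\<lambda>x. {y. y - x \<in> fideal k}) ` T"
 proof
  fix C assume "C \<in> (\<lambda>x. {y. y - x \<in> fideal k}) ` fideal j"
  then obtain x where x: "x \<in> fideal j" "C = {y. y - x \<in> fideal k}"
   by blast
  then obtain t where t: "t \<in> T" "x - t \<in> fideal k"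
   using T(2) by blast
  then show "C \<in> (\<lambda>x. {y. y - x \<in> fideal k}) ` T"
   unfolding x(2) by (intro image_eqI[OF _ t(1)]) (simp only: coset_eq_iff)
 qed
 then show ?thesis
  using T(1) finite_subset by blast
qed

lemma resq_pos: "0 < resq"
 unfolding resq_def using finite_cosets[of 1 0] fideal_0[of 0] by (auto simp: card_gt_0_iff simp del: fideal_0)

lemma fideal_index: "\<exists>T. card T = resq \<and> T \<subseteq> fideal k \<and> (\<forall>x\<in>fideal k. \<exists>!t. t \<in> T \<and> x - t \<in> fideal (k + 1))"
proof -
 let ?c = "\<lambda>x. {y. y - x \<in> fideal 1}"
 obtain T where T: "T \<subseteq> fideal 0" "?c ` T = ?c ` fideal 0" "inj_on ?c T"
  using subset_image_inj[of "?c ` fideal 0" ?c "fideal 0"] by auto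
 have uniq: "\<exists>!t. t \<in> T \<and> x - t \<in> fideal 1" if "x \<in> fideal 0" for x
 proof -
  have "?c x \<in> ?c ` T"
   using that T(2) by blast
  then obtain t where t: "t \<in> T" "x - t \<in> fideal 1"
   using coset_eq_iff by blast
  moreover have "s = t" if "s \<in> T" "x - s \<in> fideal 1" for s
  proof (rule inj_onD[OF T(3)])
   show "?c s = ?c t"
    using that(2) t(2) coset_eq_iff by metis
  qed (use that t in auto)
  ultimately show ?thesis
   by blast
 qed
 let ?u = "unif powi k"
 show ?thesis
 proof (intro exI[of _ "(*) ?u ` T"] conjI ballI)
  have "inj_on ((*) ?u) T"
   by (auto simp: inj_on_def)
  then show "card ((*) ?u ` T) = resq"
   using card_image[OF T(3)] by (simp add: card_image resq_def T(2))
  show "(*) ?u ` T \<subseteq> fideal k"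
   using T(1) by (auto simp: unif_mult_fideal)
  fix x assume x: "x \<in> fideal k"
  have e: "x - ?u * t \<in> fideal (k + 1) \<longleftrightarrow> x / ?u - t \<in> fideal 1" for t
  proof -
   have "x - ?u * t = ?u * (x / ?u - t)"
    by (simp add: right_diff_distrib)
   then show ?thesis
    using unif_mult_fideal[of k "x / ?u - t" "k + 1"] by simp
  qed
  have "x / ?u \<in> fideal 0"
   using x unif_mult_fideal[of k "x / ?u" k] by simp
  from uniq[OF this] obtain t where t: "t \<in> T" "x / ?u - t \<in> fideal 1"
   "\<And>s. s \<in> T \<Longrightarrow> x / ?u - s \<in> fideal 1 \<Longrightarrow> s = t"
   by (elim ex1E) blast
  show "\<exists>!t. t \<in> (*) ?u ` T \<and> x - t \<in> fideal (k + 1)"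
  proof (rule ex1I[of _ "?u * t"])
   show "?u * t \<in> (*) ?u ` T \<and> x - ?u * t \<in> fideal (k + 1)"
    using t e by blast
   fix z assume "z \<in> (*) ?u ` T \<and> x - z \<in> fideal (k + 1)"
   then show "z = ?u * t"
    using t(3) e by blast
  qed
 qed
qed

end

section \<open>The additive character and its conductor\<close>

locale local_coeff = nonarch_local_field absv
 for absv :: "'f::field \<Rightarrow> real" +
 fixes chi :: "'f \<Rightarrow> 'r::idom" and iq :: 'r
 assumes two_neq_0 [simp]: "(2::'f) \<noteq> 0"
  and two_neq_0_coeff [simp]: "(2::'r) \<noteq> 0"
  and iq: "of_nat resq * iq = 1"
  and chi_add: "chi (x + y) = chi x * chi y"
  and chi_nontrivial: "\<exists>x. chi x \<noteq> 1"
  and chi_smooth: "\<exists>k. \<forall>x\<in>fideal k. chi x = 1"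
begin

lemma chi_0 [simp]: "chi 0 = 1"
 using chi_smooth by auto

lemma chi_uminus: "chi x * chi (- x) = 1" "chi (- x) * chi x = 1"
 by (simp_all flip: chi_add)

lemma chi_neq_0 [simp]: "chi x \<noteq> 0"
 using chi_uminus(1)[of x] by auto

text \<open>The conductor exponent: the two conditions make \<open>fideal (cond - k)\<close> the
  exact annihilator of \<open>fideal k\<close> for the pairing by \<open>chi\<close> of a
  product.\<close>

definition cond :: int
 where "cond = (SOME c. (\<forall>x\<in>fideal c. chi x = 1) \<and> (\<exists>x\<in>fideal (c - 1). chi x \<noteq> 1))"

lemma cond: "x \<in> fideal cond \<Longrightarrow> chi x = 1" "\<exists>x\<in>fideal (cond - 1). chi x \<noteq> 1"
proof -
 let ?P = "\<lambda>k. \<forall>x\<in>fideal k. chi x = 1"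
 obtain k where k: "?P k"
  using chi_smooth by blast
 obtain x j where x: "chi x \<noteq> 1" "x \<in> fideal j"
  using chi_nontrivial exists_fideal by blast
 have "j < k"
  using k x fideal_antimono[of k j] by (cases "j < k") auto
 then have ex: "?P (j + int (nat (k - j)))"
  using k by simp
 define d where "d = (LEAST d. ?P (j + int d))"
 have d: "?P (j + int d)"
  unfolding d_def by (rule LeastI[of "\<lambda>d. ?P (j + int d)"]) (rule ex)
 have "d \<noteq> 0"
  using d x by (intro notI) simp
 then have "\<not> ?P (j + int (d - 1))"
  using not_less_Least[of "d - 1" "\<lambda>d. ?P (j + int d)"] by (simp flip: d_def)
 moreover have "j + int (d - 1) = j + int d - 1"
  using \<open>d \<noteq> 0\<close> by simp
 ultimately have "\<exists>x\<in>fideal (j + int d - 1). chi x \<noteq> 1"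
  by metis
 then have "\<exists>c. ?P c \<and> (\<exists>x\<in>fideal (c - 1). chi x \<noteq> 1)"
  using d by blast
 from someI_ex[OF this, folded cond_def]
 show "x \<in> fideal cond \<Longrightarrow> chi x = 1" "\<exists>x\<in>fideal (cond - 1). chi x \<noteq> 1" for x
  by blast+
qed

lemma chi_cong: "x - y \<in> fideal cond \<Longrightarrow> chi x = chi y"
 using chi_add[of "x - y" y] cond(1) by simp

text \<open>If \<open>c\<close> were too large, then dividing by \<open>c\<close> would carry an
  element of \<open>fideal (cond - 1)\<close> at which \<open>chi\<close> is non-trivial into
  \<open>fideal k\<close>.\<close>

lemma fideal_dual:
 assumes "\<And>t. t \<in> fideal k \<Longrightarrow> chi (t * c) = 1"
 shows "c \<in> fideal (cond - k)"
proof (rule ccontr)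
 assume c: "c \<notin> fideal (cond - k)"
 then have "c \<noteq> 0"
  by auto
 then obtain m where m: "absv c = absv unif powi m"
  by (rule absv_eq_unif_powi)
 have "m < cond - k"
  using c \<open>c \<noteq> 0\<close> m in_fideal_int_iff[of c m] by simp
 obtain z where z: "z \<in> fideal (cond - 1)" "chi z \<noteq> 1"
  using cond(2) by blast
 have "inverse c \<in> fideal (- m)"
  using m by (simp add: fideal_def absv_inverse power_int_minus)
 from fideal_mult[OF z(1) this] have "z * inverse c \<in> fideal k"
  using fideal_antimono[of k "cond - 1 + - m"] \<open>m < cond - k\<close> by auto
 from assms[OF this] show False
  using z(2) \<open>c \<noteq> 0\<close> by (simp add: mult.assoc)
qed

end

section \<open>The Schwartz space of a coordinate space\<close>

locale weil = local_coeff absv chi iq + coordinates smul n co bv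
 for absv :: "'f::field \<Rightarrow> real" and chi :: "'f \<Rightarrow> 'r::idom" and iq :: 'r
  and smul :: "'f \<Rightarrow> 'x::ab_group_add \<Rightarrow> 'x" and n :: nat
  and co :: "nat \<Rightarrow> 'x \<Rightarrow> 'f" and bv :: "nat \<Rightarrow> 'x"
begin

definition lat :: "int \<Rightarrow> 'x set"
 where "lat k = {x. \<forall>i<n. co i x \<in> fideal k}"

lemma lat_diff: "x \<in> lat k \<Longrightarrow> y \<in> lat k \<Longrightarrow> x - y \<in> lat k"
 by (simp add: lat_def fideal_diff)

lemma lat_antimono: "j \<le> k \<Longrightarrow> lat k \<subseteq> lat j"
 using fideal_antimono by (auto simp: lat_def)

lemma lat_exhausts: "\<exists>k. x \<in> lat k"
proof -
 have "\<exists>m. \<forall>i. co i x \<in> fideal (m i)"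
  using exists_fideal by (intro choice) blast
 then obtain m where m: "\<And>i. co i x \<in> fideal (m i)"
  by blast
 \<comment> \<open>Minus the sum of absolute values is a crude common lower bound of the exponents
   that also makes sense for \<open>n = 0\<close>.\<close>
 define k where "k = - (\<Sum>i<n. \<bar>m i\<bar>)"
 have "k \<le> m i" if "i < n" for i
 proof -
  have "\<bar>m i\<bar> \<le> (\<Sum>i<n. \<bar>m i\<bar>)"
   using that by (intro member_le_sum) auto
  then show ?thesis
   by (simp add: k_def)
 qed
 then have "x \<in> lat k"
  unfolding lat_def using m fideal_antimono by blast
 then show ?thesis ..
qed

lemma lat_index: "\<exists>T. card T = resq ^ n \<and> T \<subseteq> lat k \<and> (\<forall>x\<in>lat k. \<exists>!t. t \<in> T \<and> x - t \<in> lat (k + 1))"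
proof -
 obtain S where S: "card S = resq" "S \<subseteq> fideal k"
  "\<And>x. x \<in> fideal k \<Longrightarrow> \<exists>!t. t \<in> S \<and> x - t \<in> fideal (k + 1)"
  using fideal_index[of k] by blast
 let ?T = "vec ` PiE {..<n} (\<lambda>_. S)"
 show ?thesis
 proof (intro exI[of _ ?T] conjI ballI)
  have "inj_on vec (PiE {..<n} (\<lambda>_. S))"
  proof (rule inj_onI)
   fix f g assume fg: "f \<in> PiE {..<n} (\<lambda>_. S)" "g \<in> PiE {..<n} (\<lambda>_. S)" "vec f = vec g"
   then have "f i = g i" if "i < n" for i
    using co_vec[OF that, of f] co_vec[OF that, of g] by simp
   then show "f = g"
    using fg by (intro PiE_ext) auto
  qed
  then show "card ?T = resq ^ n"
   by (simp add: card_image card_PiE S(1))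
  show "?T \<subseteq> lat k"
   using S(2) by (auto simp: lat_def PiE_def Pi_def)
  fix x assume x: "x \<in> lat k"
  then have "\<exists>t. t \<in> S \<and> co i x - t \<in> fideal (k + 1)" if "i < n" for i
   using S(3)[of "co i x"] that by (auto simp: lat_def)
  then obtain t where t: "\<And>i. i < n \<Longrightarrow> t i \<in> S \<and> co i x - t i \<in> fideal (k + 1)"
   by metis
  let ?t = "restrict t {..<n}"
  show "\<exists>!u. u \<in> ?T \<and> x - u \<in> lat (k + 1)"
  proof (rule ex1I[of _ "vec ?t"])
   show "vec ?t \<in> ?T \<and> x - vec ?t \<in> lat (k + 1)"
    using t by (auto simp: lat_def)
   fix u assume u: "u \<in> ?T \<and> x - u \<in> lat (k + 1)"
   then obtain s where s: "u = vec s" "s \<in> PiE {..<n} (\<lambda>_. S)"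
    by blast
   have "s i = t i" if "i < n" for i
   proof -
    have "s i \<in> S" "co i x - s i \<in> fideal (k + 1)"
     using s u that by (auto simp: lat_def)
    then show ?thesis
     using S(3)[of "co i x"] t[OF that] x that by (auto simp: lat_def)
   qed
   then show "u = vec ?t"
    unfolding s(1) by (intro co_eqI) simp
  qed
 qed
qed

definition lat_card :: nat
 where "lat_card = resq ^ n"

definition lat_card_inverse :: 'r
 where "lat_card_inverse = iq ^ n"

lemma lattice_integral_lat: "lattice_integral lat lat_card lat_card_inverse"
 unfolding lat_card_def lat_card_inverse_def
proof
 show "0 \<in> lat k" for k
  by (simp add: lat_def)
 show "0 < resq ^ n"
  using resq_pos by simp
 show "of_nat (resq ^ n) * iq ^ n = 1"
  using iq by (simp flip: power_mult_distrib)
qed (fact lat_diff lat_antimono lat_exhausts lat_index)+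

sublocale lattice_integral lat lat_card lat_card_inverse
 by (rule lattice_integral_lat)

lemma smul_lat: "c \<in> fideal j \<Longrightarrow> x \<in> lat k \<Longrightarrow> smul c x \<in> lat (j + k)"
 by (simp add: lat_def fideal_mult)

lemma sum_lat: "(\<And>i. i \<in> A \<Longrightarrow> f i \<in> lat k) \<Longrightarrow> sum f A \<in> lat k"
 by (simp add: lat_def fideal_sum)

lemma dot_fideal: "x \<in> lat j \<Longrightarrow> y \<in> lat k \<Longrightarrow> dot x y \<in> fideal (j + k)"
 unfolding dot_def by (rule fideal_sum) (simp add: lat_def fideal_mult)

lemma lat_dual:
 assumes "\<And>x. x \<in> lat k \<Longrightarrow> chi (dot x y) = 1"
 shows "y \<in> lat (cond - k)"
 unfolding lat_def
proof (intro CollectI allI impI fideal_dual)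
 fix i t assume i: "i < n" and t: "t \<in> fideal k"
 have "smul t (bv i) \<in> lat k"
  using i t by (auto simp: lat_def co_bv)
 from assms[OF this] show "chi (t * co i y) = 1"
  using i by simp
qed

lemma lin_lat:
 assumes "lin a"
 obtains m where "\<And>k x. x \<in> lat k \<Longrightarrow> a x \<in> lat (k + m)"
proof -
 have "\<exists>l. \<forall>i. a (bv i) \<in> lat (l i)"
  using lat_exhausts by (intro choice) blast
 then obtain l where l: "\<And>i. a (bv i) \<in> lat (l i)"
  by blast
 define m where "m = - (\<Sum>i<n. \<bar>l i\<bar>)"
 have m: "a (bv i) \<in> lat m" if "i < n" for i
 proof -
  have "\<bar>l i\<bar> \<le> (\<Sum>i<n. \<bar>l i\<bar>)"
   using that by (intro member_le_sum) auto
  then have "m \<le> l i"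
   by (simp add: m_def)
  then show ?thesis
   using l lat_antimono by blast
 qed
 have "a x \<in> lat (k + m)" if "x \<in> lat k" for k x
  by (subst lin_expand[OF assms], rule sum_lat, rule smul_lat) (use that m in \<open>auto simp: lat_def\<close>)
 then show thesis
  using that by blast
qed

lemma chi_dot_locally_constant: "\<exists>k. \<forall>x\<in>lat j. \<forall>y\<in>lat k. chi (dot (x + y) z) = chi (dot x z)"
proof -
 obtain m where "z \<in> lat m"
  using lat_exhausts by blast
 then have "dot y z \<in> fideal cond" if "y \<in> lat (cond - m)" for y
  using dot_fideal[OF that] by fastforce
 then show ?thesis
  by (intro exI[of _ "cond - m"]) (simp add: chi_add cond(1))
qed

lemma chi_quadratic_locally_constant:
 assumes "lin b"
 shows "\<exists>k. \<forall>x\<in>lat j. \<forall>y\<in>lat k. chi (c * dot (x + y) (b (x + y))) = chi (c * dot x (b x))"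
proof -
 obtain m where m: "\<And>k x. x \<in> lat k \<Longrightarrow> b x \<in> lat (k + m)"
  using lin_lat[OF assms] by blast
 obtain l where l: "c \<in> fideal l"
  using exists_fideal by blast
 \<comment> \<open>The difference of the two values is \<open>c\<close> times two cross terms. This
   exponent puts both of them into \<open>fideal (cond - l)\<close>; the maximum with
   \<open>j\<close> keeps \<open>y\<close> in the lattice of \<open>x\<close>.\<close>
 define k where "k = max j (cond - l - m - j)"
 show ?thesis
 proof (intro exI[of _ k] ballI)
  fix x y assume x: "x \<in> lat j" and y: "y \<in> lat k"
  have yj: "y \<in> lat j" and y': "y \<in> lat (cond - l - m - j)"
   using y lat_antimono[of j k] lat_antimono[of "cond - l - m - j" k] by (auto simp: k_def)
  have "dot (x + y) (b y) \<in> fideal (j + (cond - l - m - j + m))"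
   using x yj m[OF y'] by (intro dot_fideal L_add)
  moreover have "dot y (b x) \<in> fideal (cond - l - m - j + (j + m))"
   using y' m[OF x] by (rule dot_fideal)
  ultimately have "dot (x + y) (b y) + dot y (b x) \<in> fideal (cond - l)"
   by (intro fideal_add) (simp_all add: algebra_simps)
  from fideal_mult[OF l this] have "c * (dot (x + y) (b y) + dot y (b x)) \<in> fideal cond"
   by simp
  moreover have "c * dot (x + y) (b (x + y)) - c * dot x (b x) = c * (dot (x + y) (b y) + dot y (b x))"
   by (simp add: lin_simps[OF assms] algebra_simps)
  ultimately show "chi (c * dot (x + y) (b (x + y))) = chi (c * dot x (b x))"
   by (intro chi_cong) simp
 qed
qed

end

section \<open>Heisenberg operators and Schur's lemma\<close>

context weil
begin

definition linop :: "(('x \<Rightarrow> 'r) \<Rightarrow> 'x \<Rightarrow> 'r) \<Rightarrow> bool"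
 where "linop T \<longleftrightarrow> (\<forall>\<Phi>\<in>Sch. T \<Phi> \<in> Sch) \<and>
  (\<forall>\<Phi>\<in>Sch. \<forall>\<Psi>\<in>Sch. T (\<lambda>x. \<Phi> x + \<Psi> x) = (\<lambda>x. T \<Phi> x + T \<Psi> x)) \<and>
  (\<forall>c. \<forall>\<Phi>\<in>Sch. T (\<lambda>x. c * \<Phi> x) = (\<lambda>x. c * T \<Phi> x))"

lemma linopD:
 assumes "linop T" "\<Phi> \<in> Sch"
 shows "T \<Phi> \<in> Sch" "\<Psi> \<in> Sch \<Longrightarrow> T (\<lambda>x. \<Phi> x + \<Psi> x) = (\<lambda>x. T \<Phi> x + T \<Psi> x)"
  "T (\<lambda>x. c * \<Phi> x) = (\<lambda>x. c * T \<Phi> x)"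
 using assms by (simp_all add: linop_def)

lemma linopI:
 assumes "\<And>\<Phi>. \<Phi> \<in> Sch \<Longrightarrow> T \<Phi> \<in> Sch"
  and "\<And>\<Phi> \<Psi> x. \<Phi> \<in> Sch \<Longrightarrow> \<Psi> \<in> Sch \<Longrightarrow> T (\<lambda>x. \<Phi> x + \<Psi> x) x = T \<Phi> x + T \<Psi> x"
  and "\<And>\<Phi> c x. \<Phi> \<in> Sch \<Longrightarrow> T (\<lambda>x. c * \<Phi> x) x = c * T \<Phi> x"
 shows "linop T"
 using assms by (auto simp: linop_def fun_eq_iff)

lemma linop_comp: "linop S \<Longrightarrow> linop T \<Longrightarrow> linop (S \<circ> T)"
 by (simp add: linop_def)

definition U :: "'x \<times> 'x \<Rightarrow> ('x \<Rightarrow> 'r) \<Rightarrow> 'x \<Rightarrow> 'r"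
 where "U p \<Phi> = (\<lambda>x. \<Phi> (x + fst p) * chi (dot (snd p) x))"

lemma chi_dot_Sch:
 assumes "\<Phi> \<in> Sch"
 shows "(\<lambda>x. \<Phi> x * chi (dot z x)) \<in> Sch"
 using mult_Sch[OF assms, of "\<lambda>x. chi (dot x z)", OF chi_dot_locally_constant]
 by (simp add: dot_commute mult.commute)

lemma U_Sch [simp]: "\<Phi> \<in> Sch \<Longrightarrow> U p \<Phi> \<in> Sch"
 unfolding U_def by (intro chi_dot_Sch translate_Sch)

lemma linop_U: "linop (U p)"
 by (rule linopI) (simp_all, simp_all add: U_def algebra_simps)

lemma ind_eq_sum_translates:
 "ind k = (\<lambda>x. \<Sum>t\<in>reps k (k + 1). 1 * ind (k + 1) (x - t) :: 'r)"
proof -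
 have T: "transversal k (k + 1) (reps k (k + 1))"
  by (rule transversal_reps) simp
 show ?thesis
  by (rule trans[OF Sch_decompose[OF supp_in_ind inv_under_mono[OF inv_under_ind] _ T]])
   (use transversalD(2)[OF T] in \<open>auto simp: ind_def intro!: ext sum.cong\<close>)
qed

lemma linop_0:
 assumes "linop T"
 shows "T (\<lambda>x. 0) = (\<lambda>x. 0)"
 using linopD(3)[OF assms zero_Sch, of 0] by simp

lemma linop_sum:
 assumes "linop T" "\<And>i. i \<in> I \<Longrightarrow> f i \<in> Sch"
 shows "T (\<lambda>x. \<Sum>i\<in>I. f i x) = (\<lambda>x. \<Sum>i\<in>I. T (f i) x)"
 using assms(2)
proof (induction I rule: infinite_finite_induct)
 case (insert i I)
 then show ?case
  using linopD(2)[OF assms(1), of "f i" "\<lambda>x. \<Sum>i\<in>I. f i x"] by (simp add: sum_Sch)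
qed (simp_all add: linop_0[OF assms(1)])

text \<open>
 Commuting with the translations by \<open>lat k\<close> and the characters trivial on it forces \<open>T (ind k)\<close> to be
 a multiple of \<open>ind k\<close>.
\<close>

lemma schur:
 assumes T: "linop T" and comm: "\<And>p \<Phi>. \<Phi> \<in> Sch \<Longrightarrow> T (U p \<Phi>) = U p (T \<Phi>)"
 obtains c where "\<And>\<Phi>. \<Phi> \<in> Sch \<Longrightarrow> T \<Phi> = (\<lambda>x. c * \<Phi> x)"
proof -
 define c where "c k = T (ind k) 0" for k
 have trans: "T (\<lambda>x. \<Phi> (x + v)) = (\<lambda>x. T \<Phi> (x + v))" if "\<Phi> \<in> Sch" for \<Phi> :: "'x \<Rightarrow> 'r" and v
  using comm[OF that, of "(v, 0)"] by (simp add: U_def)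
 have ind: "T (ind k) = (\<lambda>x. c k * ind k x)" for k
 proof
  fix x
  show "T (ind k) x = c k * ind k x"
  proof (cases "x \<in> lat k")
   case True
   have "(\<lambda>y. ind k (y + x) :: 'r) = ind k"
    using True by (simp add: ind_def L_add_cancel fun_eq_iff)
   then have "T (ind k) = (\<lambda>y. T (ind k) (y + x))"
    using trans[OF ind_Sch, of k x] by simp
   then have "T (ind k) 0 = T (ind k) (0 + x)"
    by (rule fun_cong)
   then show ?thesis
    using True by (simp add: c_def ind_def)
  next
   case False
   have "\<exists>v\<in>lat (cond - k). chi (dot v x) \<noteq> 1"
    using False lat_dual[of "cond - k" x] by auto
   then obtain v where v: "v \<in> lat (cond - k)" "chi (dot v x) \<noteq> 1"
    by blast
   have "U (0, v) (ind k) = ind k"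
    using dot_fideal[OF v(1), of _ k] cond(1) by (auto simp: U_def ind_def)
   then have "T (ind k) x = T (ind k) x * chi (dot v x)"
    using comm[OF ind_Sch, of "(0, v)" k] by (metis U_def add.right_neutral fst_conv snd_conv)
   then have "T (ind k) x * (chi (dot v x) - 1) = 0"
    by (simp add: algebra_simps)
   then show ?thesis
    using v(2) False by (simp add: ind_def)
  qed
 qed
 \<comment> \<open>The multipliers for neighbouring lattices agree because \<open>ind k\<close> is a
   sum of translates of \<open>ind (k + 1)\<close>.\<close>
 have step: "c k = c (k + 1)" for k
 proof -
  have tr: "T (\<lambda>x. 1 * ind (k + 1) (x - t)) = (\<lambda>x. c (k + 1) * ind (k + 1) (x - t))" for t
   using trans[OF ind_Sch, of "k + 1" "- t"] ind[of "k + 1"] by simp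
  have "T (ind k) = (\<lambda>x. \<Sum>t\<in>reps k (k + 1). T (\<lambda>x. 1 * ind (k + 1) (x - t)) x)"
   by (subst ind_eq_sum_translates, rule linop_sum[OF T])
    (use translate_Sch[OF ind_Sch, of "k + 1" "- _"] in simp)
  also have "\<dots> = (\<lambda>x. c (k + 1) * ind k x)"
   by (subst (2) ind_eq_sum_translates) (simp only: tr sum_distrib_left, simp)
  finally show ?thesis
   using ind[of k] by (metis L_0 ind_def mult.right_neutral)
 qed
 have const: "c k = c 0" for k
 proof (induction k rule: int_induct[where k = 0])
  case (step1 i)
  then show ?case
   using step[of i] by simp
 next
  case (step2 i)
  then show ?case
   using step[of "i - 1"] by simp
 qed simp
 note ind_c = ind
 have "T \<Phi> = (\<lambda>x. c 0 * \<Phi> x)" if "\<Phi> \<in> Sch" for \<Phi> :: "'x \<Rightarrow> 'r"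
  using that
 proof (induction rule: Sch_induct)
  case (ind k)
  then show ?case
   using ind_c[of k] const[of k] by simp
 next
  case (translate \<Phi> v)
  then show ?case
   by (simp add: trans)
 next
  case (scale \<Phi> d)
  then show ?case
   by (simp add: linopD(3)[OF T] mult.left_commute)
 next
  case (add \<Phi> \<Psi>)
  then show ?case
   by (simp add: linopD(2)[OF T] distrib_left)
 qed
 then show thesis
  by (rule that)
qed

section \<open>Operators over symplectic transformations\<close>

definition fq :: "('x \<times> 'x \<Rightarrow> 'x \<times> 'x) \<Rightarrow> 'x \<times> 'x \<Rightarrow> 'f"
 where "fq f p = (dot (fst (f p)) (snd (f p)) - dot (fst p) (snd p)) / 2"

text \<open>Compatibility of an operator with a symplectic map, written as an intertwining relation
  so that no inverse operator occurs; \<open>implements_iff_conj\<close> relates it to conjugation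
  in the operator group.\<close>

definition implements :: "('x \<times> 'x \<Rightarrow> 'x \<times> 'x) \<Rightarrow> (('x \<Rightarrow> 'r) \<Rightarrow> 'x \<Rightarrow> 'r) \<Rightarrow> bool"
 where "implements f T \<longleftrightarrow> linop T \<and> bij_betw T Sch Sch \<and>
  (\<forall>p. \<forall>\<Phi>\<in>Sch. T (U p \<Phi>) = (\<lambda>x. chi (fq f p) * U (f p) (T \<Phi>) x))"

lemma implementsD:
 fixes \<Phi> :: "'x \<Rightarrow> 'r"
 assumes "implements f T"
 shows "linop T" "bij_betw T Sch Sch"
  "\<Phi> \<in> Sch \<Longrightarrow> T (U p \<Phi>) = (\<lambda>x. chi (fq f p) * U (f p) (T \<Phi>) x)"
 using assms unfolding implements_def by blast+

lemma implements_Sch [simp]: "implements f T \<Longrightarrow> \<Phi> \<in> Sch \<Longrightarrow> T \<Phi> \<in> Sch"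
 by (simp add: implementsD(1) linopD(1))

text \<open>The values of \<open>fq\<close> telescope along a composition, so the two phases
  multiply to the phase of the composite.\<close>

lemma implements_comp:
 assumes "implements f S" "implements g T"
 shows "implements (f \<circ> g) (S \<circ> T)"
 unfolding implements_def
proof (intro conjI allI ballI)
 show "linop (S \<circ> T)" "bij_betw (S \<circ> T) Sch Sch"
  using assms by (auto intro: linop_comp bij_betw_trans simp: implements_def)
 fix p and \<Phi> :: "'x \<Rightarrow> 'r" assume \<Phi>: "\<Phi> \<in> Sch"
 have "(S \<circ> T) (U p \<Phi>) = S (\<lambda>x. chi (fq g p) * U (g p) (T \<Phi>) x)"
  using implementsD(3)[OF assms(2) \<Phi>] by simp
 also have "\<dots> = (\<lambda>x. chi (fq g p) * S (U (g p) (T \<Phi>)) x)"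
  using assms \<Phi> by (intro linopD(3)) (auto simp: implementsD(1))
 also have "\<dots> = (\<lambda>x. chi (fq g p) * (chi (fq f (g p)) * U (f (g p)) (S (T \<Phi>)) x))"
  using implementsD(3)[OF assms(1), of "T \<Phi>"] assms \<Phi> by simp
 also have "\<dots> = (\<lambda>x. chi (fq (f \<circ> g) p) * U (f (g p)) (S (T \<Phi>)) x)"
  by (simp add: fq_def diff_divide_distrib flip: mult.assoc chi_add)
 finally show "(S \<circ> T) (U p \<Phi>) = (\<lambda>x. chi (fq (f \<circ> g) p) * U ((f \<circ> g) p) ((S \<circ> T) \<Phi>) x)"
  by simp
qed

lemma implements_cong:
 assumes "implements f T" "\<And>\<Phi>. \<Phi> \<in> Sch \<Longrightarrow> T \<Phi> = T' \<Phi>"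
 shows "implements f T'"
proof -
 have "bij_betw T' Sch Sch"
  using implementsD(2)[OF assms(1)] assms(2) by (metis (no_types, lifting) bij_betw_cong)
 moreover have "linop T'"
  using implementsD(1)[OF assms(1)] assms(2) unfolding linop_def by (simp add: add_Sch scale_Sch)
 ultimately show ?thesis
  using implementsD(3)[OF assms(1)] assms(2) unfolding implements_def by simp
qed

lemma implements_scale:
 assumes "implements f T" "c * d = 1"
 shows "implements f (\<lambda>\<Phi> x. c * T \<Phi> x)"
 unfolding implements_def
proof (intro conjI allI ballI)
 note lin = implementsD(1)[OF assms(1)]
 show "linop (\<lambda>\<Phi> x. c * T \<Phi> x)"
  using lin by (intro linopI) (auto simp: linopD scale_Sch algebra_simps)
 have bij: "bij_betw (\<lambda>\<Phi> x. c * \<Phi> x) Sch (Sch :: ('x \<Rightarrow> 'r) set)"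
 proof (rule bij_betw_byWitness[where f' = "\<lambda>\<Phi> x. d * \<Phi> x"])
  have "d * c = 1"
   using assms(2) by (simp add: mult.commute)
  then show "\<forall>\<Phi>\<in>Sch. (\<lambda>x. d * (c * \<Phi> x)) = \<Phi>" "\<forall>\<Phi>\<in>Sch. (\<lambda>x. c * (d * \<Phi> x)) = \<Phi>"
   using assms(2) by (simp_all flip: mult.assoc)
 qed (auto intro: scale_Sch)
 show "bij_betw (\<lambda>\<Phi> x. c * T \<Phi> x) Sch Sch"
  using bij_betw_trans[OF implementsD(2)[OF assms(1)] bij] by (simp add: comp_def)
 fix p and \<Phi> :: "'x \<Rightarrow> 'r" assume "\<Phi> \<in> Sch"
 then show "(\<lambda>x. c * T (U p \<Phi>) x) = (\<lambda>x. chi (fq f p) * U (f p) (\<lambda>x. c * T \<Phi> x) x)"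
  using implementsD(3)[OF assms(1)] by (simp add: U_def mult_ac)
qed

lemma implements_inverse:
 assumes "implements f T" "\<And>p. g (f p) = p" "\<And>p. f (g p) = p"
 shows "implements g (inv_into Sch T)"
 unfolding implements_def
proof (intro conjI allI ballI)
 let ?S = "inv_into Sch T"
 note bij = implementsD(2)[OF assms(1)]
 have TS: "T (?S \<Phi>) = \<Phi>" "?S \<Phi> \<in> Sch" if "\<Phi> \<in> Sch" for \<Phi> :: "'x \<Rightarrow> 'r"
  using bij that by (auto simp: bij_betw_inv_into_right intro: bij_betwE[OF bij_betw_inv_into, rule_format])
 have eqI: "\<Phi> = \<Psi>" if "T \<Phi> = T \<Psi>" "\<Phi> \<in> Sch" "\<Psi> \<in> Sch" for \<Phi> \<Psi> :: "'x \<Rightarrow> 'r"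
  using bij that by (auto simp: bij_betw_def dest: inj_onD)
 note lin = implementsD(1)[OF assms(1)]
 show "bij_betw ?S Sch Sch"
  by (rule bij_betw_inv_into[OF bij])
 have add: "?S (\<lambda>x. \<Phi> x + \<Psi> x) = (\<lambda>x. ?S \<Phi> x + ?S \<Psi> x)" if "\<Phi> \<in> Sch" "\<Psi> \<in> Sch" for \<Phi> \<Psi> :: "'x \<Rightarrow> 'r"
  by (rule eqI) (simp_all add: that TS add_Sch linopD(2)[OF lin])
 have scale: "?S (\<lambda>x. c * \<Phi> x) = (\<lambda>x. c * ?S \<Phi> x)" if "\<Phi> \<in> Sch" for \<Phi> :: "'x \<Rightarrow> 'r" and c
  by (rule eqI) (simp_all add: that TS scale_Sch linopD(3)[OF lin])
 show "linop ?S"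
  by (rule linopI) (simp_all add: TS add scale)
 fix p and \<Phi> :: "'x \<Rightarrow> 'r" assume \<Phi>: "\<Phi> \<in> Sch"
 have fq: "fq f (g p) + fq g p = 0"
  by (simp add: fq_def assms(3) flip: add_divide_distrib)
 show "?S (U p \<Phi>) = (\<lambda>x. chi (fq g p) * U (g p) (?S \<Phi>) x)"
 proof (rule eqI)
  have "T (\<lambda>x. chi (fq g p) * U (g p) (?S \<Phi>) x) = (\<lambda>x. chi (fq g p) * (chi (fq f (g p)) * U p \<Phi> x))"
   using \<Phi> by (simp add: linopD(3)[OF lin] TS implementsD(3)[OF assms(1)] assms(3))
  also have "\<dots> = U p \<Phi>"
   using fq by (simp add: add.commute flip: mult.assoc chi_add)
  finally show "T (?S (U p \<Phi>)) = T (\<lambda>x. chi (fq g p) * U (g p) (?S \<Phi>) x)"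
   by (simp add: TS \<Phi>)
 qed (simp_all add: TS \<Phi> scale_Sch)
qed

text \<open>The operator \<open>S\<close> followed by the inverse of \<open>T\<close> commutes with
  all \<open>U p\<close>, so Schur's lemma applies. Exchanging \<open>S\<close> and \<open>T\<close>
  gives a second scalar; the two are inverse to each other, as a preimage of \<open>ind 0\<close>
  shows.\<close>

lemma implements_unique:
 assumes "implements f S" "implements f T"
 shows "\<exists>c d. c * d = 1 \<and> (\<forall>\<Phi>\<in>Sch. S \<Phi> = (\<lambda>x. c * T \<Phi> x))"
proof -
 have ex: "\<exists>c. \<forall>\<Phi>\<in>Sch. S \<Phi> = (\<lambda>x. c * T \<Phi> x)"
  if S: "implements f S" and T: "implements f T" for S T
 proof -
  let ?Ti = "inv_into Sch T"
  have bij: "bij_betw T Sch Sch"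
   by (rule implementsD(2)[OF T])
  have Ti: "?Ti (T \<Phi>) = \<Phi>" if "\<Phi> \<in> Sch" for \<Phi> :: "'x \<Rightarrow> 'r"
   using bij that by (simp add: bij_betw_inv_into_left)
  have TS: "T (?Ti \<Phi>) = \<Phi>" "?Ti \<Phi> \<in> Sch" if "\<Phi> \<in> Sch" for \<Phi> :: "'x \<Rightarrow> 'r"
   using bij that by (auto simp: bij_betw_inv_into_right intro: bij_betwE[OF bij_betw_inv_into, rule_format])
  have eqI: "\<Phi> = \<Psi>" if "T \<Phi> = T \<Psi>" "\<Phi> \<in> Sch" "\<Psi> \<in> Sch" for \<Phi> \<Psi> :: "'x \<Rightarrow> 'r"
   using bij that by (auto simp: bij_betw_def dest: inj_onD)
  note linT = implementsD(1)[OF T] and linS = implementsD(1)[OF S] and S_Sch = implements_Sch[OF S]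
  have lin: "linop (\<lambda>\<Phi>. ?Ti (S \<Phi>))"
  proof (rule linopI)
   fix \<Phi> \<Psi> :: "'x \<Rightarrow> 'r" and c :: 'r and x
   assume \<Phi>: "\<Phi> \<in> Sch"
   show "?Ti (S \<Phi>) \<in> Sch"
    using TS S_Sch \<Phi> by simp
   show "?Ti (S (\<lambda>x. c * \<Phi> x)) x = c * ?Ti (S \<Phi>) x"
    by (rule fun_cong[of _ "\<lambda>x. c * ?Ti (S \<Phi>) x"], rule eqI)
     (simp_all add: TS S_Sch \<Phi> scale_Sch linopD(3)[OF linS] linopD(3)[OF linT])
   assume \<Psi>: "\<Psi> \<in> Sch"
   show "?Ti (S (\<lambda>x. \<Phi> x + \<Psi> x)) x = ?Ti (S \<Phi>) x + ?Ti (S \<Psi>) x"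
    by (rule fun_cong[of _ "\<lambda>x. ?Ti (S \<Phi>) x + ?Ti (S \<Psi>) x"], rule eqI)
     (simp_all add: TS S_Sch \<Phi> \<Psi> add_Sch linopD(2)[OF linS] linopD(2)[OF linT])
  qed
  have comm: "?Ti (S (U p \<Phi>)) = U p (?Ti (S \<Phi>))" if \<Phi>: "\<Phi> \<in> Sch" for p and \<Phi> :: "'x \<Rightarrow> 'r"
   by (rule eqI) (simp_all add: TS S_Sch \<Phi> scale_Sch implementsD(3)[OF S] implementsD(3)[OF T])
  obtain c where c: "\<And>\<Phi>. \<Phi> \<in> Sch \<Longrightarrow> ?Ti (S \<Phi>) = (\<lambda>x. c * \<Phi> x)"
   using schur[OF lin comm] by blast
  have "S \<Phi> = (\<lambda>x. c * T \<Phi> x)" if \<Phi>: "\<Phi> \<in> Sch" for \<Phi> :: "'x \<Rightarrow> 'r"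
  proof -
   have "S \<Phi> = T (?Ti (S \<Phi>))"
    using TS S_Sch \<Phi> by simp
   then show ?thesis
    using c[OF \<Phi>] linopD(3)[OF linT \<Phi>] by simp
  qed
  then show ?thesis
   by blast
 qed
 obtain c where c: "\<And>\<Phi>. \<Phi> \<in> Sch \<Longrightarrow> S \<Phi> = (\<lambda>x. c * T \<Phi> x)"
  using ex[OF assms] by blast
 obtain d where d: "\<And>\<Phi>. \<Phi> \<in> Sch \<Longrightarrow> T \<Phi> = (\<lambda>x. d * S \<Phi> x)"
  using ex[OF assms(2,1)] by blast
 have "ind 0 \<in> S ` Sch"
  using implementsD(2)[OF assms(1)] by (simp add: bij_betw_def)
 then obtain \<Phi> where \<Phi>: "\<Phi> \<in> Sch" "S \<Phi> = ind 0"
  by (metis imageE)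
 have "ind 0 0 = c * (d * ind 0 (0::'x))"
  using c[OF \<Phi>(1)] d[OF \<Phi>(1)] \<Phi>(2) by (metis (no_types, lifting))
 then have "c * d = 1"
  by (simp add: ind_def)
 then show ?thesis
  using c by blast
qed

end

section \<open>Generators of the symplectic group and their operators\<close>

context weil
begin

text \<open>\<open>nn\<close> and \<open>mm\<close> are the unipotent and Levi parts of the
  stabilizer of the Lagrangian of second components, and \<open>ww\<close> is a Weyl element; by
  \<open>bruhat\<close> they describe the big cell.\<close>

definition nn :: "('x \<Rightarrow> 'x) \<Rightarrow> 'x \<times> 'x \<Rightarrow> 'x \<times> 'x"
 where "nn b p = (fst p, snd p + b (fst p))"

definition mm :: "('x \<Rightarrow> 'x) \<Rightarrow> 'x \<times> 'x \<Rightarrow> 'x \<times> 'x"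
 where "mm a p = (a (fst p), adj (ginv a) (snd p))"

definition ww :: "'x \<times> 'x \<Rightarrow> 'x \<times> 'x"
 where "ww p = (snd p, - fst p)"

text \<open>The sign of the phase is dictated by the convention \<open>\<Phi> (x + v)\<close> in
  \<open>U\<close>: commuting past the translation must produce the frequency
  \<open>+ b v\<close>.\<close>

definition Nop :: "('x \<Rightarrow> 'x) \<Rightarrow> ('x \<Rightarrow> 'r) \<Rightarrow> 'x \<Rightarrow> 'r"
 where "Nop b \<Phi> = (\<lambda>x. chi (- (1 / 2) * dot x (b x)) * \<Phi> x)"

definition Mop :: "('x \<Rightarrow> 'x) \<Rightarrow> ('x \<Rightarrow> 'r) \<Rightarrow> 'x \<Rightarrow> 'r"
 where "Mop a \<Phi> = (\<lambda>x. \<Phi> (ginv a x))"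

definition Fop :: "('x \<Rightarrow> 'r) \<Rightarrow> 'x \<Rightarrow> 'r"
 where "Fop \<Phi> = (\<lambda>y. integ (\<lambda>x. \<Phi> x * chi (dot x y)))"

lemma Nop_Sch: "lin b \<Longrightarrow> \<Phi> \<in> Sch \<Longrightarrow> Nop b \<Phi> \<in> Sch"
 unfolding Nop_def by (rule mult_Sch) (use chi_quadratic_locally_constant in blast)+

lemma Mop_Sch:
 assumes "a \<in> GL" "\<Phi> \<in> Sch"
 shows "Mop a \<Phi> \<in> Sch"
proof -
 obtain j k where jk: "supp_in j \<Phi>" "inv_under k \<Phi>"
  using SchE[OF assms(2)] by metis
 obtain l where l: "\<And>k x. x \<in> lat k \<Longrightarrow> a x \<in> lat (k + l)"
  using lin_lat GL_lin assms(1) by metis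
 obtain m where m: "\<And>k x. x \<in> lat k \<Longrightarrow> ginv a x \<in> lat (k + m)"
  using lin_lat GL_lin GL_inv_in assms(1) by metis
 have "supp_in (j + l) (Mop a \<Phi>)"
  unfolding supp_in_def
 proof (intro allI impI)
  fix x assume "x \<notin> lat (j + l)"
  then have "ginv a x \<notin> lat j"
   using l[of "ginv a x" j] assms(1) by auto
  then show "Mop a \<Phi> x = 0"
   using jk(1) by (simp add: Mop_def supp_in_def)
 qed
 moreover have "inv_under (k - m) (Mop a \<Phi>)"
  using jk(2) m[of _ "k - m"] GL_lin[OF GL_inv_in[OF assms(1)]]
  by (simp add: Mop_def inv_under_def lin_simps)
 ultimately show ?thesis
  by (rule SchI)
qed

lemma implements_N:
 assumes "sym b"
 shows "implements (nn b) (Nop b)"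
 unfolding implements_def
proof (intro conjI allI ballI)
 have b: "lin b"
  using assms by (rule sym_lin)
 have b': "lin (\<lambda>x. - b x)"
  using b by (simp add: lin_def)
 show "linop (Nop b)"
  by (rule linopI) (simp_all add: Nop_Sch b, simp_all add: Nop_def algebra_simps)
 show "bij_betw (Nop b) Sch Sch"
  by (rule bij_betw_byWitness[where f' = "Nop (\<lambda>x. - b x)"])
   (auto simp: Nop_Sch b b', simp_all add: Nop_def chi_uminus flip: mult.assoc)
 fix p :: "'x \<times> 'x" and \<Phi> :: "'x \<Rightarrow> 'r"
 obtain v w where p: "p = (v, w)"
  by (cases p)
 show "Nop b (U p \<Phi>) = (\<lambda>x. chi (fq (nn b) p) * U (nn b p) (Nop b \<Phi>) x)"
 proof
  fix x
  have "dot x (b v) = dot v (b x)"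
   using sym_dot[OF assms, of v x] by (simp add: dot_commute)
  then have "- (1 / 2) * dot x (b x) + dot w x =
    (dot v (w + b v) - dot v w) / 2 + (- (1 / 2) * dot (x + v) (b (x + v)) + dot (w + b v) x)"
   by (simp add: lin_simps[OF b] dot_commute[of "b v"] field_simps)
  then have "chi (- (1 / 2) * dot x (b x)) * chi (dot w x) =
    chi ((dot v (w + b v) - dot v w) / 2) *
    (chi (- (1 / 2) * dot (x + v) (b (x + v))) * chi (dot (w + b v) x))"
   by (metis chi_add)
  then show "Nop b (U p \<Phi>) x = chi (fq (nn b) p) * U (nn b p) (Nop b \<Phi>) x"
   unfolding Nop_def U_def nn_def fq_def p by (simp add: mult_ac del: dot_simps)
 qed
qed

lemma implements_M:
 assumes "a \<in> GL"
 shows "implements (mm a) (Mop a)"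
 unfolding implements_def
proof (intro conjI allI ballI)
 note l = GL_lin[OF GL_inv_in[OF assms]]
 show "linop (Mop a)"
  by (rule linopI) (simp_all add: Mop_Sch assms, simp_all add: Mop_def)
 show "bij_betw (Mop a) Sch Sch"
  by (rule bij_betw_byWitness[where f' = "Mop (ginv a)"])
   (auto simp: Mop_Sch assms, simp_all add: Mop_def assms)
 fix p and \<Phi> :: "'x \<Rightarrow> 'r"
 have "dot (a v) (adj (ginv a) w) = dot v w" for v w
  by (simp add: assms flip: dot_adj[OF l])
 then show "Mop a (U p \<Phi>) = (\<lambda>x. chi (fq (mm a) p) * U (mm a p) (Mop a \<Phi>) x)"
  by (simp add: Mop_def U_def mm_def fq_def lin_simps[OF l] assms flip: dot_adj[OF l])
qed

lemma chi_dot_Sch2: "\<Phi> \<in> Sch \<Longrightarrow> (\<lambda>x. \<Phi> x * chi (dot x z)) \<in> Sch"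
 using chi_dot_Sch[of \<Phi> z] by (simp add: dot_commute)

lemma Fop_add: "\<Phi> \<in> Sch \<Longrightarrow> \<Psi> \<in> Sch \<Longrightarrow> Fop (\<lambda>x. \<Phi> x + \<Psi> x) = (\<lambda>y. Fop \<Phi> y + Fop \<Psi> y)"
 unfolding Fop_def distrib_right by (intro ext integ_add chi_dot_Sch2)

lemma Fop_scale: "\<Phi> \<in> Sch \<Longrightarrow> Fop (\<lambda>x. c * \<Phi> x) = (\<lambda>y. c * Fop \<Phi> y)"
 unfolding Fop_def mult.assoc by (intro ext integ_scale chi_dot_Sch2)

lemma Fop_at_0: "Fop \<Phi> 0 = integ \<Phi>"
 by (simp add: Fop_def)

lemma Fop_U:
 assumes "\<Phi> \<in> Sch"
 shows "Fop (U p \<Phi>) = (\<lambda>x. chi (fq ww p) * U (ww p) (Fop \<Phi>) x)"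
proof
 fix y
 obtain v w where p: "p = (v, w)"
  by (cases p)
 let ?\<Psi> = "\<lambda>x. \<Phi> x * chi (dot x (w + y))"
 have *: "dot w x + dot x y = (dot w (- v) - dot v w) / 2 + (dot (- v) y + dot (x + v) (y + w))" for x
  by (simp add: dot_commute[of w] field_simps)
 have "U p \<Phi> x * chi (dot x y) = chi (fq ww p) * chi (dot (- v) y) * ?\<Psi> (x + v)" for x
 proof -
  have "chi (dot w x) * chi (dot x y) = chi ((dot w (- v) - dot v w) / 2) * (chi (dot (- v) y) * chi (dot (x + v) (y + w)))"
   using * by (metis chi_add)
  then show ?thesis
   unfolding p U_def ww_def fq_def fst_conv snd_conv by (simp add: mult_ac add.commute[of w] del: dot_simps)
 qed
 then have "Fop (U p \<Phi>) y = integ (\<lambda>x. chi (fq ww p) * chi (dot (- v) y) * ?\<Psi> (x + v))"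
  by (simp only: Fop_def)
 also have "\<dots> = chi (fq ww p) * chi (dot (- v) y) * integ ?\<Psi>"
  by (subst integ_scale[OF translate_Sch[OF chi_dot_Sch2[OF assms]]])
   (simp only: integ_translate[OF chi_dot_Sch2[OF assms]])
 finally show "Fop (U p \<Phi>) y = chi (fq ww p) * U (ww p) (Fop \<Phi>) y"
  by (simp add: U_def ww_def p Fop_def mult_ac add.commute)
qed

lemma Fop_ind: "Fop (ind k) = (\<lambda>y. vol k * ind (cond - k) y)"
proof
 fix y
 show "Fop (ind k) y = vol k * ind (cond - k) y"
 proof (cases "y \<in> lat (cond - k)")
  case True
  then have "(\<lambda>x. ind k x * chi (dot x y)) = ind k"
   using dot_fideal[of _ k y "cond - k"] cond(1) by (auto simp: ind_def)
  then show ?thesis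
   using True by (simp add: Fop_def integ_ind) (simp add: ind_def)
 next
  case False
  then obtain v where "v \<in> lat k" "chi (dot v y) \<noteq> 1"
   using lat_dual by blast
  then have "integ (\<lambda>x. ind k x * chi (dot x y)) = 0"
   by (intro integ_character_eq_0[where v = v] chi_dot_Sch2) (auto simp: chi_add)
  then show ?thesis
   using False by (simp add: Fop_def ind_def)
 qed
qed

lemma Fop_Sch: "\<Phi> \<in> Sch \<Longrightarrow> Fop \<Phi> \<in> Sch"
proof (induction rule: Sch_induct)
 case (ind k)
 then show ?case
  unfolding Fop_ind by (intro scale_Sch ind_Sch)
next
 case (translate \<Phi> v)
 have "Fop (\<lambda>x. \<Phi> (x + v)) = (\<lambda>x. chi (fq ww (v, 0)) * U (ww (v, 0)) (Fop \<Phi>) x)"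
  using Fop_U[OF translate(1), of "(v, 0)"] by (simp add: U_def)
 then show ?case
  using translate(2) by (simp add: scale_Sch)
qed (simp_all add: Fop_scale Fop_add scale_Sch add_Sch)

lemma linop_F: "linop Fop"
 by (rule linopI) (simp_all add: Fop_Sch Fop_add Fop_scale)

text \<open>Inversion by Schur's lemma instead of a double integral: the square of the transform,
  followed by reflection, commutes with all \<open>U p\<close>, and its scalar is read off from
  \<open>ind 0\<close>.\<close>

lemma Fop_Fop:
 assumes "\<Phi> \<in> Sch"
 shows "Fop (Fop \<Phi>) = (\<lambda>x. vol cond * \<Phi> (- x))"
proof -
 let ?T = "\<lambda>\<Phi> x. Fop (Fop \<Phi>) (- x)"
 have "(\<lambda>x. \<Phi> (- x)) \<in> Sch" if "\<Phi> \<in> Sch" for \<Phi> :: "'x \<Rightarrow> 'r"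
  using Mop_Sch[OF GL_uminus(1) that] by (simp add: Mop_def GL_uminus(2))
 then have lin: "linop ?T"
  by (intro linopI) (simp_all add: Fop_Sch Fop_add Fop_scale)
 have comm: "?T (U p \<Phi>) = U p (?T \<Phi>)" if \<Phi>: "\<Phi> \<in> Sch" for p and \<Phi> :: "'x \<Rightarrow> 'r"
 proof -
  have "fq ww (ww p) + fq ww p = 0"
   by (simp add: fq_def ww_def flip: add_divide_distrib)
  then have c: "chi (fq ww p) * (chi (fq ww (ww p)) * z) = z" for z
   by (simp add: add.commute flip: mult.assoc chi_add)
  have "Fop (Fop (U p \<Phi>)) = (\<lambda>x. chi (fq ww p) * (chi (fq ww (ww p)) * U (ww (ww p)) (Fop (Fop \<Phi>)) x))"
   by (simp add: Fop_U \<Phi> Fop_Sch Fop_scale)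
  then show ?thesis
   by (simp add: c) (simp add: U_def ww_def)
 qed
 obtain c where c: "\<And>\<Phi>. \<Phi> \<in> Sch \<Longrightarrow> ?T \<Phi> = (\<lambda>x. c * \<Phi> x)"
  using schur[OF lin comm] by blast
 have "c = vol cond"
  using fun_cong[OF c[OF ind_Sch[of 0]], of 0] by (simp add: Fop_ind Fop_scale) (simp add: ind_def)
 then show ?thesis
  using c[OF assms] by (metis minus_minus)
qed

lemma implements_F: "implements ww Fop"
 unfolding implements_def
proof (intro conjI allI ballI)
 show "linop Fop"
  by (rule linop_F)
 show "bij_betw Fop Sch Sch"
  unfolding bij_betw_def
 proof
  show "inj_on Fop Sch"
  proof (rule inj_onI)
   fix \<Phi> \<Psi> :: "'x \<Rightarrow> 'r" assume "\<Phi> \<in> Sch" "\<Psi> \<in> Sch" "Fop \<Phi> = Fop \<Psi>"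
   then have "(\<lambda>x. vol cond * \<Phi> (- x)) = (\<lambda>x. vol cond * \<Psi> (- x))"
    by (metis Fop_Fop)
   then have "\<Phi> (- x) = \<Psi> (- x)" for x
    by (auto simp: fun_eq_iff)
   from this[of "- _"] show "\<Phi> = \<Psi>"
    by (simp add: fun_eq_iff)
  qed
  show "Fop ` Sch = Sch"
  proof
   show "Fop ` Sch \<subseteq> Sch"
    using Fop_Sch by blast
   show "Sch \<subseteq> Fop ` Sch"
   proof
    fix \<Phi> :: "'x \<Rightarrow> 'r" assume \<Phi>: "\<Phi> \<in> Sch"
    define \<Psi> where "\<Psi> = (\<lambda>x. vol (- cond) * \<Phi> (- x))"
    have \<Psi>: "\<Psi> \<in> Sch"
     using scale_Sch[OF Mop_Sch[OF GL_uminus(1) \<Phi>], of "vol (- cond)"]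
     by (simp add: \<Psi>_def Mop_def GL_uminus(2))
    have "Fop (Fop \<Psi>) = \<Phi>"
     using vol_inverse[of cond] unfolding Fop_Fop[OF \<Psi>] by (simp add: \<Psi>_def flip: mult.assoc)
    then show "\<Phi> \<in> Fop ` Sch"
     using Fop_Sch[OF \<Psi>] by (metis imageI)
   qed
  qed
 qed
qed (rule Fop_U)

section \<open>The modulus of a linear automorphism\<close>

text \<open>The factor by which \<open>a\<close> scales the measure, namely the volume of the image
  of the unit lattice, as an element of the coefficients.\<close>

definition modulus :: "('x \<Rightarrow> 'x) \<Rightarrow> 'r"
 where "modulus a = integ (Mop a (ind 0))"

text \<open>Both sides implement the same symplectic map, so they differ by a scalar; evaluating the
  images of \<open>ind 0\<close> at 0 identifies it.\<close>

lemma Fop_Mop: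
 assumes a: "a \<in> GL" and \<Phi>: "\<Phi> \<in> Sch"
 shows "Fop (Mop a \<Phi>) = (\<lambda>x. modulus a * Mop (adj (ginv a)) (Fop \<Phi>) x)"
proof -
 have e: "ww \<circ> mm a = mm (adj (ginv a)) \<circ> ww"
  using a by (auto simp: ww_def mm_def inv_adj GL_lin lin_simps)
 have "implements (ww \<circ> mm a) (Fop \<circ> Mop a)"
  by (intro implements_comp implements_F implements_M a)
 moreover have "implements (mm (adj (ginv a)) \<circ> ww) (Mop (adj (ginv a)) \<circ> Fop)"
  using a by (intro implements_comp implements_F implements_M) simp
 ultimately obtain c where c: "\<And>\<Phi>. \<Phi> \<in> Sch \<Longrightarrow> (Fop \<circ> Mop a) \<Phi> = (\<lambda>x. c * (Mop (adj (ginv a)) \<circ> Fop) \<Phi> x)"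
  unfolding e using implements_unique by blast
 have "modulus a = c * Fop (ind 0) (ginv (adj (ginv a)) 0)"
  using fun_cong[OF c[OF ind_Sch[of 0]], of 0] by (simp add: modulus_def Fop_at_0 Mop_def)
 also have "ginv (adj (ginv a)) 0 = 0"
  using a by (simp add: inv_adj GL_lin lin_simps)
 finally have "modulus a = c"
  by (simp add: Fop_at_0 integ_ind)
 then show ?thesis
  using c[OF \<Phi>] by simp
qed

lemma Mop_at_0 [simp]: "a \<in> GL \<Longrightarrow> Mop a \<Phi> 0 = \<Phi> 0"
 by (simp add: Mop_def GL_lin lin_simps)

lemma integ_Mop: "a \<in> GL \<Longrightarrow> \<Phi> \<in> Sch \<Longrightarrow> integ (Mop a \<Phi>) = modulus a * integ \<Phi>"
 using fun_cong[OF Fop_Mop, of a \<Phi> 0] by (simp add: Fop_at_0)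

lemma modulus_id [simp]: "modulus id = 1"
 by (simp add: modulus_def Mop_def ginv_def integ_ind)

lemma modulus_comp:
 assumes "a \<in> GL" "b \<in> GL"
 shows "modulus (a \<circ> b) = modulus a * modulus b"
proof -
 have "Mop (a \<circ> b) (ind 0) = Mop a (Mop b (ind 0))"
  using assms by (simp add: Mop_def GL_inv_comp)
 then show ?thesis
  using integ_Mop[OF assms(1) Mop_Sch[OF assms(2) ind_Sch[of 0]]] by (simp add: modulus_def)
qed

lemma modulus_inv:
 assumes "a \<in> GL"
 shows "modulus a * modulus (ginv a) = 1" "modulus (ginv a) * modulus a = 1"
proof -
 have "a \<circ> ginv a = id"
  using assms by auto
 then show "modulus a * modulus (ginv a) = 1"
  using modulus_comp[of a "ginv a"] assms by simp
 then show "modulus (ginv a) * modulus a = 1"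
  by (simp add: mult.commute)
qed

text \<open>Two Fourier transforms of a dilated indicator produce the moduli of
  \<open>ginv a\<close> and of \<open>adj a\<close>; by inversion their product is 1.\<close>

lemma modulus_adj:
 assumes "a \<in> GL"
 shows "modulus (adj a) = modulus a"
proof -
 let ?b = "ginv a"
 have b: "?b \<in> GL" "adj (ginv ?b) = adj a"
  using assms by auto
 have "Fop (Fop (Mop ?b (ind 0))) = (\<lambda>x. modulus ?b * (modulus (adj a) * Mop ?b (Fop (Fop (ind 0))) x))"
  using assms b by (simp add: Fop_Mop Fop_Sch Mop_Sch Fop_scale inv_adj GL_lin)
 from fun_cong[OF this, of 0] have "vol cond * ind 0 (0::'x) = modulus ?b * (modulus (adj a) * (vol cond * ind 0 (0::'x)))"
  using b by (simp add: Fop_Fop Mop_Sch)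
 then have "modulus ?b * modulus (adj a) = 1"
  by (simp add: ind_def)
 then have "modulus a * (modulus ?b * modulus (adj a)) = modulus a"
  by simp
 then show ?thesis
  using modulus_inv(1)[OF assms] by (simp flip: mult.assoc)
qed

section \<open>Gauss sums of quadratic forms\<close>

text \<open>Defined as an intertwining scalar because a quadratic phase on the whole space is not a
  Schwartz function and has no integral here; \<open>gauss_formula\<close> recovers the truncated
  Gauss integral.\<close>

definition gauss :: "('x \<Rightarrow> 'x) \<Rightarrow> 'r"
 where "gauss B = (SOME g. (\<exists>h. g * h = 1) \<and> (\<forall>\<Phi>\<in>Sch. Fop (Nop B (Fop \<Phi>)) =
  (\<lambda>x. g * Nop (\<lambda>x. - ginv B x) (Mop B (Fop (Nop (\<lambda>x. - ginv B x) \<Phi>))) x)))"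

lemma sym_uminus_inv: "B \<in> GL \<Longrightarrow> sym B \<Longrightarrow> sym (\<lambda>x. - ginv B x)"
 using sym_inv[of B] sym_lin[of "ginv B"] by (intro symI) (auto simp: lin_def sym_dot)

text \<open>The relation \<open>w n(B) w = n(-B\<^sup>-\<^sup>1) m(B) w n(-B\<^sup>-\<^sup>1)\<close> holds for the operators up to the scalar \<open>gauss B\<close>.\<close>

lemma
 assumes B: "B \<in> GL" "sym B"
 shows gauss_relation: "\<Phi> \<in> Sch \<Longrightarrow> Fop (Nop B (Fop \<Phi>)) =
   (\<lambda>x. gauss B * Nop (\<lambda>x. - ginv B x) (Mop B (Fop (Nop (\<lambda>x. - ginv B x) \<Phi>))) x)"
  and gauss_unit: "\<exists>h. gauss B * h = 1"
proof -
 let ?b = "\<lambda>x. - ginv B x"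
 have s: "sym ?b"
  using sym_uminus_inv[OF B] .
 have l: "lin B" "lin (ginv B)"
  using B GL_lin by auto
 have adj: "adj (ginv B) = ginv B"
  using sym_inv[OF B] by (simp add: sym_def)
 have e: "ww \<circ> (nn B \<circ> ww) = nn ?b \<circ> (mm B \<circ> (ww \<circ> nn ?b))"
  using B(1) l by (auto simp: ww_def nn_def mm_def adj lin_simps)
 have i1: "implements (ww \<circ> (nn B \<circ> ww)) (Fop \<circ> (Nop B \<circ> Fop))"
  by (intro implements_comp implements_F implements_N B)
 have i2: "implements (nn ?b \<circ> (mm B \<circ> (ww \<circ> nn ?b))) (Nop ?b \<circ> (Mop B \<circ> (Fop \<circ> Nop ?b)))"
  by (intro implements_comp implements_F implements_N implements_M B s)
 obtain c d where cd: "c * d = 1" "\<forall>\<Phi>\<in>Sch. (Fop \<circ> (Nop B \<circ> Fop)) \<Phi> =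
   (\<lambda>x. c * (Nop ?b \<circ> (Mop B \<circ> (Fop \<circ> Nop ?b))) \<Phi> x)"
  using implements_unique[OF i1[unfolded e] i2] by (elim exE conjE)
 then have "\<exists>g. (\<exists>h. g * h = 1) \<and> (\<forall>\<Phi>\<in>Sch. Fop (Nop B (Fop \<Phi>)) =
  (\<lambda>x. g * Nop ?b (Mop B (Fop (Nop ?b \<Phi>))) x))"
  unfolding comp_def by (intro exI[of _ c] conjI exI[of _ d])
 from someI_ex[OF this, folded gauss_def]
 show "\<Phi> \<in> Sch \<Longrightarrow> Fop (Nop B (Fop \<Phi>)) = (\<lambda>x. gauss B * Nop ?b (Mop B (Fop (Nop ?b \<Phi>))) x)"
  "\<exists>h. gauss B * h = 1"
  by blast+
qed

lemma gauss_neq_0: "B \<in> GL \<Longrightarrow> sym B \<Longrightarrow> gauss B \<noteq> 0"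
 using gauss_unit[of B] by auto

text \<open>Evaluation at 0 removes the outer factor of the relation, and the hypothesis on
  \<open>\<Phi>\<close> makes the inner one act trivially.\<close>

lemma gauss_at_0:
 assumes B: "B \<in> GL" "sym B" and \<Phi>: "\<Phi> \<in> Sch"
  and triv: "\<And>x. \<Phi> x \<noteq> 0 \<Longrightarrow> chi (1 / 2 * dot x (ginv B x)) = 1"
 shows "integ (Nop B (Fop \<Phi>)) = gauss B * integ \<Phi>"
proof -
 have N: "Nop (\<lambda>x. - ginv B x) \<Phi> = \<Phi>"
 proof
  fix x
  show "Nop (\<lambda>x. - ginv B x) \<Phi> x = \<Phi> x"
   using triv[of x] by (cases "\<Phi> x = 0") (simp_all add: Nop_def)
 qed
 have "Fop (Nop B (Fop \<Phi>)) 0 = gauss B * Mop B (Fop \<Phi>) 0"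
  unfolding gauss_relation[OF B \<Phi>] N by (simp add: Nop_def)
 then show ?thesis
  using B by (simp add: Fop_at_0)
qed

text \<open>The previous evaluation for \<open>ind k\<close>, whose Fourier transform is a multiple
  of the indicator of the dual lattice; this multiple cancels.\<close>

lemma gauss_formula:
 assumes B: "B \<in> GL" "sym B" and triv: "\<And>x. x \<in> lat k \<Longrightarrow> chi (1 / 2 * dot x (ginv B x)) = 1"
 shows "gauss B = integ (\<lambda>x. chi (- (1 / 2) * dot x (B x)) * ind (cond - k) x)"
proof -
 have "integ (Nop B (Fop (ind k))) = gauss B * integ (ind k)"
  using triv by (intro gauss_at_0[OF B ind_Sch]) (simp add: ind_def split: if_splits)
 moreover have "Nop B (Fop (ind k)) = (\<lambda>x. vol k * Nop B (ind (cond - k)) x)"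
  by (simp add: Nop_def Fop_ind mult_ac)
 ultimately have "vol k * integ (Nop B (ind (cond - k))) = vol k * gauss B"
  using integ_scale[OF Nop_Sch[OF sym_lin[OF B(2)] ind_Sch]] by (simp add: integ_ind mult.commute)
 then show ?thesis
  by (simp add: Nop_def)
qed

lemma quadratic_trivial: "lin b \<Longrightarrow> \<exists>k0. \<forall>k\<ge>k0. \<forall>x\<in>lat k. chi (c * dot x (b x)) = 1"
proof -
 assume b: "lin b"
 obtain k0 where "\<forall>x\<in>lat 0. \<forall>y\<in>lat k0. chi (c * dot (x + y) (b (x + y))) = chi (c * dot x (b x))"
  using chi_quadratic_locally_constant[OF b] by blast
 then have "\<forall>y\<in>lat k0. chi (c * dot y (b y)) = 1"
  using L_0[of 0] by (metis add_0 chi_0 dot_simps(7) mult_zero_right)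
 then show ?thesis
  using lat_antimono by blast
qed

text \<open>The substitution of \<open>P x\<close> for \<open>x\<close> in the Gauss integral, with
  \<open>modulus P\<close> as its Jacobian. It is carried out on test functions, since the Gauss sum
  is only defined through them.\<close>

lemma gauss_congruence:
 assumes B: "B \<in> GL" "sym B" and P: "P \<in> GL"
 shows "modulus P * gauss (adj P \<circ> B \<circ> P) = gauss B"
proof -
 let ?B = "adj P \<circ> B \<circ> P" and ?Q = "adj (ginv P)"
 have lP: "lin P"
  using P by (rule GL_lin)
 have GL: "?B \<in> GL" "?Q \<in> GL"
  using B P by simp_all
 have sym: "sym ?B"
 proof (rule symI)
  show "lin ?B"
   using GL(1) by (rule GL_lin)
  show "dot (?B x) y = dot x (?B y)" for x y
   by (simp add: sym_dot[OF B(2)] dot_adj[OF lP] flip: dot_adj(2)[OF lP])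
 qed
 obtain k1 where k1: "\<And>k x. k1 \<le> k \<Longrightarrow> x \<in> lat k \<Longrightarrow> chi (1 / 2 * dot x (ginv ?B x)) = 1"
  using quadratic_trivial GL_lin GL_inv_in GL(1) by metis
 obtain k2 where k2: "\<And>k x. k2 \<le> k \<Longrightarrow> x \<in> lat k \<Longrightarrow> chi (1 / 2 * dot x (ginv B x)) = 1"
  using quadratic_trivial GL_lin GL_inv_in B(1) by metis
 obtain l where l: "\<And>k x. x \<in> lat k \<Longrightarrow> ?Q x \<in> lat (k + l)"
  using lin_lat GL_lin GL(2) by metis
 \<comment> \<open>Fine enough that the phase of the transformed form vanishes on
   \<open>lat k\<close> and the phase of \<open>B\<close> on its image under
   \<open>?Q\<close>.\<close>
 define k where "k = max k1 (k2 - l)"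
 have 1: "chi (1 / 2 * dot x (ginv ?B x)) = 1" if "ind k x \<noteq> (0::'r)" for x
  using that k1[of k x] by (simp add: ind_def k_def split: if_splits)
 have 2: "chi (1 / 2 * dot x (ginv B x)) = 1" if "Mop ?Q (ind k) x \<noteq> (0::'r)" for x
 proof -
  have "ginv ?Q x \<in> lat k"
   using that by (simp add: Mop_def ind_def split: if_splits)
  from l[OF this] have "x \<in> lat (k + l)"
   using GL(2) by simp
  then show ?thesis
   using k2[of "k + l" x] by (simp add: k_def)
 qed
 have Q: "Mop ?Q (ind k) \<in> Sch"
  using GL(2) by (simp add: Mop_Sch)
 have NM: "Nop ?B \<Phi> = Mop (ginv P) (Nop B (Mop P \<Phi>))" for \<Phi>
  using P by (simp add: Nop_def Mop_def dot_commute[of _ "adj P _"] flip: dot_adj(2)[OF lP])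
   (simp add: dot_commute)
 have lB: "lin B"
  using B(2) by (rule sym_lin)
 have FQ: "Fop (Mop ?Q (ind k)) = (\<lambda>x. modulus ?Q * Mop P (Fop (ind k)) x)"
  using Fop_Mop[OF GL(2) ind_Sch] P by (simp add: inv_adj GL_lin)
 have "modulus ?Q * (modulus P * integ (Nop ?B (Fop (ind k)))) =
   modulus ?Q * (modulus P * (modulus (ginv P) * integ (Nop B (Mop P (Fop (ind k))))))"
  unfolding NM using P lB by (simp add: integ_Mop Nop_Sch Mop_Sch Fop_Sch)
 also have "\<dots> = modulus ?Q * integ (Nop B (Mop P (Fop (ind k))))"
  using modulus_inv(1)[OF P] by (simp add: mult.assoc[symmetric, of "modulus P"])
 also have "\<dots> = integ (Nop B (Fop (Mop ?Q (ind k))))"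
 proof -
  have "Nop B (Fop (Mop ?Q (ind k))) = (\<lambda>x. modulus ?Q * Nop B (Mop P (Fop (ind k))) x)"
   by (simp add: FQ Nop_def mult.left_commute)
  then show ?thesis
   using integ_scale[OF Nop_Sch[OF lB Mop_Sch[OF P Fop_Sch[OF ind_Sch]]]] by simp
 qed
 also have "\<dots> = gauss B * (modulus ?Q * integ (ind k))"
  using gauss_at_0[OF B Q 2] integ_Mop[OF GL(2) ind_Sch] by simp
 also have "integ (Nop ?B (Fop (ind k))) = gauss ?B * integ (ind k)"
  using gauss_at_0[OF GL(1) sym ind_Sch 1] by simp
 finally have "(modulus ?Q * integ (ind k)) * (modulus P * gauss ?B) = (modulus ?Q * integ (ind k)) * gauss B"
  by (simp add: mult_ac)
 moreover have "modulus ?Q \<noteq> 0"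
  using modulus_inv(1)[OF GL(2)] by auto
 ultimately show ?thesis
  by (simp add: integ_ind)
qed

end

section \<open>Diagonal forms\<close>

context local_coeff
begin

text \<open>The field as a line over itself; its Gauss sums are the factors of those of diagonal
  forms.\<close>

lemma weil_one: "weil absv chi iq (*) (Suc 0) (\<lambda>i x. x) (\<lambda>i. 1)"
 by unfold_locales (auto simp: algebra_simps)

sublocale one: weil absv chi iq "(*)" "Suc 0" "\<lambda>i x. x" "\<lambda>i. 1"
 by (rule weil_one)

declare one.co_0 [simp del] one.co_add [simp del] one.co_smul [simp del] one.co_uminus [simp del]
 one.co_diff [simp del] one.co_sum [simp del] one.co_vec [simp del] one.dot_bv [simp del]
 one.smul_simps [simp del]

lemma one_lat: "one.lat k = fideal k"
 by (simp add: one.lat_def)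

lemma one_dot: "one.dot x y = x * y"
 by (simp add: one.dot_def)

lemma one_scale_GL:
 assumes "d \<noteq> 0"
 shows "(*) d \<in> one.GL" "one.ginv ((*) d) = (\<lambda>x. x / d)"
 using one.GL_I[of "(*) d" "\<lambda>x. x / d"] assms by (simp_all add: one.lin_def algebra_simps)

lemma one_scale_sym: "one.sym ((*) d)"
 by (rule one.symI) (auto simp: one.lin_def one_dot algebra_simps)

definition gauss1 :: "'f \<Rightarrow> 'r"
 where "gauss1 d = one.gauss ((*) d)"

definition modulus1 :: "'f \<Rightarrow> 'r"
 where "modulus1 d = one.modulus ((*) d)"

lemma one_transversal_index:
 assumes "one.transversal j k T" "j \<le> k"
 shows "card T = resq ^ nat (k - j)"
 using one.card_transversal[OF assms] by (simp add: one.lat_card_def)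

end

context weil
begin

definition diag :: "(nat \<Rightarrow> 'f) \<Rightarrow> 'x \<Rightarrow> 'x"
 where "diag d x = vec (\<lambda>i. d i * co i x)"

lemma lin_diag: "lin (diag d)"
 unfolding diag_def by (rule linI; rule co_eqI) (simp_all add: algebra_simps)

lemma diag_GL:
 assumes "\<And>i. i < n \<Longrightarrow> d i \<noteq> 0"
 shows "diag d \<in> GL" "ginv (diag d) = diag (\<lambda>i. inverse (d i))"
proof -
 have "diag d (diag (\<lambda>i. inverse (d i)) x) = x" "diag (\<lambda>i. inverse (d i)) (diag d x) = x" for x
  by (rule co_eqI; simp add: diag_def assms)+
 then show "diag d \<in> GL" "ginv (diag d) = diag (\<lambda>i. inverse (d i))"
  by (rule GL_I[OF lin_diag])+
qed

lemma dot_diag: "dot x (diag d y) = (\<Sum>i<n. d i * co i x * co i y)"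
 by (simp add: dot_def diag_def mult_ac)

lemma sym_diag: "sym (diag d)"
 by (rule symI[OF lin_diag]) (simp add: dot_def diag_def mult_ac)

lemma diag_comp: "diag d \<circ> diag e = diag (\<lambda>i. d i * e i)"
 by (rule ext, rule co_eqI) (simp add: diag_def mult.assoc)

lemma diag_one: "diag (\<lambda>i. 1) = id"
 by (rule ext, rule co_eqI) (simp add: diag_def)

lemma transversal_vec:
 assumes T: "one.transversal j k T"
 shows "transversal j k (vec ` PiE {..<n} (\<lambda>_. T))" "inj_on vec (PiE {..<n} (\<lambda>_. T))"
proof -
 show "inj_on vec (PiE {..<n} (\<lambda>_. T))"
 proof (rule inj_onI)
  fix f g assume fg: "f \<in> PiE {..<n} (\<lambda>_. T)" "g \<in> PiE {..<n} (\<lambda>_. T)" "vec f = vec g"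
  then have "f i = g i" if "i < n" for i
   using co_vec[OF that, of f] co_vec[OF that, of g] by simp
  then show "f = g"
   using fg by (intro PiE_ext) auto
 qed
 note TD = one.transversalD[OF T, unfolded one_lat]
 show "transversal j k (vec ` PiE {..<n} (\<lambda>_. T))"
  unfolding transversal_def
 proof (intro conjI ballI)
  show "finite (vec ` PiE {..<n} (\<lambda>_. T))"
   using TD(1) by (simp add: finite_PiE)
  show "vec ` PiE {..<n} (\<lambda>_. T) \<subseteq> lat j"
   using TD(2) by (auto simp: lat_def PiE_def Pi_def)
  fix x assume x: "x \<in> lat j"
  then have "\<exists>t. t \<in> T \<and> co i x - t \<in> fideal k" if "i < n" for i
   using TD(3)[of "co i x"] that by (auto simp: lat_def)
  then obtain t where t: "\<And>i. i < n \<Longrightarrow> t i \<in> T \<and> co i x - t i \<in> fideal k"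
   by metis
  let ?t = "restrict t {..<n}"
  show "\<exists>!u. u \<in> vec ` PiE {..<n} (\<lambda>_. T) \<and> x - u \<in> lat k"
  proof (rule ex1I[of _ "vec ?t"])
   show "vec ?t \<in> vec ` PiE {..<n} (\<lambda>_. T) \<and> x - vec ?t \<in> lat k"
    using t by (auto simp: lat_def)
   fix u assume u: "u \<in> vec ` PiE {..<n} (\<lambda>_. T) \<and> x - u \<in> lat k"
   then obtain s where s: "u = vec s" "s \<in> PiE {..<n} (\<lambda>_. T)"
    by blast
   have "s i = t i" if "i < n" for i
   proof -
    have "s i \<in> T" "co i x - s i \<in> fideal k"
     using s u that by (auto simp: lat_def)
    then show ?thesis
     using TD(3)[of "co i x"] t[OF that] x that by (auto simp: lat_def)
   qed
   then show "u = vec ?t"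
    unfolding s(1) by (intro co_eqI) simp
  qed
 qed
qed

lemma vol_eq_power: "vol k = one.vol k ^ n"
 unfolding vol_def one.vol_def
 unfolding lat_card_def one.lat_card_def lat_card_inverse_def one.lat_card_inverse_def
 by (simp add: power_mult[symmetric] mult.commute)

text \<open>Fubini for functions that are products in the coordinates: a power of a one-dimensional
  transversal is a transversal of the lattice.\<close>

lemma integ_prod:
 assumes "\<And>i. i < n \<Longrightarrow> \<phi> i \<in> one.Sch"
 shows "(\<lambda>x. \<Prod>i<n. \<phi> i (co i x)) \<in> Sch"
  "integ (\<lambda>x. \<Prod>i<n. \<phi> i (co i x)) = (\<Prod>i<n. one.integ (\<phi> i))"
proof -
 have "\<exists>j k. \<forall>i<m. one.supp_in j (\<phi> i) \<and> one.inv_under k (\<phi> i)" if "m \<le> n" for m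
  using that
 proof (induction m)
  case (Suc m)
  then obtain j k where jk: "\<And>i. i < m \<Longrightarrow> one.supp_in j (\<phi> i) \<and> one.inv_under k (\<phi> i)"
   by auto
  obtain j' k' where jk': "one.supp_in j' (\<phi> m)" "one.inv_under k' (\<phi> m)" "j' \<le> j" "k \<le> k'"
   using one.SchE[OF assms, of m j k] Suc.prems by (metis Suc_le_lessD)
  have "one.supp_in j' (\<phi> i) \<and> one.inv_under k' (\<phi> i)" if "i < Suc m" for i
   using that jk jk' one.supp_in_mono one.inv_under_mono by (metis less_Suc_eq)
  then show ?case
   by blast
 qed simp
 from this[of n] obtain j0 k where jk0: "\<And>i. i < n \<Longrightarrow> one.supp_in j0 (\<phi> i)" "\<And>i. i < n \<Longrightarrow> one.inv_under k (\<phi> i)"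
  by auto
 define j where "j = min j0 k"
 have jk: "j \<le> k" "\<And>i. i < n \<Longrightarrow> one.supp_in j (\<phi> i)"
  using one.supp_in_mono[OF jk0(1), of _ j] by (auto simp: j_def)
 let ?\<Phi> = "\<lambda>x. \<Prod>i<n. \<phi> i (co i x)"
 have supp: "supp_in j ?\<Phi>"
  using jk(2) by (auto simp: supp_in_def one.supp_in_def lat_def one_lat)
 have inv: "inv_under k ?\<Phi>"
  using jk0(2) by (auto simp: inv_under_def one.inv_under_def lat_def one_lat intro!: prod.cong)
 show "?\<Phi> \<in> Sch"
  using supp inv by (rule SchI)
 obtain T where T: "one.transversal j k T"
  using one.transversal_reps[OF jk(1)] by blast
 have "integ ?\<Phi> = vol k * (\<Sum>g\<in>PiE {..<n} (\<lambda>_. T). ?\<Phi> (vec g))"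
  by (subst integ_transversal[OF transversal_vec(1)[OF T] jk(1) supp inv])
   (simp add: sum.reindex[OF transversal_vec(2)[OF T]])
 also have "(\<Sum>g\<in>PiE {..<n} (\<lambda>_. T). ?\<Phi> (vec g)) = (\<Sum>g\<in>PiE {..<n} (\<lambda>_. T). \<Prod>i<n. \<phi> i (g i))"
  by simp
 also have "\<dots> = (\<Prod>i<n. \<Sum>t\<in>T. \<phi> i t)"
  using one.transversalD(1)[OF T] by (subst prod_sum_PiE) auto
 also have "vol k * \<dots> = (\<Prod>i<n. one.vol k * (\<Sum>t\<in>T. \<phi> i t))"
  by (simp add: prod.distrib vol_eq_power)
 also have "\<dots> = (\<Prod>i<n. one.integ (\<phi> i))"
  using one.integ_transversal[OF T jk(1)] jk jk0(2) by (intro prod.cong) auto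
 finally show "integ ?\<Phi> = (\<Prod>i<n. one.integ (\<phi> i))" .
qed

lemma ind_eq_prod: "ind k x = (\<Prod>i<n. one.ind k (co i x) :: 'r)"
proof (cases "x \<in> lat k")
 case True
 then show ?thesis
  by (simp add: ind_def one.ind_def lat_def one_lat)
next
 case False
 then obtain i where "i < n" "co i x \<notin> fideal k"
  by (auto simp: lat_def)
 then have "(\<Prod>i<n. one.ind k (co i x) :: 'r) = 0"
  by (intro prod_zero) (auto simp: one.ind_def one_lat)
 with False show ?thesis
  by (simp add: ind_def)
qed

lemma modulus_diag:
 assumes "\<And>i. i < n \<Longrightarrow> d i \<noteq> 0"
 shows "modulus (diag d) = (\<Prod>i<n. modulus1 (d i))"
proof -
 have "Mop (diag d) (ind 0) = (\<lambda>x. \<Prod>i<n. one.Mop ((*) (d i)) (one.ind 0) (co i x))"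
  by (rule ext) (simp add: Mop_def one.Mop_def ind_eq_prod diag_GL assms one_scale_GL diag_def
    divide_inverse mult.commute)
 then have "modulus (diag d) = (\<Prod>i<n. one.integ (one.Mop ((*) (d i)) (one.ind 0)))"
  unfolding modulus_def using integ_prod(2)[of "\<lambda>i. one.Mop ((*) (d i)) (one.ind 0)"]
  by (simp add: one.Mop_Sch one_scale_GL assms)
 then show ?thesis
  by (simp add: modulus1_def one.modulus_def)
qed

lemma gauss_diag:
 assumes "\<And>i. i < n \<Longrightarrow> d i \<noteq> 0"
 shows "gauss (diag d) = (\<Prod>i<n. gauss1 (d i))"
proof -
 \<comment> \<open>An index beyond which all the one-dimensional phases are trivial at once, so that
   a single truncation computes every Gauss sum involved.\<close>
 have "\<exists>k. \<forall>i<m. \<forall>x\<in>fideal k. chi (1 / 2 * (x * (x / d i))) = 1" for m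
 proof (induction m)
  case (Suc m)
  then obtain k where k: "\<And>i x. i < m \<Longrightarrow> x \<in> fideal k \<Longrightarrow> chi (1 / 2 * (x * (x / d i))) = 1"
   by blast
  have "one.lin (\<lambda>x. x / d m)"
   by (simp add: one.lin_def add_divide_distrib)
  from one.quadratic_trivial[OF this, of "1 / 2"] obtain k' where
   k': "\<And>l x. k' \<le> l \<Longrightarrow> x \<in> fideal l \<Longrightarrow> chi (1 / 2 * (x * (x / d m))) = 1"
   unfolding one_lat one_dot by blast
  have "chi (1 / 2 * (x * (x / d i))) = 1" if "i < Suc m" "x \<in> fideal (max k k')" for i x
   using that k[of i x] k'[of "max k k'" x] fideal_antimono[of k "max k k'"]
   by (cases "i = m") auto
  then show ?case
   by blast
 qed simp
 from this[of n] obtain k where k: "\<And>i x. i < n \<Longrightarrow> x \<in> fideal k \<Longrightarrow> chi (1 / 2 * (x * (x / d i))) = 1"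
  by blast
 let ?\<phi> = "\<lambda>i x. chi (- (1 / 2) * (x * (d i * x))) * one.ind (cond - k) x"
 have chi_sum: "chi (\<Sum>i<m. f i) = (\<Prod>i<m. chi (f i))" for f and m :: nat
  by (induction m) (simp_all add: chi_add)
 have one: "gauss1 (d i) = one.integ (?\<phi> i)" if "i < n" for i
  unfolding gauss1_def
  using one.gauss_formula[OF one_scale_GL(1)[OF assms[OF that]] one_scale_sym, of k]
   k[OF that] one_scale_GL(2)[OF assms[OF that]] by (simp add: one_lat one_dot)
 have triv: "chi (1 / 2 * dot x (ginv (diag d) x)) = 1" if "x \<in> lat k" for x
 proof -
  have inv: "ginv (diag d) = diag (\<lambda>i. inverse (d i))"
   by (rule diag_GL(2)) (rule assms)
  have "1 / 2 * dot x (ginv (diag d) x) = (\<Sum>i<n. 1 / 2 * (co i x * (co i x / d i)))"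
   unfolding inv dot_diag sum_distrib_left
   by (intro sum.cong refl) (simp add: field_simps assms)
  also have "chi \<dots> = 1"
   unfolding chi_sum using k that by (intro prod.neutral) (simp add: lat_def)
  finally show ?thesis .
 qed
 have "gauss (diag d) = integ (\<lambda>x. chi (- (1 / 2) * dot x (diag d x)) * ind (cond - k) x)"
  using diag_GL(1)[of d] assms sym_diag triv by (intro gauss_formula) auto
 also have "(\<lambda>x. chi (- (1 / 2) * dot x (diag d x)) * ind (cond - k) x) = (\<lambda>x. \<Prod>i<n. ?\<phi> i (co i x))"
 proof
  fix x
  have "- (1 / 2) * dot x (diag d x) = (\<Sum>i<n. - (1 / 2) * (co i x * (d i * co i x)))"
   unfolding dot_diag sum_distrib_left by (simp add: mult_ac)
  then show "chi (- (1 / 2) * dot x (diag d x)) * ind (cond - k) x = (\<Prod>i<n. ?\<phi> i (co i x))"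
   by (simp only: chi_sum ind_eq_prod prod.distrib)
 qed
 also have "integ \<dots> = (\<Prod>i<n. one.integ (?\<phi> i))"
 proof (rule integ_prod(2))
  show "?\<phi> i \<in> one.Sch" for i
   using one.Nop_Sch[OF one.sym_lin[OF one_scale_sym] one.ind_Sch, of "d i" "cond - k"]
   by (simp add: one.Nop_def one_dot)
 qed
 finally show ?thesis
  by (simp add: one)
qed

end

section \<open>Binary forms and Gauss sums over the residue field\<close>

context local_coeff
begin

definition smul2 :: "'f \<Rightarrow> 'f \<times> 'f \<Rightarrow> 'f \<times> 'f"
 where "smul2 c v = (c * fst v, c * snd v)"

definition co2 :: "nat \<Rightarrow> 'f \<times> 'f \<Rightarrow> 'f"
 where "co2 i v = (if i = 0 then fst v else snd v)"

definition bv2 :: "nat \<Rightarrow> 'f \<times> 'f"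
 where "bv2 i = (if i = 0 then (1, 0) else (0, 1))"

lemma weil_two: "weil absv chi iq smul2 2 co2 bv2"
 by unfold_locales (auto simp: smul2_def co2_def bv2_def eval_nat_numeral prod_eq_iff less_Suc_eq)

interpretation two: weil absv chi iq smul2 2 co2 bv2
 by (rule weil_two)

lemma two_lat: "two.lat k = fideal k \<times> fideal k"
 unfolding two.lat_def co2_def by (auto simp: numeral_2_eq_2 less_Suc_eq)

lemma two_dot: "two.dot x y = fst x * fst y + snd x * snd y"
 unfolding two.dot_def co2_def by (simp add: numeral_2_eq_2)

definition mat2 :: "'f \<Rightarrow> 'f \<Rightarrow> 'f \<Rightarrow> 'f \<Rightarrow> 'f \<times> 'f \<Rightarrow> 'f \<times> 'f"
 where "mat2 p r s t v = (p * fst v + r * snd v, s * fst v + t * snd v)"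

lemma mat2_lin: "two.lin (mat2 p r s t)"
 by (simp add: two.lin_def mat2_def smul2_def algebra_simps)

lemma mat2_comp: "mat2 p r s t \<circ> mat2 p' r' s' t' = mat2 (p * p' + r * s') (p * r' + r * t') (s * p' + t * s') (s * r' + t * t')"
 by (rule ext) (simp add: mat2_def algebra_simps)

lemma mat2_adj: "two.adj (mat2 p r s t) = mat2 p s r t"
 by (rule two.adj_unique[OF mat2_lin]) (simp add: two_dot mat2_def algebra_simps)

lemma mat2_GL:
 assumes "p * t - r * s \<noteq> 0"
 shows "mat2 p r s t \<in> two.GL"
  "two.ginv (mat2 p r s t) = mat2 (t / (p * t - r * s)) (- r / (p * t - r * s)) (- s / (p * t - r * s)) (p / (p * t - r * s))"
proof -
 define D where "D = p * t - r * s"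
 have D: "D \<noteq> 0" "p * t = D + r * s"
  using assms by (simp_all add: D_def)
 let ?i = "mat2 (t / D) (- r / D) (- s / D) (p / D)"
 have id: "mat2 1 0 0 1 v = v" for v
  by (simp add: mat2_def)
 have "mat2 p r s t \<circ> ?i = mat2 1 0 0 1" "?i \<circ> mat2 p r s t = mat2 1 0 0 1"
  unfolding mat2_comp using D by (simp_all add: field_simps)
 then have "mat2 p r s t (?i v) = v" "?i (mat2 p r s t v) = v" for v
  by (metis comp_apply id)+
 from two.GL_I[OF mat2_lin this]
 show "mat2 p r s t \<in> two.GL" "two.ginv (mat2 p r s t) = mat2 (t / (p * t - r * s)) (- r / (p * t - r * s)) (- s / (p * t - r * s)) (p / (p * t - r * s))"
  by (simp_all add: D_def)
qed

lemma mat2_sym: "two.sym (mat2 p r r t)"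
 by (simp add: two.sym_def mat2_lin mat2_adj)

lemma mat2_diag: "mat2 p 0 0 t = two.diag (\<lambda>i. if i = 0 then p else t)"
proof (rule ext, rule two.co_eqI)
 fix v i assume "i < (2::nat)"
 then show "co2 i (mat2 p 0 0 t v) = co2 i (two.diag (\<lambda>i. if i = 0 then p else t) v)"
  unfolding two.diag_def by (subst two.co_vec) (auto simp: mat2_def co2_def)
qed

lemma modulus1_mult:
 assumes "a \<noteq> 0" "b \<noteq> 0"
 shows "modulus1 (a * b) = modulus1 a * modulus1 b"
proof -
 have "(*) (a * b) = (*) a \<circ> (*) b"
  by (simp add: fun_eq_iff mult.assoc)
 then show ?thesis
  unfolding modulus1_def using one.modulus_comp[OF one_scale_GL(1)[OF assms(1)] one_scale_GL(1)[OF assms(2)]]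
  by simp
qed

lemma modulus1_1 [simp]: "modulus1 1 = 1"
proof -
 have "(*) (1::'f) = id"
  by auto
 then show ?thesis
  unfolding modulus1_def by simp
qed

lemma modulus1_neq_0: "a \<noteq> 0 \<Longrightarrow> modulus1 a \<noteq> 0"
 using one.modulus_inv(1)[OF one_scale_GL(1)[of a]] unfolding modulus1_def by auto

lemma gauss1_unit: "a \<noteq> 0 \<Longrightarrow> \<exists>h. gauss1 a * h = 1"
 unfolding gauss1_def by (rule one.gauss_unit[OF one_scale_GL(1) one_scale_sym])

lemma gauss1_neq_0: "a \<noteq> 0 \<Longrightarrow> gauss1 a \<noteq> 0"
 using gauss1_unit by fastforce

lemma gauss1_square:
 assumes "d \<noteq> 0" "r \<noteq> 0"
 shows "modulus1 r * gauss1 (d * r\<^sup>2) = gauss1 d"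
proof -
 have "one.adj ((*) r) = (*) r"
  using one_scale_sym by (simp add: one.sym_def)
 then have "one.adj ((*) r) \<circ> (*) d \<circ> (*) r = (*) (d * r\<^sup>2)"
  by (simp add: fun_eq_iff power2_eq_square mult_ac)
 then show ?thesis
  unfolding modulus1_def gauss1_def
  using one.gauss_congruence[OF one_scale_GL(1)[OF assms(1)] one_scale_sym one_scale_GL(1)[OF assms(2)]] by simp
qed

lemma two_modulus_diag:
 assumes "p \<noteq> 0" "t \<noteq> 0"
 shows "two.modulus (mat2 p 0 0 t) = modulus1 p * modulus1 t"
 unfolding mat2_diag using assms by (subst two.modulus_diag) (auto simp: eval_nat_numeral)

lemma two_gauss_diag:
 assumes "p \<noteq> 0" "t \<noteq> 0"
 shows "two.gauss (mat2 p 0 0 t) = gauss1 p * gauss1 t"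
 unfolding mat2_diag using assms by (subst two.gauss_diag) (auto simp: eval_nat_numeral)

text \<open>A shear is conjugate to its square, hence has modulus 1.\<close>

lemma two_modulus_shear: "two.modulus (mat2 1 0 s 1) = 1" "two.modulus (mat2 1 s 0 1) = 1"
proof -
 let ?L = "mat2 1 0 s 1" and ?D = "mat2 1 0 0 2"
 have GL: "?L \<in> two.GL" "?D \<in> two.GL"
  by (simp_all add: mat2_GL)
 have "?D \<circ> ?L = (?L \<circ> ?L) \<circ> ?D"
  unfolding mat2_comp by (simp add: mult.commute)
 then have "two.modulus ?D * two.modulus ?L = two.modulus ?L * two.modulus ?L * two.modulus ?D"
  using GL by (metis two.GL_comp two.modulus_comp)
 then have "(two.modulus ?D * two.modulus ?L) * (two.modulus ?L - 1) = 0"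
  by (simp add: algebra_simps)
 moreover have "two.modulus ?D \<noteq> 0" "two.modulus ?L \<noteq> 0"
  using two.modulus_inv(1)[OF GL(1)] two.modulus_inv(1)[OF GL(2)] by auto
 ultimately show "two.modulus ?L = 1"
  by simp
 then show "two.modulus (mat2 1 s 0 1) = 1"
  using two.modulus_adj[OF GL(1)] by (simp add: mat2_adj)
qed

text \<open>The pivot \<open>p\<close> allows a factorization into a lower shear, a diagonal matrix
  and an upper shear; the shears have modulus 1.\<close>

lemma two_modulus:
 assumes "p \<noteq> 0" "p * t - r * s \<noteq> 0"
 shows "two.modulus (mat2 p r s t) = modulus1 (p * t - r * s)"
proof -
 let ?q = "(p * t - r * s) / p"
 have "mat2 p r s t = mat2 1 0 (s / p) 1 \<circ> (mat2 p 0 0 ?q \<circ> mat2 1 (r / p) 0 1)"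
  unfolding mat2_comp using assms by (simp add: field_simps)
 then have "two.modulus (mat2 p r s t) = two.modulus (mat2 p 0 0 ?q)"
  using assms by (simp add: two.modulus_comp two_modulus_shear mat2_GL)
 also have "\<dots> = modulus1 p * modulus1 ?q"
  using assms by (simp add: two_modulus_diag)
 also have "\<dots> = modulus1 (p * t - r * s)"
  using assms by (simp flip: modulus1_mult)
 finally show ?thesis .
qed

text \<open>The binary forms \<open>\<langle>a, b\<rangle>\<close> and \<open>\<langle>c, a b c\<rangle>\<close> are isometric if \<open>c = a x\<^sup>2 + b y\<^sup>2 \<noteq> 0\<close>.\<close>

lemma gauss1_binary:
 assumes "a \<noteq> 0" "b \<noteq> 0" "x \<noteq> 0" "c = a * x\<^sup>2 + b * y\<^sup>2" "c \<noteq> 0"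
 shows "modulus1 c * (gauss1 c * gauss1 (a * b * c)) = gauss1 a * gauss1 b"
proof -
 \<comment> \<open>The first column \<open>(x, y)\<close> represents \<open>c\<close>; the second
   one is orthogonal to it for the form and chosen so that the determinant is \<open>c\<close> as
   well.\<close>
 let ?P = "mat2 x (- b * y) y (a * x)" and ?B = "mat2 a 0 0 b"
 have det: "x * (a * x) - (- b * y) * y = c"
  by (simp add: assms(4) power2_eq_square algebra_simps)
 have P: "?P \<in> two.GL" "two.modulus ?P = modulus1 c"
  using mat2_GL(1)[of x "a * x" "- b * y" y] two_modulus[of x "a * x" "- b * y" y] assms unfolding det by simp_all
 have B: "?B \<in> two.GL" "two.sym ?B"
  using assms mat2_sym[of a 0 b] by (simp_all add: mat2_GL)
 have e: "two.adj ?P \<circ> ?B \<circ> ?P = mat2 c 0 0 (a * b * c)"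
  unfolding mat2_adj mat2_comp assms(4) by (simp add: power2_eq_square algebra_simps)
 have "a * b * c \<noteq> 0"
  using assms by simp
 from two.gauss_congruence[OF B P(1), unfolded e P(2) two_gauss_diag[OF assms(1,2)]
   two_gauss_diag[OF assms(5) this]]
 show ?thesis .
qed

section \<open>Sums over the residue field\<close>

definition resreps :: "'f set"
 where "resreps = one.reps 0 1"

lemma resreps_transversal: "one.transversal 0 1 resreps"
 unfolding resreps_def by (rule one.transversal_reps) simp

lemma finite_resreps: "finite resreps" and resreps_fideal: "t \<in> resreps \<Longrightarrow> t \<in> fideal 0"
 and card_resreps: "card resreps = resq"
 using one.transversalD[OF resreps_transversal] one_transversal_index[OF resreps_transversal]
 by (simp_all add: one_lat)

lemma resreps_unique: "s \<in> resreps \<Longrightarrow> t \<in> resreps \<Longrightarrow> s - t \<in> fideal 1 \<Longrightarrow> s = t"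
 using one.transversal_unique[OF resreps_transversal] by (simp add: one_lat)

definition resrep :: "'f \<Rightarrow> 'f"
 where "resrep x = (SOME t. t \<in> resreps \<and> x - t \<in> fideal 1)"

lemma resrep:
 assumes "x \<in> fideal 0"
 shows "resrep x \<in> resreps" "x - resrep x \<in> fideal 1"
proof -
 have "\<exists>t. t \<in> resreps \<and> x - t \<in> fideal 1"
  using one.transversalD(3)[OF resreps_transversal] assms unfolding one_lat by blast
 from someI_ex[OF this] show "resrep x \<in> resreps" "x - resrep x \<in> fideal 1"
  by (simp_all add: resrep_def)
qed

lemma resrep_eq_iff:
 assumes "x \<in> fideal 0" "y \<in> fideal 0"
 shows "resrep x = resrep y \<longleftrightarrow> x - y \<in> fideal 1"
proof
 assume "resrep x = resrep y"
 then show "x - y \<in> fideal 1"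
  using fideal_diff[OF resrep(2)[OF assms(1)] resrep(2)[OF assms(2)]] by simp
next
 assume "x - y \<in> fideal 1"
 then have "(x - y) - (x - resrep x) + (y - resrep y) \<in> fideal 1"
  using resrep(2)[OF assms(1)] resrep(2)[OF assms(2)] fideal_add fideal_diff by blast
 then have "resrep x - resrep y \<in> fideal 1"
  by simp
 then show "resrep x = resrep y"
  using resreps_unique resrep(1) assms by blast
qed

text \<open>A self-map that is injective modulo the maximal ideal permutes the finite set of residue
  classes and may be substituted in a sum over them.\<close>

lemma resreps_reindex:
 fixes f :: "'f \<Rightarrow> 'r"
 assumes h: "\<And>x. x \<in> fideal 0 \<Longrightarrow> h x \<in> fideal 0"
  and inj: "\<And>x y. x \<in> fideal 0 \<Longrightarrow> y \<in> fideal 0 \<Longrightarrow> h x - h y \<in> fideal 1 \<Longrightarrow> x - y \<in> fideal 1"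
  and f: "\<And>x y. x - y \<in> fideal 1 \<Longrightarrow> f x = f y"
 shows "(\<Sum>t\<in>resreps. f (h t)) = (\<Sum>t\<in>resreps. f t)"
proof -
 let ?g = "\<lambda>t. resrep (h t)"
 have "inj_on ?g resreps"
 proof (rule inj_onI)
  fix s t assume st: "s \<in> resreps" "t \<in> resreps" "?g s = ?g t"
  note st0 = resreps_fideal[OF st(1)] resreps_fideal[OF st(2)]
  have "h s - h t \<in> fideal 1"
   using st(3) resrep_eq_iff[OF h[OF st0(1)] h[OF st0(2)]] by simp
  from resreps_unique[OF st(1,2) inj[OF st0 this]] show "s = t" .
 qed
 moreover have "?g ` resreps \<subseteq> resreps"
  using h resrep(1) resreps_fideal by blast
 ultimately have "bij_betw ?g resreps resreps"
  using finite_resreps by (simp add: bij_betw_def endo_inj_surj)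
 then have "(\<Sum>t\<in>resreps. f t) = (\<Sum>t\<in>resreps. f (?g t))"
  by (rule sum.reindex_bij_betw[symmetric])
 also have "\<dots> = (\<Sum>t\<in>resreps. f (h t))"
  using h resreps_fideal resrep(2) by (intro sum.cong refl f[symmetric]) auto
 finally show ?thesis ..
qed

text \<open>\<open>c0\<close> lies exactly at the conductor, so \<open>chi\<close> is trivial on its
  integral multiples; \<open>c1\<close> lies one step below, so \<open>chi\<close> of a multiple of
  \<open>c1\<close> is a non-trivial character of the residue field.\<close>

definition c0 :: 'f where "c0 = unif powi cond"
definition c1 :: 'f where "c1 = unif powi (cond - 1)"

lemma c_neq_0 [simp]: "c0 \<noteq> 0" "c1 \<noteq> 0"
 by (simp_all add: c0_def c1_def)

lemma c0_eq: "c0 = c1 * unif"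
 by (simp add: c0_def c1_def power_int_diff)

definition unit :: "'f \<Rightarrow> bool"
 where "unit e \<longleftrightarrow> absv e = 1"

lemma unitD:
 assumes "unit e"
 shows "e \<noteq> 0" "e \<in> fideal 0" "inverse e \<in> fideal 0" "e * x \<in> fideal k \<longleftrightarrow> x \<in> fideal k"
  "x * e \<in> fideal k \<longleftrightarrow> x \<in> fideal k" "x / e \<in> fideal k \<longleftrightarrow> x \<in> fideal k"
 using assms by (auto simp: unit_def fideal_def absv_mult absv_inverse absv_divide)

lemma unit_iff: "unit e \<longleftrightarrow> e \<in> fideal 0 \<and> e \<notin> fideal 1"
 unfolding unit_def fideal_0_iff fideal_1_iff by auto

lemma unit_mult: "unit a \<Longrightarrow> unit b \<Longrightarrow> unit (a * b)"
 by (simp add: unit_def absv_mult)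

lemma unit_divide: "unit a \<Longrightarrow> unit b \<Longrightarrow> unit (a / b)"
 by (simp add: unit_def absv_divide)

lemma chi_c1_cong: "e \<in> fideal 0 \<Longrightarrow> x - y \<in> fideal 1 \<Longrightarrow> chi (e * c1 * x) = chi (e * c1 * y)"
proof (rule chi_cong)
 assume "e \<in> fideal 0" "x - y \<in> fideal 1"
 from fideal_mult[OF this] have "e * (x - y) \<in> fideal 1"
  by simp
 then have "unif powi (cond - 1) * (e * (x - y)) \<in> fideal cond"
  unfolding unif_mult_fideal by simp
 then show "e * c1 * x - e * c1 * y \<in> fideal cond"
  by (simp add: c1_def algebra_simps)
qed

lemma sum_chi_c1:
 assumes "unit e"
 shows "(\<Sum>t\<in>resreps. chi (e * c1 * t)) = 0"
proof -
 let ?\<psi> = "\<lambda>x. chi (e * c1 * x)"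
 let ?\<Phi> = "\<lambda>x. one.ind 0 x * ?\<psi> x"
 obtain z where z: "z \<in> fideal (cond - 1)" "chi z \<noteq> 1"
  using cond(2) by blast
 define v where "v = z / c1 / e"
 have "unif powi (cond - 1) * (z / c1) \<in> fideal (cond - 1)"
  using z(1) by (simp add: c1_def)
 then have "z / c1 \<in> fideal 0"
  unfolding unif_mult_fideal by simp
 then have "v \<in> fideal 0"
  unfolding v_def using unitD(6)[OF assms] by blast
 moreover have "?\<psi> v \<noteq> 1"
  using z(2) unitD(1)[OF assms] by (simp add: v_def)
 ultimately have v: "v \<in> fideal 0" "?\<psi> v \<noteq> 1"
  by simp_all
 have supp: "one.supp_in 0 ?\<Phi>"
  by (simp add: one.supp_in_def one.ind_def)
 have inv: "one.inv_under 1 ?\<Phi>"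
  unfolding one.inv_under_def
 proof (intro allI impI)
  fix x y assume y: "y \<in> one.lat 1"
  then have "y \<in> one.lat 0"
   using fideal_antimono[of 0 1] by (auto simp: one_lat)
  then have "one.ind 0 (x + y) = (one.ind 0 x :: 'r)"
   by (simp add: one.ind_def one.L_add_cancel)
  moreover have "?\<psi> (x + y) = ?\<psi> x"
   using y unitD(2)[OF assms] by (intro chi_c1_cong) (simp_all add: one_lat)
  ultimately show "?\<Phi> (x + y) = ?\<Phi> x"
   by simp
 qed
 have "one.integ ?\<Phi> = 0"
 proof (rule one.integ_character_eq_0)
  show "?\<Phi> \<in> one.Sch"
   by (rule one.SchI[OF supp inv])
  show "?\<psi> (x + y) = ?\<psi> x * ?\<psi> y" for x y
   by (simp add: distrib_left chi_add)
  show "v \<in> one.lat 0" "?\<psi> v \<noteq> 1"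
   using v by (simp_all add: one_lat)
 qed
 moreover have "one.integ ?\<Phi> = one.vol 1 * (\<Sum>t\<in>resreps. ?\<Phi> t)"
  by (rule one.integ_transversal[OF resreps_transversal _ supp inv]) simp
 moreover have "(\<Sum>t\<in>resreps. ?\<Phi> t) = (\<Sum>t\<in>resreps. ?\<psi> t)"
  by (rule sum.cong) (simp_all add: one.ind_def one_lat resreps_fideal)
 ultimately show ?thesis
  by simp
qed

lemma resreps_zero: obtains z where "z \<in> resreps" "z \<in> fideal 1" "\<And>t. t \<in> resreps - {z} \<Longrightarrow> unit t"
proof -
 have z: "resrep 0 \<in> resreps" "resrep 0 \<in> fideal 1"
  using resrep[of 0] by simp_all
 moreover have "unit t" if "t \<in> resreps - {resrep 0}" for t
  using that resreps_fideal[of t] resreps_unique[of t "resrep 0"] z fideal_diff[of t 1 "resrep 0"]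
  by (auto simp: unit_iff)
 ultimately show thesis
  by (rule that)
qed

lemma modulus1_unif: "modulus1 unif = iq"
proof -
 have "one.Mop ((*) unif) (one.ind 0) = (one.ind 1 :: 'f \<Rightarrow> 'r)"
 proof
  fix x
  have "x / unif \<in> fideal 0 \<longleftrightarrow> x \<in> fideal 1"
   using unif_mult_fideal[of 1 "x / unif" 1] by simp
  then show "one.Mop ((*) unif) (one.ind 0) x = (one.ind 1 x :: 'r)"
   by (simp add: one.Mop_def one_scale_GL one.ind_def one_lat)
 qed
 then have "modulus1 unif = one.vol 1"
  by (simp only: modulus1_def one.modulus_def one.integ_ind)
 also have "\<dots> = iq"
  unfolding one.vol_def unfolding one.lat_card_inverse_def by simp
 finally show ?thesis .
qed

section \<open>Gauss sums are not multiplicative\<close>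

lemma unif_powi_mult_fideal_iff: "x / unif powi i \<in> fideal k \<longleftrightarrow> x \<in> fideal (i + k)"
 using unif_mult_fideal[of i "x / unif powi i" "i + k"] by simp

text \<open>At the level of the conductor the phase is trivial on the integers, and only the volume
  of the unit lattice remains.\<close>

lemma gauss1_c0:
 assumes "unit 2" "unit e"
 shows "gauss1 (c0 * e) = 1"
proof -
 have GL: "(*) (c0 * e) \<in> one.GL" "one.ginv ((*) (c0 * e)) = (\<lambda>x. x / (c0 * e))"
  using unitD(1)[OF assms(2)] by (simp_all add: one_scale_GL)
 have triv: "chi (1 / 2 * one.dot x (one.ginv ((*) (c0 * e)) x)) = 1" if "x \<in> one.lat cond" for x
 proof (rule cond(1))
  have "x * x \<in> fideal (cond + cond)"
   using that fideal_mult[of x cond x cond] by (simp add: one_lat)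
  then have "x * x / c0 / e / 2 \<in> fideal cond"
   unfolding unitD(6)[OF assms(1)] unitD(6)[OF assms(2)] c0_def unif_powi_mult_fideal_iff by simp
  moreover have "1 / 2 * one.dot x (one.ginv ((*) (c0 * e)) x) = x * x / c0 / e / 2"
   unfolding GL(2) one_dot by simp
  ultimately show "1 / 2 * one.dot x (one.ginv ((*) (c0 * e)) x) \<in> fideal cond"
   by (simp only:)
 qed
 have "gauss1 (c0 * e) = one.integ (\<lambda>x. chi (- (1 / 2) * one.dot x (c0 * e * x)) * one.ind (cond - cond) x)"
  unfolding gauss1_def by (rule one.gauss_formula[OF GL(1) one_scale_sym triv])
 also have "(\<lambda>x. chi (- (1 / 2) * one.dot x (c0 * e * x)) * one.ind (cond - cond) x) = one.ind 0"
 proof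
  fix x
  have "chi (- (1 / 2) * one.dot x (c0 * e * x)) = 1" if "x \<in> fideal 0"
  proof (rule cond(1))
   have "e * (x * x) \<in> fideal 0"
    using unitD(4)[OF assms(2)] fideal_mult[OF that that] by simp
   then have "c0 * (e * (x * x)) / 2 \<in> fideal cond"
    unfolding unitD(6)[OF assms(1)] c0_def unif_mult_fideal by simp
   then have "- (c0 * (e * (x * x)) / 2) \<in> fideal cond"
    by simp
   then show "- (1 / 2) * one.dot x (c0 * e * x) \<in> fideal cond"
    by (simp add: one_dot mult_ac)
  qed
  then show "chi (- (1 / 2) * one.dot x (c0 * e * x)) * one.ind (cond - cond) x = one.ind 0 x"
   by (simp add: one.ind_def one_lat)
 qed
 finally show ?thesis
  by (simp add: one.integ_ind)
qed

text \<open>One step below the conductor the truncation is still to the integers, but the phase now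
  depends on the residue class: a quadratic Gauss sum of the residue field.\<close>

lemma gauss1_c1:
 assumes "unit 2" "unit e"
 shows "gauss1 (c1 * e) = one.vol 1 * (\<Sum>t\<in>resreps. chi (- (1 / 2) * c1 * (e * t\<^sup>2)))"
proof -
 have GL: "(*) (c1 * e) \<in> one.GL" "one.ginv ((*) (c1 * e)) = (\<lambda>x. x / (c1 * e))"
  using unitD(1)[OF assms(2)] by (simp_all add: one_scale_GL)
 have triv: "chi (1 / 2 * one.dot x (one.ginv ((*) (c1 * e)) x)) = 1" if "x \<in> one.lat cond" for x
 proof (rule cond(1))
  have "x * x \<in> fideal (cond + cond)"
   using that fideal_mult[of x cond x cond] by (simp add: one_lat)
  then have "x * x \<in> fideal (cond - 1 + cond)"
   using fideal_antimono[of "cond - 1 + cond" "cond + cond"] by auto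
  then have "x * x / c1 / e / 2 \<in> fideal cond"
   unfolding unitD(6)[OF assms(1)] unitD(6)[OF assms(2)] c1_def unif_powi_mult_fideal_iff by simp
  moreover have "1 / 2 * one.dot x (one.ginv ((*) (c1 * e)) x) = x * x / c1 / e / 2"
   unfolding GL(2) one_dot by simp
  ultimately show "1 / 2 * one.dot x (one.ginv ((*) (c1 * e)) x) \<in> fideal cond"
   by (simp only:)
 qed
 let ?\<Phi> = "\<lambda>x. chi (- (1 / 2) * one.dot x (c1 * e * x)) * one.ind (cond - cond) x"
 have "unit (- (1 / 2))"
  using assms(1) by (simp add: unit_def absv_divide)
 then have half: "- (1 / 2) \<in> fideal 0"
  by (simp add: unit_iff)
 have supp: "one.supp_in 0 ?\<Phi>"
  by (simp add: one.supp_in_def one.ind_def)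
 have inv: "one.inv_under 1 ?\<Phi>"
  unfolding one.inv_under_def
 proof (intro allI impI)
  fix x y assume "y \<in> one.lat 1"
  then have y: "y \<in> fideal 1" "y \<in> fideal 0"
   using fideal_antimono[of 0 1] by (auto simp: one_lat)
  show "?\<Phi> (x + y) = ?\<Phi> x"
  proof (cases "x \<in> fideal 0")
   case True
   have "y * (x + x + y) \<in> fideal (1 + 0)"
    using y True by (intro fideal_mult fideal_add)
   then have "e * (y * (x + x + y)) \<in> fideal 1"
    unfolding unitD(4)[OF assms(2)] by simp
   moreover have "e * (y * (x + x + y)) = e * (x + y)\<^sup>2 - e * x\<^sup>2"
    by (simp add: power2_eq_square algebra_simps)
   ultimately have "e * (x + y)\<^sup>2 - e * x\<^sup>2 \<in> fideal 1"
    by (simp only:)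
   from chi_c1_cong[OF half this]
   have "chi (- (1 / 2) * one.dot (x + y) (c1 * e * (x + y))) = chi (- (1 / 2) * one.dot x (c1 * e * x))"
    by (simp add: one_dot power2_eq_square mult_ac)
   moreover have "x + y \<in> fideal 0"
    using True y fideal_add by blast
   ultimately show ?thesis
    using True by (simp add: one.ind_def one_lat)
  next
   case False
   then have "x + y \<notin> fideal 0"
    using fideal_diff[of "x + y" 0 y] y by auto
   then show ?thesis
    using False by (simp add: one.ind_def one_lat)
  qed
 qed
 have "gauss1 (c1 * e) = one.integ ?\<Phi>"
  unfolding gauss1_def by (rule one.gauss_formula[OF GL(1) one_scale_sym triv])
 also have "\<dots> = one.vol 1 * (\<Sum>t\<in>resreps. ?\<Phi> t)"
  by (rule one.integ_transversal[OF resreps_transversal _ supp inv]) simp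
 also have "(\<Sum>t\<in>resreps. ?\<Phi> t) = (\<Sum>t\<in>resreps. chi (- (1 / 2) * c1 * (e * t\<^sup>2)))"
  by (rule sum.cong) (simp_all add: one.ind_def one_lat one_dot resreps_fideal power2_eq_square mult_ac)
 finally show ?thesis .
qed

text \<open>
 For odd residue characteristic and a nonsquare unit \<open>e\<close>, the values \<open>t\<^sup>2\<close> and \<open>e t\<^sup>2\<close> together
 cover every nonzero residue class twice.
\<close>

lemma squares_and_nonsquares:
 assumes two: "unit 2" and f: "\<And>x y. x - y \<in> fideal 1 \<Longrightarrow> f x = f y"
 obtains e where "unit e" "(\<Sum>t\<in>resreps. f (t\<^sup>2)) + (\<Sum>t\<in>resreps. f (e * t\<^sup>2)) = 2 * (\<Sum>t\<in>resreps. f t :: 'r)"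
proof -
 obtain z where z: "z \<in> resreps" "z \<in> fideal 1" "\<And>t. t \<in> resreps - {z} \<Longrightarrow> unit t"
  using resreps_zero by blast
 let ?K = "resreps - {z}"
 have K0: "t \<in> fideal 0" if "t \<in> ?K" for t
  using resreps_fideal that by blast
 have resrep_K: "resrep x \<in> ?K" if "unit x" for x
 proof -
  have "resrep x \<noteq> z"
   using z(2) resrep(2)[of x] fideal_add[of "x - resrep x" 1 z] that by (auto simp: unit_iff)
  then show ?thesis
   using resrep(1)[of x] that by (simp add: unit_iff)
 qed
 let ?s = "\<lambda>e t. resrep (e * t\<^sup>2)"
 have s0: "unit (e * t\<^sup>2)" if "unit e" "t \<in> ?K" for e t
  using that z(3)[OF that(2)] by (simp add: unit_def absv_mult absv_power)
 have sq_iff: "?s e t = ?s e u \<longleftrightarrow> u = t \<or> u = resrep (- t)" if e: "unit e" and t: "t \<in> ?K" and u: "u \<in> ?K" for e t u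
 proof -
  have 0: "e * t\<^sup>2 \<in> fideal 0" "e * u\<^sup>2 \<in> fideal 0" "- t \<in> fideal 0"
   using s0[OF e t] s0[OF e u] z(3)[OF t] by (simp_all add: unit_iff)
  have "?s e t = ?s e u \<longleftrightarrow> e * t\<^sup>2 - e * u\<^sup>2 \<in> fideal 1"
   using 0 by (simp add: resrep_eq_iff)
  also have "\<dots> \<longleftrightarrow> (t - u) * (t + u) \<in> fideal 1"
  proof -
   have "e * t\<^sup>2 - e * u\<^sup>2 = e * ((t - u) * (t + u))"
    by (simp add: power2_eq_square algebra_simps)
   then show ?thesis
    using unitD(4)[OF e] by simp
  qed
  also have "\<dots> \<longleftrightarrow> t - u \<in> fideal 1 \<or> t + u \<in> fideal 1"
  proof
   assume prod: "(t - u) * (t + u) \<in> fideal 1"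
   show "t - u \<in> fideal 1 \<or> t + u \<in> fideal 1"
   proof (rule ccontr)
    assume "\<not> ?thesis"
    then have "unit (t - u)" "unit (t + u)"
     using K0[OF t] K0[OF u] by (auto simp: unit_iff fideal_add fideal_diff)
    then have "unit ((t - u) * (t + u))"
     by (rule unit_mult)
    then show False
     using prod by (simp add: unit_iff)
   qed
  next
   assume "t - u \<in> fideal 1 \<or> t + u \<in> fideal 1"
   moreover have "t - u \<in> fideal 0" "t + u \<in> fideal 0"
    using K0[OF t] K0[OF u] fideal_add fideal_diff by auto
   ultimately show "(t - u) * (t + u) \<in> fideal 1"
    using fideal_mult[of "t - u" 1 "t + u" 0] fideal_mult[of "t - u" 0 "t + u" 1] by auto
  qed
  also have "t - u \<in> fideal 1 \<longleftrightarrow> u = t"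
   using resreps_unique[of t u] t u by auto
  also have "t + u \<in> fideal 1 \<longleftrightarrow> u = resrep (- t)"
  proof
   assume tu: "t + u \<in> fideal 1"
   have "(t + u) + (- t - resrep (- t)) \<in> fideal 1"
    using tu resrep(2)[OF 0(3)] by (rule fideal_add)
   then have "u - resrep (- t) \<in> fideal 1"
    by simp
   then show "u = resrep (- t)"
    using resreps_unique[of u] u resrep(1)[OF 0(3)] by blast
  next
   assume "u = resrep (- t)"
   then have "- (- t - u) \<in> fideal 1"
    using resrep(2)[OF 0(3)] unfolding fideal_uminus by simp
   then show "t + u \<in> fideal 1"
    by (simp add: add.commute)
  qed
  finally show ?thesis .
 qed
 have neg: "resrep (- t) \<in> ?K" "resrep (- t) \<noteq> t" if t: "t \<in> ?K" for t
 proof -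
  have ut: "unit t" "unit (- t)"
   using z(3)[OF t] by (simp_all add: unit_def)
  show "resrep (- t) \<in> ?K"
   using resrep_K[OF ut(2)] .
  show "resrep (- t) \<noteq> t"
  proof
   assume "resrep (- t) = t"
   then have "- (2 * t) \<in> fideal 1"
    using resrep(2)[of "- t"] ut(2) by (simp add: unit_iff)
   then have "2 * t \<in> fideal 1"
    unfolding fideal_uminus .
   then show False
    using unitD(4)[OF two] ut(1) by (simp add: unit_iff)
  qed
 qed
 have finK: "finite ?K"
  using finite_resreps by simp
 have fibre: "card {t \<in> ?K. ?s e t = y} = 2" if e: "unit e" and y: "y \<in> ?s e ` ?K" for e y
 proof -
  obtain t where t: "t \<in> ?K" "y = ?s e t"
   using y by blast
  have "{u \<in> ?K. ?s e u = y} = {u \<in> ?K. u = t \<or> u = resrep (- t)}"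
   unfolding t(2) by (intro Collect_cong conj_cong refl) (metis sq_iff[OF e t(1)])
  also have "\<dots> = {t, resrep (- t)}"
   using t(1) neg[OF t(1)] by auto
  finally have "{u \<in> ?K. ?s e u = y} = {t, resrep (- t)}" .
  then show ?thesis
   using neg(2)[OF t(1)] by simp
 qed
 have sumK: "(\<Sum>t\<in>?K. f (e * t\<^sup>2)) = 2 * (\<Sum>y\<in>?s e ` ?K. f y)" if e: "unit e" for e
 proof -
  have "(\<Sum>t\<in>?K. f (e * t\<^sup>2)) = (\<Sum>t\<in>?K. f (?s e t))"
   using s0[OF e] resrep(2) by (intro sum.cong refl f) (simp add: unit_iff)
  also have "\<dots> = (\<Sum>y\<in>?s e ` ?K. \<Sum>t\<in>{t \<in> ?K. ?s e t = y}. f (?s e t))"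
   by (rule sum.image_gen[OF finK])
  also have "\<dots> = (\<Sum>y\<in>?s e ` ?K. \<Sum>t\<in>{t \<in> ?K. ?s e t = y}. f y)"
   by (intro sum.cong refl) simp
  also have "\<dots> = (\<Sum>y\<in>?s e ` ?K. 2 * f y)"
   using fibre[OF e] by (intro sum.cong refl) simp
  finally show ?thesis
   by (simp add: sum_distrib_left)
 qed
 have cardK: "card ?K = 2 * card (?s e ` ?K)" if e: "unit e" for e
 proof -
  have "card ?K = (\<Sum>y\<in>?s e ` ?K. card {t \<in> ?K. ?s e t = y})"
   using sum.image_gen[OF finK, of "\<lambda>_. 1::nat" "?s e"] by simp
  then show ?thesis
   using fibre[OF e] by simp
 qed
 have subK: "?s e ` ?K \<subseteq> ?K" if e: "unit e" for e
  using resrep_K s0[OF e] by blast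
 have one: "unit 1" "1 \<in> fideal 0"
  by (simp_all add: unit_def fideal_0_iff)
 \<comment> \<open>Every fibre of squaring has two elements, so the squares are half of the
   non-empty set \<open>?K\<close>, and a nonsquare \<open>e\<close> exists.\<close>
 have "?K \<noteq> {}"
  using resrep_K[OF one(1)] by blast
 then have "card ?K \<noteq> 0"
  using finK by simp
 then have "card (?s 1 ` ?K) < card ?K"
  using cardK[OF one(1)] by linarith
 then obtain e where e: "e \<in> ?K" "e \<notin> ?s 1 ` ?K"
  using subK[OF one(1)] by (metis card_mono finK finite_imageI not_le subsetI)
 have ue: "unit e"
  using z(3)[OF e(1)] .
 have disj: "?s 1 ` ?K \<inter> ?s e ` ?K = {}"
 proof (rule ccontr)
  assume "\<not> ?thesis"
  then obtain t u where tu: "t \<in> ?K" "u \<in> ?K" "?s 1 t = ?s e u"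
   by blast
  have "1 * t\<^sup>2 - e * u\<^sup>2 \<in> fideal 1"
   using tu s0[OF one(1) tu(1)] s0[OF ue tu(2)] by (subst resrep_eq_iff[symmetric]) (auto simp: unit_iff)
  then have "(t\<^sup>2 - e * u\<^sup>2) / u / u \<in> fideal 1"
   unfolding unitD(6)[OF z(3)[OF tu(2)]] by simp
  moreover have "(t\<^sup>2 - e * u\<^sup>2) / u / u = (t / u)\<^sup>2 - e"
   using unitD(1)[OF z(3)[OF tu(2)]] by (simp add: power2_eq_square field_simps)
  ultimately have d: "(t / u)\<^sup>2 - e \<in> fideal 1"
   by simp
  have ut: "unit (t / u)"
   using unit_divide z(3) tu by blast
  define v where "v = resrep (t / u)"
  have v: "v \<in> ?K" "t / u - v \<in> fideal 1" "t / u \<in> fideal 0" "v \<in> fideal 0"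
   using resrep_K[OF ut] resrep[of "t / u"] ut resreps_fideal by (auto simp: v_def unit_iff)
  have "(t / u - v) * (t / u + v) \<in> fideal (1 + 0)"
   using v by (intro fideal_mult fideal_add)
  then have "((t / u)\<^sup>2 - e) - (t / u - v) * (t / u + v) \<in> fideal 1"
   using d fideal_diff by simp
  then have "1 * v\<^sup>2 - e \<in> fideal 1"
   by (simp add: power2_eq_square algebra_simps)
  then have "?s 1 v = resrep e"
   using s0[OF one(1) v(1)] ue by (subst resrep_eq_iff) (auto simp: unit_iff)
  also have "resrep e = e"
   using resrep[of e] resreps_unique[of e "resrep e"] e ue by (auto simp: unit_iff)
  finally show False
   using e(2) v(1) by blast
 qed
 have "card (?s 1 ` ?K \<union> ?s e ` ?K) = card ?K"
  using cardK[OF one(1)] cardK[OF ue] disj finK by (subst card_Un_disjoint) auto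
 then have un: "?s 1 ` ?K \<union> ?s e ` ?K = ?K"
  using subK[OF one(1)] subK[OF ue] finK by (intro card_subset_eq) auto
 have split: "(\<Sum>t\<in>resreps. g t) = g z + (\<Sum>t\<in>?K. g t)" for g :: "'f \<Rightarrow> 'r"
  using z(1) finite_resreps by (simp add: sum.remove)
 have fz: "f (e' * z\<^sup>2) = f z" if "e' \<in> fideal 0" for e'
 proof (rule f)
  have "e' * z * z \<in> fideal (0 + 0 + 1)"
   using that z fideal_antimono[of 0 1] by (intro fideal_mult) auto
  then show "e' * z\<^sup>2 - z \<in> fideal 1"
   using z(2) fideal_diff by (simp add: power2_eq_square mult.assoc)
 qed
 have "(\<Sum>t\<in>?K. f (1 * t\<^sup>2)) + (\<Sum>t\<in>?K. f (e * t\<^sup>2)) = 2 * ((\<Sum>y\<in>?s 1 ` ?K. f y) + (\<Sum>y\<in>?s e ` ?K. f y))"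
  unfolding sumK[OF one(1)] sumK[OF ue] by (simp add: distrib_left)
 also have "(\<Sum>y\<in>?s 1 ` ?K. f y) + (\<Sum>y\<in>?s e ` ?K. f y) = (\<Sum>y\<in>?K. f y)"
  using sum.union_disjoint[OF _ _ disj, of f] finK unfolding un by simp
 finally have "(\<Sum>t\<in>resreps. f (t\<^sup>2)) + (\<Sum>t\<in>resreps. f (e * t\<^sup>2)) = 2 * (\<Sum>t\<in>resreps. f t)"
  unfolding split using fz[OF one(2)] fz[of e] ue by (simp add: unit_iff algebra_simps)
 then show thesis
  using ue that by blast
qed

text \<open>The values at \<open>c0\<close> and \<open>c0 * e\<close> are 1 for every unit
  \<open>e\<close>, so multiplicativity would give \<open>gauss1 e = gauss1 1\<close> and hence
  equal values at \<open>c1\<close> and \<open>c1 * e\<close>. For a nonsquare \<open>e\<close>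
  these values add up to 0.\<close>

lemma gauss1_not_multiplicative_odd:
 assumes two: "unit 2" and hom: "\<And>a b. a \<noteq> 0 \<Longrightarrow> b \<noteq> 0 \<Longrightarrow> gauss1 (a * b) * gauss1 1 = gauss1 a * gauss1 b"
 shows False
proof -
 have half: "unit (- (1 / 2))"
  using two by (simp add: unit_def absv_divide)
 then have half0: "- (1 / 2) \<in> fideal 0"
  by (simp add: unit_iff)
 obtain e where e: "unit e" and "(\<Sum>t\<in>resreps. chi (- (1 / 2) * c1 * t\<^sup>2)) +
   (\<Sum>t\<in>resreps. chi (- (1 / 2) * c1 * (e * t\<^sup>2))) = 2 * (\<Sum>t\<in>resreps. chi (- (1 / 2) * c1 * t))"
  by (rule squares_and_nonsquares[OF two, of "\<lambda>x. chi (- (1 / 2) * c1 * x)", OF chi_c1_cong[OF half0]])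
 then have 0: "(\<Sum>t\<in>resreps. chi (- (1 / 2) * c1 * t\<^sup>2)) + (\<Sum>t\<in>resreps. chi (- (1 / 2) * c1 * (e * t\<^sup>2))) = 0"
  unfolding sum_chi_c1[OF half] by simp
 have one: "unit 1"
  by (simp add: unit_def)
 have "gauss1 (c1 * 1) + gauss1 (c1 * e) = one.vol 1 *
   ((\<Sum>t\<in>resreps. chi (- (1 / 2) * c1 * t\<^sup>2)) + (\<Sum>t\<in>resreps. chi (- (1 / 2) * c1 * (e * t\<^sup>2))))"
  using gauss1_c1[OF two one] gauss1_c1[OF two e] by (simp add: distrib_left)
 then have "gauss1 (c1 * 1) + gauss1 (c1 * e) = 0"
  unfolding 0 by simp
 moreover have "gauss1 (c0 * e) * gauss1 1 = gauss1 c0 * gauss1 e" "gauss1 (c0 * 1) = 1" "gauss1 (c0 * e) = 1"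
  using hom[of c0 e] gauss1_c0[OF two one] gauss1_c0[OF two e] unitD(1)[OF e] by simp_all
 then have "gauss1 1 = gauss1 e"
  by simp
 then have "gauss1 (c1 * e) = gauss1 c1"
  using hom[of c1 e] unitD(1)[OF e] gauss1_neq_0[of 1] by simp
 ultimately have "2 * gauss1 c1 = 0"
  by simp
 then show False
  using gauss1_neq_0[of c1] by simp
qed

text \<open>
 For residue characteristic 2 we compare \<open>a (x\<^sup>2 + x y + d y\<^sup>2)\<close> for \<open>a = c0\<close> and \<open>a = c1\<close>,
 where \<open>x\<^sup>2 + x + d\<close> is irreducible modulo the maximal ideal.
\<close>

interpretation two: weil absv chi iq smul2 2 co2 bv2
 by (rule weil_two)

text \<open>Completing the square: 2 is invertible in the field although it is not a unit of the
  integers, so the form is diagonal over the field and its Gauss sum is a product.\<close>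

lemma two_gauss_unramified_form:
 assumes "a \<noteq> 0" "4 * d - 1 \<noteq> 0"
 shows "two.gauss (mat2 (2 * a) a a (2 * a * d)) = gauss1 (2 * a) * gauss1 (a * (2 * d - 1 / 2))"
proof -
 let ?B = "mat2 (2 * a) a a (2 * a * d)" and ?P = "mat2 1 (- 1 / 2) 0 1"
 have det: "2 * a * (2 * a * d) - a * a = a * a * (4 * d - 1)"
  by (simp add: algebra_simps)
 have B: "?B \<in> two.GL" "two.sym ?B"
  using assms by (simp_all add: mat2_GL mat2_sym det)
 have P: "?P \<in> two.GL" "two.modulus ?P = 1"
  by (simp_all add: mat2_GL two_modulus_shear)
 have e: "two.adj ?P \<circ> ?B \<circ> ?P = mat2 (2 * a) 0 0 (a * (2 * d - 1 / 2))"
  unfolding mat2_adj mat2_comp by (simp add: field_simps)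
 have "2 * d - 1 / 2 \<noteq> 0"
  using assms(2) by (auto simp: field_simps)
 then have "two.gauss (mat2 (2 * a) 0 0 (a * (2 * d - 1 / 2))) = gauss1 (2 * a) * gauss1 (a * (2 * d - 1 / 2))"
  using assms by (intro two_gauss_diag) auto
 then show ?thesis
  using two.gauss_congruence[OF B P(1), unfolded e P(2)] by simp
qed

text \<open>Because \<open>4 * d - 1\<close> is a unit, the Gram matrix is
  \<open>unif powi m\<close> times an integrally invertible one. The inverse form is therefore
  integral up to that power, and truncation to the unit lattice is admissible.\<close>

lemma two_gauss_formula:
 assumes "d \<in> fideal 0" "unit (4 * d - 1)" "m \<le> cond"
 shows "two.gauss (mat2 (2 * unif powi m) (unif powi m) (unif powi m) (2 * unif powi m * d)) =
  two.integ (\<lambda>v. chi (- (unif powi m * ((fst v)\<^sup>2 + fst v * snd v + d * (snd v)\<^sup>2))) * two.ind 0 v)"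
proof -
 let ?a = "unif powi m" and ?D = "4 * d - 1"
 let ?B = "mat2 (2 * ?a) ?a ?a (2 * ?a * d)"
 have det: "2 * ?a * (2 * ?a * d) - ?a * ?a = ?a * ?a * ?D"
  by (simp add: algebra_simps)
 have D: "?a \<noteq> 0" "?D \<noteq> 0"
  using unitD(1)[OF assms(2)] by simp_all
 have GL: "?B \<in> two.GL" "two.sym ?B"
  using D by (simp_all add: mat2_GL mat2_sym det)
 have inv: "1 / 2 * two.dot v (two.ginv ?B v) = (d * (fst v * fst v) - fst v * snd v + snd v * snd v) / ?a / ?D" for v
 proof -
  have "two.ginv ?B = mat2 (2 * ?a * d / (?a * ?a * ?D)) (- ?a / (?a * ?a * ?D)) (- ?a / (?a * ?a * ?D)) (2 * ?a / (?a * ?a * ?D))"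
   using mat2_GL(2)[of "2 * ?a" "2 * ?a * d" ?a ?a] D unfolding det by simp
  also have "\<dots> = mat2 (2 * d / (?a * ?D)) (- 1 / (?a * ?D)) (- 1 / (?a * ?D)) (2 / (?a * ?D))"
   using D(1) by simp
  finally have e: "two.ginv ?B v = ((2 * d * fst v - snd v) / (?a * ?D), (2 * snd v - fst v) / (?a * ?D))"
   by (simp add: mat2_def diff_divide_distrib)
  define E where "E = ?a * ?D"
  have E: "E \<noteq> 0"
   using D by (simp add: E_def)
  have "1 / 2 * (fst v * ((2 * d * fst v - snd v) / E) + snd v * ((2 * snd v - fst v) / E)) =
    (d * (fst v * fst v) - fst v * snd v + snd v * snd v) / E"
   using E by (simp add: field_simps)
  then show ?thesis
   unfolding two_dot e fst_conv snd_conv divide_divide_eq_left E_def .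
 qed
 have triv: "chi (1 / 2 * two.dot v (two.ginv ?B v)) = 1" if "v \<in> two.lat cond" for v
 proof (rule cond(1))
  have v: "fst v \<in> fideal cond" "snd v \<in> fideal cond"
   using that by (auto simp: two_lat)
  have "d * (fst v * fst v) \<in> fideal (0 + (cond + cond))" "fst v * snd v \<in> fideal (cond + cond)"
   "snd v * snd v \<in> fideal (cond + cond)"
   by (intro fideal_mult v assms(1))+
  then have "d * (fst v * fst v) - fst v * snd v + snd v * snd v \<in> fideal (cond + cond)"
   by (intro fideal_add fideal_diff) simp_all
  then have "d * (fst v * fst v) - fst v * snd v + snd v * snd v \<in> fideal (m + cond)"
   using fideal_antimono[of "m + cond" "cond + cond"] assms(3) by auto
  then show "1 / 2 * two.dot v (two.ginv ?B v) \<in> fideal cond"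
   unfolding inv unitD(6)[OF assms(2)] unif_powi_mult_fideal_iff .
 qed
 have "two.gauss ?B = two.integ (\<lambda>v. chi (- (1 / 2) * two.dot v (?B v)) * two.ind (cond - cond) v)"
  by (rule two.gauss_formula[OF GL triv])
 also have "(\<lambda>v. chi (- (1 / 2) * two.dot v (?B v)) * two.ind (cond - cond) v) =
   (\<lambda>v. chi (- (?a * ((fst v)\<^sup>2 + fst v * snd v + d * (snd v)\<^sup>2))) * two.ind 0 v)"
 proof
  fix v
  have "- (1 / 2) * two.dot v (?B v) = - (?a * ((fst v)\<^sup>2 + fst v * snd v + d * (snd v)\<^sup>2))"
   unfolding two_dot mat2_def by (simp add: power2_eq_square field_simps)
  then show "chi (- (1 / 2) * two.dot v (?B v)) * two.ind (cond - cond) v =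
   chi (- (?a * ((fst v)\<^sup>2 + fst v * snd v + d * (snd v)\<^sup>2))) * two.ind 0 v"
   by simp
 qed
 finally show ?thesis .
qed

lemma two_vol_1: "two.vol 1 = iq\<^sup>2"
 unfolding two.vol_def unfolding two.lat_card_inverse_def by simp

text \<open>In residue characteristic 2 the map \<open>t^2 + t\<close> identifies the classes of 0
  and 1, so on the finite residue field it also misses a class, and any such class serves as
  \<open>d\<close>.\<close>

lemma exists_irreducible:
 assumes "2 \<in> fideal 1"
 obtains d where "d \<in> fideal 0" "\<And>s. s \<in> fideal 0 \<Longrightarrow> unit (s\<^sup>2 + s + d)"
proof -
 let ?h = "\<lambda>t. resrep (t\<^sup>2 + t)"
 have h0: "t\<^sup>2 + t \<in> fideal 0" if "t \<in> fideal 0" for t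
  using that fideal_mult[of t 0 t 0] fideal_add by (simp add: power2_eq_square)
 have one: "1 \<in> fideal 0"
  by (simp add: fideal_0_iff)
 define o1 where "o1 = resrep 1"
 define z where "z = resrep 0"
 have r: "o1 \<in> resreps" "1 - o1 \<in> fideal 1" "z \<in> resreps" "- z \<in> fideal 1"
  using resrep[OF one] resrep[of 0] by (simp_all add: o1_def z_def)
 have "o1 \<noteq> z"
  using r(2,4) fideal_diff[of "1 - o1" 1 "- z"] by (auto simp: fideal_1_iff)
 have z1: "z \<in> fideal 1"
  using r(4) unfolding fideal_uminus .
 have "- (1 - o1) \<in> fideal 1"
  using r(2) unfolding fideal_uminus .
 then have "o1 - 1 \<in> fideal 1"
  by simp
 moreover have "o1 + 1 + 1 \<in> fideal 0" "z + 1 \<in> fideal 0"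
  by (intro fideal_add resreps_fideal r one)+
 ultimately have "(o1 - 1) * (o1 + 1 + 1) \<in> fideal (1 + 0)" "z * (z + 1) \<in> fideal (1 + 0)"
  using z1 by - (rule fideal_mult; assumption)+
 then have "(o1 - 1) * (o1 + 1 + 1) + 2 - z * (z + 1) \<in> fideal 1"
  using assms by (intro fideal_diff fideal_add) simp_all
 then have "(o1\<^sup>2 + o1) - (z\<^sup>2 + z) \<in> fideal 1"
  by (simp add: power2_eq_square algebra_simps)
 then have "?h o1 = ?h z"
  using h0 resreps_fideal r by (subst resrep_eq_iff) auto
 then have "\<not> inj_on ?h resreps"
  using r \<open>o1 \<noteq> z\<close> by (auto simp: inj_on_def)
 moreover have "?h ` resreps \<subseteq> resreps"
  using resrep(1) h0 resreps_fideal by blast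
 moreover have "?h ` resreps \<noteq> resreps"
  using \<open>\<not> inj_on ?h resreps\<close> eq_card_imp_inj_on[OF finite_resreps, of ?h] by auto
 ultimately have "?h ` resreps \<subset> resreps"
  by blast
 then obtain d where d: "d \<in> resreps" "d \<notin> ?h ` resreps"
  by blast
 have d0: "d \<in> fideal 0"
  using d(1) resreps_fideal by blast
 have "unit (s\<^sup>2 + s + d)" if s: "s \<in> fideal 0" for s
 proof (rule ccontr)
  assume "\<not> ?thesis"
  then have 1: "s\<^sup>2 + s + d \<in> fideal 1"
   using h0[OF s] d0 fideal_add by (auto simp: unit_iff)
  let ?t = "resrep s"
  have t: "?t \<in> resreps" "s - ?t \<in> fideal 1" "?t \<in> fideal 0"
   using resrep[OF s] resreps_fideal by auto
  \<comment> \<open>Twice \<open>?t^2 + ?t\<close> lies in the maximal ideal, which turns a root of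
    \<open>s^2 + s + d\<close> into a solution of \<open>d = ?t^2 + ?t\<close> modulo that
    ideal.\<close>
  have 2: "2 * (?t\<^sup>2 + ?t) \<in> fideal (1 + 0)"
   using assms h0[OF t(3)] by (rule fideal_mult)
  have 3: "(s - ?t) * (s + ?t + 1) \<in> fideal (1 + 0)"
   using t s one by (intro fideal_mult fideal_add)
  have "s\<^sup>2 + s + d - (s - ?t) * (s + ?t + 1) - 2 * (?t\<^sup>2 + ?t) \<in> fideal 1"
   using 1 2 3 by (intro fideal_diff) simp_all
  moreover have "s\<^sup>2 + s + d - (s - ?t) * (s + ?t + 1) - 2 * (?t\<^sup>2 + ?t) = d - (?t\<^sup>2 + ?t)"
   by (simp add: power2_eq_square algebra_simps)
  ultimately have 4: "d - (?t\<^sup>2 + ?t) \<in> fideal 1"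
   by (simp only:)
  have "(d - (?t\<^sup>2 + ?t)) + ((?t\<^sup>2 + ?t) - ?h ?t) \<in> fideal 1"
   using 4 resrep(2)[OF h0[OF t(3)]] by (rule fideal_add)
  then have "d = ?h ?t"
   using resreps_unique[OF d(1) resrep(1)[OF h0[OF t(3)]]] by simp
  then show False
   using d(2) t(1) by blast
 qed
 then show thesis
  using d0 that by blast
qed

text \<open>For \<open>y\<close> nonzero in the residue field, replacing \<open>x\<close> by
  \<open>y * x\<close> makes the argument \<open>(x^2 + x + d) * y^2\<close>. Squaring is a
  bijection of the residue field, so each sum over all \<open>y\<close> vanishes and omitting the
  zero class leaves -1 for each of the \<open>resq\<close> values of \<open>x\<close>. The terms
  with \<open>y\<close> in the zero class also sum to 0.\<close>

lemma sum_chi_unramified: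
 assumes two: "2 \<in> fideal 1" and d: "d \<in> fideal 0" "\<And>s. s \<in> fideal 0 \<Longrightarrow> unit (s\<^sup>2 + s + d)"
 shows "(\<Sum>x\<in>resreps. \<Sum>y\<in>resreps. chi (- 1 * c1 * (x\<^sup>2 + x * y + d * y\<^sup>2))) = - of_nat resq"
proof -
 let ?e = "\<lambda>x. chi (- 1 * c1 * x)"
 have um: "unit (- 1)" "- 1 \<in> fideal 0"
  by (simp_all add: unit_def fideal_0_iff)
 have cong: "?e x = ?e y" if "x - y \<in> fideal 1" for x y
  by (rule chi_c1_cong[OF um(2) that])
 have sum_e: "(\<Sum>t\<in>resreps. ?e t) = 0"
  by (rule sum_chi_c1[OF um(1)])
 have sq0: "x\<^sup>2 \<in> fideal 0" if "x \<in> fideal 0" for x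
  using fideal_mult[OF that that] by (simp add: power2_eq_square)
 have sq_inj: "x - y \<in> fideal 1" if "x \<in> fideal 0" "y \<in> fideal 0" "x\<^sup>2 - y\<^sup>2 \<in> fideal 1" for x y
 proof (rule ccontr)
  assume n: "x - y \<notin> fideal 1"
  then have u: "unit (x - y)"
   using that fideal_diff by (simp add: unit_iff)
  have "2 * (y * (x - y)) \<in> fideal (1 + (0 + 0))"
   using that two fideal_diff by (intro fideal_mult) auto
  then have "(x\<^sup>2 - y\<^sup>2) - 2 * (y * (x - y)) \<in> fideal 1"
   using that(3) fideal_diff by simp
  then have "(x - y) * (x - y) \<in> fideal 1"
   by (simp add: power2_eq_square algebra_simps)
  then show False
   using unitD(4)[OF u] n by simp
 qed
 have sum_square: "(\<Sum>t\<in>resreps. ?e (r * t\<^sup>2)) = 0" if r: "unit r" for r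
 proof -
  have "(\<Sum>t\<in>resreps. ?e (r * t\<^sup>2)) = (\<Sum>t\<in>resreps. ?e t)"
  proof (rule resreps_reindex)
   show "r * x\<^sup>2 \<in> fideal 0" if "x \<in> fideal 0" for x
    using sq0[OF that] unitD(4)[OF r] by simp
   show "x - y \<in> fideal 1" if "x \<in> fideal 0" "y \<in> fideal 0" "r * x\<^sup>2 - r * y\<^sup>2 \<in> fideal 1" for x y
    using sq_inj[OF that(1,2)] that(3) unitD(4)[OF r] by (simp flip: right_diff_distrib)
  qed (rule cong)
  then show ?thesis
   using sum_e by simp
 qed
 obtain z where z: "z \<in> resreps" "z \<in> fideal 1" "\<And>t. t \<in> resreps - {z} \<Longrightarrow> unit t"
  using resreps_zero by blast
 have z0: "z \<in> fideal 0"
  using z(1) resreps_fideal by blast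
 have split: "(\<Sum>t\<in>resreps. g t) = g z + (\<Sum>t\<in>resreps - {z}. g t)" for g :: "'f \<Rightarrow> 'r"
  using z(1) finite_resreps by (simp add: sum.remove)
 have "(\<Sum>x\<in>resreps. \<Sum>y\<in>resreps. ?e (x\<^sup>2 + x * y + d * y\<^sup>2)) =
   (\<Sum>y\<in>resreps. \<Sum>x\<in>resreps. ?e (x\<^sup>2 + x * y + d * y\<^sup>2))"
  by (rule sum.swap)
 also have "\<dots> = (\<Sum>x\<in>resreps. ?e (x\<^sup>2 + x * z + d * z\<^sup>2)) +
   (\<Sum>y\<in>resreps - {z}. \<Sum>x\<in>resreps. ?e (x\<^sup>2 + x * y + d * y\<^sup>2))"
  by (rule split)
 also have "(\<Sum>x\<in>resreps. ?e (x\<^sup>2 + x * z + d * z\<^sup>2)) = (\<Sum>x\<in>resreps. ?e (1 * x\<^sup>2))"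
 proof (intro sum.cong refl cong)
  fix x assume "x \<in> resreps"
  then have "z * (x + d * z) \<in> fideal (1 + 0)"
   using z(2) z0 d(1) fideal_mult[of d 0 z 0] resreps_fideal by (intro fideal_mult fideal_add) auto
  then show "x\<^sup>2 + x * z + d * z\<^sup>2 - 1 * x\<^sup>2 \<in> fideal 1"
   by (simp add: power2_eq_square algebra_simps)
 qed
 also have "\<dots> = 0"
  by (rule sum_square) (simp add: unit_def)
 also have "(\<Sum>y\<in>resreps - {z}. \<Sum>x\<in>resreps. ?e (x\<^sup>2 + x * y + d * y\<^sup>2)) =
   (\<Sum>y\<in>resreps - {z}. \<Sum>x\<in>resreps. ?e ((x\<^sup>2 + x + d) * y\<^sup>2))"
 proof (rule sum.cong[OF refl])
  fix y assume "y \<in> resreps - {z}"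
  then have y: "unit y"
   by (rule z(3))
  have y0: "y \<in> fideal 0"
   using y by (simp add: unit_iff)
  let ?f = "\<lambda>x. ?e (x\<^sup>2 + x * y + d * y\<^sup>2)"
  have "(\<Sum>x\<in>resreps. ?f (resrep (y * x))) = (\<Sum>x\<in>resreps. ?f (resrep x))"
  proof (rule resreps_reindex)
   show "y * x \<in> fideal 0" if "x \<in> fideal 0" for x
    using that unitD(4)[OF y] by simp
   show "x - x' \<in> fideal 1" if "y * x - y * x' \<in> fideal 1" for x x'
    using that unitD(4)[OF y] by (simp flip: right_diff_distrib)
   show "?f (resrep x) = ?f (resrep x')" if "x - x' \<in> fideal 1" for x x'
   proof -
    have "resrep x = resrep x'"
    proof -
     have "x - t \<in> fideal 1 \<longleftrightarrow> x' - t \<in> fideal 1" for t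
      using fideal_diff[OF _ that, of "x - t"] fideal_add[OF _ that, of "x' - t"] by auto
     then show ?thesis
      by (simp add: resrep_def)
    qed
    then show ?thesis
     by simp
   qed
  qed
  moreover have fr: "?f (resrep x) = ?f x" if x: "x \<in> fideal 0" for x
  proof (rule cong)
   note t = resrep(2)[OF x] resreps_fideal[OF resrep(1)[OF x]]
   have "- (x - resrep x) \<in> fideal 1"
    using t(1) unfolding fideal_uminus .
   then have "(resrep x - x) * (resrep x + x + y) \<in> fideal (1 + 0)"
    using t(2) x y0 by (intro fideal_mult fideal_add) simp_all
   then show "(resrep x)\<^sup>2 + resrep x * y + d * y\<^sup>2 - (x\<^sup>2 + x * y + d * y\<^sup>2) \<in> fideal 1"
    by (simp add: power2_eq_square algebra_simps)
  qed
  ultimately have "(\<Sum>x\<in>resreps. ?f x) = (\<Sum>x\<in>resreps. ?f (y * x))"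
   using resreps_fideal unitD(4)[OF y] by simp
  also have "\<dots> = (\<Sum>x\<in>resreps. ?e ((x\<^sup>2 + x + d) * y\<^sup>2))"
   by (intro sum.cong refl) (simp add: power2_eq_square algebra_simps)
  finally show "(\<Sum>x\<in>resreps. ?f x) = (\<Sum>x\<in>resreps. ?e ((x\<^sup>2 + x + d) * y\<^sup>2))" .
 qed
 also have "\<dots> = (\<Sum>x\<in>resreps. \<Sum>y\<in>resreps - {z}. ?e ((x\<^sup>2 + x + d) * y\<^sup>2))"
  by (rule sum.swap)
 also have "\<dots> = (\<Sum>x\<in>resreps. - 1)"
 proof (rule sum.cong[OF refl])
  fix x assume "x \<in> resreps"
  then have r: "unit (x\<^sup>2 + x + d)"
   using d(2) resreps_fideal by blast
  have "(x\<^sup>2 + x + d) * z\<^sup>2 - 0 \<in> fideal 1"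
   using unitD(4)[OF r] fideal_mult[OF z(2) z0] by (simp add: power2_eq_square)
  from cong[OF this] have "?e ((x\<^sup>2 + x + d) * z\<^sup>2) = 1"
   by simp
  then show "(\<Sum>y\<in>resreps - {z}. ?e ((x\<^sup>2 + x + d) * y\<^sup>2)) = - 1"
   using sum_square[OF r] split[of "\<lambda>y. ?e ((x\<^sup>2 + x + d) * y\<^sup>2)"] by (simp add: eq_neg_iff_add_eq_0 add.commute)
 qed
 also have "\<dots> = - of_nat resq"
  by (simp add: card_resreps)
 finally show ?thesis
  by simp
qed

text \<open>Let \<open>G a\<close> be the Gauss sum of the form scaled by \<open>a\<close>.
  Multiplicativity would make \<open>G a * modulus1 a\<close> independent of \<open>a\<close>. But
  \<open>G\<close> is 1 at \<open>c0\<close> and \<open>- iq\<close> at \<open>c1\<close>, while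
  \<open>modulus1 c0\<close> is \<open>iq * modulus1 c1\<close>, so the two products differ by a
  sign.\<close>

lemma gauss1_not_multiplicative_even:
 assumes two: "2 \<in> fideal 1" and hom: "\<And>a b. a \<noteq> 0 \<Longrightarrow> b \<noteq> 0 \<Longrightarrow> gauss1 (a * b) * gauss1 1 = gauss1 a * gauss1 b"
 shows False
proof -
 obtain d where d: "d \<in> fideal 0" "\<And>s. s \<in> fideal 0 \<Longrightarrow> unit (s\<^sup>2 + s + d)"
  using exists_irreducible[OF two] by blast
 have "2 * (2 * d) \<in> fideal (1 + (1 + 0))"
  using two d(1) by (intro fideal_mult)
 then have "2 * (2 * d) \<in> fideal 1"
  using fideal_antimono[of 1 "1 + (1 + 0)"] by auto
 then have "absv (4 * d) < absv (- 1)"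
  by (simp add: fideal_1_iff)
 from absv_add_eq[OF this] have D: "unit (4 * d - 1)"
  by (simp add: unit_def)
 have D0: "4 * d - 1 \<noteq> 0"
  using unitD(1)[OF D] .
 then have k: "2 * d - 1 / 2 \<noteq> 0"
  by (auto simp: field_simps)
 let ?q = "\<lambda>a v. chi (- (a * ((fst v)\<^sup>2 + fst v * snd v + d * (snd v)\<^sup>2)))"
 let ?G = "\<lambda>a. two.gauss (mat2 (2 * a) a a (2 * a * d))"
 have const: "?G a * modulus1 a = gauss1 2 * gauss1 (2 * d - 1 / 2)" if a: "a \<noteq> 0" for a
 proof -
  let ?g = "gauss1 1"
  have 1: "?G a * ?g * ?g = gauss1 2 * gauss1 (2 * d - 1 / 2) * (gauss1 a * gauss1 a)"
  proof -
   have "?G a * ?g * ?g = (gauss1 (2 * a) * ?g) * (gauss1 (a * (2 * d - 1 / 2)) * ?g)"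
    unfolding two_gauss_unramified_form[OF a D0] by (simp only: mult_ac)
   also have "\<dots> = (gauss1 2 * gauss1 a) * (gauss1 a * gauss1 (2 * d - 1 / 2))"
    using hom[of 2 a] hom[of a "2 * d - 1 / 2"] a k by simp
   finally show ?thesis
    by (simp add: mult_ac)
  qed
  have "gauss1 a * gauss1 a * modulus1 a = (modulus1 a * gauss1 (1 * a\<^sup>2)) * ?g"
   using hom[OF a a] by (simp add: power2_eq_square mult_ac)
  also have "\<dots> = ?g * ?g"
   using gauss1_square[of 1 a] a by simp
  finally have 2: "gauss1 a * gauss1 a * modulus1 a = ?g * ?g" .
  have "?g * ?g * (?G a * modulus1 a) = (?G a * ?g * ?g) * modulus1 a"
   by (simp add: mult_ac)
  also have "\<dots> = gauss1 2 * gauss1 (2 * d - 1 / 2) * (gauss1 a * gauss1 a * modulus1 a)"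
   unfolding 1 by (simp add: mult_ac)
  also have "\<dots> = ?g * ?g * (gauss1 2 * gauss1 (2 * d - 1 / 2))"
   unfolding 2 by (simp add: mult_ac)
  finally show ?thesis
   using gauss1_neq_0[of 1] by simp
 qed
 have quad0: "x\<^sup>2 + x * y + d * y\<^sup>2 \<in> fideal 0" if "x \<in> fideal 0" "y \<in> fideal 0" for x y
 proof -
  have "x * x \<in> fideal (0 + 0)" "x * y \<in> fideal (0 + 0)" "d * (y * y) \<in> fideal (0 + (0 + 0))"
   by (intro fideal_mult that d(1))+
  then show ?thesis
   unfolding power2_eq_square by (intro fideal_add) simp_all
 qed
 have "?G c0 = two.integ (\<lambda>v. ?q c0 v * two.ind 0 v)"
  unfolding c0_def by (rule two_gauss_formula[OF d(1) D]) simp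
 also have "(\<lambda>v. ?q c0 v * two.ind 0 v) = two.ind 0"
 proof
  fix v
  have "?q c0 v = 1" if v: "v \<in> two.lat 0"
  proof (rule cond(1))
   have "(fst v)\<^sup>2 + fst v * snd v + d * (snd v)\<^sup>2 \<in> fideal (cond - cond)"
    using quad0[of "fst v" "snd v"] v by (auto simp: two_lat)
   then show "- (c0 * ((fst v)\<^sup>2 + fst v * snd v + d * (snd v)\<^sup>2)) \<in> fideal cond"
    unfolding fideal_uminus c0_def unif_mult_fideal .
  qed
  then show "?q c0 v * two.ind 0 v = two.ind 0 v"
   by (simp add: two.ind_def)
 qed
 finally have G0: "?G c0 = 1"
  by (simp add: two.integ_ind)
 let ?\<Phi> = "\<lambda>v. ?q c1 v * two.ind 0 v"
 have T: "two.transversal 0 1 (resreps \<times> resreps)"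
  unfolding two.transversal_def two_lat
 proof (intro conjI ballI)
  show "finite (resreps \<times> resreps)" "resreps \<times> resreps \<subseteq> fideal 0 \<times> fideal 0"
   using finite_resreps resreps_fideal by auto
  fix v assume v: "v \<in> fideal 0 \<times> fideal 0"
  show "\<exists>!t. t \<in> resreps \<times> resreps \<and> v - t \<in> fideal 1 \<times> fideal 1"
  proof (rule ex1I[of _ "(resrep (fst v), resrep (snd v))"])
   show "(resrep (fst v), resrep (snd v)) \<in> resreps \<times> resreps \<and>
     v - (resrep (fst v), resrep (snd v)) \<in> fideal 1 \<times> fideal 1"
    using v resrep by (auto simp: minus_prod_def)
   fix t assume t: "t \<in> resreps \<times> resreps \<and> v - t \<in> fideal 1 \<times> fideal 1"
   have eq: "u = resrep x" if "u \<in> resreps" "x - u \<in> fideal 1" "x \<in> fideal 0" for x u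
    using resreps_unique[OF that(1) resrep(1)[OF that(3)]] fideal_diff[OF resrep(2)[OF that(3)] that(2)] by simp
   show "t = (resrep (fst v), resrep (snd v))"
    using t v eq[of "fst t" "fst v"] eq[of "snd t" "snd v"] by (auto simp: minus_prod_def mem_Times_iff prod_eq_iff)
  qed
 qed
 have supp: "two.supp_in 0 ?\<Phi>"
  by (simp add: two.supp_in_def two.ind_def)
 have inv: "two.inv_under 1 ?\<Phi>"
  unfolding two.inv_under_def
 proof (intro allI impI)
  fix v w assume "w \<in> two.lat 1"
  then have w: "fst w \<in> fideal 1" "snd w \<in> fideal 1" "fst w \<in> fideal 0" "snd w \<in> fideal 0" "w \<in> two.lat 0"
   using fideal_antimono[of 0 1] by (auto simp: two_lat)
  show "?\<Phi> (v + w) = ?\<Phi> v"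
  proof (cases "v \<in> two.lat 0")
   case True
   then have v: "fst v \<in> fideal 0" "snd v \<in> fideal 0"
    by (auto simp: two_lat)
   let ?Q = "\<lambda>v. (fst v)\<^sup>2 + fst v * snd v + d * (snd v)\<^sup>2"
   have "fst v + fst v + fst w + snd v + snd w \<in> fideal 0" "snd v + snd v + snd w \<in> fideal 0"
    by (intro fideal_add v w)+
   moreover from fideal_mult[OF d(1) this(2)] have "fst v + d * (snd v + snd v + snd w) \<in> fideal 0"
    using v(1) fideal_add by simp
   ultimately have "fst w * (fst v + fst v + fst w + snd v + snd w) \<in> fideal (1 + 0)"
    "snd w * (fst v + d * (snd v + snd v + snd w)) \<in> fideal (1 + 0)"
    using w(1,2) by - (rule fideal_mult; assumption)+
   then have "fst w * (fst v + fst v + fst w + snd v + snd w) + snd w * (fst v + d * (snd v + snd v + snd w)) \<in> fideal 1"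
    by (intro fideal_add) simp_all
   then have "?Q (v + w) - ?Q v \<in> fideal 1"
    by (simp add: power2_eq_square algebra_simps)
   from chi_c1_cong[OF _ this, of "- 1"] have "?q c1 (v + w) = ?q c1 v"
    by (simp add: fideal_0_iff)
   then show ?thesis
    using True w(5) by (simp add: two.ind_def two.L_add_cancel)
  next
   case False
   then show ?thesis
    using w(5) by (simp add: two.ind_def two.L_add_cancel)
  qed
 qed
 have "?G c1 = two.integ ?\<Phi>"
  unfolding c1_def by (rule two_gauss_formula[OF d(1) D]) simp
 also have "\<dots> = two.vol 1 * (\<Sum>v\<in>resreps \<times> resreps. ?\<Phi> v)"
  by (rule two.integ_transversal[OF T _ supp inv]) simp
 also have "(\<Sum>v\<in>resreps \<times> resreps. ?\<Phi> v) =
   (\<Sum>v\<in>resreps \<times> resreps. case v of (x, y) \<Rightarrow> chi (- 1 * c1 * (x\<^sup>2 + x * y + d * y\<^sup>2)))"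
  by (rule sum.cong) (auto simp: two.ind_def two_lat resreps_fideal)
 also have "\<dots> = - of_nat resq"
  using sum_chi_unramified[OF two d] by (simp only: sum.cartesian_product)
 also have "two.vol 1 * - of_nat resq = - iq"
  using iq unfolding two_vol_1 by (simp add: power2_eq_square mult.assoc mult.commute[of iq "of_nat resq"])
 finally have G1: "?G c1 = - iq" .
 have "1 * modulus1 c0 = - iq * modulus1 c1"
  using const[OF c_neq_0(1)] const[OF c_neq_0(2)] unfolding G0 G1 by (rule trans[OF _ sym])
 then have "modulus1 c1 * iq = modulus1 c1 * (- iq)"
  by (simp add: c0_eq modulus1_mult modulus1_unif mult.commute)
 then have "iq = - iq"
  using modulus1_neq_0[of c1] by simp
 then have "2 * iq = 0"
  by (simp add: eq_neg_iff_add_eq_0)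
 then show False
  using iq by auto
qed

lemma gauss1_not_multiplicative:
 "\<exists>a b. a \<noteq> 0 \<and> b \<noteq> 0 \<and> gauss1 (a * b) * gauss1 1 \<noteq> gauss1 a * gauss1 b"
proof (rule ccontr)
 assume "\<not> ?thesis"
 then have hom: "\<And>a b. a \<noteq> 0 \<Longrightarrow> b \<noteq> 0 \<Longrightarrow> gauss1 (a * b) * gauss1 1 = gauss1 a * gauss1 b"
  by blast
 have "absv 2 \<le> 1"
  using absv_of_nat_le[of 2] by simp
 then have "unit 2 \<or> 2 \<in> fideal 1"
  by (auto simp: unit_def fideal_1_iff)
 then show False
  using gauss1_not_multiplicative_odd[OF _ hom] gauss1_not_multiplicative_even[OF _ hom] by blast
qed

end

section \<open>Square classes in finite quotients of commutative groups\<close>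

text \<open>For the squaring endomorphism of a finite commutative group, kernel and cokernel have
  the same size; the sets \<open>B\<close> represent distinct classes of the cokernel.\<close>

lemma (in comm_group) square_classes_finite:
 assumes fin: "finite (carrier G)"
 defines "S \<equiv> (\<lambda>x. x \<otimes> x) ` carrier G" and "K \<equiv> {x \<in> carrier G. x \<otimes> x = \<one>}"
 shows "B \<subseteq> carrier G \<Longrightarrow> (\<And>a b. a \<in> B \<Longrightarrow> b \<in> B \<Longrightarrow> a \<otimes> inv b \<in> S \<Longrightarrow> a = b) \<Longrightarrow> card B \<le> card K"
  and "\<exists>B \<subseteq> carrier G. card B = card K \<and> (\<forall>a\<in>B. \<forall>b\<in>B. a \<otimes> inv b \<in> S \<longrightarrow> a = b)"
proof -
 have sub: "subgroup S G"
 proof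
  show "S \<subseteq> carrier G"
   by (auto simp: S_def)
  show "x \<otimes> y \<in> S" if xy: "x \<in> S" "y \<in> S" for x y
  proof -
   obtain a b where ab: "a \<in> carrier G" "b \<in> carrier G" "x = a \<otimes> a" "y = b \<otimes> b"
    using xy by (auto simp: S_def)
   then have "x \<otimes> y = (a \<otimes> b) \<otimes> (a \<otimes> b)"
    by (simp add: m_ac)
   then show ?thesis
    using ab by (auto simp: S_def)
  qed
  show "\<one> \<in> S"
   unfolding S_def by (rule image_eqI[of _ _ \<one>]) auto
  show "inv x \<in> S" if x: "x \<in> S" for x
  proof -
   obtain a where a: "a \<in> carrier G" "x = a \<otimes> a"
    using x by (auto simp: S_def)
   then have "inv x = inv a \<otimes> inv a"
    by (simp add: inv_mult)
   then show ?thesis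
    using a by (auto simp: S_def)
  qed
 qed
 have fibre: "card {x \<in> carrier G. x \<otimes> x = s} = card K" if s: "s \<in> S" for s
 proof -
  obtain a where a: "a \<in> carrier G" "s = a \<otimes> a"
   using s by (auto simp: S_def)
  have "bij_betw (\<lambda>k. a \<otimes> k) K {x \<in> carrier G. x \<otimes> x = s}"
  proof (rule bij_betw_byWitness[where f' = "\<lambda>x. inv a \<otimes> x"])
   show "\<forall>k\<in>K. inv a \<otimes> (a \<otimes> k) = k" "\<forall>x\<in>{x \<in> carrier G. x \<otimes> x = s}. a \<otimes> (inv a \<otimes> x) = x"
    using a by (auto simp: K_def simp flip: m_assoc)
   show "(\<lambda>k. a \<otimes> k) ` K \<subseteq> {x \<in> carrier G. x \<otimes> x = s}"
   proof
    fix x assume "x \<in> (\<lambda>k. a \<otimes> k) ` K"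
    then obtain k where k: "k \<in> carrier G" "k \<otimes> k = \<one>" "x = a \<otimes> k"
     by (auto simp: K_def)
    then have "x \<otimes> x = (a \<otimes> a) \<otimes> (k \<otimes> k)"
     using a by (simp add: m_ac)
    then show "x \<in> {x \<in> carrier G. x \<otimes> x = s}"
     using a k by simp
   qed
   show "(\<lambda>x. inv a \<otimes> x) ` {x \<in> carrier G. x \<otimes> x = s} \<subseteq> K"
   proof
    fix k assume "k \<in> (\<lambda>x. inv a \<otimes> x) ` {x \<in> carrier G. x \<otimes> x = s}"
    then obtain x where x: "x \<in> carrier G" "x \<otimes> x = a \<otimes> a" "k = inv a \<otimes> x"
     using a by auto
    have "k \<otimes> k = (inv a \<otimes> inv a) \<otimes> (x \<otimes> x)"
     unfolding x(3) using a(1) x(1) by (simp add: m_ac)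
    also have "\<dots> = inv (a \<otimes> a) \<otimes> (a \<otimes> a)"
     unfolding x(2) using a by (simp only: inv_mult)
    also have "\<dots> = \<one>"
     using a by simp
    finally have kk: "k \<otimes> k = \<one>" .
    have "k \<in> carrier G"
     using a x by simp
    then show "k \<in> K"
     using kk by (simp only: K_def mem_Collect_eq)
   qed
  qed
  from bij_betw_same_card[OF this] show ?thesis ..
 qed
 have "card (carrier G) = (\<Sum>s\<in>S. card {x \<in> carrier G. x \<otimes> x = s})"
  unfolding S_def using sum.image_gen[OF fin, of "\<lambda>_. 1::nat" "\<lambda>x. x \<otimes> x"] by simp
 then have "card (carrier G) = card S * card K"
  using fibre by simp
 moreover have "card (rcosets S) * card S = card (carrier G)"
  using lagrange_finite[OF fin sub] by (simp add: order_def)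
 moreover have "card S \<noteq> 0"
  using fin subgroup.one_closed[OF sub] by (auto simp: S_def)
 ultimately have card: "card (rcosets S) = card K"
  by simp
 have finR: "finite (rcosets S)"
  using fin by (simp add: RCOSETS_def)
 have S_carrier: "S \<subseteq> carrier G"
  by (rule subgroup.subset[OF sub])
 {
  assume B: "B \<subseteq> carrier G" "\<And>a b. a \<in> B \<Longrightarrow> b \<in> B \<Longrightarrow> a \<otimes> inv b \<in> S \<Longrightarrow> a = b"
  have "inj_on (\<lambda>b. S #> b) B"
  proof (rule inj_onI)
   fix a b assume ab: "a \<in> B" "b \<in> B" "S #> a = S #> b"
   then have "a \<in> S #> b"
    using rcos_self[OF _ sub, of a] B(1) by auto
   then obtain s where s: "s \<in> S" "a = s \<otimes> b"
    by (auto simp: r_coset_def)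
   have "s \<in> carrier G" "b \<in> carrier G"
    using s ab B(1) S_carrier by blast+
   then have "a \<otimes> inv b = s"
    using s(2) by (simp add: m_assoc)
   then show "a = b"
    using B(2) ab s by blast
  qed
  then have "card B \<le> card (rcosets S)"
   using finR B(1) by (intro card_inj_on_le) (auto simp: RCOSETS_def)
  then show "card B \<le> card K"
   by (simp add: card)
 }
 define rep where "rep C = (SOME x. x \<in> carrier G \<and> C = S #> x)" for C
 have rep: "rep C \<in> carrier G" "C = S #> rep C" if "C \<in> rcosets S" for C
 proof -
  have "\<exists>x. x \<in> carrier G \<and> C = S #> x"
   using that by (auto simp: RCOSETS_def)
  from someI_ex[OF this] show "rep C \<in> carrier G" "C = S #> rep C"
   by (simp_all add: rep_def)
 qed
 show "\<exists>B \<subseteq> carrier G. card B = card K \<and> (\<forall>a\<in>B. \<forall>b\<in>B. a \<otimes> inv b \<in> S \<longrightarrow> a = b)"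
 proof (intro exI[of _ "rep ` (rcosets S)"] conjI ballI impI)
  show "rep ` (rcosets S) \<subseteq> carrier G"
   using rep by blast
  have "inj_on rep (rcosets S)"
   using rep by (metis inj_onI)
  then show "card (rep ` (rcosets S)) = card K"
   by (simp add: card_image card)
  fix a b assume "a \<in> rep ` (rcosets S)" "b \<in> rep ` (rcosets S)" and ab: "a \<otimes> inv b \<in> S"
  then obtain C D where CD: "C \<in> rcosets S" "D \<in> rcosets S" "a = rep C" "b = rep D"
   by blast
  have c: "a \<in> carrier G" "b \<in> carrier G"
   using rep CD by auto
  have "a = (a \<otimes> inv b) \<otimes> b"
   using c by (simp add: m_assoc)
  then have "a \<in> S #> b"
   using ab by (auto simp: r_coset_def)
  then have "S #> a = S #> b"
   using repr_independence[OF _ _ sub] c by metis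
  then show "a = b"
   using rep CD by metis
 qed
qed

text \<open>Squares of \<open>G\<close> map to squares of the quotient, so inequivalent classes
  lift, which gives the lower bound. Conversely, if all of \<open>H\<close> consists of squares,
  then being a square can be detected in the quotient, which gives the upper bound.\<close>

lemma (in comm_group) square_classes_quotient:
 assumes H: "subgroup H G" and fin: "finite (rcosets H)"
 defines "K \<equiv> {C \<in> rcosets H. C <#> C = H}"
 shows "A \<subseteq> carrier G \<Longrightarrow> (\<And>h. h \<in> H \<Longrightarrow> \<exists>g\<in>carrier G. h = g \<otimes> g) \<Longrightarrow>
   (\<And>a b g. a \<in> A \<Longrightarrow> b \<in> A \<Longrightarrow> g \<in> carrier G \<Longrightarrow> a \<otimes> inv b = g \<otimes> g \<Longrightarrow> a = b) \<Longrightarrow> card A \<le> card K"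
  and "\<exists>A \<subseteq> carrier G. card A = card K \<and> (\<forall>a\<in>A. \<forall>b\<in>A. \<forall>g\<in>carrier G. a \<otimes> inv b = g \<otimes> g \<longrightarrow> a = b)"
proof -
 let ?Q = "G Mod H"
 interpret Q: comm_group ?Q
  by (rule abelian_FactGroup[OF H])
 have N: "normal H G"
  by (rule subgroup_imp_normal[OF H])
 interpret h: group_hom G ?Q "\<lambda>x. H #> x"
  using normal.r_coset_hom_Mod[OF N] by unfold_locales
 have carr: "carrier ?Q = rcosets H" "\<one>\<^bsub>?Q\<^esub> = H" "\<And>C D. C \<otimes>\<^bsub>?Q\<^esub> D = C <#> D"
  by (auto simp: FactGroup_def)
 have finQ: "finite (carrier ?Q)"
  using fin by (simp add: carr)
 have K: "K = {C \<in> carrier ?Q. C \<otimes>\<^bsub>?Q\<^esub> C = \<one>\<^bsub>?Q\<^esub>}"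
  by (simp add: K_def carr)
 have surj: "\<exists>x\<in>carrier G. C = H #> x" if "C \<in> carrier ?Q" for C
  using that by (auto simp: carr RCOSETS_def)
 note sqQ = Q.square_classes_finite[OF finQ, folded K]
 {
  assume A: "A \<subseteq> carrier G"
   and sq: "\<And>h. h \<in> H \<Longrightarrow> \<exists>g\<in>carrier G. h = g \<otimes> g"
   and ineq: "\<And>a b g. a \<in> A \<Longrightarrow> b \<in> A \<Longrightarrow> g \<in> carrier G \<Longrightarrow> a \<otimes> inv b = g \<otimes> g \<Longrightarrow> a = b"
  have eq: "a = b" if ab: "a \<in> A" "b \<in> A"
   "(H #> a) \<otimes>\<^bsub>?Q\<^esub> inv\<^bsub>?Q\<^esub> (H #> b) \<in> (\<lambda>x. x \<otimes>\<^bsub>?Q\<^esub> x) ` carrier ?Q" for a b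
  proof -
   have c: "a \<in> carrier G" "b \<in> carrier G"
    using ab A by auto
   obtain x where x: "x \<in> carrier G" "(H #> a) \<otimes>\<^bsub>?Q\<^esub> inv\<^bsub>?Q\<^esub> (H #> b) = (H #> x) \<otimes>\<^bsub>?Q\<^esub> (H #> x)"
    using ab(3) surj by blast
   then have "H #> (a \<otimes> inv b) = H #> (x \<otimes> x)"
    using c by simp
   then have "a \<otimes> inv b \<in> H #> (x \<otimes> x)"
    using rcos_self[OF _ H, of "a \<otimes> inv b"] c by simp
   then obtain h where h: "h \<in> H" "a \<otimes> inv b = h \<otimes> (x \<otimes> x)"
    by (auto simp: r_coset_def)
   obtain g where g: "g \<in> carrier G" "h = g \<otimes> g"
    using sq[OF h(1)] by blast
   have "a \<otimes> inv b = (g \<otimes> x) \<otimes> (g \<otimes> x)"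
    using h g x by (simp add: m_ac)
   then show ?thesis
    using ineq[OF ab(1,2), of "g \<otimes> x"] g x by simp
  qed
  have "inj_on (\<lambda>a. H #> a) A"
  proof (rule inj_onI)
   fix a b assume ab: "a \<in> A" "b \<in> A" "H #> a = H #> b"
   have "H #> b \<in> carrier ?Q"
    using A ab(2) by (intro h.hom_closed) blast
   then have "(H #> a) \<otimes>\<^bsub>?Q\<^esub> inv\<^bsub>?Q\<^esub> (H #> b) = \<one>\<^bsub>?Q\<^esub> \<otimes>\<^bsub>?Q\<^esub> \<one>\<^bsub>?Q\<^esub>"
    unfolding ab(3) by (simp only: Q.r_inv Q.l_one Q.one_closed)
   then show "a = b"
    by (intro eq[OF ab(1,2)] image_eqI[OF _ Q.one_closed])
  qed
  then have "card A = card ((\<lambda>a. H #> a) ` A)"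
   by (simp add: card_image)
  also have "\<dots> \<le> card K"
  proof (rule sqQ(1))
   show "(\<lambda>a. H #> a) ` A \<subseteq> carrier ?Q"
    using A by (intro image_subsetI h.hom_closed) (rule subsetD)
   fix C D assume CD: "C \<in> (\<lambda>a. H #> a) ` A" "D \<in> (\<lambda>a. H #> a) ` A"
    "C \<otimes>\<^bsub>?Q\<^esub> inv\<^bsub>?Q\<^esub> D \<in> (\<lambda>x. x \<otimes>\<^bsub>?Q\<^esub> x) ` carrier ?Q"
   then obtain a b where ab: "a \<in> A" "b \<in> A" "C = H #> a" "D = H #> b"
    by (elim imageE)
   have "a = b"
    by (rule eq[OF ab(1,2)]) (use CD(3) in \<open>simp only: ab\<close>)
   then show "C = D"
    by (simp only: ab)
  qed
  finally show "card A \<le> card K" .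
 }
 obtain B where B: "B \<subseteq> carrier ?Q" "card B = card K"
  "\<forall>a\<in>B. \<forall>b\<in>B. a \<otimes>\<^bsub>?Q\<^esub> inv\<^bsub>?Q\<^esub> b \<in> (\<lambda>x. x \<otimes>\<^bsub>?Q\<^esub> x) ` carrier ?Q \<longrightarrow> a = b"
  using sqQ(2) by (elim exE conjE)
 define rep where "rep C = (SOME x. x \<in> carrier G \<and> C = H #> x)" for C
 have rep: "rep C \<in> carrier G" "C = H #> rep C" if "C \<in> B" for C
 proof -
  have "\<exists>x. x \<in> carrier G \<and> C = H #> x"
   using surj that B(1) by blast
  from someI_ex[OF this] show "rep C \<in> carrier G" "C = H #> rep C"
   by (simp_all add: rep_def)
 qed
 show "\<exists>A \<subseteq> carrier G. card A = card K \<and> (\<forall>a\<in>A. \<forall>b\<in>A. \<forall>g\<in>carrier G. a \<otimes> inv b = g \<otimes> g \<longrightarrow> a = b)"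
 proof (intro exI[of _ "rep ` B"] conjI ballI impI)
  show "rep ` B \<subseteq> carrier G"
   using rep by blast
  have "inj_on rep B"
   using rep by (metis inj_onI)
  then show "card (rep ` B) = card K"
   by (simp add: card_image B(2))
  fix a b g assume "a \<in> rep ` B" "b \<in> rep ` B" and g: "g \<in> carrier G" and ab: "a \<otimes> inv b = g \<otimes> g"
  then obtain C D where CD: "C \<in> B" "D \<in> B" "a = rep C" "b = rep D"
   by blast
  have "(H #> a) \<otimes>\<^bsub>?Q\<^esub> inv\<^bsub>?Q\<^esub> (H #> b) = (H #> g) \<otimes>\<^bsub>?Q\<^esub> (H #> g)"
  proof -
   have c: "a \<in> carrier G" "b \<in> carrier G"
    using rep CD by auto
   have "(H #> a) \<otimes>\<^bsub>?Q\<^esub> inv\<^bsub>?Q\<^esub> (H #> b) = H #> (a \<otimes> inv b)"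
    using c by (simp only: h.hom_mult h.hom_inv inv_closed)
   also have "\<dots> = (H #> g) \<otimes>\<^bsub>?Q\<^esub> (H #> g)"
    unfolding ab using g by (rule h.hom_mult[OF _ g])
   finally show ?thesis .
  qed
  then have "C \<otimes>\<^bsub>?Q\<^esub> inv\<^bsub>?Q\<^esub> D \<in> (\<lambda>x. x \<otimes>\<^bsub>?Q\<^esub> x) ` carrier ?Q"
   unfolding CD(3,4) rep(2)[OF CD(1), symmetric] rep(2)[OF CD(2), symmetric]
   using h.hom_closed[OF g] by (intro image_eqI)
  then have "C = D"
   using B(3)[rule_format, OF CD(1,2)] by simp
  then show "a = b"
   by (simp only: CD(3,4))
 qed
qed

section \<open>Sums of two squares\<close>

context nonarch_local_field
begin

section \<open>An upper bound for the square classes of the field\<close>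

definition unit_grp :: "'f monoid"
 where "unit_grp = \<lparr>carrier = {x. absv x = 1}, mult = (*), one = 1\<rparr>"

lemma comm_group_unit_grp: "comm_group unit_grp"
proof (rule comm_groupI)
 fix x assume x: "x \<in> carrier unit_grp"
 then have "x \<noteq> 0"
  by (auto simp: unit_grp_def)
 then show "\<exists>y\<in>carrier unit_grp. y \<otimes>\<^bsub>unit_grp\<^esub> x = \<one>\<^bsub>unit_grp\<^esub>"
  using x by (intro bexI[of _ "inverse x"]) (auto simp: unit_grp_def absv_inverse)
qed (auto simp: unit_grp_def absv_mult mult_ac)

lemma unit_grp_inv:
 assumes "absv x = 1"
 shows "inv\<^bsub>unit_grp\<^esub> x = inverse x"
proof -
 have "x \<noteq> 0"
  using assms by auto
 then show ?thesis
  using assms by (intro group.inv_equality[OF comm_group.axioms(2)[OF comm_group_unit_grp]])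
   (auto simp: unit_grp_def absv_inverse)
qed

lemma absv_eq_1_of_near_1: "x - 1 \<in> fideal 1 \<Longrightarrow> absv x = 1"
 using absv_add_eq[of "x - 1" 1] by (simp add: fideal_1_iff)

lemma finite_transversal:
 assumes "j \<le> k"
 shows "\<exists>T. finite T \<and> card T = resq ^ nat (k - j) \<and> T \<subseteq> fideal j \<and>
  (\<forall>x\<in>fideal j. \<exists>t\<in>T. x - t \<in> fideal k) \<and> (\<forall>s\<in>T. \<forall>t\<in>T. s - t \<in> fideal k \<longrightarrow> s = t)"
proof -
 interpret c: lattice_chain fideal resq
  by unfold_locales (use fideal_diff fideal_antimono exists_fideal fideal_index resq_pos in auto)
 obtain T where T: "c.transversal j k T"
  using c.transversal_reps[OF assms] by blast
 show ?thesis
 proof (intro exI[of _ T] conjI ballI impI subsetI)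
  show "finite T" "card T = resq ^ nat (k - j)"
   by (fact c.transversalD(1)[OF T] c.card_transversal[OF T assms])+
  show "x \<in> fideal j" if "x \<in> T" for x
   by (rule c.transversalD(2)[OF T that])
  show "\<exists>t\<in>T. x - t \<in> fideal k" if x: "x \<in> fideal j" for x
   by (rule c.transversal_cover[OF T x]) (rule bexI)
  show "s = t" if "s \<in> T" "t \<in> T" "s - t \<in> fideal k" for s t
   by (rule c.transversal_unique[OF T that])
 qed
qed

text \<open>The valuation of 2, which is 0 in odd residue characteristic; all bounds on square
  classes are expressed through it.\<close>

definition two_exp :: nat
 where "two_exp = (SOME e. absv (2::'f) = absv unif ^ e)"

lemma two_exp:
 assumes "(2::'f) \<noteq> 0"
 shows "absv (2::'f) = absv unif ^ two_exp"
proof -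
 obtain k where k: "absv (2::'f) = absv unif powi k"
  using assms by (rule absv_eq_unif_powi)
 have "absv (2::'f) \<le> 1"
  using absv_of_nat_le[of 2] by simp
 then have "0 \<le> k"
  using k absv_unif_powi_le_iff[of k 0] by simp
 then have "\<exists>e. absv (2::'f) = absv unif ^ e"
  using k by (intro exI[of _ "nat k"]) (simp add: power_int_def)
 then show ?thesis
  unfolding two_exp_def by (rule someI_ex)
qed

lemma two_mult_fideal:
 assumes "(2::'f) \<noteq> 0"
 shows "2 * x \<in> fideal k \<longleftrightarrow> x \<in> fideal (k - int two_exp)"
proof -
 have "absv (2 * x) = absv (unif powi int two_exp * x)"
  by (simp add: absv_mult two_exp[OF assms] absv_power)
 then have "2 * x \<in> fideal k \<longleftrightarrow> unif powi int two_exp * x \<in> fideal k"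
  by (simp add: fideal_def)
 then show ?thesis
  by (simp only: unif_mult_fideal)
qed

text \<open>With \<open>e\<close> the valuation of 2, the subgroup \<open>?H\<close> at level
  \<open>2 * e + 1\<close> is 1 plus 4 times the maximal ideal and so consists of squares. It
  remains to bound the elements of order two modulo \<open>?H\<close>: they are 1 or -1 up to level
  \<open>e + 1\<close>, which leaves \<open>resq ^ e\<close> choices for each sign.\<close>

lemma square_classes_units:
 fixes A :: "'f set"
 assumes two: "(2::'f) \<noteq> 0" and A: "A \<subseteq> {x. absv x = 1}"
  and ineq: "\<And>a b t. a \<in> A \<Longrightarrow> b \<in> A \<Longrightarrow> a * b = t\<^sup>2 \<Longrightarrow> a = b"
 shows "card A \<le> 2 * resq ^ two_exp"
proof -
 interpret G: comm_group unit_grp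
  by (rule comm_group_unit_grp)
 define e where "e = int two_exp"
 define k where "k = 2 * e + 1"
 have k1: "1 \<le> k"
  by (simp add: k_def e_def)
 let ?H = "{x. x - 1 \<in> fideal k}"
 have near: "absv x = 1" if "x \<in> ?H" for x
  using that fideal_antimono[OF k1] absv_eq_1_of_near_1 by auto
 have carr: "carrier unit_grp = {x. absv x = 1}" "x \<otimes>\<^bsub>unit_grp\<^esub> y = x * y" "\<one>\<^bsub>unit_grp\<^esub> = 1" for x y
  by (simp_all add: unit_grp_def)
 have f0: "x \<in> fideal 0" if "absv x = 1" for x
  using that by (simp add: fideal_0_iff)
 have H: "subgroup ?H unit_grp"
 proof
  show "?H \<subseteq> carrier unit_grp"
   unfolding carr using near by blast
  show "x \<otimes>\<^bsub>unit_grp\<^esub> y \<in> ?H" if "x \<in> ?H" "y \<in> ?H" for x y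
  proof -
   have "(x - 1) * y \<in> fideal (k + 0)"
    using that f0[OF near] by (intro fideal_mult) auto
   then have "(x - 1) * y + (y - 1) \<in> fideal k"
    using that by (intro fideal_add) auto
   then show ?thesis
    by (simp add: carr algebra_simps)
  qed
  show "\<one>\<^bsub>unit_grp\<^esub> \<in> ?H"
   by (simp add: carr)
  show "inv\<^bsub>unit_grp\<^esub> x \<in> ?H" if x: "x \<in> ?H" for x
  proof -
   have "- (x - 1) * inverse x \<in> fideal (k + 0)"
    using x near[OF x] by (intro fideal_mult) (simp_all only: fideal_uminus mem_Collect_eq, simp add: fideal_0_iff absv_inverse)
   moreover have "x \<noteq> 0"
    using near[OF x] by auto
   ultimately show ?thesis
    unfolding unit_grp_inv[OF near[OF x]] by (simp add: algebra_simps)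
  qed
 qed
 have coset_eq: "?H #>\<^bsub>unit_grp\<^esub> x = ?H #>\<^bsub>unit_grp\<^esub> y" if xy: "absv x = 1" "absv y = 1" "x - y \<in> fideal k" for x y
 proof -
  have "(x - y) * inverse y \<in> fideal (k + 0)"
   using xy by (intro fideal_mult) (simp_all add: fideal_0_iff absv_inverse)
  moreover have "y \<noteq> 0"
   using xy by auto
  ultimately have "x * inverse y \<in> ?H"
   by (simp add: algebra_simps)
  moreover have "x = (x * inverse y) \<otimes>\<^bsub>unit_grp\<^esub> y"
   using \<open>y \<noteq> 0\<close> by (simp add: carr)
  ultimately have "x \<in> ?H #>\<^bsub>unit_grp\<^esub> y"
   unfolding r_coset_def by blast
  then show ?thesis
   using G.repr_independence[OF _ _ H] xy(2) by (simp add: carr)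
 qed
 obtain T0 where T0: "finite T0" "\<And>x. x \<in> fideal 0 \<Longrightarrow> \<exists>t\<in>T0. x - t \<in> fideal k"
  using exists_finite_coset_cover[of 0 k] by blast
 have fin: "finite (rcosets\<^bsub>unit_grp\<^esub> ?H)"
 proof -
  let ?c = "\<lambda>t. {x. absv x = 1 \<and> x - t \<in> fideal k}"
  have "rcosets\<^bsub>unit_grp\<^esub> ?H \<subseteq> (\<lambda>t. ?H #>\<^bsub>unit_grp\<^esub> (SOME x. x \<in> ?c t)) ` T0"
  proof
   fix C assume "C \<in> rcosets\<^bsub>unit_grp\<^esub> ?H"
   then obtain x where x: "absv x = 1" "C = ?H #>\<^bsub>unit_grp\<^esub> x"
    by (auto simp: RCOSETS_def carr)
   obtain t where t: "t \<in> T0" "x - t \<in> fideal k"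
    using T0(2)[OF f0[OF x(1)]] by blast
   have "(SOME x. x \<in> ?c t) \<in> ?c t"
    using x t by (intro someI[of "\<lambda>x. x \<in> ?c t" x]) simp
   then have "absv (SOME x. x \<in> ?c t) = 1" "x - (SOME x. x \<in> ?c t) \<in> fideal k"
    using fideal_diff[OF t(2), of "(SOME x. x \<in> ?c t) - t"] by simp_all
   then show "C \<in> (\<lambda>t. ?H #>\<^bsub>unit_grp\<^esub> (SOME x. x \<in> ?c t)) ` T0"
    using coset_eq[OF x(1)] x(2) t(1) by (intro image_eqI) auto
  qed
  then show ?thesis
   using T0(1) finite_surj by blast
 qed
 let ?K = "{C \<in> rcosets\<^bsub>unit_grp\<^esub> ?H. C <#>\<^bsub>unit_grp\<^esub> C = ?H}"
 have "card A \<le> card ?K"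
 proof (rule G.square_classes_quotient(1)[OF H fin])
  show "A \<subseteq> carrier unit_grp"
   using A by (simp add: carr)
  show "\<exists>g\<in>carrier unit_grp. h = g \<otimes>\<^bsub>unit_grp\<^esub> g" if h: "h \<in> ?H" for h
  proof -
   define c where "c = (h - 1) / 4"
   have four: "(4::'f) \<noteq> 0"
    using two by (metis mult_2_right mult_eq_0_iff numeral_Bit0 one_add_one)
   have "4 * c = h - 1"
    using four by (simp add: c_def)
   then have c: "2 * (2 * c) = h - 1" "1 + 4 * c = h"
    by simp_all
   have "2 * (2 * c) \<in> fideal k"
    unfolding c(1) using h by simp
   then have "c \<in> fideal 1"
    unfolding two_mult_fideal[OF two] by (simp add: k_def e_def)
   then obtain g where g: "1 + 4 * c = g\<^sup>2"
    using one_plus_4_square[of c] by (auto simp: fideal_1_iff)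
   have "h = g * g"
    using g unfolding c(2) by (simp add: power2_eq_square)
   moreover from this have "absv g * absv g = 1"
    using near[OF h] by (simp add: absv_mult)
   then have "absv g = 1"
    using absv_nonneg[of g] by (metis abs_of_nonneg abs_square_eq_1 power2_eq_square)
   ultimately show ?thesis
    by (auto simp: carr)
  qed
  fix a b g assume ab: "a \<in> A" "b \<in> A" "a \<otimes>\<^bsub>unit_grp\<^esub> inv\<^bsub>unit_grp\<^esub> b = g \<otimes>\<^bsub>unit_grp\<^esub> g"
  have b: "absv b = 1" "b \<noteq> 0"
   using A ab(2) by auto
  then have "a * b = (g * b)\<^sup>2"
   using ab(3) unit_grp_inv[OF b(1)] by (simp add: carr power2_eq_square field_simps)
  then show "a = b"
   using ineq ab by blast
 qed
 also have "card ?K \<le> 2 * resq ^ two_exp"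
 proof -
  have "e + 1 \<le> k"
   by (simp add: k_def e_def)
  then obtain T where T: "finite T" "card T = resq ^ nat (k - (e + 1))" "T \<subseteq> fideal (e + 1)"
   "\<forall>x\<in>fideal (e + 1). \<exists>t\<in>T. x - t \<in> fideal k"
   using finite_transversal by metis
  have cardT: "card T = resq ^ two_exp"
   using T(2) by (simp add: k_def e_def)
  let ?f = "\<lambda>(s, t). ?H #>\<^bsub>unit_grp\<^esub> (s * (1 + t))"
  have "?K \<subseteq> ?f ` ({1, - 1} \<times> T)"
  proof
   fix C assume C: "C \<in> ?K"
   then obtain u where u: "absv u = 1" "C = ?H #>\<^bsub>unit_grp\<^esub> u"
    by (auto simp: RCOSETS_def carr)
   have uC: "u \<in> C"
    unfolding u(2) by (rule G.rcos_self[OF _ H]) (simp add: carr u)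
   then have "u * u \<in> C <#>\<^bsub>unit_grp\<^esub> C"
    unfolding set_mult_def carr by blast
   then have u2: "u * u - 1 \<in> fideal k"
    using C by simp
   \<comment> \<open>Otherwise both factors of \<open>u^2 - 1\<close> have valuation at most
     \<open>e\<close>, and their product cannot reach level \<open>2 * e + 1\<close>.\<close>
   have or: "u - 1 \<in> fideal (e + 1) \<or> u + 1 \<in> fideal (e + 1)"
   proof (rule ccontr)
    assume "\<not> ?thesis"
    then have n: "u - 1 \<notin> fideal (e + 1)" "u + 1 \<notin> fideal (e + 1)"
     by auto
    then have nz: "u - 1 \<noteq> 0" "u + 1 \<noteq> 0"
     by auto
    obtain i where i: "absv (u - 1) = absv unif powi i"
     using nz(1) by (rule absv_eq_unif_powi)
    obtain j where j: "absv (u + 1) = absv unif powi j"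
     using nz(2) by (rule absv_eq_unif_powi)
    have ij: "i \<le> e" "j \<le> e"
     using n in_fideal_int_iff[OF nz(1) i] in_fideal_int_iff[OF nz(2) j] by auto
    have "absv (u * u - 1) = absv ((u - 1) * (u + 1))"
     by (simp add: algebra_simps)
    also have "\<dots> = absv unif powi (i + j)"
     using absv_unif_pos by (simp add: absv_mult i j power_int_add)
    finally have v: "absv (u * u - 1) = absv unif powi (i + j)" .
    have "u * u - 1 \<noteq> 0"
     using nz by (simp add: square_eq_1_iff eq_neg_iff_add_eq_0)
    then have "k \<le> i + j"
     using in_fideal_int_iff[OF _ v] u2 by blast
    then show False
     using ij by (simp add: k_def)
   qed
   obtain s where s: "s = 1 \<or> s = - 1" "s * u - 1 \<in> fideal (e + 1)"
   proof (cases "u - 1 \<in> fideal (e + 1)")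
    case True
    then show thesis
     using that[of 1] by simp
   next
    case False
    then have "- (u + 1) \<in> fideal (e + 1)"
     using or unfolding fideal_uminus by simp
    then show thesis
     using that[of "- 1"] by simp
   qed
   obtain t where t: "t \<in> T" "s * u - 1 - t \<in> fideal k"
    using T(4) s(2) by blast
   have s1: "absv s = 1" "s * s = 1"
    using s(1) by auto
   have "absv (1 + t) = 1"
   proof (rule absv_eq_1_of_near_1)
    show "1 + t - 1 \<in> fideal 1"
     using T(3) t(1) fideal_antimono[of 1 "e + 1"] by (auto simp: e_def)
   qed
   moreover have "u - s * (1 + t) \<in> fideal k"
   proof -
    have "s * (s * u - 1 - t) \<in> fideal (0 + k)"
     using t(2) s1(1) by (intro fideal_mult) (simp_all add: fideal_0_iff)
    moreover have "s * (s * u - 1 - t) = u - s * (1 + t)"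
     using s1(2) by (simp add: algebra_simps flip: mult.assoc)
    ultimately show ?thesis
     by simp
   qed
   ultimately have "C = ?H #>\<^bsub>unit_grp\<^esub> (s * (1 + t))"
    unfolding u(2) by (intro coset_eq u(1)) (simp_all add: absv_mult s1)
   then show "C \<in> ?f ` ({1, - 1} \<times> T)"
    using s(1) t(1) by (intro image_eqI[of _ _ "(s, t)"]) auto
  qed
  then have "card ?K \<le> card ({1, - 1 :: 'f} \<times> T)"
   using T(1) by (intro surj_card_le) auto
  also have "\<dots> \<le> 2 * card T"
   by (simp add: card_cartesian_product card_insert_if)
  finally show ?thesis
   using cardT by simp
 qed
 finally show ?thesis .
qed

text \<open>Powers of \<open>unif\<close> with even exponent are squares, so only the parity of the
  valuation is added to the square class of a unit, which doubles the bound.\<close>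

lemma square_classes:
 fixes A :: "'f set"
 assumes two: "(2::'f) \<noteq> 0" and A: "finite A" "0 \<notin> A"
  and ineq: "\<And>a b t. a \<in> A \<Longrightarrow> b \<in> A \<Longrightarrow> a * b = t\<^sup>2 \<Longrightarrow> a = b"
 shows "card A \<le> 4 * resq ^ two_exp"
proof -
 have "\<exists>v. \<forall>a\<in>A. absv a = absv unif powi (v a)"
  using A(2) absv_eq_unif_powi by (intro bchoice) metis
 then obtain v where v: "\<And>a. a \<in> A \<Longrightarrow> absv a = absv unif powi (v a)"
  by blast
 define u where "u a = a / unif powi (v a)" for a
 have a: "a = u a * unif powi (v a)" for a
  by (simp add: u_def)
 have u1: "absv (u a) = 1" if "a \<in> A" for a
  using absv_unif_pos by (simp add: u_def absv_divide absv_powi v[OF that])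
 have "card B \<le> 2 * resq ^ two_exp" if B: "B \<subseteq> A" "\<And>a b. a \<in> B \<Longrightarrow> b \<in> B \<Longrightarrow> even (v a + v b)" for B
 proof -
  have eq: "a = b" if ab: "a \<in> B" "b \<in> B" "u a * u b = t\<^sup>2" for a b t
  proof -
   obtain m where m: "v a + v b = 2 * m"
    using B(2)[OF ab(1,2)] by blast
   have "a * b = u a * u b * (unif powi (v a) * unif powi (v b))"
    by (subst (1) a[of a], subst (1) a[of b]) simp
   also have "unif powi (v a) * unif powi (v b) = (unif powi m)\<^sup>2"
    by (simp add: power2_eq_square m flip: power_int_add)
   finally have "a * b = (t * unif powi m)\<^sup>2"
    using ab(3) by (simp add: power_mult_distrib)
   then show ?thesis
    using ineq ab B(1) by blast
  qed
  have "inj_on u B"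
   using eq by (intro inj_onI) (metis power2_eq_square)
  then have "card B = card (u ` B)"
   by (simp add: card_image)
  also have "\<dots> \<le> 2 * resq ^ two_exp"
   using u1 B(1) eq by (intro square_classes_units[OF two]) blast+
  finally show ?thesis .
 qed
 from this[of "{a \<in> A. even (v a)}"] this[of "{a \<in> A. odd (v a)}"]
 have "card {a \<in> A. even (v a)} + card {a \<in> A. odd (v a)} \<le> 4 * resq ^ two_exp"
  by fastforce
 moreover have "card A = card {a \<in> A. even (v a)} + card {a \<in> A. odd (v a)}"
  using A(1) by (subst card_Un_disjoint[symmetric]) (auto intro: arg_cong[of _ _ card])
 ultimately show ?thesis
  by simp
qed

section \<open>The algebra of \<open>x^2 + 1\<close>, its norm and its rotation group\<close>

definition rmul :: "'f \<times> 'f \<Rightarrow> 'f \<times> 'f \<Rightarrow> 'f \<times> 'f"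
 where "rmul z w = (fst z * fst w - snd z * snd w, fst z * snd w + snd z * fst w)"

definition rconj :: "'f \<times> 'f \<Rightarrow> 'f \<times> 'f"
 where "rconj z = (fst z, - snd z)"

definition rnorm :: "'f \<times> 'f \<Rightarrow> 'f"
 where "rnorm z = (fst z)\<^sup>2 + (snd z)\<^sup>2"

lemma rnorm_mult: "rnorm (rmul z w) = rnorm z * rnorm w"
 by (simp add: rnorm_def rmul_def power2_eq_square algebra_simps)

lemma rnorm_conj [simp]: "rnorm (rconj z) = rnorm z"
 by (simp add: rnorm_def rconj_def)

lemma rmul_assoc: "rmul (rmul z w) v = rmul z (rmul w v)"
 by (simp add: rmul_def algebra_simps)

lemma rmul_commute: "rmul z w = rmul w z"
 by (simp add: rmul_def algebra_simps)

lemma rmul_conj: "rmul (rconj z) z = (rnorm z, 0)"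
 by (simp add: rmul_def rconj_def rnorm_def power2_eq_square)

text \<open>The elements of norm 1. The pairs form a field only if -1 is not a square, but the group
  law makes sense in any case.\<close>

definition SO :: "('f \<times> 'f) monoid"
 where "SO = \<lparr>carrier = {z. rnorm z = 1}, mult = rmul, one = (1, 0)\<rparr>"

lemma comm_group_SO: "comm_group SO"
proof (rule comm_groupI)
 fix z assume z: "z \<in> carrier SO"
 then show "\<exists>y\<in>carrier SO. y \<otimes>\<^bsub>SO\<^esub> z = \<one>\<^bsub>SO\<^esub>"
  using rmul_conj[of z] by (intro bexI[of _ "rconj z"]) (auto simp: SO_def)
 show "\<one>\<^bsub>SO\<^esub> \<otimes>\<^bsub>SO\<^esub> z = z"
  by (simp add: SO_def rmul_def)
next
 show "\<one>\<^bsub>SO\<^esub> \<in> carrier SO"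
  by (simp add: SO_def rnorm_def)
next
 fix z w
 show "z \<otimes>\<^bsub>SO\<^esub> w = w \<otimes>\<^bsub>SO\<^esub> z"
  by (simp add: SO_def rmul_commute)
qed (simp_all add: SO_def rnorm_mult rmul_assoc)

lemma SO_inv: "rnorm z = 1 \<Longrightarrow> inv\<^bsub>SO\<^esub> z = rconj z"
 using rmul_conj[of z]
 by (intro group.inv_equality[OF comm_group.axioms(2)[OF comm_group_SO]]) (auto simp: SO_def)

text \<open>An anisotropic form has a bounded unit sphere: for large \<open>x\<close> the element
  \<open>1 - 1 / x^2\<close> is a square \<open>w^2\<close>, so \<open>y^2\<close> is minus the
  square of \<open>w * x\<close>, and -1 would be a square.\<close>

lemma rnorm_bounded:
 assumes two: "(2::'f) \<noteq> 0" and neg: "\<And>t::'f. t\<^sup>2 \<noteq> - 1" and z: "(x::'f)\<^sup>2 + y\<^sup>2 = 1"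
 shows "x \<in> fideal (- int two_exp)"
proof (rule ccontr)
 assume x: "x \<notin> fideal (- int two_exp)"
 then have x0: "x \<noteq> 0"
  by auto
 define c where "c = - inverse ((2 * x)\<^sup>2)"
 have "2 * x \<notin> fideal 0"
  using x two_mult_fideal[OF two, of x 0] by simp
 then have gt: "1 < absv (2 * x)"
  by (simp add: fideal_0_iff)
 then have "1 < (absv (2 * x))\<^sup>2"
  by (rule one_less_power) simp
 moreover have "absv c = inverse ((absv (2 * x))\<^sup>2)"
  unfolding c_def by (simp only: absv_minus absv_inverse absv_power)
 ultimately have "absv c < 1"
  by (simp only: inverse_less_1_iff) simp
 then obtain w where w: "1 + 4 * c = w\<^sup>2"
  using one_plus_4_square by blast
 have four: "(4::'f) \<noteq> 0"
  using two by (metis mult_2_right mult_eq_0_iff numeral_Bit0 one_add_one)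
 have "4 * c = - inverse (x\<^sup>2)"
  using four x0 by (simp add: c_def power_mult_distrib)
 then have w2: "w\<^sup>2 * x\<^sup>2 = x\<^sup>2 - 1"
  using x0 by (simp flip: w add: field_simps)
 have "w \<noteq> 0"
 proof
  assume "w = 0"
  then have "x\<^sup>2 = 1"
   using w2 by simp
  then have "absv x * absv x = 1"
   by (simp add: power2_eq_square flip: absv_mult)
  then have "absv x = 1"
   by (metis abs_of_nonneg abs_square_eq_1 power2_eq_square absv_nonneg)
  then have "absv (2 * x) \<le> 1"
   using absv_of_nat_le[of 2] by (simp add: absv_mult)
  with gt show False
   by simp
 qed
 then have "(y / (w * x))\<^sup>2 = y\<^sup>2 / (x\<^sup>2 - 1)"
  using x0 by (simp add: power_divide power_mult_distrib w2)
 also have "y\<^sup>2 = - (x\<^sup>2 - 1)"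
  using z by (simp add: algebra_simps)
 also have "- (x\<^sup>2 - 1) / (x\<^sup>2 - 1) = - 1"
  using w2 \<open>w \<noteq> 0\<close> x0 by (metis divide_minus_left divide_self mult_eq_0_iff power_eq_0_iff)
 finally have "(y / (w * x))\<^sup>2 = - 1" .
 then show False
  using neg by blast
qed

text \<open>Elements of order two are exhibited in the quotient by the congruence subgroup of level
  \<open>2 * e + 1\<close>, which has finite index because the rotations are bounded. They are the
  classes of \<open>(s y, y)\<close> and its negative, where \<open>s y\<close> is the root of
  \<open>1 - y^2\<close> near 1 and \<open>y\<close> runs over level \<open>e + 1\<close> modulo
  level \<open>2 * e + 1\<close>.\<close>

lemma rotation_square_classes:
 assumes two: "(2::'f) \<noteq> 0" and neg: "\<And>t::'f. t\<^sup>2 \<noteq> - 1"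
 shows "\<exists>A. finite A \<and> 2 * resq ^ two_exp \<le> card A \<and> A \<subseteq> carrier SO \<and>
  (\<forall>a\<in>A. \<forall>b\<in>A. \<forall>g\<in>carrier SO. rmul a (rconj b) = rmul g g \<longrightarrow> a = b)"
proof -
 interpret G: comm_group SO
  by (rule comm_group_SO)
 define e where "e = int two_exp"
 define k where "k = 2 * e + 1"
 have e0: "0 \<le> e" and k0: "0 \<le> k"
  by (simp_all add: e_def k_def)
 let ?H = "{z. rnorm z = 1 \<and> fst z - 1 \<in> fideal k \<and> snd z \<in> fideal k}"
 have carr: "carrier SO = {z. rnorm z = 1}" "z \<otimes>\<^bsub>SO\<^esub> w = rmul z w" "\<one>\<^bsub>SO\<^esub> = (1, 0)" for z w
  by (simp_all add: SO_def)
 have mult_H: "rmul z w \<in> ?H" if zw: "z \<in> ?H" "w \<in> ?H" for z w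
 proof -
  have w0: "fst w \<in> fideal 0" "snd w \<in> fideal 0"
  proof -
   have "(fst w - 1) + 1 \<in> fideal 0"
    using zw(2) fideal_antimono[OF k0] by (intro fideal_add) (auto simp: fideal_0_iff)
   then show "fst w \<in> fideal 0"
    by simp
   show "snd w \<in> fideal 0"
    using zw(2) fideal_antimono[OF k0] by auto
  qed
  have "(fst z - 1) * fst w \<in> fideal (k + 0)" "snd z * snd w \<in> fideal (k + 0)"
   "(fst z - 1) * snd w \<in> fideal (k + 0)" "snd z * fst w \<in> fideal (k + 0)"
   by (rule fideal_mult; use zw w0 in simp)+
  then have p: "(fst z - 1) * fst w \<in> fideal k" "snd z * snd w \<in> fideal k"
   "(fst z - 1) * snd w \<in> fideal k" "snd z * fst w \<in> fideal k"
   by (simp_all only: add_0_right)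
  have q: "fst w - 1 \<in> fideal k" "snd w \<in> fideal k"
   using zw(2) by simp_all
  have "(fst z - 1) * fst w + (fst w - 1) - snd z * snd w \<in> fideal k"
   "(fst z - 1) * snd w + snd w + snd z * fst w \<in> fideal k"
   by (rule fideal_diff[OF fideal_add[OF p(1) q(1)] p(2)], rule fideal_add[OF fideal_add[OF p(3) q(2)] p(4)])
  moreover have "(fst z - 1) * fst w + (fst w - 1) - snd z * snd w = fst (rmul z w) - 1"
   "(fst z - 1) * snd w + snd w + snd z * fst w = snd (rmul z w)"
   by (simp_all add: rmul_def algebra_simps)
  moreover have "rnorm (rmul z w) = 1"
   using zw by (simp add: rnorm_mult)
  ultimately show ?thesis
   by simp
 qed
 have conj_H: "rconj z \<in> ?H" if "z \<in> ?H" for z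
  using that by (simp add: rnorm_conj) (simp add: rconj_def)
 have H: "subgroup ?H SO"
 proof
  show "?H \<subseteq> carrier SO"
   by (auto simp: carr)
  show "x \<otimes>\<^bsub>SO\<^esub> y \<in> ?H" if "x \<in> ?H" "y \<in> ?H" for x y
   unfolding carr using that by (rule mult_H)
  show "\<one>\<^bsub>SO\<^esub> \<in> ?H"
   by (simp add: carr rnorm_def)
  show "inv\<^bsub>SO\<^esub> x \<in> ?H" if x: "x \<in> ?H" for x
   using conj_H[OF x] x SO_inv[of x] by simp
 qed
 have coset_iff: "?H #>\<^bsub>SO\<^esub> z = ?H #>\<^bsub>SO\<^esub> w \<longleftrightarrow> rmul z (rconj w) \<in> ?H"
  if zw: "rnorm z = 1" "rnorm w = 1" for z w
 proof
  have zwc: "rmul (rmul z (rconj w)) w = z"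
   unfolding rmul_assoc rmul_conj zw by (simp add: rmul_def)
  {
   assume "?H #>\<^bsub>SO\<^esub> z = ?H #>\<^bsub>SO\<^esub> w"
   then have "z \<in> ?H #>\<^bsub>SO\<^esub> w"
    using G.rcos_self[OF _ H, of z] zw by (simp add: carr)
   then obtain h where h: "h \<in> ?H" "z = rmul h w"
    unfolding r_coset_def carr by blast
   have "rmul z (rconj w) = rmul h (rmul (rconj w) w)"
    unfolding h(2) rmul_assoc by (simp add: rmul_commute)
   also have "\<dots> = h"
    unfolding rmul_conj zw by (simp add: rmul_def)
   finally show "rmul z (rconj w) \<in> ?H"
    using h(1) by simp
  }
  assume "rmul z (rconj w) \<in> ?H"
  then have "rmul (rmul z (rconj w)) w \<in> ?H #>\<^bsub>SO\<^esub> w"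
   unfolding r_coset_def carr by blast
  then show "?H #>\<^bsub>SO\<^esub> z = ?H #>\<^bsub>SO\<^esub> w"
   using G.repr_independence[OF _ _ H, of z w] zw unfolding zwc by (simp add: carr)
 qed
 have bounded: "fst z \<in> fideal (- e)" "snd z \<in> fideal (- e)" if "rnorm z = 1" for z
  using rnorm_bounded[OF two neg, of "fst z" "snd z"] rnorm_bounded[OF two neg, of "snd z" "fst z"] that
  by (simp_all add: rnorm_def e_def add.commute)
 have near: "?H #>\<^bsub>SO\<^esub> z = ?H #>\<^bsub>SO\<^esub> w"
  if zw: "rnorm z = 1" "rnorm w = 1" and d: "fst z - fst w \<in> fideal (k + e)" "snd z - snd w \<in> fideal (k + e)" for z w
 proof -
  have "(fst z - fst w) * fst w \<in> fideal (k + e + - e)" "(snd z - snd w) * snd w \<in> fideal (k + e + - e)"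
   "(snd z - snd w) * fst w \<in> fideal (k + e + - e)" "(fst z - fst w) * snd w \<in> fideal (k + e + - e)"
   by (rule fideal_mult; use d bounded[OF zw(2)] in simp)+
  then have p: "(fst z - fst w) * fst w \<in> fideal k" "(snd z - snd w) * snd w \<in> fideal k"
   "(snd z - snd w) * fst w \<in> fideal k" "(fst z - fst w) * snd w \<in> fideal k"
   by (simp_all only: add.right_inverse add_0_right add.assoc)
  have "(fst z - fst w) * fst w + (snd z - snd w) * snd w \<in> fideal k"
   "(snd z - snd w) * fst w - (fst z - fst w) * snd w \<in> fideal k"
   by (rule fideal_add[OF p(1,2)], rule fideal_diff[OF p(3,4)])
  moreover have "(fst z - fst w) * fst w + (snd z - snd w) * snd w = fst (rmul z (rconj w)) - 1"
   "(snd z - snd w) * fst w - (fst z - fst w) * snd w = snd (rmul z (rconj w))"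
   using zw(2) by (simp_all add: rmul_def rconj_def rnorm_def power2_eq_square algebra_simps)
  moreover have "rnorm (rmul z (rconj w)) = 1"
   using zw by (simp add: rnorm_mult)
  ultimately show ?thesis
   unfolding coset_iff[OF zw] by simp
 qed
 have fin: "finite (rcosets\<^bsub>SO\<^esub> ?H)"
 proof -
  obtain T where T: "finite T" "\<forall>x\<in>fideal (- e). \<exists>t\<in>T. x - t \<in> fideal (k + e)"
   using exists_finite_coset_cover[of "- e" "k + e"] by (elim exE conjE)
  let ?c = "\<lambda>t z. rnorm z = 1 \<and> fst z - fst t \<in> fideal (k + e) \<and> snd z - snd t \<in> fideal (k + e)"
  have "rcosets\<^bsub>SO\<^esub> ?H \<subseteq> (\<lambda>t. ?H #>\<^bsub>SO\<^esub> (SOME z. ?c t z)) ` (T \<times> T)"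
  proof
   fix C assume "C \<in> rcosets\<^bsub>SO\<^esub> ?H"
   then obtain z where z: "rnorm z = 1" "C = ?H #>\<^bsub>SO\<^esub> z"
    by (auto simp: RCOSETS_def carr)
   obtain t1 t2 where t: "t1 \<in> T" "fst z - t1 \<in> fideal (k + e)" "t2 \<in> T" "snd z - t2 \<in> fideal (k + e)"
    using T(2) bounded[OF z(1)] by blast
   then have "?c (t1, t2) z"
    using z(1) by simp
   then have w: "?c (t1, t2) (SOME z. ?c (t1, t2) z)"
    by (rule someI)
   then have "fst z - fst (SOME z. ?c (t1, t2) z) \<in> fideal (k + e)" "snd z - snd (SOME z. ?c (t1, t2) z) \<in> fideal (k + e)"
    using fideal_diff[OF t(2), of "fst (SOME z. ?c (t1, t2) z) - t1"]
     fideal_diff[OF t(4), of "snd (SOME z. ?c (t1, t2) z) - t2"] by simp_all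
   then have "C = ?H #>\<^bsub>SO\<^esub> (SOME z. ?c (t1, t2) z)"
    unfolding z(2) using w by (intro near[OF z(1)]; elim conjE)
   then show "C \<in> (\<lambda>t. ?H #>\<^bsub>SO\<^esub> (SOME z. ?c t z)) ` (T \<times> T)"
    using t by (intro image_eqI[of _ _ "(t1, t2)"]) auto
  qed
  then show ?thesis
   by (rule finite_subset) (intro finite_imageI finite_cartesian_product T(1))
 qed
 let ?K = "{C \<in> rcosets\<^bsub>SO\<^esub> ?H. C <#>\<^bsub>SO\<^esub> C = ?H}"
 have finK: "finite ?K"
  using fin by simp
 \<comment> \<open>At this level \<open>1 - y^2\<close> is \<open>1 + 4 * c\<close> with
   \<open>absv c < 1\<close>, so the root exists, and there are still \<open>resq ^ two_exp\<close>
   classes modulo level \<open>k\<close>.\<close>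
 define m where "m = e + 1"
 obtain T where T: "finite T" "card T = resq ^ nat (k - m)" "T \<subseteq> fideal m"
  "\<forall>s\<in>T. \<forall>t\<in>T. s - t \<in> fideal k \<longrightarrow> s = t"
  using finite_transversal[of m k] e0 by (auto simp: m_def k_def)
 have cardT: "card T = resq ^ two_exp"
  using T(2) by (simp add: m_def k_def e_def)
 have four: "(4::'f) \<noteq> 0"
  using two by (metis mult_2_right mult_eq_0_iff numeral_Bit0 one_add_one)
 have "\<exists>s. s\<^sup>2 + y\<^sup>2 = 1 \<and> s - 1 \<in> fideal (m + 1)" if y: "y \<in> fideal m" for y
 proof -
  define c where "c = - y\<^sup>2 / 4"
  have yy: "y * y \<in> fideal (m + m)"
   using y by (intro fideal_mult)
  have c4: "2 * (2 * c) = - (y * y)"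
   using four by (simp add: c_def power2_eq_square)
  have "2 * (2 * c) \<in> fideal (m + m)"
   unfolding c4 fideal_uminus by (rule yy)
  then have c: "2 * c \<in> fideal (m + m - e)"
   unfolding two_mult_fideal[OF two, of "2 * c"] e_def .
  then have "c \<in> fideal (m + m - e - e)"
   unfolding two_mult_fideal[OF two] e_def .
  then have "absv c < 1"
   using fideal_antimono[of 1 "m + m - e - e"] by (auto simp: m_def fideal_1_iff)
  then obtain s where s: "1 + 4 * c = s\<^sup>2" "absv (s - 1) = absv (2 * c)"
   by (rule one_plus_4_square)
  have "s - 1 \<in> fideal (m + m - e)"
   using c s(2) by (simp add: fideal_def)
  moreover have "m + m - e = m + 1"
   unfolding m_def by linarith
  moreover have "s\<^sup>2 + y\<^sup>2 = 1"
  proof -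
   have "4 * c = - (y * y)"
    unfolding c4[symmetric] by simp
   then show ?thesis
    unfolding s(1)[symmetric] by (simp add: power2_eq_square)
  qed
  ultimately have "s\<^sup>2 + y\<^sup>2 = 1 \<and> s - 1 \<in> fideal (m + 1)"
   by (simp only: simp_thms)
  then show ?thesis
   by (rule exI)
 qed
 then obtain s where s: "\<And>y. y \<in> fideal m \<Longrightarrow> (s y)\<^sup>2 + y\<^sup>2 = 1" "\<And>y. y \<in> fideal m \<Longrightarrow> s y - 1 \<in> fideal (m + 1)"
  by metis
 define z where "z \<epsilon> y = (\<epsilon> * s y, \<epsilon> * y)" for \<epsilon> y :: 'f
 have sgn: "\<epsilon> * \<epsilon> = 1" if "\<epsilon> \<in> {1, - 1 :: 'f}" for \<epsilon>
  using that by auto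
 have z1: "rnorm (z \<epsilon> y) = 1" if "\<epsilon> \<in> {1, - 1}" "y \<in> fideal m" for \<epsilon> y
 proof -
  have "rnorm (z \<epsilon> y) = \<epsilon> * \<epsilon> * ((s y)\<^sup>2 + y\<^sup>2)"
   by (simp add: rnorm_def z_def power2_eq_square algebra_simps)
  then show ?thesis
   using sgn[OF that(1)] s(1)[OF that(2)] by simp
 qed
 have m0: "0 \<le> m"
  using e0 by (simp add: m_def)
 have s0: "s y \<in> fideal 0" if "y \<in> fideal m" for y
 proof -
  have "(s y - 1) + 1 \<in> fideal 0"
   using s(2)[OF that] fideal_antimono[of 0 "m + 1"] m0 by (intro fideal_add) (auto simp: fideal_0_iff)
  then show ?thesis
   by simp
 qed
 let ?f = "\<lambda>(\<epsilon>, y). ?H #>\<^bsub>SO\<^esub> z \<epsilon> y"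
 have "inj_on ?f ({1, - 1} \<times> T)"
 proof (rule inj_onI)
  fix p p' assume pp: "p \<in> {1, - 1} \<times> T" "p' \<in> {1, - 1} \<times> T" "?f p = ?f p'"
  obtain \<epsilon> y where p: "p = (\<epsilon>, y)"
   by (cases p)
  obtain \<epsilon>' y' where p': "p' = (\<epsilon>', y')"
   by (cases p')
  have ey: "\<epsilon> \<in> {1, - 1}" "\<epsilon>' \<in> {1, - 1}" "y \<in> T" "y' \<in> T" "y \<in> fideal m" "y' \<in> fideal m"
   using pp(1,2) T(3) by (auto simp: p p')
  have "rmul (z \<epsilon> y) (rconj (z \<epsilon>' y')) \<in> ?H"
   using pp(3) coset_iff[OF z1[OF ey(1,5)] z1[OF ey(2,6)]] by (simp add: p p')
  then have 1: "\<epsilon> * \<epsilon>' * (s y * s y' + y * y') - 1 \<in> fideal k" and 2: "\<epsilon> * \<epsilon>' * (y * s y' - s y * y') \<in> fideal k"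
   by (simp_all add: rmul_def rconj_def z_def algebra_simps)
  have near1: "s y * s y' + y * y' - 1 \<in> fideal (m)"
  proof -
   have "(s y - 1) * s y' \<in> fideal (m + 1 + 0)" "y * y' \<in> fideal (m + m)"
    by (rule fideal_mult[OF s(2)[OF ey(5)] s0[OF ey(6)]], rule fideal_mult[OF ey(5,6)])
   then have "(s y - 1) * s y' \<in> fideal m" "y * y' \<in> fideal m" "s y' - 1 \<in> fideal m"
    using fideal_antimono[of m "m + 1 + 0"] fideal_antimono[of m "m + m"] fideal_antimono[of m "m + 1"] m0 s(2)[OF ey(6)] by auto
   then have "(s y - 1) * s y' + (s y' - 1) + y * y' \<in> fideal m"
    by (intro fideal_add)
   then show ?thesis
    by (simp add: algebra_simps)
  qed
  have sign: "\<epsilon> * \<epsilon>' = 1"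
  proof (rule ccontr)
   assume "\<epsilon> * \<epsilon>' \<noteq> 1"
   then have "\<epsilon> * \<epsilon>' = - 1"
    using ey(1,2) by auto
   then have "- (s y * s y' + y * y') - 1 \<in> fideal m"
    using 1 fideal_antimono[of m k] e0 by (auto simp: m_def k_def)
   from fideal_add[OF this near1] have "- (2 * 1) \<in> fideal m"
    by simp
   then have "2 * 1 \<in> fideal m"
    unfolding fideal_uminus .
   then have "(1::'f) \<in> fideal 1"
    unfolding two_mult_fideal[OF two] by (simp add: m_def e_def)
   then show False
    by (simp add: fideal_1_iff)
  qed
  have "y * (s y' - 1) \<in> fideal (m + (m + 1))" "y' * (s y - 1) \<in> fideal (m + (m + 1))"
   by (rule fideal_mult; use ey s(2) in blast)+
  then have 3: "y * (s y' - 1) \<in> fideal k" "y' * (s y - 1) \<in> fideal k"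
   using fideal_antimono[of k "m + (m + 1)"] by (auto simp: m_def k_def)
  have "y * s y' - s y * y' \<in> fideal k"
   using 2 unfolding sign by simp
  from fideal_add[OF fideal_diff[OF this 3(1)] 3(2)]
  have "y * s y' - s y * y' - y * (s y' - 1) + y' * (s y - 1) \<in> fideal k" .
  then have "y - y' \<in> fideal k"
   by (simp add: algebra_simps)
  then have "y = y'"
   using T(4) ey by blast
  moreover have "\<epsilon> = \<epsilon>'"
   using sign ey(1,2) by auto
  ultimately show "p = p'"
   by (simp add: p p')
 qed
 moreover have "?f ` ({1, - 1} \<times> T) \<subseteq> ?K"
 proof
  fix C assume "C \<in> ?f ` ({1, - 1} \<times> T)"
  then obtain \<epsilon> y where ey: "\<epsilon> \<in> {1, - 1}" "y \<in> T" "C = ?H #>\<^bsub>SO\<^esub> z \<epsilon> y"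
   by auto
  have y: "y \<in> fideal m"
   using ey(2) T(3) by blast
  let ?z = "z \<epsilon> y"
  have n: "rnorm ?z = 1"
   by (rule z1[OF ey(1) y])
  have "y * y \<in> fideal (m + m)" "y * s y \<in> fideal (m + 0)"
   by (rule fideal_mult[OF y y], rule fideal_mult[OF y s0[OF y]])
  then have "2 * - (y * y) \<in> fideal k" "2 * (y * s y) \<in> fideal k"
   unfolding two_mult_fideal[OF two] fideal_uminus
   using fideal_antimono[of "k - int two_exp" "m + m"] by (auto simp: m_def k_def e_def)
  moreover have "fst (rmul ?z ?z) - 1 = 2 * - (y * y)" "snd (rmul ?z ?z) = 2 * (y * s y)"
  proof -
   have "fst (rmul ?z ?z) = \<epsilon> * \<epsilon> * (s y * s y - y * y)" "snd (rmul ?z ?z) = \<epsilon> * \<epsilon> * (2 * (y * s y))"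
    by (simp_all add: rmul_def z_def algebra_simps)
   moreover have "s y * s y = 1 - y * y"
    using s(1)[OF y] by (simp add: power2_eq_square algebra_simps)
   ultimately show "fst (rmul ?z ?z) - 1 = 2 * - (y * y)" "snd (rmul ?z ?z) = 2 * (y * s y)"
    using sgn[OF ey(1)] by simp_all
  qed
  ultimately have sq: "rmul ?z ?z \<in> ?H"
   using n by (simp add: rnorm_mult)
  have "C <#>\<^bsub>SO\<^esub> C = ?H #>\<^bsub>SO\<^esub> (?z \<otimes>\<^bsub>SO\<^esub> ?z)"
   unfolding ey(3) using normal.rcos_sum[OF G.subgroup_imp_normal[OF H], of ?z ?z] n by (simp add: carr)
  also have "\<dots> = ?H"
   unfolding carr by (rule subgroup.rcos_const[OF H G.is_group sq])
  finally have "C <#>\<^bsub>SO\<^esub> C = ?H" .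
  moreover have "C \<in> rcosets\<^bsub>SO\<^esub> ?H"
   unfolding RCOSETS_def using n by (intro UN_I[of ?z]) (simp_all add: carr ey(3))
  ultimately show "C \<in> ?K"
   by simp
 qed
 ultimately have "card ({1, - 1 :: 'f} \<times> T) \<le> card ?K"
  using finK by (rule card_inj_on_le)
 moreover have "(1::'f) \<noteq> - 1"
  using two by (metis add.right_inverse one_add_one)
 ultimately have "2 * resq ^ two_exp \<le> card ?K"
  using cardT by (simp add: card_cartesian_product)
 moreover obtain A where A: "A \<subseteq> carrier SO" "card A = card ?K"
  "\<forall>a\<in>A. \<forall>b\<in>A. \<forall>g\<in>carrier SO. a \<otimes>\<^bsub>SO\<^esub> inv\<^bsub>SO\<^esub> b = g \<otimes>\<^bsub>SO\<^esub> g \<longrightarrow> a = b"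
  using G.square_classes_quotient(2)[OF H fin] by (elim exE conjE)
 moreover have "0 < 2 * resq ^ two_exp"
  using resq_pos by simp
 ultimately have "finite A"
  by (metis card_ge_0_finite le_less_trans not_le)
 moreover have "rmul a (rconj b) = a \<otimes>\<^bsub>SO\<^esub> inv\<^bsub>SO\<^esub> b" if "a \<in> A" "b \<in> A" for a b
  using that A(1) SO_inv[of b] by (auto simp: carr)
 ultimately show ?thesis
  using \<open>2 * resq ^ two_exp \<le> card ?K\<close> A by (intro exI[of _ A]) (simp add: carr)
qed

definition sum2 :: "'f \<Rightarrow> bool"
 where "sum2 t \<longleftrightarrow> (\<exists>x y. t = x\<^sup>2 + y\<^sup>2)"

lemma sum2_iff_norm: "sum2 t \<longleftrightarrow> (\<exists>z. t = rnorm z)"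
 by (auto simp: sum2_def rnorm_def)

lemma sum2_mult: "sum2 s \<Longrightarrow> sum2 t \<Longrightarrow> sum2 (s * t)"
 unfolding sum2_iff_norm by (metis rnorm_mult)

lemma sum2_square: "sum2 (t\<^sup>2)"
 unfolding sum2_def by (rule exI[of _ t], rule exI[of _ 0]) simp

lemma sum2_inverse:
 assumes "sum2 t"
 shows "sum2 (inverse t)"
proof -
 have "t * (inverse t)\<^sup>2 = inverse t"
  by (cases "t = 0") (simp_all add: power2_eq_square)
 then show ?thesis
  using sum2_mult[OF assms sum2_square[of "inverse t"]] by simp
qed

text \<open>
 The norm group of \<open>z \<mapsto> x\<^sup>2 + y\<^sup>2\<close> has index at most 2. Hilbert 90 identifies its square classes with
 those of the rotation group, of which there are at least half as many as square classes of the field.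
\<close>

lemma sum2_index:
 assumes two: "(2::'f) \<noteq> 0" and ab: "a \<noteq> 0" "b \<noteq> 0" "\<not> sum2 a" "\<not> sum2 b"
 shows "sum2 (a * b)"
proof (rule ccontr)
 assume nab: "\<not> sum2 (a * b)"
 \<comment> \<open>If -1 were a square the form would be hyperbolic and represent everything, since
   \<open>a\<close> is the difference of the squares of \<open>(a + 1) / 2\<close> and
   \<open>(a - 1) / 2\<close>.\<close>
 have neg: "t\<^sup>2 \<noteq> - 1" for t :: 'f
 proof
  assume t: "t\<^sup>2 = - 1"
  have "((a + 1) / 2)\<^sup>2 + (t * ((a - 1) / 2))\<^sup>2 = ((a + 1) / 2)\<^sup>2 - ((a - 1) / 2)\<^sup>2"
   unfolding power_mult_distrib[of t] t by simp
  also have "\<dots> = (a + 1 + (a - 1)) * ((a + 1) - (a - 1)) / (2 * 2)"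
   by (simp add: power2_eq_square field_simps)
  also have "\<dots> = a"
  proof -
   have eq: "(a + 1 + (a - 1)) * ((a + 1) - (a - 1)) = a * (2 * 2)"
    by (simp add: algebra_simps)
   have "(2::'f) * 2 \<noteq> 0"
    using two by (simp only: mult_eq_0_iff) simp
   then show ?thesis
    unfolding eq by (rule nonzero_mult_div_cancel_right)
  qed
  finally show False
   using ab(3) unfolding sum2_def by metis
 qed
 obtain A where A: "finite A" "2 * resq ^ two_exp \<le> card A" "A \<subseteq> carrier SO"
  "\<forall>a\<in>A. \<forall>b\<in>A. \<forall>g\<in>carrier SO. rmul a (rconj b) = rmul g g \<longrightarrow> a = b"
  using rotation_square_classes[OF two neg] by (elim exE conjE)
 \<comment> \<open>The explicit Hilbert 90 element \<open>1 + z\<close>, for which the square of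
   \<open>w z\<close> is its norm times \<open>z\<close>. It vanishes at the rotation -1, where the
   imaginary unit takes its place.\<close>
 define w where "w z = (if fst z = - 1 then (0, 1) else (1 + fst z, snd z))" for z :: "'f \<times> 'f"
 have w2: "rmul (w z) (w z) = (rnorm (w z) * fst z, rnorm (w z) * snd z)" and w0: "rnorm (w z) \<noteq> 0"
  if z: "rnorm z = 1" for z
 proof -
  have n: "snd z * snd z = 1 - fst z * fst z"
   using z by (simp add: rnorm_def power2_eq_square algebra_simps)
  show "rmul (w z) (w z) = (rnorm (w z) * fst z, rnorm (w z) * snd z)"
  proof (cases "fst z = - 1")
   case True
   then have "snd z = 0"
    using n by simp
   then show ?thesis
    using True by (simp add: w_def rmul_def rnorm_def)
  next
   case False
   have "rnorm (w z) = 2 * (1 + fst z)"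
    using False n by (simp add: w_def rnorm_def power2_eq_square algebra_simps)
   then show ?thesis
    using False n by (simp add: w_def rmul_def algebra_simps)
  qed
  show "rnorm (w z) \<noteq> 0"
  proof (cases "fst z = - 1")
   case False
   have "rnorm (w z) = 2 * (1 + fst z)"
    using False n by (simp add: w_def rnorm_def power2_eq_square algebra_simps)
   then show ?thesis
    using False two by (metis add.commute eq_neg_iff_add_eq_0 mult_eq_0_iff)
  qed (simp add: w_def rnorm_def)
 qed
 let ?\<nu> = "\<lambda>z. rnorm (w z)"
 \<comment> \<open>If the product of two norms is \<open>t^2\<close>, then dividing by
   \<open>t\<close> the product of \<open>w z\<close> and the conjugate of \<open>w z'\<close> gives
   a rotation whose square is the quotient of \<open>z\<close> by \<open>z'\<close>.\<close>
 have eq: "z = z'" if zz: "z \<in> A" "z' \<in> A" "?\<nu> z * ?\<nu> z' = t\<^sup>2" for z z' t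
 proof -
  have n: "rnorm z = 1" "rnorm z' = 1"
   using zz A(3) by (auto simp: SO_def)
  have t0: "t \<noteq> 0"
   using w0[OF n(1)] w0[OF n(2)] zz(3) by auto
  define v where "v = rmul (w z) (rconj (w z'))"
  define g where "g = (fst v / t, snd v / t)"
  have "rnorm v = t\<^sup>2"
   by (simp add: v_def rnorm_mult zz(3))
  then have "rnorm g = 1"
   using t0 by (simp add: g_def rnorm_def power_divide flip: add_divide_distrib)
  moreover have "rmul z (rconj z') = rmul g g"
  proof -
   have conj: "rconj (rmul x y) = rmul (rconj x) (rconj y)" for x y
    by (simp add: rconj_def rmul_def)
   have "rmul v v = rmul (rmul (w z) (w z)) (rconj (rmul (w z') (w z')))"
    unfolding v_def conj by (metis rmul_assoc rmul_commute)
   also have "\<dots> = (t\<^sup>2 * fst (rmul z (rconj z')), t\<^sup>2 * snd (rmul z (rconj z')))"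
    unfolding w2[OF n(1)] w2[OF n(2)] by (simp add: rmul_def rconj_def algebra_simps flip: zz(3))
   finally have vv: "rmul v v = (t\<^sup>2 * fst (rmul z (rconj z')), t\<^sup>2 * snd (rmul z (rconj z')))" .
   have "rmul g g = (fst (rmul v v) / t\<^sup>2, snd (rmul v v) / t\<^sup>2)"
    by (simp add: g_def rmul_def power2_eq_square diff_divide_distrib flip: add_divide_distrib)
   then show ?thesis
    unfolding vv using t0 by simp
  qed
  ultimately show ?thesis
   by (intro A(4)[rule_format, OF zz(1,2), of g]) (simp_all add: SO_def)
 qed
 define D where "D = ?\<nu> ` A"
 have "inj_on ?\<nu> A"
  by (rule inj_onI) (metis eq power2_eq_square)
 then have cardD: "card D = card A"
  by (simp add: D_def card_image)
 have finD: "finite D"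
  using A(1) by (simp add: D_def)
 have D: "d \<noteq> 0" "sum2 d" if "d \<in> D" for d
 proof -
  obtain z where z: "z \<in> A" "d = rnorm (w z)"
   using \<open>d \<in> D\<close> unfolding D_def by (rule imageE)
  then have "rnorm z = 1"
   using A(3) by (auto simp: SO_def)
  then show "d \<noteq> 0"
   unfolding z(2) by (rule w0)
  show "sum2 d"
   unfolding sum2_iff_norm z(2) by (rule exI) (rule refl)
 qed
 have eqD: "d = d'" if "d \<in> D" "d' \<in> D" "d * d' = t\<^sup>2" for d d' t
  using that eq unfolding D_def by blast
 have cross: "sum2 c" if "c \<noteq> 0" "d \<in> D" "d' \<in> D" "c * (d * d') = t\<^sup>2" for c d d' t
 proof -
  have "c = t\<^sup>2 * inverse (d * d')"
   using that(4) D(1)[OF that(2)] D(1)[OF that(3)] by (simp add: field_simps)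
  then show ?thesis
   using sum2_mult[OF sum2_square sum2_inverse[OF sum2_mult[OF D(2) D(2)]]] that by simp
 qed
 \<comment> \<open>If neither \<open>a\<close>, \<open>b\<close> nor \<open>a * b\<close> were a
   norm, three disjoint copies of \<open>D\<close> would consist of inequivalent elements. Three
   times \<open>2 * resq ^ two_exp\<close> exceeds the bound \<open>4 * resq ^ two_exp\<close> on
   square classes.\<close>
 let ?A = "D \<union> (*) a ` D \<union> (*) b ` D"
 have "card ?A \<le> 4 * resq ^ two_exp"
 proof (rule square_classes[OF two])
  show "finite ?A" "0 \<notin> ?A"
   using finD D(1) ab by auto
  fix x y t assume xy: "x \<in> ?A" "y \<in> ?A" "x * y = t\<^sup>2"
  obtain c d where c: "x = c * d" "d \<in> D" "c \<in> {1, a, b}"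
   using xy(1) by (auto intro: that[of 1])
  obtain c' d' where c': "y = c' * d'" "d' \<in> D" "c' \<in> {1, a, b}"
   using xy(2) by (auto intro: that[of 1])
  have *: "c * c' * (d * d') = t\<^sup>2"
   using xy(3) c(1) c'(1) by (simp add: mult_ac)
  have c0: "c * c' \<noteq> 0" "c \<noteq> 0"
   using c(3) c'(3) ab by auto
  have s: "sum2 (c * c')"
   by (rule cross[OF c0(1) c(2) c'(2) *])
  have "c = c'"
   using c(3) c'(3) s ab nab by (auto simp: mult.commute)
  then have "d * d' = (t / c)\<^sup>2"
   using * c0(2) by (simp add: power_divide power2_eq_square field_simps)
  then show "x = y"
   using eqD[OF c(2) c'(2)] c(1) c'(1) \<open>c = c'\<close> by simp
 qed
 moreover have "card ?A = 3 * card D"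
 proof -
  have inj: "card ((*) c ` D) = card D" if "c \<noteq> 0" for c
   using that by (intro card_image) (auto simp: inj_on_def)
  have d1: "D \<inter> (*) a ` D = {}"
  proof (rule ccontr)
   assume "\<not> ?thesis"
   then obtain d d' where "d \<in> D" "d' \<in> D" "d = a * d'"
    by auto
   then show False
    using cross[OF ab(1), of d d' "d"] ab(3) by (simp add: power2_eq_square mult_ac)
  qed
  have d2: "(D \<union> (*) a ` D) \<inter> (*) b ` D = {}"
  proof (rule ccontr)
   assume "\<not> ?thesis"
   then obtain y where y: "y \<in> D \<or> y \<in> (*) a ` D" "y \<in> (*) b ` D"
    unfolding disjoint_iff Un_iff not_all not_imp not_not by (elim exE conjE)
   have "\<exists>d\<in>D. y = d \<or> y = a * d"
    using y(1) by blast
   moreover have "\<exists>d'\<in>D. y = b * d'"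
    using y(2) by blast
   ultimately obtain d d' where dd: "d \<in> D" "d' \<in> D" "d = b * d' \<or> a * d = b * d'"
    by metis
   from dd(3) show False
   proof
    assume "d = b * d'"
    then show False
     using cross[OF ab(2) dd(1,2), of d] ab(4) by (simp add: power2_eq_square mult_ac)
   next
    assume "a * d = b * d'"
    then have "a * b * (d * d') = (a * d)\<^sup>2"
     by (simp add: power2_eq_square mult_ac)
    then show False
     using cross[OF _ dd(1,2), of "a * b"] ab(1,2) nab by auto
   qed
  qed
  show ?thesis
   using finD d1 d2 by (simp add: card_Un_disjoint inj[OF ab(1)] inj[OF ab(2)])
 qed
 ultimately have "3 * (2 * resq ^ two_exp) \<le> 4 * resq ^ two_exp"
  using A(2) cardD by linarith
 moreover have "0 < resq ^ two_exp"
  using resq_pos by simp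
 ultimately show False
  by linarith
qed

end

section \<open>Expressing -1 through sums of two squares\<close>

context nonarch_local_field
begin

text \<open>By the pigeonhole principle two natural numbers share a residue class; their difference
  is small.\<close>

lemma exists_small_nat: "\<exists>m>0. (of_nat m :: 'f) \<in> fideal 1"
proof -
 obtain T where T: "finite T" "\<forall>x\<in>fideal 0. \<exists>t\<in>T. x - t \<in> fideal 1"
  using exists_finite_coset_cover[of 0 1] by (elim exE conjE)
 have "\<forall>i. \<exists>t. t \<in> T \<and> (of_nat i :: 'f) - t \<in> fideal 1"
  using T(2) absv_of_nat_le fideal_0_iff by blast
 then obtain c where c: "\<And>i. c i \<in> T" "\<And>i. (of_nat i :: 'f) - c i \<in> fideal 1"
  by metis
 have "\<not> inj c"
  using finite_subset[of "range c" T] c(1) T(1) range_inj_infinite by blast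
 then have "\<exists>i j. i < j \<and> c i = c j"
  unfolding inj_def by (metis nat_neq_iff)
 then obtain i j where ij: "i < j" "c i = c j"
  by (elim exE conjE)
 have "(of_nat j - c j) - (of_nat i - c i) \<in> fideal 1"
  by (rule fideal_diff[OF c(2) c(2)])
 then have "(of_nat (j - i) :: 'f) \<in> fideal 1"
  using ij by (simp add: of_nat_diff)
 then show ?thesis
  using ij(1) by (intro exI[of _ "j - i"]) simp
qed

text \<open>Closure under addition makes all natural numbers sums of two squares. For a small
  \<open>m\<close> the element \<open>1 - 4 * m\<close> is a nonzero square \<open>w^2\<close>, and
  -1 is the quotient of \<open>4 * m - 1\<close> by \<open>w^2\<close>.\<close>

lemma minus_one_sum2_of_closed:
 assumes closed: "\<And>s t. sum2 s \<Longrightarrow> sum2 t \<Longrightarrow> sum2 (s + t)"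
 shows "sum2 (- 1)"
proof -
 have nat: "sum2 (of_nat i)" for i
  using sum2_square[of 0] sum2_square[of 1] by (induction i) (simp_all add: closed)
 obtain m where m: "0 < m" "(of_nat m :: 'f) \<in> fideal 1"
  using exists_small_nat by (elim exE conjE)
 have small: "absv (- of_nat m) < 1"
  using m(2) by (simp add: fideal_1_iff)
 then have "\<exists>w. 1 + 4 * - of_nat m = (w::'f)\<^sup>2"
  using one_plus_4_square by metis
 then obtain w where w: "1 + 4 * - of_nat m = (w::'f)\<^sup>2"
  by (elim exE)
 have "w \<noteq> 0"
 proof
  assume "w = 0"
  then have "1 = 4 * (of_nat m :: 'f)"
   using w by (simp add: eq_diff_eq)
  then have "absv (4::'f) * absv (of_nat m) = 1"
   by (metis absv_1 absv_mult)
  moreover have "absv (4::'f) * absv (of_nat m) \<le> 1 * absv (of_nat m)"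
   using absv_of_nat_le[of 4] by (intro mult_right_mono) (simp_all add: absv_nonneg)
  ultimately show False
   using small by simp
 qed
 have "sum2 (of_nat (4 * m - 1) * inverse (w\<^sup>2))"
  by (intro sum2_mult sum2_inverse sum2_square nat)
 moreover have "(of_nat (4 * m - 1) :: 'f) = - w\<^sup>2"
  using m(1) by (simp add: of_nat_diff flip: w)
 moreover have "- w\<^sup>2 * inverse (w\<^sup>2) = - 1"
  using \<open>w \<noteq> 0\<close> by simp
 ultimately show ?thesis
  by (simp only:)
qed

text \<open>By the preceding lemma some sum \<open>s + t\<close> leaves the norm group. As -1 is
  also outside, the index bound puts \<open>- (s + t)\<close> inside, and dividing by it gives the
  decomposition; \<open>eta_cases\<close> uses it to evaluate \<open>eta\<close> at -1.\<close>

lemma minus_one_eq_sum2_add_sum2: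
 assumes two: "(2::'f) \<noteq> 0" and neg: "\<not> sum2 (- 1)"
 shows "\<exists>s t. sum2 s \<and> sum2 t \<and> s \<noteq> 0 \<and> t \<noteq> 0 \<and> - 1 = s + t"
proof -
 obtain s t where st: "sum2 s" "sum2 t" "\<not> sum2 (s + t)"
  using minus_one_sum2_of_closed neg by metis
 let ?u = "- (s + t)"
 have nz: "s \<noteq> 0" "t \<noteq> 0"
  using st by auto
 have "sum2 0"
  using sum2_square[of 0] by simp
 then have "s + t \<noteq> 0"
  using st(3) by metis
 then have u: "?u \<noteq> 0"
  by (simp only: neg_equal_0_iff_equal not_False_eq_True)
 have "sum2 ((s + t) * - 1)"
  by (rule sum2_index[OF two \<open>s + t \<noteq> 0\<close> _ st(3) neg]) simp
 then have su: "sum2 ?u"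
  by (simp only: mult_minus_right mult_1_right)
 have "s * inverse ?u + t * inverse ?u = - ((s + t) * inverse (s + t))"
  unfolding inverse_minus_eq by (simp only: distrib_right mult_minus_right minus_add_distrib)
 then have "- 1 = s * inverse ?u + t * inverse ?u"
  using right_inverse[OF \<open>s + t \<noteq> 0\<close>] by simp
 then show ?thesis
  using nz u st(1,2) by (intro exI[of _ "s * inverse ?u"] exI[of _ "t * inverse ?u"] conjI sum2_mult sum2_inverse su) simp_all
qed

end

section \<open>The quadratic character \<open>eta\<close>\<close>

context local_coeff
begin

text \<open>The \<open>SOME\<close> term is the inverse of \<open>gauss1 1\<close>, which is a unit
  of a domain that need not be a field.\<close>

definition eta :: "'f \<Rightarrow> 'r"
 where "eta d = (gauss1 d)\<^sup>2 * modulus1 d * (SOME h. gauss1 1 * h = 1)\<^sup>2"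

lemma eta_gauss1: "(gauss1 d)\<^sup>2 * modulus1 d = eta d * (gauss1 1)\<^sup>2"
proof -
 have h: "gauss1 1 * (SOME h. gauss1 1 * h = 1) = (1::'r)"
  by (rule someI_ex) (rule gauss1_unit, simp)
 then have "(gauss1 1)\<^sup>2 * (SOME h. gauss1 1 * h = 1)\<^sup>2 = (1::'r)"
  by (metis power_mult_distrib power_one)
 moreover have "eta d * (gauss1 1)\<^sup>2
   = (gauss1 d)\<^sup>2 * modulus1 d * ((gauss1 1)\<^sup>2 * (SOME h. gauss1 1 * h = 1)\<^sup>2)"
  unfolding eta_def by (simp only: mult_ac)
 ultimately show ?thesis
  by simp
qed

lemma eta_eq_iff: "eta d = e \<longleftrightarrow> (gauss1 d)\<^sup>2 * modulus1 d = e * (gauss1 1)\<^sup>2"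
 unfolding eta_gauss1 using gauss1_neq_0[of 1] by simp

lemma eta_1 [simp]: "eta 1 = 1"
 by (simp add: eta_eq_iff)

lemma eta_square:
 assumes "d \<noteq> 0" "r \<noteq> 0"
 shows "eta (d * r\<^sup>2) = eta d"
proof -
 have "(gauss1 (d * r\<^sup>2))\<^sup>2 * modulus1 (d * r\<^sup>2) = (modulus1 r * gauss1 (d * r\<^sup>2))\<^sup>2 * modulus1 d"
  using assms by (simp add: modulus1_mult power2_eq_square mult_ac)
 then show ?thesis
  unfolding gauss1_square[OF assms] eta_eq_iff eta_gauss1 .
qed

lemma eta_binary:
 assumes "a \<noteq> 0" "b \<noteq> 0" "c = a * x\<^sup>2 + b * y\<^sup>2" "c \<noteq> 0"
 shows "eta a * eta b = eta c * eta (a * b * c)"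
proof -
 have g: "modulus1 c * (gauss1 c * gauss1 (a * b * c)) = gauss1 a * gauss1 b"
 proof (cases "x = 0")
  case True
  then have "y \<noteq> 0" "c = b * y\<^sup>2 + a * x\<^sup>2"
   using assms by auto
  then show ?thesis
   using gauss1_binary[of b a y c x] assms by (simp add: mult.commute[of a b] mult.commute[of "gauss1 a"])
 qed (use gauss1_binary assms in blast)
 have "(eta c * eta (a * b * c)) * ((gauss1 1)\<^sup>2 * (gauss1 1)\<^sup>2)
   = ((gauss1 c)\<^sup>2 * modulus1 c) * ((gauss1 (a * b * c))\<^sup>2 * modulus1 (a * b * c))"
  unfolding eta_gauss1 by (simp only: mult_ac)
 also have "\<dots> = (modulus1 c * (gauss1 c * gauss1 (a * b * c)))\<^sup>2 * (modulus1 a * modulus1 b)"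
  using assms by (simp add: modulus1_mult power2_eq_square mult_ac)
 also have "\<dots> = ((gauss1 a)\<^sup>2 * modulus1 a) * ((gauss1 b)\<^sup>2 * modulus1 b)"
  unfolding g by (simp add: power2_eq_square mult_ac)
 also have "\<dots> = (eta a * eta b) * ((gauss1 1)\<^sup>2 * (gauss1 1)\<^sup>2)"
  unfolding eta_gauss1 by (simp only: mult_ac)
 finally show ?thesis
  using gauss1_neq_0[of 1] by simp
qed

text \<open>For \<open>s = x^2 + y^2\<close> the forms with coefficients \<open>a, a\<close> and
  \<open>a * s, a * s\<close> are isometric up to the square \<open>a^2\<close> in one coefficient,
  so the squares of their one-dimensional Gauss sums agree up to the modulus.\<close>

lemma eta_sum2:
 assumes "a \<noteq> 0" "s \<noteq> 0" "sum2 s"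
 shows "eta (a * s) = eta a"
proof -
 obtain x y where xy: "s = x\<^sup>2 + y\<^sup>2"
  using assms(3) unfolding sum2_def by (elim exE)
 have c: "a * s = a * x\<^sup>2 + a * y\<^sup>2" "a * s = a * y\<^sup>2 + a * x\<^sup>2"
  by (simp_all add: xy distrib_left)
 have c0: "a * s \<noteq> 0"
  using assms by simp
 have main: "modulus1 (a * s) * (gauss1 (a * s) * gauss1 (a * a * (a * s))) = gauss1 a * gauss1 a"
 proof (cases "x = 0")
  case True
  then have "y \<noteq> 0"
   using xy assms(2) by auto
  then show ?thesis
   by (rule gauss1_binary[OF assms(1) assms(1) _ c(2) c0])
 next
  case False
  then show ?thesis
   by (rule gauss1_binary[OF assms(1) assms(1) _ c(1) c0])
 qed
 have sq: "modulus1 a * gauss1 (a * a * (a * s)) = gauss1 (a * s)"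
  using gauss1_square[of "a * s" a] assms by (simp add: power2_eq_square mult_ac)
 have "(gauss1 (a * s))\<^sup>2 * modulus1 (a * s)
   = modulus1 (a * s) * (gauss1 (a * s) * (modulus1 a * gauss1 (a * a * (a * s))))"
  unfolding sq by (simp add: power2_eq_square mult_ac)
 also have "\<dots> = modulus1 a * (gauss1 a * gauss1 a)"
  unfolding main[symmetric] by (simp only: mult_ac)
 also have "\<dots> = eta a * (gauss1 1)\<^sup>2"
  unfolding eta_gauss1[symmetric] by (simp add: power2_eq_square mult_ac)
 finally show ?thesis
  unfolding eta_eq_iff .
qed

text \<open>The form with coefficients \<open>a, - a\<close> is a hyperbolic plane and represents 1,
  hence is isometric to the one with coefficients \<open>1, -1\<close> up to squares. The explicit
  \<open>?x\<close> and \<open>?y\<close> solve \<open>?x + ?y = 1\<close> and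
  \<open>?x - ?y = 1 / a\<close>.\<close>

lemma eta_minus:
 assumes "a \<noteq> 0"
 shows "eta a * eta (- a) = eta (- 1)"
proof -
 let ?x = "(1 + 1 / a) / 2" and ?y = "(1 - 1 / a) / 2"
 have "?x + ?y = 1" "?x - ?y = 1 / a"
  using two_neq_0 by (simp_all flip: add_divide_distrib diff_divide_distrib)
 moreover have "?x\<^sup>2 - ?y\<^sup>2 = (?x + ?y) * (?x - ?y)"
  by (simp only: power2_eq_square square_diff_square_factored)
 ultimately have "?x\<^sup>2 - ?y\<^sup>2 = 1 / a"
  by (simp only: mult_1_left)
 moreover have "a * ?x\<^sup>2 + - a * ?y\<^sup>2 = a * (?x\<^sup>2 - ?y\<^sup>2)"
  by (simp only: right_diff_distrib mult_minus_left) simp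
 ultimately have "1 = a * ?x\<^sup>2 + - a * ?y\<^sup>2"
  using assms by simp
 then have "eta a * eta (- a) = eta 1 * eta (a * - a * 1)"
  using assms by (intro eta_binary) simp_all
 moreover have "a * - a * 1 = - 1 * a\<^sup>2"
  by (simp add: power2_eq_square)
 ultimately show ?thesis
  using eta_square[of "- 1" a] assms by (simp only:) simp
qed

text \<open>If -1 is a sum of two squares, \<open>eta\<close> is even and \<open>eta_minus\<close>
  gives the claim. Otherwise a form with two norms as coefficients represents -1, which gives the
  claim for -1, and by the index bound every element is a norm or minus a norm.\<close>

lemma eta_cases:
 assumes "a \<noteq> 0"
 shows "(eta a)\<^sup>2 = 1"
proof (cases "sum2 (- 1)")
 case True
 then have "eta (- 1) = 1" "eta (- a) = eta a"
  using eta_sum2[of 1 "- 1"] eta_sum2[of a "- 1"] assms by simp_all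
 then show ?thesis
  using eta_minus[OF assms] by (simp add: power2_eq_square)
next
 case False
 obtain s t where st: "sum2 s" "sum2 t" "s \<noteq> 0" "t \<noteq> 0" "- 1 = s + t"
  using minus_one_eq_sum2_add_sum2[OF two_neq_0 False] by (elim exE conjE)
 have "eta s * eta t = eta (- 1) * eta (s * t * - 1)"
  using st(3,4) by (intro eta_binary[of _ _ _ 1 1]) (simp_all flip: st(5))
 moreover have "eta s = 1" "eta t = 1"
  using eta_sum2[of 1] st by (metis eta_1 mult_1_left one_neq_zero)+
 moreover have "eta (s * t * - 1) = eta (- 1)"
  unfolding mult.commute[of "s * t"] by (rule eta_sum2) (use sum2_mult[OF st(1,2)] st(3,4) in simp_all)
 ultimately have 1: "(eta (- 1))\<^sup>2 = 1"
  by (simp add: power2_eq_square)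
 show ?thesis
 proof (cases "sum2 a")
  case True
  then show ?thesis
   using eta_sum2[of 1 a] assms by simp
 next
  case not_sum: False
  have "sum2 (- 1 * a)"
   using not_sum False assms by (intro sum2_index[OF two_neq_0]) simp_all
  then have "eta (- 1 * (- 1 * a)) = eta (- 1)"
   using assms by (intro eta_sum2) simp_all
  then show ?thesis
   using 1 by simp
 qed
qed

text \<open>\<open>eta\<close> is invariant under multiplication by norms. If neither factor is a
  norm, then their product is, whence \<open>eta a = eta b\<close>, and the common value squares to
  1.\<close>

lemma eta_mult:
 assumes "a \<noteq> 0" "b \<noteq> 0"
 shows "eta (a * b) = eta a * eta b"
proof (cases "sum2 a \<or> sum2 b")
 case True
 then show ?thesis
  using eta_sum2[of 1 a] eta_sum2[of b a] eta_sum2[of 1 b] eta_sum2[of a b] assms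
  by (auto simp: mult.commute)
next
 case False
 then have ab: "sum2 (a * b)"
  using assms by (intro sum2_index[OF two_neq_0]) simp_all
 have "eta b = eta (b * a\<^sup>2)"
  using eta_square assms by simp
 also have "\<dots> = eta (a * (a * b))"
  by (simp add: power2_eq_square mult_ac)
 also have "\<dots> = eta a"
  using ab assms by (intro eta_sum2) simp_all
 finally have "eta a * eta b = 1"
  using eta_cases[OF assms(1)] by (simp add: power2_eq_square)
 then show ?thesis
  using eta_sum2[of 1 "a * b"] ab assms by simp
qed

end

section \<open>Linear algebra in coordinates\<close>

context coordinates
begin

lemma lin_id [simp]: "lin id" "lin (\<lambda>x. x)"
 by (simp_all add: lin_def)

lemma lin_add: "lin a \<Longrightarrow> lin b \<Longrightarrow> lin (\<lambda>x. a x + b x)"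
 by (simp add: lin_def smul_distrib)

lemma lin_diff: "lin a \<Longrightarrow> lin b \<Longrightarrow> lin (\<lambda>x. a x - b x)"
 by (simp add: lin_def smul_distrib)

lemma lin_scale: "lin a \<Longrightarrow> lin (\<lambda>x. smul c (a x))"
 by (simp add: lin_def smul_distrib smul_smul mult.commute)

lemma lin_rank_one: "lin (\<lambda>x. smul (dot v x) u)"
 by (simp add: lin_def smul_distrib smul_smul)

lemma lin_co_smul: "lin (\<lambda>x. smul (co k x) u)"
 by (simp add: lin_def smul_distrib smul_smul)

lemma lin_comp: "lin a \<Longrightarrow> lin b \<Longrightarrow> lin (a \<circ> b)"
 by (simp add: lin_def)

lemma lin_eqI: "lin a \<Longrightarrow> lin b \<Longrightarrow> (\<And>i. i < n \<Longrightarrow> a (bv i) = b (bv i)) \<Longrightarrow> a = b"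
 by (rule ext, subst lin_expand[of a], assumption, subst lin_expand[of b], assumption) simp

lemma bv_neq_0: "i < n \<Longrightarrow> bv i \<noteq> 0"
 using co_bv[of i i] by auto

section \<open>Determinants, kernels and singular pencils\<close>

definition mat_of :: "('x \<Rightarrow> 'x) \<Rightarrow> 'f mat"
 where "mat_of a = mat n n (\<lambda>(i, j). co i (a (bv j)))"

definition lin_of :: "'f mat \<Rightarrow> 'x \<Rightarrow> 'x"
 where "lin_of A x = vec (\<lambda>i. \<Sum>j<n. A $$ (i, j) * co j x)"

definition deter :: "('x \<Rightarrow> 'x) \<Rightarrow> 'f"
 where "deter a = det (mat_of a)"

lemma mat_of_carrier [simp]: "mat_of a \<in> carrier_mat n n"
 by (simp add: mat_of_def)

lemma co_lin: "lin a \<Longrightarrow> co i (a x) = (\<Sum>j<n. co i (a (bv j)) * co j x)"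
 by (subst lin_expand) (simp_all add: mult.commute)

lemma mat_of_comp:
 assumes "lin a"
 shows "mat_of (a \<circ> b) = mat_of a * mat_of b"
proof (rule eq_matI)
 fix i j assume "i < dim_row (mat_of a * mat_of b)" "j < dim_col (mat_of a * mat_of b)"
 then have ij: "i < n" "j < n"
  by (simp_all add: mat_of_def)
 have "(mat_of a * mat_of b) $$ (i, j) = (\<Sum>k<n. co i (a (bv k)) * co k (b (bv j)))"
  using ij by (simp add: mat_of_def scalar_prod_def lessThan_atLeast0)
 then show "mat_of (a \<circ> b) $$ (i, j) = (mat_of a * mat_of b) $$ (i, j)"
  using ij co_lin[OF assms, of i "b (bv j)"] by (simp add: mat_of_def)
qed (simp_all add: mat_of_def)

lemma mat_of_id: "mat_of id = 1\<^sub>m n"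
 by (rule eq_matI) (simp_all add: mat_of_def co_bv)

lemma lin_lin_of: "lin (lin_of A)"
 unfolding lin_of_def
 by (rule linI; rule co_eqI) (simp_all add: distrib_left sum.distrib sum_distrib_left mult.left_commute)

lemma co_lin_of: "i < n \<Longrightarrow> co i (lin_of A x) = (\<Sum>j<n. A $$ (i, j) * co j x)"
 by (simp add: lin_of_def)

lemma mat_of_lin_of:
 assumes "A \<in> carrier_mat n n"
 shows "mat_of (lin_of A) = A"
proof (rule eq_matI)
 fix i j assume "i < dim_row A" "j < dim_col A"
 then have ij: "i < n" "j < n"
  using assms by auto
 have "co i (lin_of A (bv j)) = (\<Sum>k<n. if k = j then A $$ (i, k) else 0)"
  unfolding co_lin_of[OF ij(1)] by (rule sum.cong) (simp_all add: co_bv ij)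
 then show "mat_of (lin_of A) $$ (i, j) = A $$ (i, j)"
  using ij by (simp add: mat_of_def)
qed (use assms in \<open>simp_all add: mat_of_def\<close>)

lemma mat_of_inj:
 assumes "lin a" "lin b" "mat_of a = mat_of b"
 shows "a = b"
proof (rule lin_eqI[OF assms(1,2)], rule co_eqI)
 fix i j assume "i < n" "j < n"
 then show "co j (a (bv i)) = co j (b (bv i))"
  using arg_cong[OF assms(3), of "\<lambda>A. A $$ (j, i)"] by (simp add: mat_of_def)
qed

lemma deter_comp: "lin a \<Longrightarrow> deter (a \<circ> b) = deter a * deter b"
 unfolding deter_def mat_of_comp by (rule det_mult[OF mat_of_carrier mat_of_carrier])

lemma deter_id [simp]: "deter id = 1"
 by (simp add: deter_def mat_of_id)

lemma deter_adj:
 assumes "lin a"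
 shows "deter (adj a) = deter a"
proof -
 have "mat_of (adj a) = transpose_mat (mat_of a)"
  by (rule eq_matI) (simp_all add: mat_of_def adj_def)
 then show ?thesis
  unfolding deter_def by (simp add: det_transpose[of _ n])
qed

lemma deter_neq_0: "a \<in> GL \<Longrightarrow> deter a \<noteq> 0"
proof -
 assume a: "a \<in> GL"
 have "a \<circ> ginv a = id"
  using a by auto
 then have "deter a * deter (ginv a) = 1"
  using deter_comp[OF GL_lin[OF a], of "ginv a"] by simp
 then show ?thesis
  by auto
qed

lemma GL_if_deter:
 assumes "lin a" "deter a \<noteq> 0"
 shows "a \<in> GL"
proof -
 have "mat_of a \<in> Units (ring_mat TYPE('f) n ())"
  using assms(2) unfolding deter_def by (rule det_non_zero_imp_unit[OF mat_of_carrier])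
 then obtain B where B: "B \<in> carrier_mat n n" "B * mat_of a = 1\<^sub>m n" "mat_of a * B = 1\<^sub>m n"
  unfolding Units_def ring_mat_def by auto
 have "mat_of (a \<circ> lin_of B) = mat_of id" "mat_of (lin_of B \<circ> a) = mat_of id"
  using B by (simp_all add: mat_of_comp assms(1) lin_lin_of mat_of_lin_of mat_of_id)
 then have "a \<circ> lin_of B = id" "lin_of B \<circ> a = id"
  by (auto intro!: mat_of_inj lin_comp lin_lin_of assms(1))
 then show ?thesis
  by (intro GL_I(1)[of a "lin_of B"] assms(1)) (auto simp: fun_eq_iff)
qed

lemma kernel_if_deter_0:
 assumes a: "lin a" and d: "deter a = 0"
 shows "\<exists>x. x \<noteq> 0 \<and> a x = 0"
proof -
 have "\<exists>v. v \<in> carrier_vec n \<and> v \<noteq> 0\<^sub>v n \<and> mat_of a *\<^sub>v v = 0\<^sub>v n"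
  using d unfolding deter_def det_0_iff_vec_prod_zero[OF mat_of_carrier] .
 then obtain v where v: "v \<in> carrier_vec n" "v \<noteq> 0\<^sub>v n" "mat_of a *\<^sub>v v = 0\<^sub>v n"
  by (elim exE conjE)
 let ?x = "local.vec (\<lambda>i. v $ i)"
 have "a ?x = 0"
 proof (rule co_eqI)
  fix i assume i: "i < n"
  have "co i (a ?x) = (\<Sum>j<n. co i (a (bv j)) * v $ j)"
   unfolding co_lin[OF a, of i ?x] by simp
  also have "\<dots> = (mat_of a *\<^sub>v v) $ i"
   using i v(1) by (simp add: mat_of_def scalar_prod_def lessThan_atLeast0)
  finally show "co i (a ?x) = co i 0"
   using i v(3) by simp
 qed
 moreover have "?x \<noteq> 0"
 proof
  assume 0: "?x = 0"
  have "v = 0\<^sub>v n"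
  proof (rule eq_vecI)
   fix i assume "i < dim_vec (0\<^sub>v n :: 'f Matrix.vec)"
   then show "v $ i = 0\<^sub>v n $ i"
    using arg_cong[OF 0, of "co i"] by simp
  qed (use v(1) in simp)
  then show False
   using v(2) by simp
 qed
 ultimately show ?thesis
  by metis
qed

lemma GL_if_kernel: "lin a \<Longrightarrow> (\<And>x. a x = 0 \<Longrightarrow> x = 0) \<Longrightarrow> a \<in> GL"
 using GL_if_deter kernel_if_deter_0 by metis

lemma GL_kernel: "a \<in> GL \<Longrightarrow> a x = 0 \<Longrightarrow> x = 0"
 using GL_inv(1)[of a x] GL_lin[OF GL_inv_in, of a] by (simp add: lin_simps)

lemma GL_if_surj:
 assumes a: "lin a" and s: "\<And>y. \<exists>x. a x = y"
 shows "a \<in> GL"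
proof -
 have "adj a \<in> GL"
 proof (rule GL_if_kernel)
  fix y assume 0: "adj a y = 0"
  show "y = 0"
  proof (rule dot_eqI)
   fix z
   obtain x where "a x = z"
    using s by metis
   then show "dot z y = dot z 0"
    using dot_adj(1)[OF a, of x y] 0 by simp
  qed
 qed (use a in simp)
 from GL_adj[OF this] show ?thesis
  using a by simp
qed

text \<open>A singular parameter \<open>t\<close> is nonzero, and \<open>- 1 / t\<close> is then an
  eigenvalue of the inverse of \<open>A\<close> composed with \<open>D\<close>, of which there are
  finitely many.\<close>

lemma finite_singular_pencil:
 assumes A: "A \<in> GL" and D: "lin D"
 shows "finite {t. (\<lambda>x. A x + smul t (D x)) \<notin> GL}"
proof -
 let ?C = "ginv A \<circ> D"
 have C: "lin ?C"
  by (intro lin_comp GL_lin[OF GL_inv_in[OF A]] D)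
 have "{t. (\<lambda>x. A x + smul t (D x)) \<notin> GL} \<subseteq> (\<lambda>e. - inverse e) ` {e. poly (char_poly (mat_of ?C)) e = 0}"
 proof
  fix t assume "t \<in> {t. (\<lambda>x. A x + smul t (D x)) \<notin> GL}"
  then have "\<exists>x. x \<noteq> 0 \<and> A x + smul t (D x) = 0"
   using GL_if_kernel[of "\<lambda>x. A x + smul t (D x)"] lin_add[OF GL_lin[OF A] lin_scale[OF D, of t]] by blast
  then obtain x where x: "x \<noteq> 0" "A x + smul t (D x) = 0"
   by (elim exE conjE)
  have "ginv A (A x + smul t (D x)) = 0"
   unfolding x(2) by (rule lin_simps(3)[OF GL_lin[OF GL_inv_in[OF A]]])
  then have *: "x + smul t (?C x) = 0"
   by (simp add: A lin_simps[OF GL_lin[OF GL_inv_in[OF A]]])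
  then have t: "t \<noteq> 0"
   using x(1) by auto
  let ?e = "- inverse t"
  have "smul (inverse t) (x + smul t (?C x)) = 0"
   unfolding * by simp
  then have "?C x = smul ?e x"
   using t by (simp add: smul_distrib smul_smul eq_neg_iff_add_eq_0 add.commute)
  moreover have "lin (\<lambda>y. ?C y - smul ?e y)"
   by (intro lin_diff C lin_scale lin_id)
  ultimately have "(\<lambda>y. ?C y - smul ?e y) \<notin> GL"
   using GL_kernel[of "\<lambda>y. ?C y - smul ?e y" x] x(1) by auto
  then have "deter (\<lambda>y. ?C y - smul ?e y) = 0"
   using GL_if_deter \<open>lin (\<lambda>y. ?C y - smul ?e y)\<close> by blast
  moreover have "mat_of (\<lambda>y. ?C y - smul ?e y) = char_matrix (mat_of ?C) ?e"
   by (rule eq_matI) (simp_all add: mat_of_def char_matrix_def co_bv)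
  ultimately have "eigenvalue (mat_of ?C) ?e"
   unfolding eigenvalue_det[OF mat_of_carrier] deter_def by simp
  then have "poly (char_poly (mat_of ?C)) ?e = 0"
   unfolding eigenvalue_root_char_poly[OF mat_of_carrier] .
  then show "t \<in> (\<lambda>e. - inverse e) ` {e. poly (char_poly (mat_of ?C)) e = 0}"
   by (intro image_eqI[of _ _ ?e]) simp_all
 qed
 moreover have "char_poly (mat_of ?C) \<noteq> 0"
  using degree_monic_char_poly[OF mat_of_carrier, of ?C] by (metis coeff_0 zero_neq_one)
 then have "finite {e. poly (char_poly (mat_of ?C)) e = 0}"
  by (rule poly_roots_finite)
 ultimately show ?thesis
  using finite_surj by blast
qed

text \<open>The functionals \<open>v i\<close> together cut the kernel down to 0. Each induction
  step dispenses with one of them by adding to \<open>b\<close> a symmetric rank-one map that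
  removes a kernel vector and creates no new one.\<close>

lemma exists_kernel_avoiding:
 fixes m :: nat
 assumes "lin \<alpha>" "lin \<beta>" and surj: "\<And>z. \<exists>x y. \<alpha> x + \<beta> y = z"
  and b: "sym b" and v: "\<And>x. \<alpha> x + \<beta> (b x) = 0 \<Longrightarrow> (\<And>i. i < m \<Longrightarrow> dot (v i) x = 0) \<Longrightarrow> x = 0"
 shows "\<exists>b. sym b \<and> (\<lambda>x. \<alpha> x + \<beta> (b x)) \<in> GL"
 using b v
proof (induction m arbitrary: b)
 case 0
 have "lin (\<lambda>x. \<alpha> x + \<beta> (b x))"
  using lin_add[OF assms(1) lin_comp[OF assms(2) sym_lin[OF 0(1)]]] unfolding comp_def .
 then have "(\<lambda>x. \<alpha> x + \<beta> (b x)) \<in> GL"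
  by (rule GL_if_kernel) (rule 0(2), simp_all)
 then show ?case
  using 0(1) by blast
next
 case (Suc m)
 note lb = sym_lin[OF Suc.prems(1)] and la = assms(1) and lbe = assms(2)
 let ?A = "\<lambda>x. \<alpha> x + \<beta> (b x)"
 have lA: "lin ?A"
  using lin_add[OF la lin_comp[OF lbe lb]] by (simp add: comp_def)
 show ?case
 proof (cases "\<forall>x. ?A x = 0 \<longrightarrow> (\<forall>i<m. dot (v i) x = 0) \<longrightarrow> x = 0")
  case True
  then show ?thesis
   using Suc.IH[OF Suc.prems(1)] by blast
 next
  case False
  then obtain y where y: "?A y = 0" "\<And>i. i < m \<Longrightarrow> dot (v i) y = 0" "y \<noteq> 0"
   by blast
  have vy: "dot (v m) y \<noteq> 0"
   using Suc.prems(2)[OF y(1)] y(2,3) by (metis less_Suc_eq)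
  \<comment> \<open>If the range of \<open>?A\<close> contained that of \<open>\<beta>\<close>, it
    would be everything by \<open>surj\<close>, and \<open>?A\<close> would be invertible in spite
    of \<open>y\<close>.\<close>
  have "\<exists>z. \<forall>x. ?A x \<noteq> \<beta> z"
  proof (rule ccontr)
   assume "\<not> ?thesis"
   then have im: "\<exists>x. ?A x = \<beta> z" for z
    by auto
   have "?A \<in> GL"
   proof (rule GL_if_surj[OF lA])
    fix z
    obtain x1 y1 where z: "\<alpha> x1 + \<beta> y1 = z"
     using surj by metis
    obtain x2 where x2: "?A x2 = \<beta> (y1 - b x1)"
     using im by metis
    have "?A (x1 + x2) = ?A x1 + ?A x2"
     by (rule lin_simps(1)[OF lA])
    also have "\<dots> = z"
     unfolding x2 z[symmetric] by (simp add: lin_simps[OF lbe])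
    finally show "\<exists>x. ?A x = z"
     by (rule exI)
   qed
   then show False
    using GL_kernel[of ?A y] y by auto
  qed
  then obtain z where z: "\<And>x. ?A x \<noteq> \<beta> z"
   by metis
  \<comment> \<open>Two demands on \<open>u\<close>: its image under \<open>\<beta>\<close> must
    avoid the range of \<open>?A\<close>, and it must not be orthogonal to \<open>y\<close>. One of
    \<open>v m\<close>, \<open>z\<close> and \<open>v m + z\<close> meets both.\<close>
  have "\<exists>u. (\<forall>x. ?A x \<noteq> \<beta> u) \<and> dot u y \<noteq> 0"
  proof (cases "\<forall>x. ?A x \<noteq> \<beta> (v m)")
   case True
   then show ?thesis
    using vy by blast
  next
   case False
   then obtain x0 where x0: "?A x0 = \<beta> (v m)"
    by blast
   show ?thesis
   proof (cases "dot z y = 0")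
    case True
    have "?A x \<noteq> \<beta> (v m + z)" for x
    proof
     assume "?A x = \<beta> (v m + z)"
     then have "?A (x - x0) = \<beta> z"
      unfolding lin_simps(5)[OF lA] x0 by (simp add: lin_simps[OF lbe])
     then show False
      using z by blast
    qed
    then show ?thesis
     using True vy by (intro exI[of _ "v m + z"]) simp
   qed (use z in blast)
  qed
  then obtain u where u: "\<And>x. ?A x \<noteq> \<beta> u" "dot u y \<noteq> 0"
   by blast
  let ?b = "\<lambda>x. b x + smul (dot u x) u"
  have "sym ?b"
  proof (rule symI)
   show "lin ?b"
    by (intro lin_add lb lin_rank_one)
   fix x y
   show "dot (?b x) y = dot x (?b y)"
    using sym_dot[OF Suc.prems(1), of x y] dot_commute[of x u] by simp
  qed
  moreover have "x = 0" if x: "\<alpha> x + \<beta> (?b x) = 0" "\<And>i. i < m \<Longrightarrow> dot (v i) x = 0" for x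
  proof -
   have A: "?A x = - smul (dot u x) (\<beta> u)"
    using x(1) by (simp add: lin_simps[OF lbe] eq_neg_iff_add_eq_0 add.assoc)
   have ux: "dot u x = 0"
   proof (rule ccontr)
    assume c: "dot u x \<noteq> 0"
    have "?A (smul (- inverse (dot u x)) x) = \<beta> u"
     unfolding lin_simps(2)[OF lA] A using c by (simp add: smul_smul)
    then show False
     using u(1) by blast
   qed
   then have Ax: "?A x = 0"
    using A by simp
   let ?c = "dot (v m) x / dot (v m) y"
   have "?A (x - smul ?c y) = 0"
    unfolding lin_simps(5)[OF lA] lin_simps(2)[OF lA] Ax y(1) by simp
   then have "x - smul ?c y = 0"
    by (rule Suc.prems(2)) (use x(2) y(2) vy in \<open>auto simp: less_Suc_eq\<close>)
   then have "x = smul ?c y"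
    by simp
   then show ?thesis
    using ux u(2) by (metis dot_simps(10) mult_eq_0_iff smul_simps(1))
  qed
  ultimately show ?thesis
   by (rule Suc.IH)
 qed
qed

lemma exists_sym_regular:
 assumes "lin \<alpha>" "lin \<beta>" "\<And>z. \<exists>x y. \<alpha> x + \<beta> y = z"
 shows "\<exists>b. sym b \<and> (\<lambda>x. \<alpha> x + \<beta> (b x)) \<in> GL"
proof (rule exists_kernel_avoiding[OF assms, of "\<lambda>_. 0" n bv])
 show "sym (\<lambda>_. 0)"
  by (rule symI) (simp_all add: lin_def)
 show "x = 0" if "\<And>i. i < n \<Longrightarrow> dot (bv i) x = 0" for x
  using that by (intro co_eqI) simp
qed

text \<open>On the line through two symmetric maps, each pair that is regular at one of its points
  excludes only finitely many parameters, and the field is infinite.\<close>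

lemma exists_common_sym_regular:
 assumes inf: "infinite (UNIV :: 'f set)" and "finite I"
  and I: "\<And>\<alpha> \<beta>. (\<alpha>, \<beta>) \<in> I \<Longrightarrow> lin \<alpha> \<and> lin \<beta> \<and> (\<forall>z. \<exists>x y. \<alpha> x + \<beta> y = z)"
 shows "\<exists>b. sym b \<and> (\<forall>(\<alpha>, \<beta>)\<in>I. (\<lambda>x. \<alpha> x + \<beta> (b x)) \<in> GL)"
 using assms(2) I
proof (induction I rule: finite_induct)
 case empty
 have "sym (\<lambda>_. 0)"
  by (rule symI) (simp_all add: lin_def)
 then show ?case
  by blast
next
 case (insert p I)
 obtain \<alpha>0 \<beta>0 where p: "p = (\<alpha>0, \<beta>0)"
  by (cases p)
 have l0: "lin \<alpha>0" "lin \<beta>0" "\<exists>x y. \<alpha>0 x + \<beta>0 y = z" for z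
  using insert.prems p by blast+
 obtain b where b: "sym b" "\<forall>(\<alpha>, \<beta>)\<in>I. (\<lambda>x. \<alpha> x + \<beta> (b x)) \<in> GL"
  using insert.IH insert.prems by (metis (no_types, lifting) insertCI)
 obtain b' where b': "sym b'" "(\<lambda>x. \<alpha>0 x + \<beta>0 (b' x)) \<in> GL"
  using exists_sym_regular[OF l0] by (elim exE conjE)
 let ?d = "\<lambda>x. b' x - b x"
 let ?c = "\<lambda>t x. b x + smul t (?d x)"
 note lb = sym_lin[OF b(1)] sym_lin[OF b'(1)]
 have c: "sym (?c t)" for t
  using b(1) b'(1) by (intro symI) (simp_all add: lin_add lin_scale lin_diff lb sym_dot)
 have fin: "finite {t. (\<lambda>x. \<alpha> x + \<beta> (?c t x)) \<notin> GL}" if "(\<alpha>, \<beta>) \<in> I" for \<alpha> \<beta>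
 proof -
  have l: "lin \<alpha>" "lin \<beta>"
   using insert.prems that by blast+
  have "finite {t. (\<lambda>x. (\<lambda>x. \<alpha> x + \<beta> (b x)) x + smul t ((\<beta> \<circ> ?d) x)) \<notin> GL}"
   by (rule finite_singular_pencil) (use b(2) that lin_comp[OF l(2) lin_diff[OF lb(2,1)]] in \<open>auto simp: comp_def\<close>)
  then show ?thesis
   by (simp add: lin_simps[OF l(2)] add.assoc)
 qed
 \<comment> \<open>The new pair is known to be regular at \<open>b'\<close>, which is parameter 1 of
   the line; hence the shift by 1.\<close>
 have "finite {s. (\<lambda>x. (\<lambda>x. \<alpha>0 x + \<beta>0 (b' x)) x + smul s ((\<beta>0 \<circ> ?d) x)) \<notin> GL}"
  by (rule finite_singular_pencil[OF b'(2)]) (rule lin_comp[OF l0(2) lin_diff[OF lb(2,1)]])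
 then have "finite ((\<lambda>s. s + 1) ` {s. (\<lambda>x. (\<lambda>x. \<alpha>0 x + \<beta>0 (b' x)) x + smul s ((\<beta>0 \<circ> ?d) x)) \<notin> GL})"
  by (rule finite_imageI)
 moreover have "{t. (\<lambda>x. \<alpha>0 x + \<beta>0 (?c t x)) \<notin> GL} \<subseteq>
  (\<lambda>s. s + 1) ` {s. (\<lambda>x. (\<lambda>x. \<alpha>0 x + \<beta>0 (b' x)) x + smul s ((\<beta>0 \<circ> ?d) x)) \<notin> GL}"
 proof
  fix t assume t: "t \<in> {t. (\<lambda>x. \<alpha>0 x + \<beta>0 (?c t x)) \<notin> GL}"
  have "?c t x = b' x + smul (t - 1) (?d x)" for x
   by (simp add: smul_distrib algebra_simps)
  then have "(\<lambda>x. \<alpha>0 x + \<beta>0 (?c t x)) = (\<lambda>x. (\<lambda>x. \<alpha>0 x + \<beta>0 (b' x)) x + smul (t - 1) ((\<beta>0 \<circ> ?d) x))"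
   by (simp only: lin_simps(1,2)[OF l0(2)] add.assoc comp_def)
  then show "t \<in> (\<lambda>s. s + 1) ` {s. (\<lambda>x. (\<lambda>x. \<alpha>0 x + \<beta>0 (b' x)) x + smul s ((\<beta>0 \<circ> ?d) x)) \<notin> GL}"
   using t by (intro image_eqI[of _ _ "t - 1"]) (simp_all only: mem_Collect_eq not_False_eq_True, simp)
 qed
 ultimately have fin0: "finite {t. (\<lambda>x. \<alpha>0 x + \<beta>0 (?c t x)) \<notin> GL}"
  by (rule finite_subset[rotated])
 have "finite (\<Union>(\<alpha>, \<beta>)\<in>insert p I. {t. (\<lambda>x. \<alpha> x + \<beta> (?c t x)) \<notin> GL})"
  using fin fin0 insert.hyps(1) by (auto simp: p)
 from ex_new_if_finite[OF inf this] obtain t where "t \<notin> (\<Union>(\<alpha>, \<beta>)\<in>insert p I. {t. (\<lambda>x. \<alpha> x + \<beta> (?c t x)) \<notin> GL})"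
  by (elim exE)
 then have "\<forall>(\<alpha>, \<beta>)\<in>insert p I. (\<lambda>x. \<alpha> x + \<beta> (?c t x)) \<in> GL"
  by auto
 then show ?case
  using c[of t] by (intro exI[of _ "?c t"] conjI)
qed

text \<open>
 Column reduction: a bijection that fixes the first \<open>k\<close> basis vectors is composed with one that changes only
 \<open>bv k\<close>, and the latter is a product of symmetric maps.
\<close>

lemma GL_sym_induct:
 assumes two: "(2::'f) \<noteq> 0" and "a \<in> GL"
  and sy: "\<And>b. b \<in> GL \<Longrightarrow> sym b \<Longrightarrow> P b"
  and comp: "\<And>a b. a \<in> GL \<Longrightarrow> b \<in> GL \<Longrightarrow> P a \<Longrightarrow> P b \<Longrightarrow> P (a \<circ> b)"
 shows "P a"
proof -
 \<comment> \<open>The linear map that replaces the basis vector \<open>bv k\<close> by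
   \<open>w\<close> and fixes the others.\<close>
 define col where "col k w x = x + smul (co k x) (w - bv k)" for k :: nat and w x :: 'x
 have lin_col: "lin (col k w)" for k w
  using lin_add[OF lin_id(2) lin_co_smul[of k "w - bv k"]] unfolding col_def .
 have col_bv: "col k w (bv k) = w" if "k < n" for k w
  using that by (simp add: col_def co_bv)
 have col_other: "col k w (bv i) = bv i" if "i < n" "i \<noteq> k" "k < n" for k w i
  using that by (simp add: col_def co_bv)
 have col_GL: "col k w \<in> GL" if "k < n" "co k w \<noteq> 0" for k w
 proof (rule GL_if_kernel[OF lin_col])
  fix x assume 0: "col k w x = 0"
  have "co k (col k w x) = co k x * co k w"
   using that(1) by (simp add: col_def co_bv algebra_simps)
  then have "co k x = 0"
   using 0 that(2) by simp
  then show "x = 0"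
   using 0 by (simp add: col_def)
 qed
 have col1: "P (col k w)" if k: "k < n" and w: "co k w \<noteq> 0" "co k w \<noteq> 1" for k w
 proof -
  define u where "u = w - bv k"
  have uk: "co k u \<noteq> 0"
   using w(2) k by (simp add: u_def co_bv)
  \<comment> \<open>Chosen so that coordinate \<open>k\<close> of \<open>S x\<close> is
    \<open>dot u x\<close>: composing with \<open>col k w\<close> then adds \<open>dot u x\<close>
    times \<open>u\<close>, which is again symmetric. The division needs \<open>co k w\<close> to
    differ from 1.\<close>
  define S where "S x = (x - smul (co k x) (bv k)) + smul (dot u x / co k u) u" for x
  have lS: "lin S"
   unfolding S_def by (rule linI) (simp_all add: smul_distrib smul_smul algebra_simps add_divide_distrib)
  have S: "sym S"
  proof (rule symI[OF lS])
   fix x y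
   have d: "dot (S x) y = dot x y - co k x * co k y + dot u x * dot u y / co k u" for x y
    using k by (simp add: S_def)
   have "dot (S x) y = dot (S y) x"
    unfolding d dot_commute[of y x] by (simp add: mult.commute)
   also have "\<dots> = dot x (S y)"
    by (rule dot_commute)
   finally show "dot (S x) y = dot x (S y)" .
  qed
  have SGL: "S \<in> GL"
  proof (rule GL_if_kernel[OF lS])
   fix x assume 0: "S x = 0"
   have "co k (S x) = dot u x"
    using k uk by (simp add: S_def co_bv)
   then have ux: "dot u x = 0"
    using 0 by simp
   then have x: "x = smul (co k x) (bv k)"
    using 0 by (simp add: S_def)
   have "dot u x = co k x * co k u"
    by (subst x) (simp add: k)
   then have "co k x = 0"
    using ux uk by simp
   then show "x = 0"
    using x by simp
  qed
  have colS: "(col k w \<circ> S) x = S x + smul (dot u x) u" for x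
   using k uk by (simp add: col_def S_def co_bv u_def)
  have "sym (col k w \<circ> S)"
  proof (rule symI[OF lin_comp[OF lin_col lS]])
   fix x y show "dot ((col k w \<circ> S) x) y = dot x ((col k w \<circ> S) y)"
    using sym_dot[OF S, of x y] dot_commute[of x u] unfolding colS by simp
  qed
  then have "P (col k w \<circ> S)" "P (ginv S)"
   using SGL col_GL[OF k w(1)] S by (auto intro!: sy sym_inv)
  then have "P ((col k w \<circ> S) \<circ> ginv S)"
   using SGL col_GL[OF k w(1)] by - (rule comp; simp)
  moreover have "(col k w \<circ> S) \<circ> ginv S = col k w"
   using SGL by (auto simp: fun_eq_iff)
  ultimately show ?thesis
   by simp
 qed
 have col: "P (col k w)" if k: "k < n" and w: "co k w \<noteq> 0" for k w
 proof (cases "co k w = 1")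
  case False
  then show ?thesis
   using col1 k w by blast
 next
  case True
  \<comment> \<open>The excluded pivot 1 is written as the product of the pivots 1/2 and 2.\<close>
  let ?h = "1 / 2 :: 'f"
  have one: "(2::'f) \<noteq> 1"
   by (metis add_cancel_left_left one_add_one zero_neq_one)
  then have h: "?h \<noteq> 0" "?h \<noteq> 1" "2 * ?h = 1"
   using two by (auto simp: field_simps)
  have "P (col k (smul ?h w))" "P (col k (smul 2 (bv k)))"
   using h two True k one by (auto intro!: col1 simp: co_bv)
  then have "P (col k (smul ?h w) \<circ> col k (smul 2 (bv k)))"
   using h two True k by - (rule comp; (intro col_GL)?; simp add: co_bv)
  moreover have "col k (smul ?h w) \<circ> col k (smul 2 (bv k)) = col k w"
  proof (rule lin_eqI[OF lin_comp[OF lin_col lin_col] lin_col])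
   fix i assume i: "i < n"
   show "(col k (smul ?h w) \<circ> col k (smul 2 (bv k))) (bv i) = col k w (bv i)"
   proof (cases "i = k")
    case True
    then show ?thesis
     using k two by (simp add: col_bv lin_simps(2)[OF lin_col] smul_smul)
   next
    case False
    then show ?thesis
     using i k by (simp add: col_other)
   qed
  qed
  ultimately show ?thesis
   by simp
 qed
 have "P a" if "k \<le> n" "a \<in> GL" "\<And>i. i < k \<Longrightarrow> a (bv i) = bv i" for k a
  using that
 proof (induction "n - k" arbitrary: k a rule: less_induct)
  case less
  note a = less.prems(2) and la = GL_lin[OF less.prems(2)]
  show ?case
  proof (cases "k = n")
   case True
   have "a = id"
    by (rule lin_eqI[OF la lin_id(1)]) (use less.prems(3) True in simp)
   moreover have "sym id"
    by (rule symI) simp_all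
   ultimately show ?thesis
    using sy by simp
  next
   case False
   then have k: "k < n"
    using less.prems(1) by simp
   have step: "P a" if a: "a \<in> GL" "\<And>i. i < k \<Longrightarrow> a (bv i) = bv i" "co k (a (bv k)) \<noteq> 0" for a
   proof -
    let ?g = "col k (a (bv k))"
    have g: "?g \<in> GL"
     by (rule col_GL[OF k a(3)])
    have fix_k: "ginv ?g (a (bv i)) = bv i" if "i < Suc k" for i
    proof -
     have "?g (bv i) = a (bv i)"
      using that k a(2) by (cases "i = k") (simp_all add: col_bv col_other)
     then show ?thesis
      using GL_inv(1)[OF g, of "bv i"] by simp
    qed
    have "P (ginv ?g \<circ> a)"
     by (rule less.hyps[of "Suc k"]) (use k g a(1) fix_k in auto)
    then have "P (?g \<circ> (ginv ?g \<circ> a))"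
     using g a(1) col[OF k a(3)] by - (rule comp; simp)
    moreover have "?g \<circ> (ginv ?g \<circ> a) = a"
     using g by (auto simp: fun_eq_iff)
    ultimately show ?thesis
     by simp
   qed
   show ?thesis
   proof (cases "co k (a (bv k)) = 0")
    case False
    then show ?thesis
     using step a less.prems(3) by blast
   next
    case True
    have "\<exists>j<n. k < j \<and> co j (a (bv k)) \<noteq> 0"
    proof (rule ccontr)
     assume "\<not> ?thesis"
     then have z: "co j (a (bv k)) = 0" if "j < n" "k \<le> j" for j
      using that True by (metis le_eq_less_or_eq)
     have "a (bv k) = (\<Sum>i<n. smul (co i (a (bv k))) (a (bv i)))"
     proof (subst coordinate_expansion[of "a (bv k)"], rule sum.cong)
      fix i assume "i \<in> {..<n}"
      then show "smul (co i (a (bv k))) (bv i) = smul (co i (a (bv k))) (a (bv i))"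
       using less.prems(3)[of i] z[of i] by (cases "i < k") auto
     qed simp
     also have "\<dots> = a (a (bv k))"
      by (rule lin_expand[OF la, symmetric])
     finally have "bv k = a (bv k)"
      using GL_inv(1)[OF a] by metis
     then show False
      using True k co_bv[of k k] by simp
    qed
    then obtain j where j: "j < n" "k < j" "co j (a (bv k)) \<noteq> 0"
     by (elim exE conjE)
    \<comment> \<open>A zero pivot is repaired by adding a later nonzero coordinate to it;
      \<open>?h'\<close> undoes this shear.\<close>
    let ?h = "col j (bv j + bv k)" and ?h' = "col j (bv j - bv k)"
    have h: "?h \<in> GL" "?h' \<in> GL"
     using j k by (auto intro!: col_GL simp: co_bv)
    have hh: "?h' \<circ> (?h \<circ> a) = a"
     using j k by (auto simp: fun_eq_iff col_def co_bv smul_distrib)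
    have fix_h: "(?h \<circ> a) (bv i) = bv i" if "i < k" for i
     using that k j less.prems(3) by (simp add: col_other)
    have "co k ((?h \<circ> a) (bv k)) \<noteq> 0"
     using j k True by (simp add: col_def co_bv)
    then have "P (?h \<circ> a)"
     using h a fix_h by (intro step) simp_all
    moreover have "P ?h'"
     using j k by (intro col) (auto simp: co_bv)
    ultimately have "P (?h' \<circ> (?h \<circ> a))"
     using h a by - (rule comp; simp)
    then show ?thesis
     unfolding hh .
   qed
  qed
 qed
 from this[of 0 a] show ?thesis
  using assms(2) by simp
qed

end

section \<open>Diagonalization of symmetric maps\<close>

context weil
begin

lemma co_congruence: "lin Q \<Longrightarrow> j < n \<Longrightarrow> co j ((adj Q \<circ> C \<circ> Q) x) = dot (Q (bv j)) (C (Q x))"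
 using dot_adj(1)[of Q "bv j" "C (Q x)"] by simp

lemma sym_congruence:
 assumes "sym C" "lin Q"
 shows "sym (adj Q \<circ> C \<circ> Q)"
proof (rule symI)
 show "lin (adj Q \<circ> C \<circ> Q)"
  by (intro lin_comp lin_adj sym_lin[OF assms(1)] assms(2))
 fix x y show "dot ((adj Q \<circ> C \<circ> Q) x) y = dot x ((adj Q \<circ> C \<circ> Q) y)"
  using sym_dot[OF assms(1)] by (simp flip: dot_adj(2)[OF assms(2)] dot_adj(1)[OF assms(2)])
qed

definition diagonal_below :: "nat \<Rightarrow> ('x \<Rightarrow> 'x) \<Rightarrow> bool"
 where "diagonal_below k C \<longleftrightarrow> (\<forall>i<k. \<forall>j<n. j \<noteq> i \<longrightarrow> co j (C (bv i)) = 0)"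

lemma diagonal_below_congruence:
 assumes C: "diagonal_below k C" "k \<le> n" and Q: "lin Q" "\<And>i. i < k \<Longrightarrow> Q (bv i) = bv i"
  "\<And>i j. i < k \<Longrightarrow> j < n \<Longrightarrow> co i (Q (bv j)) = co i (bv j)"
 shows "diagonal_below k (adj Q \<circ> C \<circ> Q)"
 unfolding diagonal_below_def
proof (intro allI impI)
 fix i j assume ij: "i < k" "j < n" "j \<noteq> i"
 have "C (bv i) = smul (co i (C (bv i))) (bv i)"
  using ij C unfolding diagonal_below_def by (intro co_eqI) (auto simp: co_bv)
 then have "dot (Q (bv j)) (C (bv i)) = co i (C (bv i)) * dot (Q (bv j)) (bv i)"
  by (metis dot_simps(10))
 then show "co j ((adj Q \<circ> C \<circ> Q) (bv i)) = 0"
  using ij C(2) Q by (simp add: co_congruence co_bv del: comp_apply)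
qed

text \<open>If \<open>bv k\<close> is isotropic, nondegeneracy gives a later \<open>bv j\<close> not
  orthogonal to it; the values at \<open>bv k + bv j\<close> and \<open>bv k - bv j\<close> cannot
  both vanish because 2 is invertible.\<close>

lemma exists_nonisotropic:
 assumes C: "C \<in> GL" "sym C" "diagonal_below k C" and k: "k < n"
 shows "\<exists>u. (\<forall>i\<le>k. co i u = 0) \<and> dot (bv k + u) (C (bv k + u)) \<noteq> 0"
proof (cases "co k (C (bv k)) = 0")
 case False
 then show ?thesis
  using k by (intro exI[of _ 0]) simp
next
 case True
 have "C (bv k) \<noteq> 0"
  using GL_kernel[OF C(1)] bv_neq_0[OF k] by blast
 then obtain j where j: "j < n" "co j (C (bv k)) \<noteq> 0"
  using co_eqI[of "C (bv k)" 0] by auto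
 have "k < j"
 proof (rule ccontr)
  assume "\<not> k < j"
  with True j have jk: "j < k"
   by (metis not_less_iff_gr_or_eq)
  have "co j (C (bv k)) = dot (C (bv j)) (bv k)"
   using sym_dot[OF C(2), of "bv j" "bv k"] j by simp
  also have "\<dots> = 0"
   using C(3) jk k unfolding diagonal_below_def by simp
  finally show False
   using j by simp
 qed
 note l = lin_simps[OF sym_lin[OF C(2)]]
 have sy: "co k (C (bv j)) = co j (C (bv k))"
  using sym_dot[OF C(2), of "bv j" "bv k"] j k by simp
 have *: "dot (bv k + smul t (bv j)) (C (bv k + smul t (bv j))) = t * (2 * co j (C (bv k)) + t * co j (C (bv j)))" for t
  using j k True sy by (simp add: l algebra_simps)
 have "\<exists>t. t * (2 * co j (C (bv k)) + t * co j (C (bv j))) \<noteq> 0"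
 proof (rule ccontr)
  assume "\<not> ?thesis"
  then have "1 * (2 * co j (C (bv k)) + 1 * co j (C (bv j))) = 0" "- 1 * (2 * co j (C (bv k)) + - 1 * co j (C (bv j))) = 0"
   by blast+
  then have "2 * (2 * co j (C (bv k))) = 0"
   by (simp add: algebra_simps)
  then show False
   using j(2) two_neq_0 by (simp only: mult_eq_0_iff) simp
 qed
 then obtain t where "t * (2 * co j (C (bv k)) + t * co j (C (bv j))) \<noteq> 0"
  by (elim exE)
 then show ?thesis
  using \<open>k < j\<close> j k * by (intro exI[of _ "smul t (bv j)"]) (simp add: co_bv)
qed

text \<open>Gram-Schmidt by congruences: \<open>Q\<close> replaces \<open>bv k\<close> by a
  non-isotropic vector, and \<open>R\<close> then makes the other basis vectors orthogonal to it
  without disturbing the earlier ones.\<close>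

lemma exists_partial_diagonalization:
 assumes "B \<in> GL" "sym B" "k \<le> n"
 shows "\<exists>P\<in>GL. diagonal_below k (adj P \<circ> B \<circ> P)"
 using assms(3)
proof (induction k)
 case 0
 show ?case
  by (rule bexI[of _ id]) (simp_all add: diagonal_below_def)
next
 case (Suc k)
 have "\<exists>P\<in>GL. diagonal_below k (adj P \<circ> B \<circ> P)"
  by (intro Suc.IH Suc_leD[OF Suc.prems])
 then obtain P where P: "P \<in> GL" "diagonal_below k (adj P \<circ> B \<circ> P)"
  by (elim bexE)
 have k: "k < n"
  using Suc.prems by simp
 let ?C = "adj P \<circ> B \<circ> P"
 have C: "?C \<in> GL" "sym ?C"
  using P assms by (auto intro: sym_congruence GL_lin)
 obtain u where u: "\<And>i. i \<le> k \<Longrightarrow> co i u = 0" "dot (bv k + u) (?C (bv k + u)) \<noteq> 0"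
  using exists_nonisotropic[OF C P(2) k] by blast
 define Q where "Q x = x + smul (co k x) u" for x
 have lQ: "lin Q"
  using lin_add[OF lin_id(2) lin_co_smul[of k u]] unfolding Q_def .
 have Q: "Q \<in> GL"
 proof (rule GL_if_kernel[OF lQ])
  fix x assume 0: "Q x = 0"
  then have "co k (Q x) = 0"
   by simp
  then have "co k x = 0"
   using u(1)[of k] by (simp add: Q_def)
  then show "x = 0"
   using 0 by (simp add: Q_def)
 qed
 let ?C1 = "adj Q \<circ> ?C \<circ> Q"
 have C1: "sym ?C1" "diagonal_below k ?C1"
  using k u(1) by (auto intro!: sym_congruence C lQ diagonal_below_congruence P simp: Q_def co_bv)
 define w where "w = ?C1 (bv k)"
 have "co k w = dot (Q (bv k)) (?C (Q (bv k)))"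
  unfolding w_def by (rule co_congruence[OF lQ k])
 also have "Q (bv k) = bv k + u"
  using k by (simp add: Q_def co_bv)
 finally have wk: "co k w \<noteq> 0"
  using u(2) by simp
 have wi: "co i w = 0" if "i < k" for i
 proof -
  have "co i w = dot (?C1 (bv i)) (bv k)"
   using sym_dot[OF C1(1), of "bv i" "bv k"] that k unfolding w_def by (simp del: comp_apply)
  also have "\<dots> = 0"
   using C1(2) that k unfolding diagonal_below_def by (simp del: comp_apply)
  finally show ?thesis .
 qed
 define \<phi> where "\<phi> x = dot w x / co k w - co k x" for x
 define R where "R x = x - smul (\<phi> x) (bv k)" for x
 have \<phi>: "\<phi> (x + y) = \<phi> x + \<phi> y" "\<phi> (smul c x) = c * \<phi> x" "\<phi> (bv k) = 0" for x y c
  using k wk by (simp_all add: \<phi>_def co_bv add_divide_distrib algebra_simps)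
 have \<phi>i: "\<phi> (bv i) = 0" if "i < k" for i
  using wi[OF that] that k by (simp add: \<phi>_def co_bv)
 have lR: "lin R"
  by (rule linI) (simp_all add: R_def \<phi> smul_distrib smul_smul)
 have R: "R \<in> GL"
 proof (rule GL_if_kernel[OF lR])
  fix x assume "R x = 0"
  then have x: "x = smul (\<phi> x) (bv k)"
   by (simp add: R_def)
  then have "\<phi> x = 0"
   by (metis \<phi>(2,3) mult_zero_right)
  then show "x = 0"
   using x by simp
 qed
 let ?C2 = "adj R \<circ> ?C1 \<circ> R"
 have "diagonal_below k ?C2"
  using k by (intro diagonal_below_congruence C1 lR) (auto simp: R_def \<phi>i co_bv)
 moreover have "co j (?C2 (bv k)) = 0" if j: "j < n" "j \<noteq> k" for j
 proof -
  have "co j (?C2 (bv k)) = dot (R (bv j)) (?C1 (R (bv k)))"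
   by (rule co_congruence[OF lR j(1)])
  also have "R (bv k) = bv k"
   by (simp add: R_def \<phi>)
  also have "dot (R (bv j)) (?C1 (bv k)) = co j w - \<phi> (bv j) * co k w"
   using j k unfolding w_def[symmetric] by (simp add: R_def)
  also have "\<dots> = 0"
   using j k wk by (simp add: \<phi>_def co_bv)
  finally show ?thesis .
 qed
 ultimately have d2: "diagonal_below (Suc k) ?C2"
  unfolding diagonal_below_def less_Suc_eq by blast
 have "adj (P \<circ> Q \<circ> R) = adj R \<circ> (adj Q \<circ> adj P)"
  unfolding adj_comp[OF lin_comp[OF GL_lin[OF P(1)] lQ] lR] adj_comp[OF GL_lin[OF P(1)] lQ] ..
 then have "adj (P \<circ> Q \<circ> R) \<circ> B \<circ> (P \<circ> Q \<circ> R) = ?C2"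
  by (simp only: comp_assoc)
 then have "diagonal_below (Suc k) (adj (P \<circ> Q \<circ> R) \<circ> B \<circ> (P \<circ> Q \<circ> R))"
  by (rule ssubst) (rule d2)
 moreover have "P \<circ> Q \<circ> R \<in> GL"
  by (intro GL_comp P(1) Q R)
 ultimately show ?case
  by (rule bexI)
qed

lemma exists_diagonalization:
 assumes "B \<in> GL" "sym B"
 shows "\<exists>P\<in>GL. \<exists>d. (\<forall>i<n. d i \<noteq> 0) \<and> adj P \<circ> B \<circ> P = diag d"
proof -
 obtain P where P: "P \<in> GL" "diagonal_below n (adj P \<circ> B \<circ> P)"
  using exists_partial_diagonalization[OF assms order_refl] by (elim bexE)
 let ?C = "adj P \<circ> B \<circ> P"
 have C: "?C \<in> GL"
  using P assms by simp
 define d where "d i = co i (?C (bv i))" for i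
 have bvi: "?C (bv i) = smul (d i) (bv i)" if "i < n" for i
  using P(2) that unfolding diagonal_below_def d_def by (intro co_eqI) (auto simp: co_bv)
 have "?C = diag d"
  by (rule lin_eqI[OF GL_lin[OF C] lin_diag], rule co_eqI) (simp add: bvi diag_def co_bv del: comp_apply)
 moreover have "d i \<noteq> 0" if "i < n" for i
  using GL_kernel[OF C, of "bv i"] bv_neq_0[OF that] bvi[OF that] by (metis smul_simps(1))
 ultimately show ?thesis
  using P(1) by blast
qed

lemma deter_diag: "deter (diag d) = (\<Prod>i<n. d i)"
proof -
 have m: "mat_of (diag d) = mat n n (\<lambda>(i, j). if i = j then d i else 0)"
  by (rule eq_matI) (simp_all add: mat_of_def diag_def co_bv)
 have "deter (diag d) = prod_list (diag_mat (mat_of (diag d)))"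
  unfolding deter_def by (rule det_upper_triangular[OF _ mat_of_carrier]) (simp add: m upper_triangular_def)
 then show ?thesis
  by (simp add: m prod_list_diag_prod lessThan_atLeast0)
qed

section \<open>A character of the general linear group\<close>

definition H :: "('x \<Rightarrow> 'x) \<Rightarrow> 'r"
 where "H a = modulus a * eta (deter a)"

lemma H_comp:
 assumes "a \<in> GL" "b \<in> GL"
 shows "H (a \<circ> b) = H a * H b"
 using assms by (simp add: H_def modulus_comp deter_comp GL_lin eta_mult deter_neq_0)

lemma H_id [simp]: "H id = 1"
 by (simp add: H_def)

lemma H_unit: "a \<in> GL \<Longrightarrow> H a * H (ginv a) = 1"
proof -
 assume a: "a \<in> GL"
 then have "a \<circ> ginv a = id"
  by auto
 then show ?thesis
  using H_comp[OF a GL_inv_in[OF a]] by simp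
qed

lemma H_diag:
 assumes d: "\<And>i. i < n \<Longrightarrow> d i \<noteq> 0"
 shows "H (diag d) * (gauss (diag d))\<^sup>2 = (gauss id)\<^sup>2"
proof -
 have eta_prod: "eta (\<Prod>i\<in>I. d i) = (\<Prod>i\<in>I. eta (d i)) \<and> ((\<Prod>i\<in>I. eta (d i)) * (\<Prod>i\<in>I. eta (d i)) = 1)" if "I \<subseteq> {..<n}" for I
 proof -
  have "finite I"
   using that by (rule finite_subset) simp
  then show ?thesis
   using that
  proof (induction I rule: finite_induct)
   case (insert i I)
   have "d i \<noteq> 0" "(\<Prod>i\<in>I. d i) \<noteq> 0"
    using insert d by (auto simp: prod_zero_iff)
   then show ?case
    using insert eta_cases[of "d i"] by (auto simp: eta_mult power2_eq_square mult_ac)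
  qed simp
 qed
 have one: "gauss id = (\<Prod>i<n. gauss1 1)"
  unfolding diag_one[symmetric] by (rule gauss_diag) simp
 have "H (diag d) * (gauss (diag d))\<^sup>2
   = (\<Prod>i<n. (gauss1 (d i))\<^sup>2 * modulus1 (d i)) * eta (\<Prod>i<n. d i)"
  using d by (simp add: H_def modulus_diag gauss_diag deter_diag prod.distrib prod_power_distrib mult_ac)
 also have "\<dots> = (\<Prod>i<n. eta (d i)) * (\<Prod>i<n. eta (d i)) * (\<Prod>i<n. (gauss1 1)\<^sup>2)"
  unfolding eta_gauss1 using eta_prod[OF order_refl] by (simp add: prod.distrib mult_ac)
 also have "\<dots> = (gauss id)\<^sup>2"
  unfolding one using eta_prod[OF order_refl] by (simp add: mult.commute flip: power_mult)
 finally show ?thesis .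
qed

text \<open>A congruence by \<open>P\<close> multiplies \<open>H\<close> by the square of
  \<open>modulus P\<close>, since the determinant changes by a square, which \<open>eta\<close> does
  not see. The Gauss sum changes by the inverse of \<open>modulus P\<close>, so diagonal forms
  suffice.\<close>

lemma H_gauss:
 assumes B: "B \<in> GL" "sym B"
 shows "H B * (gauss B)\<^sup>2 = (gauss id)\<^sup>2"
proof -
 obtain P d where P: "P \<in> GL" "\<And>i. i < n \<Longrightarrow> d i \<noteq> 0" "adj P \<circ> B \<circ> P = diag d"
  using exists_diagonalization[OF B] by metis
 have "H (diag d) = H (adj P) * H B * H P"
  unfolding P(3)[symmetric] using P(1) B by (simp add: H_comp)
 also have "\<dots> = (modulus P)\<^sup>2 * H B"
  using eta_cases[OF deter_neq_0[OF P(1)]] P(1)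
  by (simp add: H_def modulus_adj deter_adj GL_lin power2_eq_square mult_ac)
 finally have "(gauss id)\<^sup>2 = (modulus P)\<^sup>2 * H B * (gauss (adj P \<circ> B \<circ> P))\<^sup>2"
  using H_diag[of d] P(2) unfolding P(3) by simp
 also have "\<dots> = H B * (modulus P * gauss (adj P \<circ> B \<circ> P))\<^sup>2"
  by (simp only: power_mult_distrib mult_ac)
 finally show ?thesis
  unfolding gauss_congruence[OF B P(1)] by simp
qed

text \<open>The root has to be a unit because it serves to rescale an invertible operator in
  \<open>Lam_lift\<close>.\<close>

lemma H_square:
 assumes "a \<in> GL"
 shows "\<exists>c d. c * d = 1 \<and> H a = c\<^sup>2"
proof (rule GL_sym_induct[OF two_neq_0 assms, where P = "\<lambda>a. \<exists>c d. c * d = 1 \<and> H a = c\<^sup>2"])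
 fix b assume b: "b \<in> GL" "sym b"
 obtain g where g: "gauss b * g = 1"
  using gauss_unit[OF b] by (elim exE)
 have "sym id"
  by (rule symI) simp_all
 obtain h where h: "gauss id * h = 1"
  using gauss_unit[OF GL_id \<open>sym id\<close>] by (elim exE)
 have "H b * (gauss b)\<^sup>2 * g\<^sup>2 = (gauss id * g)\<^sup>2"
  unfolding H_gauss[OF b] by (simp add: power_mult_distrib)
 moreover have "H b * (gauss b)\<^sup>2 * g\<^sup>2 = H b * (gauss b * g)\<^sup>2"
  by (simp only: power_mult_distrib mult_ac)
 moreover have "gauss id * g * (h * gauss b) = (gauss id * h) * (gauss b * g)"
  by (simp only: mult_ac)
 ultimately show "\<exists>c d. c * d = 1 \<and> H b = c\<^sup>2"
  using g h by (intro exI[of _ "gauss id * g"] exI[of _ "h * gauss b"]) simp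
next
 fix a b assume ab: "a \<in> GL" "b \<in> GL" "\<exists>c d. c * d = 1 \<and> H a = c\<^sup>2" "\<exists>c d. c * d = 1 \<and> H b = c\<^sup>2"
 obtain c d where c: "c * d = 1" "H a = c\<^sup>2"
  using ab(3) by (elim exE conjE)
 obtain c' d' where c': "c' * d' = 1" "H b = c'\<^sup>2"
  using ab(4) by (elim exE conjE)
 have "c * c' * (d * d') = (c * d) * (c' * d')"
  by (simp only: mult_ac)
 then show "\<exists>c d. c * d = 1 \<and> H (a \<circ> b) = c\<^sup>2"
  using c c' H_comp[OF ab(1,2)] by (intro exI[of _ "c * c'"] exI[of _ "d * d'"]) (simp add: power_mult_distrib)
qed

end

section \<open>Extending partially defined homomorphisms\<close>

text \<open>
 In Weil's style, a function that is multiplicative only on a generic subset extends to the group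
 as \<open>g \<mapsto> l (g x) / l x\<close> for generic \<open>x\<close>.
\<close>

lemma (in group) partial_hom_extends:
 fixes l :: "'a \<Rightarrow> 'r::idom"
 assumes gen: "\<And>I. finite I \<Longrightarrow> I \<subseteq> carrier G \<Longrightarrow> \<exists>x\<in>V. \<forall>g\<in>I. g \<otimes> x \<in> V"
  and V: "V \<subseteq> carrier G"
  and mult: "\<And>g h. g \<in> V \<Longrightarrow> h \<in> V \<Longrightarrow> g \<otimes> h \<in> V \<Longrightarrow> l (g \<otimes> h) = l g * l h"
  and unit: "\<And>g. g \<in> V \<Longrightarrow> \<exists>d. l g * d = 1"
 shows "\<exists>L. (\<forall>g\<in>carrier G. \<forall>h\<in>carrier G. L (g \<otimes> h) = L g * L h) \<and> (\<forall>g\<in>V. L g = l g)"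
proof -
 have nz: "l g \<noteq> 0" if "g \<in> V" for g
  using unit[OF that] by auto
 have uniq: "c = c'"
  if g: "g \<in> carrier G" and x: "x \<in> V" "g \<otimes> x \<in> V" "c * l x = l (g \<otimes> x)"
   and y: "y \<in> V" "g \<otimes> y \<in> V" "c' * l y = l (g \<otimes> y)" for g x y c c'
 proof -
  have xy: "x \<in> carrier G" "y \<in> carrier G"
   using x y V by auto
  \<comment> \<open>A generic \<open>z\<close> that both \<open>inv x\<close> and
    \<open>inv y\<close> move into \<open>V\<close> lets the quotients computed at \<open>x\<close>
    and at \<open>y\<close> be compared with the one at \<open>z\<close>.\<close>
  have "\<exists>z\<in>V. \<forall>h\<in>{g, inv x, inv y}. h \<otimes> z \<in> V"
   using g xy by (intro gen) auto
  then obtain z where z: "z \<in> V" "g \<otimes> z \<in> V" "inv x \<otimes> z \<in> V" "inv y \<otimes> z \<in> V"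
   by auto
  have zc: "z \<in> carrier G"
   using z V by auto
  have key: "c * l z = l (g \<otimes> z)"
   if "x \<in> V" "g \<otimes> x \<in> V" "c * l x = l (g \<otimes> x)" "inv x \<otimes> z \<in> V" for x c
  proof -
   have xc: "x \<in> carrier G"
    using that V by auto
   have e: "x \<otimes> (inv x \<otimes> z) = z" "g \<otimes> x \<otimes> (inv x \<otimes> z) = g \<otimes> z"
    using xc zc g by (simp_all add: inv_solve_left m_assoc) (simp_all flip: m_assoc)
   have "l z = l x * l (inv x \<otimes> z)"
    using mult[OF that(1,4)] z(1) unfolding e by simp
   moreover have "l (g \<otimes> z) = l (g \<otimes> x) * l (inv x \<otimes> z)"
    using mult[OF that(2,4)] z(2) unfolding e by simp
   ultimately show ?thesis
    by (simp add: mult.assoc flip: that(3))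
  qed
  show ?thesis
   using key[OF x z(3)] key[OF y z(4)] nz[OF z(1)] by (metis mult_right_cancel)
 qed
 define R where "R g c \<longleftrightarrow> (\<exists>x\<in>V. g \<otimes> x \<in> V \<and> c * l x = l (g \<otimes> x))" for g c
 have ratio: "\<exists>c. c * l x = l y" if xy: "x \<in> V" "y \<in> V" for x y
 proof -
  obtain d where "l x * d = 1"
   using unit[OF xy(1)] by (elim exE)
  then have "l y * d * l x = l y"
   by (metis mult.assoc mult.commute mult_1_right)
  then show ?thesis
   by (rule exI)
 qed
 have R1: "c = c'" if R: "g \<in> carrier G" "R g c" "R g c'" for g c c'
 proof -
  obtain x where x: "x \<in> V" "g \<otimes> x \<in> V" "c * l x = l (g \<otimes> x)"
   using R(2) unfolding R_def by blast
  obtain y where y: "y \<in> V" "g \<otimes> y \<in> V" "c' * l y = l (g \<otimes> y)"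
   using R(3) unfolding R_def by blast
  show ?thesis
   by (rule uniq[OF R(1) x y])
 qed
 define L where "L g = (THE c. R g c)" for g
 have L: "L g = c" if "g \<in> carrier G" "R g c" for g c
  unfolding L_def using that R1 by (intro the_equality) blast+
 have LI: "L g * l x = l (g \<otimes> x)" if gx: "g \<in> carrier G" "x \<in> V" "g \<otimes> x \<in> V" for g x
 proof -
  obtain c where c: "c * l x = l (g \<otimes> x)"
   using ratio[OF gx(2,3)] by (elim exE)
  then have "R g c"
   unfolding R_def using gx by blast
  then show ?thesis
   using L[OF gx(1)] c by simp
 qed
 have "L (g \<otimes> h) = L g * L h" if gh: "g \<in> carrier G" "h \<in> carrier G" for g h
 proof -
  have "\<exists>z\<in>V. \<forall>k\<in>{h, g \<otimes> h}. k \<otimes> z \<in> V"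
   using gh by (intro gen) auto
  then obtain z where z: "z \<in> V" "h \<otimes> z \<in> V" "g \<otimes> h \<otimes> z \<in> V"
   by auto
  have a: "g \<otimes> h \<otimes> z = g \<otimes> (h \<otimes> z)"
   using gh z V by (intro m_assoc) auto
  have "L (g \<otimes> h) * l z = L g * (L h * l z)"
   using LI[of "g \<otimes> h" z] LI[of g "h \<otimes> z"] LI[of h z] gh z unfolding a by simp
  then show ?thesis
   using nz[OF z(1)] by simp
 qed
 moreover have "L g = l g" if g: "g \<in> V" for g
 proof -
  have "\<exists>z\<in>V. \<forall>k\<in>{g}. k \<otimes> z \<in> V"
   using g V by (intro gen) auto
  then obtain z where z: "z \<in> V" "g \<otimes> z \<in> V"
   by auto
  have "L g * l z = l g * l z"
   using LI[of g z] mult[OF g z] g z V by auto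
  then show ?thesis
   using nz[OF z(1)] by simp
 qed
 ultimately show ?thesis
  by blast
qed

lemma (in nonarch_local_field) infinite_field: "infinite (UNIV :: 'f set)"
proof -
 have "inj (\<lambda>k. unif powi int k)"
 proof (rule injI)
  fix j k assume *: "unif powi int j = unif powi int k"
  have "k \<le> j" "j \<le> k"
   using absv_unif_powi_le_iff[of "int j" "int k"] absv_unif_powi_le_iff[of "int k" "int j"]
   unfolding absv_powi[symmetric] * by simp_all
  then show "j = k"
   by simp
 qed
 from range_inj_infinite[OF this] show ?thesis
  by (rule infinite_super[rotated]) simp
qed

context weil
begin

section \<open>The symplectic group in coordinates\<close>

definition psm :: "'f \<Rightarrow> 'x \<times> 'x \<Rightarrow> 'x \<times> 'x"
 where "psm c p = (smul c (fst p), smul c (snd p))"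

definition om :: "'x \<times> 'x \<Rightarrow> 'x \<times> 'x \<Rightarrow> 'f"
 where "om p q = dot (fst p) (snd q) - dot (fst q) (snd p)"

definition symp :: "('x \<times> 'x \<Rightarrow> 'x \<times> 'x) \<Rightarrow> bool"
 where "symp f \<longleftrightarrow> (\<forall>p q. f (p + q) = f p + f q) \<and> (\<forall>c p. f (psm c p) = psm c (f p)) \<and>
  bij f \<and> (\<forall>p q. om (f p) (f q) = om p q)"

lemma sympD:
 assumes "symp f"
 shows "f (p + q) = f p + f q" "f (psm c p) = psm c (f p)" "bij f" "om (f p) (f q) = om p q"
 using assms unfolding symp_def by blast+

lemma sympI:
 assumes "\<And>p q. f (p + q) = f p + f q" "\<And>c p. f (psm c p) = psm c (f p)"
  "\<And>p q. om (f p) (f q) = om p q" "\<And>p. f (g p) = p" "\<And>p. g (f p) = p"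
 shows "symp f"
 using assms unfolding symp_def by (auto intro!: o_bij[of g] simp: fun_eq_iff)

lemma symp_comp: "symp f \<Longrightarrow> symp g \<Longrightarrow> symp (f \<circ> g)"
 unfolding symp_def by (intro conjI allI) (simp_all only: comp_apply bij_comp simp_thms)

lemma symp_id: "symp id"
 by (simp add: symp_def)

lemma symp_inverse:
 assumes "symp f"
 shows "symp (inv_into UNIV f)"
proof -
 let ?g = "inv_into UNIV f"
 have fg: "f (?g p) = p" "?g (f p) = p" for p
  using sympD(3)[OF assms] by (simp_all add: bij_is_surj bij_is_inj surj_f_inv_f)
 note i = bij_is_inj[OF sympD(3)[OF assms]]
 show ?thesis
 proof (rule sympI[of _ f])
  show "?g (p + q) = ?g p + ?g q" for p q
   by (rule injD[OF i]) (simp add: fg sympD(1)[OF assms])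
  show "?g (psm c p) = psm c (?g p)" for c p
   by (rule injD[OF i]) (simp add: fg sympD(2)[OF assms])
  show "om (?g p) (?g q) = om p q" for p q
   using sympD(4)[OF assms, of "?g p" "?g q"] by (simp add: fg)
 qed (simp_all add: fg)
qed

lemma symp_nn:
 assumes "sym b"
 shows "symp (nn b)"
proof (rule sympI[of _ "nn (\<lambda>x. - b x)"])
 note l = lin_simps[OF sym_lin[OF assms]]
 show "om (nn b p) (nn b q) = om p q" for p q
  using sym_dot[OF assms, of "fst p" "fst q"] dot_commute[of "b (fst p)" "fst q"] by (simp add: nn_def om_def)
 show "nn b (p + q) = nn b p + nn b q" "nn b (psm c p) = psm c (nn b p)" for p q c
  by (simp_all add: nn_def psm_def prod_eq_iff l(1,2) smul_distrib)
qed (simp_all add: nn_def)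

lemma symp_mm:
 assumes "a \<in> GL"
 shows "symp (mm a)"
proof (rule sympI[of _ "mm (ginv a)"])
 note l = GL_lin[OF assms] GL_lin[OF GL_inv_in[OF assms]]
 have d: "dot (a x) (adj (ginv a) y) = dot x y" for x y
  using dot_adj(1)[OF l(2), of "a x" y] assms by simp
 show "om (mm a p) (mm a q) = om p q" for p q
  by (simp add: om_def mm_def d)
 have "adj (ginv a) (adj a y) = y" "adj a (adj (ginv a) y) = y" for y
  using GL_inv[OF GL_adj[OF assms], of y] by (simp_all add: inv_adj assms)
 then show "mm a (mm (ginv a) p) = p" "mm (ginv a) (mm a p) = p" for p
  using assms by (simp_all add: mm_def)
qed (simp_all add: mm_def psm_def lin_simps[OF GL_lin[OF assms]] lin_simps[OF lin_adj[OF GL_lin[OF GL_inv_in[OF assms]]]])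

lemma symp_ww: "symp ww"
proof (rule sympI[of _ "\<lambda>p. (- snd p, fst p)"])
 show "om (ww p) (ww q) = om p q" for p q
  using dot_commute[of "snd p" "fst q"] dot_commute[of "snd q" "fst p"] by (simp add: ww_def om_def)
qed (simp_all add: ww_def psm_def)

text \<open>The four blocks of a symplectic map; the big cell consists of those with invertible
  upper right block \<open>be\<close>.\<close>

definition al :: "('x \<times> 'x \<Rightarrow> 'x \<times> 'x) \<Rightarrow> 'x \<Rightarrow> 'x" where "al f x = fst (f (x, 0))"
definition be :: "('x \<times> 'x \<Rightarrow> 'x \<times> 'x) \<Rightarrow> 'x \<Rightarrow> 'x" where "be f y = fst (f (0, y))"
definition ga :: "('x \<times> 'x \<Rightarrow> 'x \<times> 'x) \<Rightarrow> 'x \<Rightarrow> 'x" where "ga f x = snd (f (x, 0))"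
definition de :: "('x \<times> 'x \<Rightarrow> 'x \<times> 'x) \<Rightarrow> 'x \<Rightarrow> 'x" where "de f y = snd (f (0, y))"

lemma block_lin:
 assumes "symp f"
 shows "lin (al f)" "lin (be f)" "lin (ga f)" "lin (de f)"
proof -
 have add: "f (x + y, 0) = f (x, 0) + f (y, 0)" "f (0, x + y) = f (0, x) + f (0, y)" for x y
  using sympD(1)[OF assms, of "(x, 0)" "(y, 0)"] sympD(1)[OF assms, of "(0, x)" "(0, y)"] by simp_all
 have scale: "f (smul c x, 0) = psm c (f (x, 0))" "f (0, smul c x) = psm c (f (0, x))" for c x
  using sympD(2)[OF assms, of c "(x, 0)"] sympD(2)[OF assms, of c "(0, x)"] by (simp_all add: psm_def)
 show "lin (al f)" "lin (be f)" "lin (ga f)" "lin (de f)"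
  by (rule linI; simp add: al_def be_def ga_def de_def add scale; simp add: psm_def)+
qed

lemma block_apply:
 assumes "symp f"
 shows "f (x, y) = (al f x + be f y, ga f x + de f y)"
 using sympD(1)[OF assms, of "(x, 0)" "(0, y)"] by (simp add: al_def be_def ga_def de_def plus_prod_def)

definition bl :: "('x \<times> 'x \<Rightarrow> 'x \<times> 'x) \<Rightarrow> 'x \<Rightarrow> 'x" where "bl f = de f \<circ> ginv (be f)"
definition br :: "('x \<times> 'x \<Rightarrow> 'x \<times> 'x) \<Rightarrow> 'x \<Rightarrow> 'x" where "br f = ginv (be f) \<circ> al f"

lemma bruhat:
 assumes f: "symp f" and b: "be f \<in> GL"
 shows "sym (bl f)" "sym (br f)" "f = nn (bl f) \<circ> mm (be f) \<circ> ww \<circ> nn (br f)"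
proof -
 note l = block_lin[OF f] and li = GL_lin[OF GL_inv_in[OF b]]
 have llin: "lin (bl f)" "lin (br f)"
  unfolding bl_def br_def by (intro lin_comp l li)+
 have al: "al f x = be f (br f x)" and de: "de f x = bl f (be f x)" for x
  using b by (simp_all add: bl_def br_def)
 have om: "om (f (x, y)) (f (x', y')) = dot x y' - dot x' y" for x y x' y'
  unfolding sympD(4)[OF f] by (simp add: om_def)
 \<comment> \<open>\<open>O1\<close> and \<open>O2\<close> say that the images of the two coordinate
   Lagrangians are isotropic, \<open>O3\<close> that they are dual to each other. The first two
   yield the symmetry of \<open>bl\<close> and \<open>br\<close>, the third determines the block
   \<open>ga\<close>.\<close>
 have O1: "dot (be f y) (de f y') = dot (be f y') (de f y)" for y y'
  using om[of 0 y 0 y'] by (simp add: block_apply[OF f] om_def lin_simps l)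
 have O2: "dot (al f x) (ga f x') = dot (al f x') (ga f x)" for x x'
  using om[of x 0 x' 0] by (simp add: block_apply[OF f] om_def lin_simps l)
 have O3: "dot (al f x) (de f y) - dot (be f y) (ga f x) = dot x y" for x y
  using om[of x 0 0 y] by (simp add: block_apply[OF f] om_def lin_simps l)
 show bls: "sym (bl f)"
 proof (rule symI[OF llin(1)])
  fix x y
  show "dot (bl f x) y = dot x (bl f y)"
   using O1[of "ginv (be f) y" "ginv (be f) x"] b unfolding de by (simp add: dot_commute)
 qed
 let ?A = "adj (ginv (be f))"
 have ga: "ga f x = bl f (be f (br f x)) - ?A x" for x
 proof -
  have "dot (be f y) (bl f (be f (br f x)) - ga f x) = dot y x" for y
   using O3[of x y] sym_dot[OF bls, of "be f (br f x)" "be f y"]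
   unfolding al de by (simp add: dot_commute)
  then have "dot y (bl f (be f (br f x)) - ga f x) = dot y (?A x)" for y
   using b dot_adj(1)[OF li, of y x] by (metis GL_inv(2))
  then have "bl f (be f (br f x)) - ga f x = ?A x"
   by (rule dot_eqI)
  then show ?thesis
   by (simp add: algebra_simps)
 qed
 have A: "dot (be f z) (?A x) = dot z x" for z x
  using dot_adj(1)[OF li, of "be f z" x] b by simp
 show "sym (br f)"
 proof (rule symI[OF llin(2)])
  fix x y
  have "dot (be f (br f x)) (bl f (be f (br f y))) - dot (br f x) y
    = dot (be f (br f y)) (bl f (be f (br f x))) - dot (br f y) x"
   using O2[of x y] unfolding al ga by (simp add: A)
  moreover have "dot (be f (br f x)) (bl f (be f (br f y))) = dot (be f (br f y)) (bl f (be f (br f x)))"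
   using sym_dot[OF bls] dot_commute by metis
  ultimately have "dot (br f x) y = dot (br f y) x"
   by simp
  then show "dot (br f x) y = dot x (br f y)"
   by (simp only: dot_commute)
 qed
 show "f = nn (bl f) \<circ> mm (be f) \<circ> ww \<circ> nn (br f)"
 proof
  fix p :: "'x \<times> 'x"
  obtain x y where p: "p = (x, y)"
   by (cases p)
  show "f p = (nn (bl f) \<circ> mm (be f) \<circ> ww \<circ> nn (br f)) p"
   unfolding p block_apply[OF f] ga
   by (simp add: nn_def mm_def ww_def al de lin_simps[OF l(2)] lin_simps[OF llin(1)] lin_simps[OF lin_adj[OF li]])
 qed
qed

lemma be_comp:
 assumes "symp f" "symp g"
 shows "be (f \<circ> g) y = al f (be g y) + be f (de g y)"
 using block_apply[OF assms(1), of "be g y" "de g y"] block_apply[OF assms(2), of 0 y]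
 by (simp add: be_def[of "f \<circ> g"] lin_simps[OF block_lin(1)[OF assms(2)]] lin_simps[OF block_lin(3)[OF assms(2)]])

lemma be_ww: "be (nn b \<circ> ww) = id"
 by (simp add: be_def nn_def ww_def fun_eq_iff)

text \<open>Right translation by \<open>nn b \<circ> ww\<close> turns the block \<open>be\<close>
  into \<open>al f + be f \<circ> b\<close>, so finitely many maps can be moved into the big cell by
  one common symmetric \<open>b\<close>.\<close>

lemma symp_generic:
 assumes "finite I" "\<And>f. f \<in> I \<Longrightarrow> symp f"
 shows "\<exists>b. sym b \<and> (\<forall>f\<in>I. be (f \<circ> (nn b \<circ> ww)) \<in> GL)"
proof -
 let ?I = "(\<lambda>f. (al f, be f)) ` I"
 have "\<exists>b. sym b \<and> (\<forall>(\<alpha>, \<beta>)\<in>?I. (\<lambda>x. \<alpha> x + \<beta> (b x)) \<in> GL)"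
 proof (rule exists_common_sym_regular[OF infinite_field])
  show "finite ?I"
   using assms(1) by simp
  fix \<alpha> \<beta> assume "(\<alpha>, \<beta>) \<in> ?I"
  then obtain f where f: "symp f" "\<alpha> = al f" "\<beta> = be f"
   using assms(2) by auto
  have "\<exists>x y. al f x + be f y = z" for z
  proof -
   have "\<exists>p. f p = (z, 0)"
    using bij_is_surj[OF sympD(3)[OF f(1)]] by (metis surjD)
   then obtain x y where "f (x, y) = (z, 0)"
    by auto
   then show ?thesis
    unfolding block_apply[OF f(1)] by blast
  qed
  then show "lin \<alpha> \<and> lin \<beta> \<and> (\<forall>z. \<exists>x y. \<alpha> x + \<beta> y = z)"
   using block_lin[OF f(1)] f by blast
 qed
 then obtain b where b: "sym b" "\<And>f. f \<in> I \<Longrightarrow> (\<lambda>x. al f x + be f (b x)) \<in> GL"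
  by auto
 have "be (f \<circ> (nn b \<circ> ww)) = (\<lambda>x. al f x + be f (b x))" if "f \<in> I" for f
  by (rule ext, subst be_comp)
   (use assms(2)[OF that] symp_nn[OF b(1)] symp_ww in \<open>auto intro: symp_comp simp: be_ww de_def nn_def ww_def\<close>)
 then show ?thesis
  using b by (intro exI[of _ b]) simp
qed

section \<open>The canonical operators on the big cell\<close>

definition W :: "('x \<times> 'x \<Rightarrow> 'x \<times> 'x) \<Rightarrow> ('x \<Rightarrow> 'r) \<Rightarrow> 'x \<Rightarrow> 'r"
 where "W f = Nop (bl f) \<circ> Mop (be f) \<circ> Fop \<circ> Nop (br f)"

lemma implements_W:
 assumes "symp f" "be f \<in> GL"
 shows "implements f (W f)"
 unfolding W_def by (subst bruhat(3)[OF assms]) (intro implements_comp implements_N implements_M implements_F bruhat assms)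

lemma W_at_0: "be f \<in> GL \<Longrightarrow> W f \<Phi> 0 = integ (Nop (br f) \<Phi>)"
 by (simp add: W_def Nop_def[of "bl f"] Fop_at_0)

lemma Nop_ind: "lin b \<Longrightarrow> \<exists>k0. \<forall>k\<ge>k0. Nop b (ind k) = ind k"
proof -
 assume "lin b"
 from quadratic_trivial[OF this, of "- (1 / 2)"] obtain k0
  where "\<forall>k\<ge>k0. \<forall>x\<in>lat k. chi (- (1 / 2) * dot x (b x)) = 1"
  by (elim exE)
 then show ?thesis
  by (intro exI[of _ k0]) (auto simp: Nop_def ind_def fun_eq_iff)
qed

lemma Nop_Nop: "Nop b (Nop c \<Phi>) = Nop (\<lambda>x. b x + c x) \<Phi>"
 unfolding Nop_def by (rule ext) (simp only: dot_simps(2) distrib_left chi_add mult.assoc)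

text \<open>Both operators implement the same map, so only a scalar is in question. It is found by
  evaluation at 0 on \<open>ind k\<close>, with \<open>k\<close> so large that the innermost
  quadratic phases disappear and the Gauss integral of \<open>B\<close> remains.\<close>

lemma W_comp:
 assumes f: "symp f" "be f \<in> GL" and g: "symp g" "be g \<in> GL" and fg: "be (f \<circ> g) \<in> GL"
 defines "B \<equiv> \<lambda>x. br f x + bl g x"
 shows "B \<in> GL" "sym B" "be (f \<circ> g) = be f \<circ> B \<circ> be g"
  "\<Phi> \<in> Sch \<Longrightarrow> W f (W g \<Phi>) = (\<lambda>x. gauss B * W (f \<circ> g) \<Phi> x)"
proof -
 note lf = block_lin[OF f(1)] and lg = block_lin[OF g(1)]
 note s = bruhat[OF f] bruhat[OF g]
 have be: "be (f \<circ> g) = be f \<circ> B \<circ> be g"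
  unfolding be_comp[OF f(1) g(1), abs_def] using f(2) g(2)
  by (simp add: fun_eq_iff B_def br_def bl_def lin_simps[OF lf(2)])
 show "be (f \<circ> g) = be f \<circ> B \<circ> be g"
  by (rule be)
 have "B = ginv (be f) \<circ> be (f \<circ> g) \<circ> ginv (be g)"
  unfolding be using f(2) g(2) by (simp add: fun_eq_iff)
 then show BG: "B \<in> GL"
  by (rule ssubst[where P = "\<lambda>B. B \<in> GL"]) (intro GL_comp GL_inv_in f(2) g(2) fg)
 show Bs: "sym B"
 proof (rule symI)
  show "lin B"
   unfolding B_def by (rule lin_add[OF sym_lin[OF s(2)] sym_lin[OF s(4)]])
 qed (simp add: B_def sym_dot[OF s(2)] sym_dot[OF s(4)])
 have sfg: "symp (f \<circ> g)"
  using f g by (intro symp_comp)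
 have "implements (f \<circ> g) (W f \<circ> W g)" "implements (f \<circ> g) (W (f \<circ> g))"
  by (rule implements_comp[OF implements_W[OF f] implements_W[OF g]], rule implements_W[OF sfg fg])
 from implements_unique[OF this] obtain c where c: "\<forall>\<Phi>\<in>Sch. (W f \<circ> W g) \<Phi> = (\<lambda>x. c * W (f \<circ> g) \<Phi> x)"
  by (elim exE conjE)
 \<comment> \<open>Up to its modulus this dilation becomes \<open>Mop (be g)\<close> under the
   Fourier transform, which brings the integral into the form required by
   \<open>gauss_at_0\<close>.\<close>
 let ?a = "adj (ginv (be g))"
 have a: "?a \<in> GL" "adj (ginv ?a) = be g"
  using g lg by (simp_all add: inv_adj)
 have la: "lin (adj ?a \<circ> ginv B \<circ> ?a)"
  using a(1) BG by (intro lin_comp lin_adj GL_lin) simp_all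
 obtain k1 where k1: "\<forall>k\<ge>k1. Nop (br g) (ind k) = ind k"
  using Nop_ind[OF sym_lin[OF s(5)]] by (elim exE)
 obtain k2 where k2: "\<forall>k\<ge>k2. Nop (br (f \<circ> g)) (ind k) = ind k"
  using Nop_ind[OF sym_lin[OF bruhat(2)[OF sfg fg]]] by (elim exE)
 obtain k3 where k3: "\<forall>k\<ge>k3. \<forall>x\<in>lat k. chi (1 / 2 * dot x ((adj ?a \<circ> ginv B \<circ> ?a) x)) = 1"
  using quadratic_trivial[OF la, of "1 / 2"] by (elim exE)
 define k where "k = max k1 (max k2 k3)"
 have k: "Nop (br g) (ind k) = ind k" "Nop (br (f \<circ> g)) (ind k) = ind k"
  using k1 k2 by (simp_all add: k_def)
 have "k3 \<le> k"
  by (simp add: k_def)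
 with k3 have k': "chi (1 / 2 * dot x ((adj ?a \<circ> ginv B \<circ> ?a) x)) = 1" if "x \<in> lat k" for x
  using that by blast
 let ?M = "Mop ?a (ind k)"
 have M: "?M \<in> Sch"
  by (intro Mop_Sch a ind_Sch)
 have "integ (Nop B (Fop ?M)) = gauss B * integ ?M"
 proof (rule gauss_at_0[OF BG Bs M])
  fix x assume "?M x \<noteq> 0"
  then have x: "ginv ?a x \<in> lat k"
   by (simp add: Mop_def ind_def split: if_splits)
  have "dot x (ginv B x) = dot (ginv ?a x) ((adj ?a \<circ> ginv B \<circ> ?a) (ginv ?a x))"
   using dot_adj(1)[OF GL_lin[OF a(1)], of "ginv ?a x" "ginv B x"] a(1) by simp
  then show "chi (1 / 2 * dot x (ginv B x)) = 1"
   using k'[OF x] by (simp only:)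
 qed
 moreover have "Fop ?M = (\<lambda>x. modulus ?a * Mop (be g) (Fop (ind k)) x)"
  using Fop_Mop[OF a(1) ind_Sch] unfolding a(2) .
 moreover have "Nop B (\<lambda>x. c * \<Phi> x) = (\<lambda>x. c * Nop B \<Phi> x)" for c and \<Phi> :: "'x \<Rightarrow> 'r"
  by (simp add: Nop_def mult_ac)
 moreover have "integ ?M = modulus ?a * vol k"
  using integ_Mop[OF a(1) ind_Sch] by (simp add: integ_ind)
 moreover have MF: "Nop B (Mop (be g) (Fop (ind k))) \<in> Sch"
  using sym_lin[OF Bs] g by (intro Nop_Sch Mop_Sch Fop_Sch ind_Sch)
 ultimately have "modulus ?a * integ (Nop B (Mop (be g) (Fop (ind k)))) = modulus ?a * (gauss B * vol k)"
  by (simp add: integ_scale mult_ac)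
 then have *: "integ (Nop B (Mop (be g) (Fop (ind k)))) = gauss B * vol k"
  using modulus_inv(1)[OF a(1)] by auto
 have "W f (W g (ind k)) 0 = integ (Nop B (Mop (be g) (Fop (ind k))))"
  unfolding W_at_0[OF f(2)] by (simp add: W_def[of g] k(1) Nop_Nop B_def)
 moreover have "W (f \<circ> g) (ind k) 0 = vol k"
  unfolding W_at_0[OF fg] k(2) by (simp add: integ_ind)
 ultimately have "c * vol k = gauss B * vol k"
  using bspec[OF c ind_Sch, of k] * by (simp add: fun_eq_iff)
 then have "c = gauss B"
  using vol_neq_0[of k] by simp
 then show "\<Phi> \<in> Sch \<Longrightarrow> W f (W g \<Phi>) = (\<lambda>x. gauss B * W (f \<circ> g) \<Phi> x)"
  using c by simp
qed

end

section \<open>The squared scalar of an implementing operator\<close>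

context weil
begin

lemma W_scalar_unique:
 assumes f: "symp f" "be f \<in> GL" and eq: "\<And>\<Phi> x. \<Phi> \<in> Sch \<Longrightarrow> s * W f \<Phi> x = t * W f \<Phi> x"
 shows "s = t"
proof -
 have "\<exists>\<Phi>\<in>Sch. W f \<Phi> = ind 0"
  using implementsD(2)[OF implements_W[OF f]] ind_Sch[of 0] unfolding bij_betw_def by (metis imageE)
 then obtain \<Phi> where "\<Phi> \<in> Sch" "W f \<Phi> = ind 0"
  by (elim bexE)
 then show ?thesis
  using eq[of \<Phi> 0] by (simp add: ind_def)
qed

definition lam :: "('x \<times> 'x \<Rightarrow> 'x \<times> 'x) \<Rightarrow> (('x \<Rightarrow> 'r) \<Rightarrow> 'x \<Rightarrow> 'r) \<Rightarrow> 'r"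
 where "lam f T = (SOME t. \<forall>\<Phi>\<in>Sch. T \<Phi> = (\<lambda>x. t * W f \<Phi> x))\<^sup>2 * (gauss id)\<^sup>2 * H (be f)"

lemma lam_eq:
 assumes f: "symp f" "be f \<in> GL" and T: "\<And>\<Phi>. \<Phi> \<in> Sch \<Longrightarrow> T \<Phi> = (\<lambda>x. t * W f \<Phi> x)"
 shows "lam f T = t\<^sup>2 * (gauss id)\<^sup>2 * H (be f)"
proof -
 have "(SOME t. \<forall>\<Phi>\<in>Sch. T \<Phi> = (\<lambda>x. t * W f \<Phi> x)) = t"
 proof (rule some_equality)
  fix s assume s: "\<forall>\<Phi>\<in>Sch. T \<Phi> = (\<lambda>x. s * W f \<Phi> x)"
  show "s = t"
  proof (rule W_scalar_unique[OF f])
   fix \<Phi> :: "'x \<Rightarrow> 'r" and x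
   assume \<Phi>: "\<Phi> \<in> Sch"
   show "s * W f \<Phi> x = t * W f \<Phi> x"
    using bspec[OF s \<Phi>] T[OF \<Phi>] by (metis (no_types))
  qed
 qed (use T in blast)
 then show ?thesis
  by (simp add: lam_def)
qed

lemma implements_scalar:
 assumes "symp f" "be f \<in> GL" "implements f T"
 shows "\<exists>t s. t * s = 1 \<and> (\<forall>\<Phi>\<in>Sch. T \<Phi> = (\<lambda>x. t * W f \<Phi> x))"
 by (rule implements_unique[OF assms(3) implements_W[OF assms(1,2)]])

lemma sym_id: "sym id"
 by (rule symI) simp_all

lemma gauss_id_unit: "\<exists>h. gauss id * h = 1"
 by (rule gauss_unit[OF GL_id sym_id])

text \<open>Composition contributes \<open>gauss B\<close> squared from the cocycle and
  \<open>H B\<close> from \<open>be (f \<circ> g)\<close>. By \<open>H_gauss\<close> their product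
  is the constant that the factor \<open>gauss id\<close> squared in \<open>lam\<close> supplies for
  the second operator.\<close>

lemma lam_mult:
 assumes f: "symp f" "be f \<in> GL" "implements f S" and g: "symp g" "be g \<in> GL" "implements g T"
  and fg: "be (f \<circ> g) \<in> GL" and ST: "\<And>\<Phi>. \<Phi> \<in> Sch \<Longrightarrow> ST \<Phi> = S (T \<Phi>)"
 shows "lam (f \<circ> g) ST = lam f S * lam g T"
proof -
 obtain s s' where s: "s * s' = 1" "\<forall>\<Phi>\<in>Sch. S \<Phi> = (\<lambda>x. s * W f \<Phi> x)"
  using implements_scalar[OF f] by (elim exE conjE)
 obtain t t' where t: "t * t' = 1" "\<forall>\<Phi>\<in>Sch. T \<Phi> = (\<lambda>x. t * W g \<Phi> x)"
  using implements_scalar[OF g] by (elim exE conjE)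
 define B where "B x = br f x + bl g x" for x
 note B = W_comp[OF f(1,2) g(1,2) fg, folded B_def]
 have lin: "linop (W f)"
  by (rule implementsD(1)[OF implements_W[OF f(1,2)]])
 have WS: "W g \<Phi> \<in> Sch" if "\<Phi> \<in> Sch" for \<Phi> :: "'x \<Rightarrow> 'r"
  by (rule implements_Sch[OF implements_W[OF g(1,2)] that])
 have "ST \<Phi> = (\<lambda>x. s * t * gauss B * W (f \<circ> g) \<Phi> x)" if \<Phi>: "\<Phi> \<in> Sch" for \<Phi>
 proof -
  have "(\<lambda>x. t * W g \<Phi> x) \<in> Sch"
   by (rule scale_Sch[OF WS[OF \<Phi>]])
  then have "ST \<Phi> = (\<lambda>x. s * W f (\<lambda>x. t * W g \<Phi> x) x)"
   unfolding ST[OF \<Phi>] bspec[OF t(2) \<Phi>] using s(2) by (rule bspec[rotated])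
  also have "W f (\<lambda>x. t * W g \<Phi> x) = (\<lambda>x. t * W f (W g \<Phi>) x)"
   by (rule linopD(3)[OF lin WS[OF \<Phi>]])
  finally show ?thesis
   unfolding B(4)[OF \<Phi>] by (simp only: mult_ac)
 qed
 then have "lam (f \<circ> g) ST = (s * t * gauss B)\<^sup>2 * (gauss id)\<^sup>2 * H (be (f \<circ> g))"
  by (rule lam_eq[OF symp_comp[OF f(1) g(1)] fg])
 also have "H (be (f \<circ> g)) = H (be f) * H B * H (be g)"
  unfolding B(3) using f(2) g(2) B(1) by (simp add: H_comp)
 also have "(s * t * gauss B)\<^sup>2 * (gauss id)\<^sup>2 * (H (be f) * H B * H (be g))
   = s\<^sup>2 * t\<^sup>2 * (gauss id)\<^sup>2 * H (be f) * H (be g) * (H B * (gauss B)\<^sup>2)"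
  by (simp only: power_mult_distrib mult_ac)
 also have "\<dots> = (s\<^sup>2 * (gauss id)\<^sup>2 * H (be f)) * (t\<^sup>2 * (gauss id)\<^sup>2 * H (be g))"
  unfolding H_gauss[OF B(1,2)] by (simp only: mult_ac)
 also have "\<dots> = lam f S * lam g T"
  using lam_eq[OF f(1,2), of S s] s(2) lam_eq[OF g(1,2), of T t] t(2) by simp
 finally show ?thesis .
qed

lemma lam_unit:
 assumes f: "symp f" "be f \<in> GL" "implements f S"
 shows "\<exists>d. lam f S * d = 1"
proof -
 obtain s s' where s: "s * s' = 1" "\<forall>\<Phi>\<in>Sch. S \<Phi> = (\<lambda>x. s * W f \<Phi> x)"
  using implements_scalar[OF f] by (elim exE conjE)
 obtain h where h: "gauss id * h = 1"
  using gauss_id_unit by (elim exE)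
 have "lam f S * (s'\<^sup>2 * h\<^sup>2 * H (ginv (be f))) = (s * s')\<^sup>2 * (gauss id * h)\<^sup>2 * (H (be f) * H (ginv (be f)))"
  using lam_eq[OF f(1,2), of S s] s(2) by (simp add: power_mult_distrib mult_ac)
 then show ?thesis
  using s(1) h H_unit[OF f(2)] by (metis mult_1_left power_one)
qed

section \<open>The metaplectic group in coordinates\<close>

definition mpg :: "(('x \<times> 'x \<Rightarrow> 'x \<times> 'x) \<times> (('x \<Rightarrow> 'r) \<Rightarrow> 'x \<Rightarrow> 'r)) monoid"
 where "mpg = \<lparr>carrier = {(f, T). symp f \<and> implements f T \<and> T \<in> extensional Sch},
  mult = \<lambda>(f, S) (g, T). (f \<circ> g, compose Sch S T), one = (id, \<lambda>\<Phi>\<in>Sch. \<Phi>)\<rparr>"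

lemma mpg_carrier: "(f, T) \<in> carrier mpg \<longleftrightarrow> symp f \<and> implements f T \<and> T \<in> extensional Sch"
 by (simp add: mpg_def)

lemma mpg_mult: "(f, S) \<otimes>\<^bsub>mpg\<^esub> (g, T) = (f \<circ> g, compose Sch S T)"
 by (simp add: mpg_def)

lemma mpg_one: "\<one>\<^bsub>mpg\<^esub> = (id, \<lambda>\<Phi>\<in>Sch. \<Phi>)"
 by (simp add: mpg_def)

lemma implements_id: "implements id (\<lambda>\<Phi>. \<Phi>)"
 unfolding implements_def by (simp add: linop_def fq_def bij_betw_def)

lemma mpg_restrict: "symp f \<Longrightarrow> implements f T \<Longrightarrow> (f, restrict T Sch) \<in> carrier mpg"
 unfolding mpg_carrier using implements_cong[of f T "restrict T Sch"] by simp

lemma group_mpg: "group mpg"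
proof (rule groupI)
 fix x y assume xy: "x \<in> carrier mpg" "y \<in> carrier mpg"
 obtain f S where x: "x = (f, S)" by (cases x)
 obtain g T where y: "y = (g, T)" by (cases y)
 have f: "symp f" "implements f S" and g: "symp g" "implements g T"
  using xy unfolding x y mpg_carrier by blast+
 have "implements (f \<circ> g) (compose Sch S T)"
  by (rule implements_cong[OF implements_comp[OF f(2) g(2)]]) (simp add: compose_def)
 then show "x \<otimes>\<^bsub>mpg\<^esub> y \<in> carrier mpg"
  unfolding x y mpg_mult mpg_carrier using symp_comp[OF f(1) g(1)] compose_extensional by blast
next
 show "\<one>\<^bsub>mpg\<^esub> \<in> carrier mpg"
  unfolding mpg_one by (rule mpg_restrict[OF symp_id implements_id])
next
 fix x y z assume xyz: "x \<in> carrier mpg" "y \<in> carrier mpg" "z \<in> carrier mpg"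
 obtain f S where x: "x = (f, S)" by (cases x)
 obtain g T where y: "y = (g, T)" by (cases y)
 obtain h R where z: "z = (h, R)" by (cases z)
 have "R \<in> Sch \<rightarrow> Sch"
  using xyz(3) unfolding z mpg_carrier by (auto intro: implements_Sch)
 then show "x \<otimes>\<^bsub>mpg\<^esub> y \<otimes>\<^bsub>mpg\<^esub> z = x \<otimes>\<^bsub>mpg\<^esub> (y \<otimes>\<^bsub>mpg\<^esub> z)"
  unfolding x y z mpg_mult by (auto simp: comp_assoc compose_def fun_eq_iff)
next
 fix x assume xc: "x \<in> carrier mpg"
 obtain f S where x: "x = (f, S)" by (cases x)
 have f: "symp f" "implements f S" "S \<in> extensional Sch"
  using xc unfolding x mpg_carrier by auto
 show "\<one>\<^bsub>mpg\<^esub> \<otimes>\<^bsub>mpg\<^esub> x = x"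
  unfolding x mpg_one mpg_mult using f by (auto simp: compose_def extensional_def fun_eq_iff intro: implements_Sch)
 let ?g = "inv_into UNIV f" and ?T = "restrict (inv_into Sch S) Sch"
 have fg: "?g (f p) = p" "f (?g p) = p" for p
  using sympD(3)[OF f(1)] by (simp_all add: bij_is_surj bij_is_inj surj_f_inv_f)
 have "(?g, ?T) \<in> carrier mpg"
  by (intro mpg_restrict symp_inverse f(1) implements_inverse[OF f(2)] fg)
 moreover have "(?g, ?T) \<otimes>\<^bsub>mpg\<^esub> x = \<one>\<^bsub>mpg\<^esub>"
 proof -
  have "compose Sch ?T S = (\<lambda>\<Phi>\<in>Sch. \<Phi>)"
   using f(2) implementsD(2)[OF f(2)] by (auto simp: compose_def fun_eq_iff bij_betw_def inv_into_f_f)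
  moreover have "?g \<circ> f = id"
   by (simp add: fun_eq_iff fg)
  ultimately show ?thesis
   unfolding x mpg_mult mpg_one by simp
 qed
 ultimately show "\<exists>y\<in>carrier mpg. y \<otimes>\<^bsub>mpg\<^esub> x = \<one>\<^bsub>mpg\<^esub>"
  by (rule bexI[rotated])
qed

lemma exists_lambda:
 "\<exists>L. (\<forall>g\<in>carrier mpg. \<forall>h\<in>carrier mpg. L (g \<otimes>\<^bsub>mpg\<^esub> h) = L g * (L h :: 'r)) \<and>
  (\<forall>g\<in>carrier mpg. be (fst g) \<in> GL \<longrightarrow> L g = lam (fst g) (snd g))"
proof -
 let ?V = "{g \<in> carrier mpg. be (fst g) \<in> GL}"
 have "\<exists>L. (\<forall>g\<in>carrier mpg. \<forall>h\<in>carrier mpg. L (g \<otimes>\<^bsub>mpg\<^esub> h) = L g * L h) \<and> (\<forall>g\<in>?V. L g = lam (fst g) (snd g))"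
 proof (rule group.partial_hom_extends[OF group_mpg])
  fix I assume I: "finite I" "I \<subseteq> carrier mpg"
  have "\<exists>b. sym b \<and> (\<forall>f\<in>fst ` I. be (f \<circ> (nn b \<circ> ww)) \<in> GL)"
   using I by (intro symp_generic) (auto simp: mpg_carrier)
  then obtain b where b: "sym b" "\<forall>f\<in>fst ` I. be (f \<circ> (nn b \<circ> ww)) \<in> GL"
   by (elim exE conjE)
  let ?f = "nn b \<circ> ww"
  have f: "symp ?f" "be ?f \<in> GL"
   using b(1) by (auto intro: symp_comp symp_nn symp_ww simp: be_ww)
  let ?x = "(?f, restrict (W ?f) Sch)"
  have x: "?x \<in> carrier mpg"
   by (intro mpg_restrict f implements_W)
  have "g \<otimes>\<^bsub>mpg\<^esub> ?x \<in> ?V" if g: "g \<in> I" for g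
  proof -
   obtain h S where h: "g = (h, S)"
    by (cases g)
   have "g \<otimes>\<^bsub>mpg\<^esub> ?x \<in> carrier mpg"
    using I g x by (intro monoid.m_closed[OF group.is_monoid[OF group_mpg]]) auto
   moreover have "h \<in> fst ` I"
    using g h by force
   then have "be (h \<circ> ?f) \<in> GL"
    using b(2) by blast
   then have "be (fst (g \<otimes>\<^bsub>mpg\<^esub> ?x)) \<in> GL"
    unfolding h mpg_mult by simp
   ultimately show ?thesis
    by blast
  qed
  then show "\<exists>x\<in>?V. \<forall>g\<in>I. g \<otimes>\<^bsub>mpg\<^esub> x \<in> ?V"
   using x f by (intro bexI[of _ ?x]) auto
 next
  fix g h assume gh: "g \<in> ?V" "h \<in> ?V" "g \<otimes>\<^bsub>mpg\<^esub> h \<in> ?V"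
  obtain f S where g: "g = (f, S)" by (cases g)
  obtain f' T where h: "h = (f', T)" by (cases h)
  have "lam (f \<circ> f') (compose Sch S T) = lam f S * lam f' T"
   using gh unfolding g h mpg_mult by (intro lam_mult) (auto simp: mpg_carrier compose_def)
  then show "lam (fst (g \<otimes>\<^bsub>mpg\<^esub> h)) (snd (g \<otimes>\<^bsub>mpg\<^esub> h)) = lam (fst g) (snd g) * lam (fst h) (snd h)"
   unfolding g h mpg_mult by simp
 next
  fix g assume "g \<in> ?V"
  then show "\<exists>d. lam (fst g) (snd g) * d = 1"
   by (cases g) (auto simp: mpg_carrier intro!: lam_unit)
 qed auto
 then obtain L where L: "\<forall>g\<in>carrier mpg. \<forall>h\<in>carrier mpg. L (g \<otimes>\<^bsub>mpg\<^esub> h) = L g * (L h :: 'r)"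
  "\<forall>g\<in>?V. L g = lam (fst g) (snd g)"
  by (elim exE conjE)
 then show ?thesis
  by (intro exI[of _ L] conjI) blast+
qed

definition Lam :: "('x \<times> 'x \<Rightarrow> 'x \<times> 'x) \<times> (('x \<Rightarrow> 'r) \<Rightarrow> 'x \<Rightarrow> 'r) \<Rightarrow> 'r"
 where "Lam = (SOME L. (\<forall>g\<in>carrier mpg. \<forall>h\<in>carrier mpg. L (g \<otimes>\<^bsub>mpg\<^esub> h) = L g * L h) \<and>
  (\<forall>g\<in>carrier mpg. be (fst g) \<in> GL \<longrightarrow> L g = lam (fst g) (snd g)))"

lemma Lam_mult: "g \<in> carrier mpg \<Longrightarrow> h \<in> carrier mpg \<Longrightarrow> Lam (g \<otimes>\<^bsub>mpg\<^esub> h) = Lam g * Lam h"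
 and Lam_eq_lam: "(f, T) \<in> carrier mpg \<Longrightarrow> be f \<in> GL \<Longrightarrow> Lam (f, T) = lam f T"
 using someI_ex[OF exists_lambda] unfolding Lam_def[symmetric] by auto

lemma Lam_neq_0:
 assumes "symp x" "be x \<in> GL"
 shows "Lam (x, restrict (W x) Sch) \<noteq> 0"
proof -
 have X: "(x, restrict (W x) Sch) \<in> carrier mpg"
  by (intro mpg_restrict assms implements_W)
 then have "implements x (restrict (W x) Sch)"
  by (simp only: mpg_carrier)
 from lam_unit[OF assms this] obtain d where "lam x (restrict (W x) Sch) * d = 1"
  by (elim exE)
 then show ?thesis
  unfolding Lam_eq_lam[OF X assms(2)] by auto
qed

text \<open>Off the big cell \<open>Lam\<close> has no formula; it is computed by translating into
  the cell with some \<open>x\<close>, and the factors \<open>H\<close> cancel when they agree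
  before and after.\<close>

lemma Lam_eqI:
 assumes f: "(f, T) \<in> carrier mpg" and x: "symp x" "be x \<in> GL" "be (f \<circ> x) \<in> GL" "H (be (f \<circ> x)) = H (be x)"
  and T: "\<And>\<Phi>. \<Phi> \<in> Sch \<Longrightarrow> T (W x \<Phi>) = (\<lambda>y. t * W (f \<circ> x) \<Phi> y)"
 shows "Lam (f, T) = t\<^sup>2"
proof -
 let ?X = "(x, restrict (W x) Sch)"
 have X: "?X \<in> carrier mpg"
  by (intro mpg_restrict x implements_W)
 have fX: "(f, T) \<otimes>\<^bsub>mpg\<^esub> ?X \<in> carrier mpg"
  using f X by (intro monoid.m_closed[OF group.is_monoid[OF group_mpg]])
 have sf: "symp f"
  using f by (simp add: mpg_carrier)
 have "Lam ((f, T) \<otimes>\<^bsub>mpg\<^esub> ?X) = lam (f \<circ> x) (compose Sch T (restrict (W x) Sch))"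
  using fX unfolding mpg_mult by (rule Lam_eq_lam) (rule x)
 also have "\<dots> = t\<^sup>2 * (gauss id)\<^sup>2 * H (be (f \<circ> x))"
  by (rule lam_eq[OF symp_comp[OF sf x(1)] x(3)]) (simp add: compose_def T)
 also have "\<dots> = t\<^sup>2 * (1\<^sup>2 * (gauss id)\<^sup>2 * H (be x))"
  unfolding x(4) by simp
 also have "1\<^sup>2 * (gauss id)\<^sup>2 * H (be x) = lam x (restrict (W x) Sch)"
  by (rule lam_eq[OF x(1,2), symmetric]) simp
 also have "\<dots> = Lam ?X"
  by (rule Lam_eq_lam[OF X x(2), symmetric])
 finally show ?thesis
  unfolding Lam_mult[OF f X] using Lam_neq_0[OF x(1,2)] by simp
qed

lemma Lam_scalar:
 assumes "c * d = (1::'r)"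
 shows "(id, \<lambda>\<Phi>\<in>Sch. \<lambda>x. c * \<Phi> x) \<in> carrier mpg" "Lam (id, \<lambda>\<Phi>\<in>Sch. \<lambda>x. c * \<Phi> x) = c\<^sup>2"
proof -
 show c: "(id, \<lambda>\<Phi>\<in>Sch. \<lambda>x. c * \<Phi> x) \<in> carrier mpg"
  using implements_scale[OF implements_id assms] by (intro mpg_restrict symp_id)
 have "be ww = id"
  by (simp add: be_def ww_def fun_eq_iff)
 then have "be ww \<in> GL" "symp ww"
  by (simp_all add: symp_ww)
 then show "Lam (id, \<lambda>\<Phi>\<in>Sch. \<lambda>x. c * \<Phi> x) = c\<^sup>2"
  by (intro Lam_eqI[OF c, of ww]) (simp_all add: implements_Sch[OF implements_W])
qed

lemma nn_comp: "nn b \<circ> nn c = nn (\<lambda>x. b x + c x)"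
 by (simp add: nn_def fun_eq_iff add_ac)

lemma Lam_N:
 assumes b: "sym b"
 shows "(nn b, restrict (Nop b) Sch) \<in> carrier mpg" "Lam (nn b, restrict (Nop b) Sch) = 1"
proof -
 show c: "(nn b, restrict (Nop b) Sch) \<in> carrier mpg"
  by (intro mpg_restrict symp_nn b implements_N)
 have w: "be ww = id" "al ww = (\<lambda>x. 0)" "de ww = (\<lambda>x. 0)"
  by (simp_all add: be_def al_def de_def ww_def fun_eq_iff)
 have bw: "be (nn b \<circ> ww) = id" "al (nn b \<circ> ww) = (\<lambda>x. 0)" "de (nn b \<circ> ww) = b"
  by (simp_all add: be_def al_def de_def ww_def nn_def fun_eq_iff lin_simps[OF sym_lin[OF b]])
 have gid: "ginv id = id"
  by (rule GL_I(2)) simp_all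
 have W0: "Nop (\<lambda>x. 0) \<Phi> = \<Phi>" for \<Phi> :: "'x \<Rightarrow> 'r"
  by (simp add: Nop_def)
 have W: "W (nn b \<circ> ww) \<Phi> = Nop b (W ww \<Phi>)" for \<Phi>
  unfolding W_def bl_def br_def w bw gid by (simp add: comp_def W0)
 have s: "symp ww" "be ww \<in> GL"
  by (simp_all add: symp_ww w)
 have "Lam (nn b, restrict (Nop b) Sch) = 1\<^sup>2"
  by (rule Lam_eqI[OF c s]) (simp_all add: w bw W implements_Sch[OF implements_W[OF s]])
 then show "Lam (nn b, restrict (Nop b) Sch) = 1"
  by simp
qed

text \<open>On the big cell the canonical operator is rescaled by the inverse of a square root of
  its \<open>Lam\<close> value, which exists by \<open>H_square\<close>. A general map is a quotient
  of two maps of the cell.\<close>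

lemma Lam_lift:
 assumes f: "symp f"
 shows "\<exists>T. (f, T) \<in> carrier mpg \<and> Lam (f, T) = 1"
proof -
 interpret mpg: group mpg
  by (rule group_mpg)
 have cell: "\<exists>T. (x, T) \<in> carrier mpg \<and> Lam (x, T) = 1" if x: "symp x" "be x \<in> GL" for x
 proof -
  obtain c d where c: "c * d = 1" "H (be x) = c\<^sup>2"
   using H_square[OF x(2)] by (elim exE conjE)
  obtain h where h: "gauss id * h = 1"
   using gauss_id_unit by (elim exE)
  let ?T = "\<lambda>\<Phi>\<in>Sch. \<lambda>y. h * d * W x \<Phi> y"
  have hd: "h * d * (gauss id * c) = (gauss id * h) * (c * d)"
   by (simp only: mult_ac)
  then have u: "h * d * (gauss id * c) = 1"
   unfolding h c(1) by simp
  have T: "(x, ?T) \<in> carrier mpg"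
   by (intro mpg_restrict x implements_scale[OF implements_W[OF x] u])
  have "Lam (x, ?T) = (h * d)\<^sup>2 * (gauss id)\<^sup>2 * H (be x)"
   unfolding Lam_eq_lam[OF T x(2)] by (rule lam_eq[OF x]) simp
  also have "\<dots> = (h * d * (gauss id * c))\<^sup>2"
   unfolding c(2) by (simp only: power_mult_distrib mult_ac)
  finally show ?thesis
   using T u by (intro exI[of _ ?T]) simp
 qed
 have "\<exists>b. sym b \<and> (\<forall>f\<in>{f}. be (f \<circ> (nn b \<circ> ww)) \<in> GL)"
  using f by (intro symp_generic) auto
 then obtain b where b: "sym b" "be (f \<circ> (nn b \<circ> ww)) \<in> GL"
  by auto
 let ?x = "nn b \<circ> ww"
 have x: "symp ?x" "be ?x \<in> GL"
  using b(1) by (auto intro: symp_comp symp_nn symp_ww simp: be_ww)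
 obtain T where T: "(?x, T) \<in> carrier mpg" "Lam (?x, T) = 1"
  using cell[OF x] by (elim exE conjE)
 obtain S where S: "(f \<circ> ?x, S) \<in> carrier mpg" "Lam (f \<circ> ?x, S) = 1"
  using cell[OF symp_comp[OF f x(1)] b(2)] by (elim exE conjE)
 define y where "y = (f \<circ> ?x, S) \<otimes>\<^bsub>mpg\<^esub> inv\<^bsub>mpg\<^esub> (?x, T)"
 have y: "y \<in> carrier mpg" "y \<otimes>\<^bsub>mpg\<^esub> (?x, T) = (f \<circ> ?x, S)"
  using S T by (simp_all add: y_def mpg.m_assoc)
 obtain g R where g: "y = (g, R)" by (cases y)
 have "g \<circ> ?x = f \<circ> ?x"
  using y(2) unfolding g mpg_mult by simp
 then have "g = f"
  using bij_is_surj[OF sympD(3)[OF x(1)]] by (metis surj_fun_eq UNIV_I o_eq_dest fun_eq_iff surjD)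
 moreover have "Lam y = 1"
  using Lam_mult[OF y(1) T(1)] T(2) S(2) unfolding y(2) by simp
 ultimately show ?thesis
  using y(1) unfolding g by blast
qed

end

context weil
begin

section \<open>The extension does not split\<close>

lemma ww_nn_ww:
 assumes B: "B \<in> GL" "sym B"
 defines "b \<equiv> \<lambda>x. - ginv B x"
 shows "ww \<circ> nn B \<circ> ww = nn b \<circ> mm B \<circ> ww \<circ> nn b"
proof -
 have "adj (ginv B) = ginv B"
  using sym_inv[OF B] by (simp add: sym_def)
 then show ?thesis
  using B(1) by (simp add: fun_eq_iff ww_def nn_def mm_def b_def lin_simps[OF sym_lin[OF B(2)]]
    lin_simps[OF GL_lin[OF GL_inv_in[OF B(1)]]])
qed

lemma mm_comp:
 assumes "a \<in> GL" "b \<in> GL"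
 shows "mm a \<circ> mm b = mm (a \<circ> b)" "Mop (a \<circ> b) \<Phi> = Mop a (Mop b \<Phi>)"
 using assms by (simp_all add: mm_def Mop_def fun_eq_iff GL_inv_comp adj_comp GL_lin)

lemma Nop_scale: "Nop b (\<lambda>x. c * \<Phi> x) = (\<lambda>x. c * Nop b \<Phi> x)"
 by (simp add: Nop_def mult.left_commute)

text \<open>\<open>nn b\<close> is the square of \<open>nn\<close> at half of \<open>b\<close>. The
  lift of the latter is determined up to a scalar \<open>c\<close> with \<open>c * c = 1\<close>,
  and this ambiguity disappears upon squaring.\<close>

lemma section_N:
 assumes k: "\<And>f. symp f \<Longrightarrow> (f, k f) \<in> carrier mpg \<and> Lam (f, k f) = 1"
  and hom: "\<And>f g. symp f \<Longrightarrow> symp g \<Longrightarrow> k (f \<circ> g) = compose Sch (k f) (k g)"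
  and b: "sym b" and \<Phi>: "\<Phi> \<in> Sch"
 shows "k (nn b) \<Phi> = Nop b \<Phi>"
proof -
 define h where "h x = smul (1 / 2) (b x)" for x
 have h: "sym h"
  unfolding h_def by (rule symI) (simp_all add: lin_scale sym_lin b sym_dot[OF b])
 have sh: "symp (nn h)"
  by (rule symp_nn[OF h])
 have ih: "implements (nn h) (k (nn h))" "k (nn h) \<in> extensional Sch"
  using k[OF sh] by (simp_all add: mpg_carrier)
 obtain c d where c: "c * d = 1" "\<forall>\<Phi>\<in>Sch. k (nn h) \<Phi> = (\<lambda>x. c * Nop h \<Phi> x)"
  using implements_unique[OF ih(1) implements_N[OF h]] by (elim exE conjE)
 let ?c = "(id, \<lambda>\<Phi>\<in>Sch. \<lambda>x. c * \<Phi> x)" and ?N = "(nn h, restrict (Nop h) Sch)"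
 have N: "Nop h \<Psi> \<in> Sch" if "\<Psi> \<in> Sch" for \<Psi> :: "'x \<Rightarrow> 'r"
  by (rule Nop_Sch[OF sym_lin[OF h] that])
 have "k (nn h) = compose Sch (\<lambda>\<Phi>\<in>Sch. \<lambda>x. c * \<Phi> x) (restrict (Nop h) Sch)"
  by (rule extensionalityI[OF ih(2) compose_extensional]) (simp add: compose_def c(2) N)
 then have "(nn h, k (nn h)) = ?c \<otimes>\<^bsub>mpg\<^esub> ?N"
  by (simp add: mpg_mult)
 then have "1 = Lam ?c * Lam ?N"
  using k[OF sh] Lam_mult[OF Lam_scalar(1)[OF c(1)] Lam_N(1)[OF h]] by simp
 then have cc: "c * c = 1"
  unfolding Lam_scalar(2)[OF c(1)] Lam_N(2)[OF h] by (simp add: power2_eq_square)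
 have "nn b = nn h \<circ> nn h"
  unfolding nn_comp by (simp add: h_def flip: smul_distrib(1))
 then have "k (nn b) \<Phi> = k (nn h) (k (nn h) \<Phi>)"
  using hom[OF sh sh] \<Phi> by (simp add: compose_def)
 also have "\<dots> = (\<lambda>x. c * Nop h (\<lambda>x. c * Nop h \<Phi> x) x)"
  using c(2) \<Phi> scale_Sch[OF N[OF \<Phi>], of c] by simp
 also have "\<dots> = (\<lambda>x. c * c * Nop h (Nop h \<Phi>) x)"
  by (simp add: Nop_def mult_ac)
 also have "\<dots> = Nop b \<Phi>"
  unfolding cc Nop_Nop by (simp add: h_def flip: smul_distrib(1))
 finally show ?thesis .
qed

lemma no_section:
 assumes n: "0 < n"
  and k: "\<And>f. symp f \<Longrightarrow> (f, k f) \<in> carrier mpg \<and> Lam (f, k f) = 1"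
  and hom: "\<And>f g. symp f \<Longrightarrow> symp g \<Longrightarrow> k (f \<circ> g) = compose Sch (k f) (k g)"
 shows False
proof -
 have kN: "k (nn b) \<Phi> = Nop b \<Phi>" if "sym b" "\<Phi> \<in> Sch" for b \<Phi>
  using section_N[of k b \<Phi>] k hom that by blast
 have kc: "k (f \<circ> g) \<Phi> = k f (k g \<Phi>)" if "symp f" "symp g" "\<Phi> \<in> Sch" for f g \<Phi>
  using hom[OF that(1,2)] that(3) by (simp add: compose_def)
 have impl: "implements f (k f)" if "symp f" for f
  using k[OF that] by (simp add: mpg_carrier)
 have klin: "k f (\<lambda>x. c * \<Phi> x) = (\<lambda>x. c * k f \<Phi> x)" if "symp f" "\<Phi> \<in> Sch" for f c \<Phi>
  by (rule linopD(3)[OF implementsD(1)[OF impl[OF that(1)]] that(2)])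
 obtain t t' where t: "t * t' = 1" "\<forall>\<Phi>\<in>Sch. k ww \<Phi> = (\<lambda>x. t * Fop \<Phi> x)"
  using implements_unique[OF impl[OF symp_ww] implements_F] by (elim exE conjE)
 have kM: "k (mm B) \<Phi> = (\<lambda>x. t * gauss B * Mop B \<Phi> x)" if B: "B \<in> GL" "sym B" and \<Phi>: "\<Phi> \<in> Sch" for B \<Phi>
 proof -
  obtain \<tau> \<tau>' where \<tau>: "\<tau> * \<tau>' = 1" "\<forall>\<Phi>\<in>Sch. k (mm B) \<Phi> = (\<lambda>x. \<tau> * Mop B \<Phi> x)"
   using implements_unique[OF impl[OF symp_mm[OF B(1)]] implements_M[OF B(1)]] by (elim exE conjE)
  define b where "b x = - ginv B x" for x
  have b: "sym b"
   using sym_uminus_inv[OF B] unfolding b_def .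
  have rel: "ww \<circ> (nn B \<circ> ww) = nn b \<circ> (mm B \<circ> (ww \<circ> nn b))"
   using ww_nn_ww[OF B] unfolding b_def comp_assoc .
  let ?T = "Nop b \<circ> Mop B \<circ> Fop \<circ> Nop b"
  have T: "implements (nn b \<circ> mm B \<circ> ww \<circ> nn b) ?T"
   by (intro implements_comp implements_N implements_M implements_F b B)
  have "ind 0 \<in> ?T ` Sch"
   unfolding bij_betw_imp_surj_on[OF implementsD(2)[OF T]] by (rule ind_Sch)
  then obtain \<Psi> where \<Psi>: "\<Psi> \<in> Sch" "?T \<Psi> = ind 0"
   by (auto simp del: comp_apply)
  have S: "Nop b \<Psi> \<in> Sch" "Fop (Nop b \<Psi>) \<in> Sch" "Mop B (Fop (Nop b \<Psi>)) \<in> Sch"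
   "Fop \<Psi> \<in> Sch" "Nop B (Fop \<Psi>) \<in> Sch"
   using sym_lin[OF b] sym_lin[OF B(2)] B(1) \<Psi>(1) by (auto intro: Nop_Sch Fop_Sch Mop_Sch)
  have sy: "symp (nn b)" "symp (nn B)" "symp (mm B)"
   by (rule symp_nn[OF b], rule symp_nn[OF B(2)], rule symp_mm[OF B(1)])
  have "k (ww \<circ> (nn B \<circ> ww)) \<Psi> = k ww (k (nn B) (k ww \<Psi>))"
   using \<Psi>(1) sy symp_ww by (simp add: kc symp_comp implements_Sch[OF impl] del: comp_apply)
  also have "\<dots> = (\<lambda>x. t * (t * Fop (Nop B (Fop \<Psi>)) x))"
   using t(2) \<Psi>(1) S by (simp add: klin[OF sy(2)] kN[OF B(2)] klin[OF symp_ww])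
  also have "\<dots> = (\<lambda>x. t * t * gauss B * ?T \<Psi> x)"
   using gauss_relation[OF B \<Psi>(1)] unfolding b_def[symmetric] by (simp add: mult_ac)
  finally have 1: "k (ww \<circ> (nn B \<circ> ww)) \<Psi> = (\<lambda>x. t * t * gauss B * ?T \<Psi> x)" .
  have "k (nn b \<circ> (mm B \<circ> (ww \<circ> nn b))) \<Psi> = k (nn b) (k (mm B) (k ww (k (nn b) \<Psi>)))"
   using \<Psi>(1) sy symp_ww by (simp add: kc symp_comp implements_Sch[OF impl] del: comp_apply)
  also have "\<dots> = (\<lambda>x. t * (\<tau> * ?T \<Psi> x))"
   using t(2) \<tau>(2) \<Psi>(1) S by (simp add: klin[OF sy(3)] kN[OF b] scale_Sch Nop_scale)
  finally have 2: "k (nn b \<circ> (mm B \<circ> (ww \<circ> nn b))) \<Psi> = (\<lambda>x. t * (\<tau> * ?T \<Psi> x))" .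
  \<comment> \<open>Lifting the relation for \<open>ww \<circ> nn B \<circ> ww\<close> in two ways
    determines the scalar of the lift of \<open>mm B\<close>.\<close>
  have "t * (\<tau> * ind 0 0) = t * t * gauss B * ind 0 0"
   by (rule fun_cong[OF 1[unfolded rel 2 \<Psi>(2)], of 0])
  then have "\<tau> = t * gauss B"
   using t(1) by (auto simp: ind_def mult.assoc)
  then show ?thesis
   using \<tau>(2) \<Phi> by simp
 qed
 \<comment> \<open>Varying one diagonal entry only keeps the maps symmetric and reduces their Gauss
   sums to one variable, with a fixed power of \<open>gauss1 1\<close> as cofactor.\<close>
 define D where "D a = diag (\<lambda>i. if i = 0 then a else 1 :: 'f)" for a
 have D: "D a \<in> GL" "sym (D a)" if "a \<noteq> 0" for a
  unfolding D_def using that by (intro diag_GL(1), simp, intro sym_diag)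
 obtain m where m: "n = Suc m"
  using n by (cases n) auto
 have gD: "gauss (D a) = gauss1 a * gauss1 1 ^ m" if "a \<noteq> 0" for a
 proof -
  have "gauss (D a) = (\<Prod>i<n. gauss1 (if i = 0 then a else 1))"
   unfolding D_def using that by (intro gauss_diag) simp
  then show ?thesis
   unfolding m prod.lessThan_Suc_shift by simp
 qed
 have DD: "gauss (D (a * b)) = t * (gauss (D a) * gauss (D b))" if ab: "a \<noteq> 0" "b \<noteq> 0" for a b
 proof -
  have Dc: "D a \<circ> D b = D (a * b)"
   unfolding D_def diag_comp by (rule arg_cong[of _ _ diag]) auto
  have M: "Mop (D b) (ind 0) \<in> Sch"
   by (rule Mop_Sch[OF D(1)[OF ab(2)] ind_Sch])
  have "k (mm (D a) \<circ> mm (D b)) (ind 0) = k (mm (D a)) (k (mm (D b)) (ind 0))"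
   by (rule kc[OF symp_mm[OF D(1)[OF ab(1)]] symp_mm[OF D(1)[OF ab(2)]] ind_Sch])
  also have "mm (D a) \<circ> mm (D b) = mm (D (a * b))"
   unfolding mm_comp(1)[OF D(1)[OF ab(1)] D(1)[OF ab(2)]] Dc ..
  finally have "(\<lambda>x. t * gauss (D (a * b)) * Mop (D (a * b)) (ind 0) x)
    = (\<lambda>x. t * gauss (D b) * (t * gauss (D a) * Mop (D a) (Mop (D b) (ind 0)) x))"
   using kM[OF D[OF ab(2)] ind_Sch] kM[OF D[of "a * b"] ind_Sch] kM[OF D[OF ab(1)] M]
    klin[OF symp_mm[OF D(1)[OF ab(1)]] M] ab by simp
  then have "t * gauss (D (a * b)) * Mop (D (a * b)) (ind 0) 0
    = t * gauss (D b) * (t * gauss (D a) * Mop (D a) (Mop (D b) (ind 0)) 0)"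
   by (rule fun_cong)
  then have "t * gauss (D (a * b)) = t * (t * (gauss (D a) * gauss (D b)))"
   using ab by (simp add: D ind_def mult_ac)
  then show ?thesis
   using t(1) by auto
 qed
 have t1: "t * gauss (D 1) = 1"
  using DD[of 1 1] gauss_neq_0[OF D[of 1]] by (simp add: mult_ac)
 have "gauss1 (a * b) * gauss1 1 = gauss1 a * gauss1 b" if ab: "a \<noteq> 0" "b \<noteq> 0" for a b
 proof -
  have "gauss (D (a * b)) * gauss (D 1) = t * gauss (D 1) * (gauss (D a) * gauss (D b))"
   unfolding DD[OF ab] by (simp only: mult_ac)
  then have "(gauss1 (a * b) * gauss1 1) * (gauss1 1 ^ m * gauss1 1 ^ m)
    = (gauss1 a * gauss1 b) * (gauss1 1 ^ m * gauss1 1 ^ m)"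
   using ab unfolding t1 by (simp add: gD mult_ac)
  then show ?thesis
   using gauss1_neq_0[of 1] by simp
 qed
 then show False
  using gauss1_not_multiplicative by blast
qed

end

section \<open>The residue field\<close>

text \<open>Serves to pass from the invertibility of the residue characteristic in the coefficients
  to that of the residue cardinality.\<close>

lemma dvd_power_if_prime_factors_dvd:
 fixes c p :: nat
 assumes "0 < c" "\<And>r. Factorial_Ring.prime r \<Longrightarrow> r dvd c \<Longrightarrow> r dvd p"
 shows "\<exists>m. c dvd p ^ m"
 using assms
proof (induction c rule: less_induct)
 case (less c)
 show ?case
 proof (cases "c = 1")
  case False
  then obtain r where r: "Factorial_Ring.prime r" "r dvd c"
   using prime_factor_nat by metis
  then obtain d where d: "c = r * d"
   by (elim dvdE)
  have "0 < d" "d < c"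
   using less.prems(1) prime_gt_1_nat[OF r(1)] unfolding d by simp_all
  moreover have "s dvd p" if "Factorial_Ring.prime s" "s dvd d" for s
   using that less.prems(2) d by simp
  ultimately obtain m where "d dvd p ^ m"
   using less.IH by blast
  then have "c dvd p ^ Suc m"
   unfolding d power_Suc using less.prems(2)[OF r] by (intro mult_dvd_mono)
  then show ?thesis
   by (rule exI)
 qed (rule exI[of _ 0], simp)
qed

text \<open>Cauchy's theorem, obtained from a Sylow subgroup of order \<open>r\<close>, supplies an
  element of order \<open>r\<close>, which the exponent \<open>p\<close> annihilates.\<close>

lemma (in group) prime_dvd_exponent:
 assumes "finite (carrier G)" "\<And>x. x \<in> carrier G \<Longrightarrow> x [^] (p::nat) = \<one>"
  and r: "Factorial_Ring.prime r" "r dvd card (carrier G)"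
 shows "r dvd p"
proof -
 obtain m where "card (carrier G) = r ^ 1 * m"
  using r(2) by (auto elim: dvdE)
 then obtain H where H: "subgroup H G" "card H = r"
  using sylow_thm[OF r(1) is_group, of 1 m] assms(1) by (auto simp: order_def)
 have "\<not> H \<subseteq> {\<one>}"
  using card_mono[of "{\<one>}" H] prime_gt_1_nat[OF r(1)] unfolding H(2) by auto
 then obtain x where x: "x \<in> H" "x \<noteq> \<one>"
  by blast
 have xG: "x \<in> carrier G"
  using x(1) subgroup.subset[OF H(1)] by blast
 have "x [^]\<^bsub>G\<lparr>carrier := H\<rparr>\<^esub> r = \<one>"
  using group.pow_order_eq_1[OF subgroup_imp_group[OF H(1)], of x] x(1) H(2) by (simp add: order_def)
 then have "x [^] r = \<one>"
  by (simp add: nat_pow_def)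
 then have "ord x dvd r"
  using pow_eq_id[OF xG] by blast
 moreover have "ord x \<noteq> 1"
  using ord_eq_1[OF xG] x(2) by blast
 ultimately have "ord x = r"
  using r(1) by (auto simp: prime_nat_iff)
 then show "r dvd p"
  using pow_eq_id[OF xG] assms(2)[OF xG] by auto
qed

text \<open>The additive group is annihilated by the characteristic, so every prime divisor of its
  order divides the characteristic.\<close>

lemma (in ring) card_dvd_characteristic_power:
 assumes "finite (carrier R)"
 shows "\<exists>m. card (carrier R) dvd ring_characteristic R ^ m"
proof (rule dvd_power_if_prime_factors_dvd)
 let ?p = "ring_characteristic R"
 show "0 < card (carrier R)"
  using assms by (auto simp: card_gt_0_iff)
 have "[?p] \<cdot> x = \<zero>" if x: "x \<in> carrier R" for x
 proof -
  have "[?p] \<cdot> \<one> = \<zero>"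
   using group.pow_ord_eq_1[OF a_group, of \<one>] unfolding ring_characteristic_def add_pow_def by simp
  then show ?thesis
   using add_pow_ldistr[OF one_closed x, of ?p] x by simp
 qed
 then show "r dvd ?p" if "Factorial_Ring.prime r" "r dvd card (carrier R)" for r
  using group.prime_dvd_exponent[OF a_group, of ?p r] assms that by (simp add: add_pow_def)
qed

context nonarch_local_field
begin

lemma valuation_ring_simps:
 "carrier (valuation_ring absv) = fideal 0" "x \<otimes>\<^bsub>valuation_ring absv\<^esub> y = x * y" "\<one>\<^bsub>valuation_ring absv\<^esub> = 1"
 "x \<oplus>\<^bsub>valuation_ring absv\<^esub> y = x + y" "\<zero>\<^bsub>valuation_ring absv\<^esub> = 0"
 by (simp_all add: valuation_ring_def ring_of_type_algebra_def fideal_0_iff set_eq_iff)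

lemma fideal_0_mult: "x \<in> fideal 0 \<Longrightarrow> y \<in> fideal k \<Longrightarrow> x * y \<in> fideal k"
 using fideal_mult[of x 0 y k] by simp

lemma fideal_mult_0: "y \<in> fideal k \<Longrightarrow> x \<in> fideal 0 \<Longrightarrow> y * x \<in> fideal k"
 using fideal_mult[of y k x 0] by simp

lemma ring_valuation_ring: "ring (valuation_ring absv)"
proof (rule ringI)
 show "abelian_group (valuation_ring absv)"
 proof (rule abelian_groupI)
  fix x assume "x \<in> carrier (valuation_ring absv)"
  then show "\<exists>y\<in>carrier (valuation_ring absv). y \<oplus>\<^bsub>valuation_ring absv\<^esub> x = \<zero>\<^bsub>valuation_ring absv\<^esub>"
   by (intro bexI[of _ "- x"]) (simp_all add: valuation_ring_simps)
 qed (simp_all add: valuation_ring_simps fideal_add add_ac)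
 show "monoid (valuation_ring absv)"
  by (rule monoidI) (simp_all add: valuation_ring_simps fideal_0_mult fideal_0_iff absv_mult mult_le_one absv_nonneg mult.assoc)
qed (simp_all add: valuation_ring_simps algebra_simps)

lemma ideal_valuation_ring: "ideal (fideal 1) (valuation_ring absv)"
proof (rule idealI[OF ring_valuation_ring])
 show "subgroup (fideal 1) (add_monoid (valuation_ring absv))"
 proof (rule group.subgroupI[OF abelian_group.a_group[OF ring.is_abelian_group[OF ring_valuation_ring]]])
  show "fideal 1 \<subseteq> carrier (add_monoid (valuation_ring absv))"
   using fideal_antimono[of 0 1] by (simp add: valuation_ring_simps)
  show "fideal 1 \<noteq> {}"
   using fideal_0[of 1] by blast
  fix x assume x: "x \<in> fideal 1"
  have "inv\<^bsub>add_monoid (valuation_ring absv)\<^esub> x = - x"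
   using x fideal_antimono[of 0 1]
   by (intro group.inv_equality[OF abelian_group.a_group[OF ring.is_abelian_group[OF ring_valuation_ring]]])
    (auto simp: valuation_ring_simps)
  then show "inv\<^bsub>add_monoid (valuation_ring absv)\<^esub> x \<in> fideal 1"
   using x by simp
 qed (simp add: valuation_ring_simps fideal_add)
qed (simp_all add: valuation_ring_simps fideal_0_mult fideal_mult_0)

lemma residue_field_eq: "residue_field absv = valuation_ring absv Quot fideal 1"
proof -
 have "{x. absv x < 1} = fideal 1"
  by (auto simp: fideal_1_iff)
 then show ?thesis
  by (simp add: residue_field_def)
qed

lemma residue_field_carrier: "carrier (residue_field absv) = (\<lambda>x. {y. y - x \<in> fideal 1}) ` fideal 0"
proof -
 have "(\<Union>h\<in>fideal 1. {h + x}) = {y. y - x \<in> fideal 1}" for x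
 proof (intro equalityI subsetI)
  fix y assume "y \<in> {y. y - x \<in> fideal 1}"
  then show "y \<in> (\<Union>h\<in>fideal 1. {h + x})"
   by (intro UN_I[of "y - x"]) simp_all
 qed auto
 then show ?thesis
  unfolding residue_field_eq FactRing_def A_RCOSETS_defs r_coset_def by (auto simp: valuation_ring_simps)
qed

lemma card_residue_field: "card (carrier (residue_field absv)) = resq"
 unfolding residue_field_carrier resq_def ..

lemma resq_unit:
 assumes "of_nat (ring_characteristic (residue_field absv)) * d = (1::'r::idom)"
 shows "\<exists>iq. of_nat resq * iq = (1::'r)"
proof -
 let ?p = "ring_characteristic (residue_field absv)"
 have "ring (residue_field absv)"
  unfolding residue_field_eq by (rule ideal.quotient_is_ring[OF ideal_valuation_ring])
 moreover have "finite (carrier (residue_field absv))"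
  unfolding residue_field_carrier by (rule finite_cosets)
 ultimately have "\<exists>m. resq dvd ?p ^ m"
  unfolding card_residue_field[symmetric] by (rule ring.card_dvd_characteristic_power)
 then obtain m e where "?p ^ m = resq * e"
  by (auto elim: dvdE)
 then have "of_nat resq * (of_nat e * d ^ m) = (of_nat ?p ^ m :: 'r) * d ^ m"
  by (metis mult.assoc of_nat_mult of_nat_power)
 then show ?thesis
  using assms by (metis power_mult_distrib power_one)
qed

end

section \<open>The Schwartz space\<close>

context weil
begin

lemma dual_space_eq: "dual_space smul = range dot"
proof -
 have vs: "vector_space smul" "vector_space ((*) :: 'f \<Rightarrow> 'f \<Rightarrow> 'f)"
  by unfold_locales (simp_all add: smul_distrib smul_smul algebra_simps)
 have "f \<in> range dot" if "Vector_Spaces.linear smul (*) f" for f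
 proof -
  have "f (x + y) = f x + f y" "f (smul c x) = c * f x" for x y c
   using that by (simp_all add: Vector_Spaces.linear_iff)
  then have "f x = dot x (vec (\<lambda>i. f (bv i)))" for x
   by (rule functional_eq_dot)
  then have "f x = dot (vec (\<lambda>i. f (bv i))) x" for x
   by (rule trans[OF _ dot_commute])
  then have "f = dot (vec (\<lambda>i. f (bv i)))"
   by (rule ext)
  then show ?thesis
   by (rule range_eqI)
 qed
 moreover have "Vector_Spaces.linear smul (*) (dot y)" for y
  using vs by (simp add: Vector_Spaces.linear_iff)
 ultimately show ?thesis
  unfolding dual_space_def by blast
qed

abbreviation XT :: "'x topology"
 where "XT \<equiv> X_topology absv smul"

lemma openin_functional: "openin (field_topology absv) V \<Longrightarrow> openin XT (dot y -` V)"
 unfolding X_topology_def by (rule topology_generated_by_Basis) (auto simp: dual_space_eq)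

lemma openin_UNIV: "openin XT UNIV"
proof -
 have "openin (field_topology absv) (fideal k)" for k
  using openin_fideal_coset[of 0 k] by simp
 then have "openin (field_topology absv) (\<Union> (range fideal))"
  by (intro openin_Union) auto
 moreover have "\<Union> (range fideal) = UNIV"
  using exists_fideal by auto
 ultimately show ?thesis
  using openin_functional[of UNIV 0] by simp
qed

lemma topspace_XT [simp]: "topspace XT = UNIV"
 using openin_subset[OF openin_UNIV] by auto

lemma openin_coset: "openin XT {x. x - a \<in> lat k}"
proof -
 have "openin XT {x. \<forall>i<m. co i (x - a) \<in> fideal k}" if "m \<le> n" for m
  using that
 proof (induction m)
  case (Suc m)
  have "openin XT (dot (bv m) -` {c. c - co m a \<in> fideal k})"
   by (rule openin_functional[OF openin_fideal_coset])
  moreover have "openin XT {x. \<forall>i<m. co i (x - a) \<in> fideal k}"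
   using Suc by simp
  ultimately have "openin XT ({x. \<forall>i<m. co i (x - a) \<in> fideal k} \<inter> dot (bv m) -` {c. c - co m a \<in> fideal k})"
   by (rule openin_Int[rotated])
  moreover have "{x. \<forall>i<m. co i (x - a) \<in> fideal k} \<inter> dot (bv m) -` {c. c - co m a \<in> fideal k}
    = {x. \<forall>i<Suc m. co i (x - a) \<in> fideal k}"
   using Suc.prems by (auto simp: less_Suc_eq)
  ultimately show ?case
   by simp
 qed (simp add: openin_UNIV)
 from this[OF order_refl] show ?thesis
  unfolding lat_def by simp
qed

lemma openin_contains_coset:
 assumes "openin XT V" "x \<in> V"
 shows "\<exists>k. \<forall>y. y - x \<in> lat k \<longrightarrow> y \<in> V"
proof -
 have "generate_topology_on {f -` V |f V. f \<in> dual_space smul \<and> openin (field_topology absv) V} V"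
  using assms(1) unfolding X_topology_def openin_topology_generated_by_iff .
 then show ?thesis
  using assms(2)
 proof (induction rule: generate_topology_on.induct)
  case (Int a b)
  then obtain k l where kl: "\<forall>y. y - x \<in> lat k \<longrightarrow> y \<in> a" "\<forall>y. y - x \<in> lat l \<longrightarrow> y \<in> b"
   by auto
  then show ?case
   using lat_antimono[of k "max k l"] lat_antimono[of l "max k l"] by (intro exI[of _ "max k l"]) auto
 next
  case (UN K)
  then show ?case
   by blast
 next
  case (Basis s)
  then obtain z V where z: "s = dot z -` V" "openin (field_topology absv) V"
   by (auto simp: dual_space_eq)
  then obtain k where k: "\<And>y. y - dot z x \<in> fideal k \<Longrightarrow> y \<in> V"
   using openin_field_fideal[of V "dot z x"] Basis(2) by auto
  obtain j where j: "z \<in> lat j"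
   using lat_exhausts by blast
  have "y \<in> s" if "y - x \<in> lat (k - j)" for y
   using dot_fideal[OF j that] by (auto simp: z intro!: k)
  then show ?case
   by blast
 qed simp
qed

text \<open>The lattice is the continuous image, under the coordinate parametrization, of a finite
  product of compact fractional ideals.\<close>

lemma compactin_lat: "compactin XT (lat j)"
proof -
 let ?P = "product_topology (\<lambda>_. field_topology absv) {..<n}"
 have top: "topspace (field_topology absv) = UNIV"
  using openin_subset[OF openin_fideal_coset] exists_fideal by (metis UNIV_eq_I diff_zero mem_Collect_eq subsetD)
 have cont: "continuous_map ?P XT vec"
  unfolding continuous_map_alt
 proof (intro conjI allI impI)
  fix V assume V: "openin XT V"
  show "openin ?P (vec -` V \<inter> topspace ?P)"
  proof (subst openin_subopen, intro ballI)
   fix c assume c: "c \<in> vec -` V \<inter> topspace ?P"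
   have "\<exists>k. \<forall>y. y - vec c \<in> lat k \<longrightarrow> y \<in> V"
    using openin_contains_coset[OF V] c by blast
   then obtain k where k: "\<And>y. y - vec c \<in> lat k \<Longrightarrow> y \<in> V"
    by blast
   let ?T = "PiE {..<n} (\<lambda>i. {x. x - c i \<in> fideal k})"
   have "openin ?P ?T"
    by (simp add: openin_PiE openin_fideal_coset)
   moreover have "c \<in> ?T"
    using c by (auto simp: PiE_def)
   moreover have "?T \<subseteq> vec -` V \<inter> topspace ?P"
    by (auto simp: top lat_def PiE_iff intro!: k)
   ultimately show "\<exists>T. openin ?P T \<and> c \<in> T \<and> T \<subseteq> vec -` V \<inter> topspace ?P"
    by blast
  qed
 qed auto
 have "compactin ?P (PiE {..<n} (\<lambda>_. fideal j))"
  by (simp add: compactin_PiE compactin_fideal)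
 from image_compactin[OF this cont] have "compactin XT (vec ` PiE {..<n} (\<lambda>_. fideal j))" .
 moreover have "vec ` PiE {..<n} (\<lambda>_. fideal j) = lat j"
 proof (intro equalityI subsetI)
  fix x assume x: "x \<in> lat j"
  have e: "vec (restrict (\<lambda>i. co i x) {..<n}) = x"
   by (rule co_eqI) simp
  have "restrict (\<lambda>i. co i x) {..<n} \<in> PiE {..<n} (\<lambda>_. fideal j)"
   using x by (simp add: lat_def)
  from imageI[OF this, of vec] show "x \<in> vec ` PiE {..<n} (\<lambda>_. fideal j)"
   unfolding e .
 next
  fix x assume "x \<in> vec ` PiE {..<n} (\<lambda>_. fideal j)"
  then obtain c where c: "x = vec c" "c \<in> PiE {..<n} (\<lambda>_. fideal j)"
   by (rule imageE)
  have "c i \<in> fideal j" if "i < n" for i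
   using PiE_mem[OF c(2)] that by simp
  then show "x \<in> lat j"
   unfolding c(1) lat_def by simp
 qed
 ultimately show ?thesis
  by simp
qed

text \<open>Finitely many cosets on which the function is constant cover the compact support, and
  the finest of their lattices is a common lattice of periods; another finite cover bounds the
  support.\<close>

lemma Schwartz_space_eq: "Schwartz_space absv smul = (Sch :: ('x \<Rightarrow> 'r) set)"
proof (intro equalityI subsetI)
 fix \<Phi> :: "'x \<Rightarrow> 'r"
 assume "\<Phi> \<in> Sch"
 then obtain j k where jk: "supp_in j \<Phi>" "inv_under k \<Phi>"
  unfolding Sch_def by blast
 have "closedin XT (lat j)"
  unfolding closedin_def
 proof
  have "openin XT (\<Union>a\<in>- lat j. {x. x - a \<in> lat j})"
   by (intro openin_Union ballI) (auto intro: openin_coset)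
  moreover have "(\<Union>a\<in>- lat j. {x. x - a \<in> lat j}) = - lat j"
  proof (intro equalityI subsetI)
   fix x assume "x \<in> (\<Union>a\<in>- lat j. {x. x - a \<in> lat j})"
   then obtain a where a: "a \<notin> lat j" "x - a \<in> lat j"
    by blast
   have "x \<notin> lat j"
    using lat_diff[of x j "x - a"] a by auto
   then show "x \<in> - lat j"
    by simp
  next
   fix x assume "x \<in> - lat j"
   then show "x \<in> (\<Union>a\<in>- lat j. {x. x - a \<in> lat j})"
    by (intro UN_I[of x]) simp_all
  qed
  ultimately show "openin XT (topspace XT - lat j)"
   by (simp add: Compl_eq_Diff_UNIV)
 qed simp
 then have "XT closure_of {x. \<Phi> x \<noteq> 0} \<subseteq> lat j"
  by (intro closure_of_minimal) (use jk(1) in \<open>auto simp: supp_in_def\<close>)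
 then have "compactin XT (XT closure_of {x. \<Phi> x \<noteq> 0})"
  by (intro closed_compactin[OF compactin_lat]) auto
 moreover have "\<exists>V. openin XT V \<and> x \<in> V \<and> (\<forall>y\<in>V. \<Phi> y = \<Phi> x)" for x
 proof (intro exI conjI ballI)
  show "\<Phi> y = \<Phi> x" if "y \<in> {y. y - x \<in> lat k}" for y
   using jk(2)[unfolded inv_under_def, rule_format, of "y - x" x] that by simp
 qed (simp_all add: openin_coset)
 ultimately show "\<Phi> \<in> Schwartz_space absv smul"
  unfolding Schwartz_space_def by blast
next
 fix \<Phi> :: "'x \<Rightarrow> 'r"
 let ?C = "XT closure_of {x. \<Phi> x \<noteq> 0}"
 assume "\<Phi> \<in> Schwartz_space absv smul"
 then have loc: "\<And>x. \<exists>V. openin XT V \<and> x \<in> V \<and> (\<forall>y\<in>V. \<Phi> y = \<Phi> x)" and comp: "compactin XT ?C"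
  unfolding Schwartz_space_def by blast+
 have supp: "x \<in> ?C" if "\<Phi> x \<noteq> 0" for x
  using closure_of_subset[of "{x. \<Phi> x \<noteq> 0}" XT] that by auto
 have "\<exists>k. \<forall>y. y - x \<in> lat k \<longrightarrow> \<Phi> y = \<Phi> x" for x
 proof -
  obtain V where V: "openin XT V" "x \<in> V" "\<forall>y\<in>V. \<Phi> y = \<Phi> x"
   using loc by blast
  then show ?thesis
   using openin_contains_coset[OF V(1,2)] by blast
 qed
 then have "\<exists>k. \<forall>x. \<forall>y. y - x \<in> lat (k x) \<longrightarrow> \<Phi> y = \<Phi> x"
  by (intro choice allI)
 then obtain k where k: "\<And>x y. y - x \<in> lat (k x) \<Longrightarrow> \<Phi> y = \<Phi> x"
  by (elim exE) blast
 have cover: "?C \<subseteq> (\<Union>x. {y. y - x \<in> lat (k x)})"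
 proof
  fix x
  show "x \<in> (\<Union>x. {y. y - x \<in> lat (k x)})"
   by (rule UN_I[of x]) simp_all
 qed
 obtain J where J: "finite J" "J \<subseteq> UNIV" "?C \<subseteq> (\<Union>x\<in>J. {y. y - x \<in> lat (k x)})"
  by (rule compactin_finite_index_cover[OF comp openin_coset cover])
 define K where "K = Max (insert 0 (k ` J))"
 have K: "k x \<le> K" if "x \<in> J" for x
  unfolding K_def using J(1) that by (intro Max_ge) auto
 have inv_C: "\<Phi> (y + z) = \<Phi> y" if yz: "y \<in> ?C" "z \<in> lat K" for y z
 proof -
  obtain x where x: "x \<in> J" "y - x \<in> lat (k x)"
   using J(3) yz(1) by blast
  have z: "z \<in> lat (k x)"
   using lat_antimono[OF K[OF x(1)]] yz(2) by blast
  have "y + z - x \<in> lat (k x)"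
   using L_add[OF x(2) z] by (simp add: algebra_simps)
  then show ?thesis
   using k x(2) by metis
 qed
 have "inv_under K \<Phi>"
  unfolding inv_under_def
 proof (intro allI impI)
  fix y z assume z: "z \<in> lat K"
  have z': "- z \<in> lat K"
   using lat_diff[of 0 K z] z by simp
  show "\<Phi> (y + z) = \<Phi> y"
  \<comment> \<open>Outside the support no covering coset is available, but there both values are 0;
    otherwise one of the two points lies in \<open>?C\<close> and the translation is read from
    it.\<close>
  proof (cases "\<Phi> y = 0 \<and> \<Phi> (y + z) = 0")
   case False
   then have "y \<in> ?C \<or> y + z \<in> ?C"
    using supp by blast
   then show ?thesis
    using inv_C[OF _ z, of y] inv_C[OF _ z', of "y + z"] by auto
  qed simp
 qed
 moreover have "\<exists>j. supp_in j \<Phi>"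
 proof -
  have cover: "?C \<subseteq> (\<Union>j. {y. y - 0 \<in> lat j})"
  proof
   fix x
   obtain j where "x \<in> lat j"
    using lat_exhausts by blast
   then show "x \<in> (\<Union>j. {y. y - 0 \<in> lat j})"
    by (intro UN_I[of j]) simp_all
  qed
  obtain J where J: "finite J" "J \<subseteq> UNIV" "?C \<subseteq> (\<Union>j\<in>J. {y. y - 0 \<in> lat j})"
   by (rule compactin_finite_index_cover[OF comp openin_coset cover])
  define j where "j = Min (insert 0 J)"
  have sub: "lat i \<subseteq> lat j" if "i \<in> J" for i
   unfolding j_def using J(1) that by (intro lat_antimono Min_le) auto
  have "?C \<subseteq> lat j"
  proof
   fix x assume "x \<in> ?C"
   then have "x \<in> (\<Union>j\<in>J. {y. y - 0 \<in> lat j})"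
    using J(3) by blast
   then obtain i where "i \<in> J" "x - 0 \<in> lat i"
    by blast
   then show "x \<in> lat j"
    using sub[of i] by auto
  qed
  then show ?thesis
   unfolding supp_in_def using supp by (intro exI[of _ j]) blast
 qed
 ultimately show "\<Phi> \<in> Sch"
  unfolding Sch_def by blast
qed

end

section \<open>The metaplectic group\<close>

lemma unit_group_iff: "t \<in> carrier (unit_group :: 'r::idom monoid) \<longleftrightarrow> (\<exists>d. t * d = 1)"
 unfolding unit_group_def units_of_def Units_def ring_of_type_algebra_def by (auto simp: mult.commute)

lemma sign_group_simps:
 "carrier (sign_group :: 'r::idom monoid) = {1, - 1}" "s \<otimes>\<^bsub>sign_group\<^esub> t = s * t" "\<one>\<^bsub>sign_group\<^esub> = (1 :: 'r)"
 by (simp_all add: sign_group_def unit_group_def units_of_def ring_of_type_algebra_def)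

lemma group_sign_group: "group (sign_group :: 'r::idom monoid)"
 by (rule groupI) (auto simp: sign_group_simps)

context weil
begin

text \<open>Transports coordinate pairs to vectors paired with linear functionals, the form in which
  the metaplectic group is defined.\<close>

definition emb :: "'x \<times> 'x \<Rightarrow> 'x \<times> ('x \<Rightarrow> 'f)"
 where "emb p = (fst p, dot (snd p))"

definition prj :: "'x \<times> ('x \<Rightarrow> 'f) \<Rightarrow> 'x \<times> 'x"
 where "prj w = (fst w, vec (\<lambda>i. snd w (bv i)))"

lemma prj_emb [simp]: "prj (emb p) = p"
proof -
 have "vec (\<lambda>i. dot (snd p) (bv i)) = snd p"
  by (rule co_eqI) simp
 then show ?thesis
  by (simp add: prj_def emb_def)
qed

lemma W_space_eq: "W_space smul = range emb"
 unfolding W_space_def dual_space_eq emb_def by (auto simp: image_iff)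

lemma emb_in [simp]: "emb p \<in> W_space smul"
 by (simp add: W_space_eq)

lemma W_spaceE:
 assumes "w \<in> W_space smul"
 obtains p where "w = emb p"
 using assms unfolding W_space_eq by (rule imageE)

lemma emb_inject [simp]: "emb p = emb q \<longleftrightarrow> p = q"
 using prj_emb by metis

lemma emb_add: "emb p + emb q = emb (p + q)"
 by (simp add: emb_def fun_eq_iff plus_fun_def)

lemma emb_smul: "W_smul smul c (emb p) = emb (psm c p)"
 by (simp add: W_smul_def emb_def psm_def fun_eq_iff)

lemma B_form_emb: "B_form (emb p) (emb q) = dot (fst p) (snd q)"
 by (simp add: B_form_def emb_def dot_commute)

definition lft :: "('x \<times> 'x \<Rightarrow> 'x \<times> 'x) \<Rightarrow> 'x \<times> ('x \<Rightarrow> 'f) \<Rightarrow> 'x \<times> ('x \<Rightarrow> 'f)"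
 where "lft f = (\<lambda>w\<in>W_space smul. emb (f (prj w)))"

lemma lft_emb [simp]: "lft f (emb p) = emb (f p)"
 by (simp add: lft_def)

lemma lft_inject: "lft f = lft g \<Longrightarrow> f = g"
 by (rule ext) (metis lft_emb emb_inject)

lemma lft_Bij:
 assumes "bij f"
 shows "lft f \<in> Bij (W_space smul)"
proof -
 have "bij_betw (lft f) (W_space smul) (W_space smul)"
  unfolding bij_betw_def
 proof
  show "inj_on (lft f) (W_space smul)"
   using bij_is_inj[OF assms] by (auto simp: inj_on_def W_space_eq inj_def)
  have "lft f ` range emb = emb ` range f"
   by (auto simp: image_image)
  then show "lft f ` W_space smul = W_space smul"
   using bij_is_surj[OF assms] by (simp add: W_space_eq)
 qed
 then show ?thesis
  by (simp add: Bij_def lft_def)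
qed

lemma lft_comp: "compose (W_space smul) (lft f) (lft g) = lft (f \<circ> g)"
 unfolding compose_def by (rule ext) (auto simp: lft_def)

lemma lft_id: "lft id = (\<lambda>w\<in>W_space smul. w)"
 by (rule ext) (auto simp: lft_def elim: W_spaceE)

lemma Sp_simps:
 "\<sigma> \<in> Bij (W_space smul) \<Longrightarrow> \<tau> \<in> Bij (W_space smul) \<Longrightarrow> \<sigma> \<otimes>\<^bsub>Sp smul\<^esub> \<tau> = compose (W_space smul) \<sigma> \<tau>"
 "\<one>\<^bsub>Sp smul\<^esub> = (\<lambda>w\<in>W_space smul. w)"
 by (simp_all add: Sp_def BijGroup_def)

lemma lft_Sp:
 assumes f: "symp f"
 shows "lft f \<in> carrier (Sp smul)"
proof -
 have "B_form (lft f (emb p)) (lft f (emb q)) - B_form (lft f (emb q)) (lft f (emb p))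
   = B_form (emb p) (emb q) - B_form (emb q) (emb p)" for p q
  using sympD(4)[OF f, of p q] by (simp add: B_form_emb om_def)
 then show ?thesis
  using lft_Bij[OF sympD(3)[OF f]]
  by (simp add: Sp_def W_space_eq emb_add emb_smul sympD(1,2)[OF f] del: split_paired_All)
qed

lemma Sp_lft:
 assumes "\<sigma> \<in> carrier (Sp smul)"
 shows "\<exists>f. symp f \<and> \<sigma> = lft f"
proof -
 have bij: "bij_betw \<sigma> (W_space smul) (W_space smul)" and ext: "\<sigma> \<in> extensional (W_space smul)"
  and add: "\<And>p q. \<sigma> (emb p + emb q) = \<sigma> (emb p) + \<sigma> (emb q)"
  and scale: "\<And>c p. \<sigma> (W_smul smul c (emb p)) = W_smul smul c (\<sigma> (emb p))"
  and form: "\<And>p q. B_form (\<sigma> (emb p)) (\<sigma> (emb q)) - B_form (\<sigma> (emb q)) (\<sigma> (emb p))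
   = B_form (emb p) (emb q) - B_form (emb q) (emb p)"
  using assms by (simp_all add: Sp_def Bij_def)
 define f where "f p = prj (\<sigma> (emb p))" for p
 have f: "\<sigma> (emb p) = emb (f p)" for p
 proof -
  have "\<sigma> (emb p) \<in> W_space smul"
   using bij_betwE[OF bij] by simp
  then show ?thesis
   unfolding f_def by (elim W_spaceE) simp
 qed
 define g where "g p = prj (inv_into (W_space smul) \<sigma> (emb p))" for p
 have g: "emb (g p) = inv_into (W_space smul) \<sigma> (emb p)" for p
 proof -
  have "inv_into (W_space smul) \<sigma> (emb p) \<in> W_space smul"
   using bij_betwE[OF bij_betw_inv_into[OF bij]] by simp
  then show ?thesis
   unfolding g_def by (elim W_spaceE) simp
 qed
 have "symp f"
 proof (rule sympI[of f g])
  show "f (p + q) = f p + f q" for p q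
   using add[of p q] unfolding emb_add f by simp
  show "f (psm c p) = psm c (f p)" for c p
   using scale[of c p] unfolding emb_smul f by simp
  show "om (f p) (f q) = om p q" for p q
   using form[of p q] unfolding f B_form_emb om_def .
  have "emb (f (g p)) = emb p" "emb (g (f p)) = emb p" for p
   unfolding g f[symmetric] by (simp_all add: g bij_betw_inv_into_left[OF bij] bij_betw_inv_into_right[OF bij])
  then show "f (g p) = p" "g (f p) = p" for p
   by simp_all
 qed
 moreover have "\<sigma> = lft f"
  by (rule extensionalityI[OF ext, of "lft f"]) (auto simp: lft_def f elim!: W_spaceE)
 ultimately show ?thesis
  by blast
qed

section \<open>Comparison with the normalizer of the Heisenberg operators\<close>

abbreviation Aut :: "(('x \<Rightarrow> 'r) \<Rightarrow> 'x \<Rightarrow> 'r) monoid"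
 where "Aut \<equiv> Aut_Schwartz absv smul"

lemma Aut_carrier: "T \<in> carrier Aut \<longleftrightarrow> T \<in> extensional Sch \<and> bij_betw T Sch Sch \<and> linop T"
proof -
 have "linop T \<longleftrightarrow> (\<forall>\<Phi>\<in>Sch. \<forall>\<Psi>\<in>Sch. T (\<Phi> + \<Psi>) = T \<Phi> + T \<Psi>) \<and>
   (\<forall>r. \<forall>\<Phi>\<in>Sch. T (\<lambda>x. r * \<Phi> x) = (\<lambda>x. r * T \<Phi> x))" if "bij_betw T Sch Sch"
  using bij_betwE[OF that] unfolding linop_def plus_fun_def by blast
 then show ?thesis
  unfolding Aut_Schwartz_def Schwartz_space_eq Bij_def by auto
qed

lemma Aut_mult: "S \<in> carrier Aut \<Longrightarrow> T \<in> carrier Aut \<Longrightarrow> S \<otimes>\<^bsub>Aut\<^esub> T = compose Sch S T"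
 by (simp add: Aut_Schwartz_def Schwartz_space_eq BijGroup_def)

lemma linop_inverse:
 assumes "linop T" and bij: "bij_betw T Sch Sch"
 shows "linop (inv_into Sch T)"
proof (rule linopI)
 let ?S = "inv_into Sch T"
 have S: "?S \<Phi> \<in> Sch" "T (?S \<Phi>) = \<Phi>" if "\<Phi> \<in> Sch" for \<Phi> :: "'x \<Rightarrow> 'r"
  using bij_betwE[OF bij_betw_inv_into[OF bij]] bij_betw_inv_into_right[OF bij] that by auto
 then show "?S \<Phi> \<in> Sch" if "\<Phi> \<in> Sch" for \<Phi>
  using that by blast
 have inj: "?S \<Psi> = \<Phi>" if "\<Phi> \<in> Sch" "T \<Phi> = \<Psi>" for \<Phi> \<Psi> :: "'x \<Rightarrow> 'r"
  using bij_betw_inv_into_left[OF bij that(1)] that(2) by simp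
 fix \<Phi> \<Psi> :: "'x \<Rightarrow> 'r" and c x
 assume \<Phi>: "\<Phi> \<in> Sch"
 have "?S (\<lambda>x. c * \<Phi> x) = (\<lambda>x. c * ?S \<Phi> x)"
  by (rule inj) (simp_all add: scale_Sch S[OF \<Phi>] linopD(3)[OF assms(1)])
 then show "?S (\<lambda>x. c * \<Phi> x) x = c * ?S \<Phi> x"
  by simp
 assume \<Psi>: "\<Psi> \<in> Sch"
 have "?S (\<lambda>x. \<Phi> x + \<Psi> x) = (\<lambda>x. ?S \<Phi> x + ?S \<Psi> x)"
  by (rule inj) (simp_all add: add_Sch S[OF \<Phi>] S[OF \<Psi>] linopD(2)[OF assms(1)])
 then show "?S (\<lambda>x. \<Phi> x + \<Psi> x) x = ?S \<Phi> x + ?S \<Psi> x"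
  by simp
qed

lemma group_Aut: "group Aut"
proof -
 have "subgroup (carrier Aut) (BijGroup Sch)"
 proof (rule group.subgroupI[OF group_BijGroup])
  show "carrier Aut \<subseteq> carrier (BijGroup Sch)"
   by (auto simp: Aut_carrier BijGroup_def Bij_def)
  have "(\<lambda>\<Phi>\<in>Sch. \<Phi>) \<in> carrier Aut"
   unfolding Aut_carrier using implementsD[OF implements_cong[OF implements_id, of "\<lambda>\<Phi>\<in>Sch. \<Phi>"]] by simp
  then show "carrier Aut \<noteq> {}"
   by blast
  fix S assume S: "S \<in> carrier Aut"
  then have SB: "S \<in> Bij Sch"
   by (simp add: Aut_carrier Bij_def)
  have "inv\<^bsub>BijGroup Sch\<^esub> S = (\<lambda>\<Phi>\<in>Sch. inv_into Sch S \<Phi>)"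
   by (rule inv_BijGroup[OF SB])
  moreover have "linop (\<lambda>\<Phi>\<in>Sch. inv_into Sch S \<Phi>)"
  proof -
   have "linop (inv_into Sch S)"
    using S by (intro linop_inverse) (simp_all add: Aut_carrier)
   then show ?thesis
    unfolding linop_def by (simp add: add_Sch scale_Sch)
  qed
  moreover have "(\<lambda>\<Phi>\<in>Sch. inv_into Sch S \<Phi>) \<in> Bij Sch"
   by (rule restrict_inv_into_Bij[OF SB])
  ultimately show "inv\<^bsub>BijGroup Sch\<^esub> S \<in> carrier Aut"
   by (simp add: Aut_carrier Bij_def)
  fix T assume T: "T \<in> carrier Aut"
  have "compose Sch S T \<in> Bij Sch"
   using S T by (intro compose_Bij) (simp_all add: Aut_carrier Bij_def)
  moreover have "linop (compose Sch S T)"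
  proof -
   have "linop (S \<circ> T)"
    using S T by (intro linop_comp) (simp_all add: Aut_carrier)
   then show ?thesis
    unfolding linop_def compose_def by (simp add: add_Sch scale_Sch)
  qed
  ultimately show "S \<otimes>\<^bsub>BijGroup Sch\<^esub> T \<in> carrier Aut"
   using S T by (simp add: Aut_carrier BijGroup_def Bij_def)
 qed
 from group.subgroup_imp_group[OF group_BijGroup this] show ?thesis
  by (simp add: Aut_Schwartz_def Schwartz_space_eq)
qed

abbreviation AG :: "(('x \<times> ('x \<Rightarrow> 'f)) \<times> 'r) set"
 where "AG \<equiv> carrier (A_group smul chi)"

abbreviation Uop :: "('x \<times> ('x \<Rightarrow> 'f)) \<times> 'r \<Rightarrow> ('x \<Rightarrow> 'r) \<Rightarrow> 'x \<Rightarrow> 'r"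
 where "Uop \<equiv> U_op absv smul chi"

lemma A_carrier: "a \<in> AG \<longleftrightarrow> (\<exists>p t d. t * d = 1 \<and> a = (emb p, t))"
 unfolding A_group_def by (cases a) (auto simp: unit_group_iff W_space_eq)

lemma U_op_emb: "Uop (emb p, t) = (\<lambda>\<Phi>\<in>Sch. \<lambda>x. t * U p \<Phi> x)"
 by (simp add: U_op_def emb_def U_def Schwartz_space_eq mult.assoc)

lemma mu_emb:
 assumes "t * d = 1"
 shows "mu smul chi (lft f) (emb p, t) = (emb (f p), chi (fq f p) * t)"
proof -
 have "f_quad (lft f) (emb p) = fq f p"
  by (simp add: f_quad_def fq_def B_form_emb)
 moreover have "(emb p, t) \<in> AG"
  unfolding A_carrier using assms by blast
 ultimately show ?thesis
  by (simp add: mu_def)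
qed

lemma U_op_Aut:
 assumes "t * d = 1"
 shows "Uop (emb p, t) \<in> carrier Aut"
proof -
 let ?T = "\<lambda>\<Phi> x. t * U p \<Phi> x" and ?S = "\<lambda>\<Phi> x. d * chi (dot (snd p) (fst p)) * U (- p) \<Phi> x"
 have e: "chi (dot (snd p) (fst p)) * (chi (- dot (snd p) x) * chi (dot (snd p) (x - fst p))) = 1"
  "chi (dot (snd p) (fst p)) * (chi (dot (snd p) x) * chi (- dot (snd p) (x + fst p))) = 1" for x
  by (simp_all flip: chi_add)
 have ST: "?S (?T \<Phi>) x = \<Phi> x" "?T (?S \<Phi>) x = \<Phi> x" for \<Phi> x
 proof -
  have "?S (?T \<Phi>) x = t * d * \<Phi> x * (chi (dot (snd p) (fst p)) * (chi (- dot (snd p) x) * chi (dot (snd p) (x - fst p))))"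
   by (simp add: U_def mult_ac)
  then show "?S (?T \<Phi>) x = \<Phi> x"
   unfolding e assms by simp
  have "?T (?S \<Phi>) x = t * d * \<Phi> x * (chi (dot (snd p) (fst p)) * (chi (dot (snd p) x) * chi (- dot (snd p) (x + fst p))))"
   by (simp add: U_def mult_ac)
  then show "?T (?S \<Phi>) x = \<Phi> x"
   unfolding e assms by simp
 qed
 have l: "linop ?T"
  by (rule linopI) (simp_all add: scale_Sch U_Sch linopD[OF linop_U], simp_all add: algebra_simps)
 have "bij_betw ?T Sch Sch"
  by (rule bij_betw_byWitness[where f' = ?S]) (use ST in \<open>auto simp: scale_Sch U_Sch\<close>)
 then have "bij_betw (\<lambda>\<Phi>\<in>Sch. ?T \<Phi>) Sch Sch"
  by (simp cong: bij_betw_cong)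
 moreover have "linop (\<lambda>\<Phi>\<in>Sch. ?T \<Phi>)"
  using l unfolding linop_def by (simp add: add_Sch scale_Sch)
 ultimately show ?thesis
  unfolding U_op_emb Aut_carrier by simp
qed

text \<open>Indicators of ever finer lattices detect the translation part; what remains is a
  multiple of an additive character, whose frequency is detected by the non-triviality of
  \<open>chi\<close>.\<close>

lemma U_op_inj: "inj_on Uop AG"
proof (rule inj_onI)
 fix a b assume ab: "a \<in> AG" "b \<in> AG"
  "Uop a = Uop b"
 obtain p t d where a: "t * d = 1" "a = (emb p, t)"
  using ab(1) unfolding A_carrier by (elim exE conjE)
 obtain q s e where b: "s * e = 1" "b = (emb q, s)"
  using ab(2) unfolding A_carrier by (elim exE conjE)
 have eq: "t * (\<Phi> (x + fst p) * chi (dot (snd p) x)) = s * (\<Phi> (x + fst q) * chi (dot (snd q) x))"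
  if "\<Phi> \<in> Sch" for \<Phi> :: "'x \<Rightarrow> 'r" and x
  using fun_cong[OF fun_cong[OF ab(3)[unfolded a(2) b(2) U_op_emb], of \<Phi>], of x] that by (simp add: U_def)
 have ts: "t \<noteq> 0" "s \<noteq> 0"
  using a(1) b(1) by auto
 have "fst q - fst p = 0"
 proof (rule ccontr)
  assume "fst q - fst p \<noteq> 0"
  then obtain i where "i < n" "co i (fst q - fst p) \<noteq> 0"
   using co_eqI[of "fst q - fst p" 0] by auto
  then obtain k where "co i (fst q - fst p) \<notin> fideal k"
   using exists_not_fideal by blast
  then have "fst q - fst p \<notin> lat k"
   using \<open>i < n\<close> by (auto simp: lat_def)
  then show False
   using eq[OF ind_Sch[of k], of "- fst p"] ts by (simp add: ind_def)
 qed
 then have pq: "fst p = fst q"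
  by simp
 have eq2: "t * chi (dot (snd p) x) = s * chi (dot (snd q) x)" for x
  using eq[OF translate_Sch[OF ind_Sch[of 0]], of x "- (x + fst p)"] by (simp add: ind_def pq)
 have "t = s"
  using eq2[of 0] by simp
 moreover have "snd p = snd q"
 proof (rule dot_eqI)
  fix x
  show "dot x (snd p) = dot x (snd q)"
  proof (rule ccontr)
   assume "dot x (snd p) \<noteq> dot x (snd q)"
   then have c: "dot (snd p - snd q) x \<noteq> 0"
    by (simp add: dot_commute)
   obtain r where r: "chi r \<noteq> 1"
    using chi_nontrivial by blast
   let ?y = "smul (r / dot (snd p - snd q) x) x"
   have y: "dot (snd p) ?y = r + dot (snd q) ?y"
   proof -
    have "dot (snd p - snd q) ?y = r"
     using c by (simp only: dot_simps(10)) simp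
    then show ?thesis
     by (simp only: dot_simps(3) diff_eq_eq)
   qed
   have "chi (dot (snd p) ?y) = chi (dot (snd q) ?y)"
    using eq2[of ?y] ts \<open>t = s\<close> by simp
   then show False
    using r unfolding y chi_add by simp
  qed
 qed
 ultimately show "a = b"
  using prod_eqI[OF pq] unfolding a(2) b(2) by simp
qed

end

context weil
begin

lemma mu_A_carrier:
 assumes "symp f"
 shows "mu smul chi (lft f) ` AG = AG"
proof (intro equalityI subsetI)
 have chi_unit: "(chi c * t) * (chi (- c) * d) = t * d" for c t d
 proof -
  have "(chi c * t) * (chi (- c) * d) = (chi c * chi (- c)) * (t * d)"
   by (simp only: mult_ac)
  then show ?thesis
   by (simp add: chi_uminus)
 qed
 fix a assume "a \<in> mu smul chi (lft f) ` AG"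
 then obtain b where b: "a = mu smul chi (lft f) b" "b \<in> AG"
  by (rule imageE)
 obtain p t d where p: "t * d = 1" "b = (emb p, t)"
  using b(2) unfolding A_carrier by (elim exE conjE)
 have "(chi (fq f p) * t) * (chi (- fq f p) * d) = 1"
  using chi_unit[of "fq f p" t d] p(1) by (simp only:)
 then show "a \<in> AG"
  unfolding b(1) p(2) mu_emb[OF p(1)] A_carrier by blast
next
 have chi_unit: "(chi (- c) * t) * (chi c * d) = t * d" for c t d
 proof -
  have "(chi (- c) * t) * (chi c * d) = (chi (- c) * chi c) * (t * d)"
   by (simp only: mult_ac)
  then show ?thesis
   by (simp add: chi_uminus)
 qed
 fix a assume "a \<in> AG"
 then obtain q t d where q: "t * d = 1" "a = (emb q, t)"
  unfolding A_carrier by (elim exE conjE)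
 obtain p where p: "f p = q"
  using bij_is_surj[OF sympD(3)[OF assms]] by (metis surjD)
 have u: "(chi (- fq f p) * t) * (chi (fq f p) * d) = 1"
  using chi_unit[of "fq f p" t d] q(1) by (simp only:)
 have "chi (fq f p) * (chi (- fq f p) * t) = t"
  by (simp add: chi_uminus flip: mult.assoc)
 then have "a = mu smul chi (lft f) (emb p, chi (- fq f p) * t)"
  unfolding mu_emb[OF u] q(2) p by simp
 moreover have "(emb p, chi (- fq f p) * t) \<in> AG"
  unfolding A_carrier using u by blast
 ultimately show "a \<in> mu smul chi (lft f) ` AG"
  by (rule image_eqI)
qed

abbreviation cj :: "(('x \<Rightarrow> 'r) \<Rightarrow> 'x \<Rightarrow> 'r) \<Rightarrow> ('x \<times> ('x \<Rightarrow> 'f)) \<times> 'r \<Rightarrow> ('x \<Rightarrow> 'r) \<Rightarrow> 'x \<Rightarrow> 'r"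
 where "cj s a \<equiv> s \<otimes>\<^bsub>Aut\<^esub> Uop a \<otimes>\<^bsub>Aut\<^esub> inv\<^bsub>Aut\<^esub> s"

text \<open>Moving the inverse to the other side turns conjugation into intertwining, and the
  central scalars \<open>t\<close> cancel, so the elements with \<open>t = 1\<close> decide.\<close>

lemma implements_iff_conj:
 assumes s: "s \<in> carrier Aut"
 shows "implements f s \<longleftrightarrow> (\<forall>a\<in>AG.
  cj s a = Uop (mu smul chi (lft f) a))"
proof -
 interpret G: group Aut
  by (rule group_Aut)
 have sl: "linop s" "\<And>\<Phi>. \<Phi> \<in> Sch \<Longrightarrow> s \<Phi> \<in> Sch"
  using s linopD(1) by (auto simp: Aut_carrier)
 have iff: "cj s (emb p, t) = Uop (mu smul chi (lft f) (emb p, t)) \<longleftrightarrow>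
   (\<forall>\<Phi>\<in>Sch. s (U p \<Phi>) = (\<lambda>x. chi (fq f p) * U (f p) (s \<Phi>) x))" if t: "t * d = 1" for p t d
 proof -
  have "(chi (fq f p) * t) * (chi (- fq f p) * d) = (chi (fq f p) * chi (- fq f p)) * (t * d)"
   by (simp only: mult_ac)
  then have u: "(chi (fq f p) * t) * (chi (- fq f p) * d) = 1"
   using t by (simp add: chi_uminus)
  note UA = U_op_Aut[OF t, of p] U_op_Aut[OF u, of "f p"]
  have "cj s (emb p, t) = Uop (emb (f p), chi (fq f p) * t) \<longleftrightarrow>
    s \<otimes>\<^bsub>Aut\<^esub> Uop (emb p, t) = Uop (emb (f p), chi (fq f p) * t) \<otimes>\<^bsub>Aut\<^esub> s"
   using G.inv_solve_right'[of "s \<otimes>\<^bsub>Aut\<^esub> Uop (emb p, t)" "Uop (emb (f p), chi (fq f p) * t)" s] s UA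
   by (metis G.inv_solve_right' G.m_closed)
  also have "\<dots> \<longleftrightarrow> (\<forall>\<Phi>\<in>Sch. s (Uop (emb p, t) \<Phi>) = Uop (emb (f p), chi (fq f p) * t) (s \<Phi>))"
   unfolding Aut_mult[OF s UA(1)] Aut_mult[OF UA(2) s]
   by (auto simp: compose_def fun_eq_iff restrict_def)
  also have "\<dots> \<longleftrightarrow> (\<forall>\<Phi>\<in>Sch. s (U p \<Phi>) = (\<lambda>x. chi (fq f p) * U (f p) (s \<Phi>) x))"
  proof (rule ball_cong[OF refl])
   fix \<Phi> :: "'x \<Rightarrow> 'r" assume \<Phi>: "\<Phi> \<in> Sch"
   have "t \<noteq> 0"
    using t by auto
   then show "s (Uop (emb p, t) \<Phi>) = Uop (emb (f p), chi (fq f p) * t) (s \<Phi>) \<longleftrightarrow>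
     s (U p \<Phi>) = (\<lambda>x. chi (fq f p) * U (f p) (s \<Phi>) x)"
    using \<Phi> sl by (simp add: U_op_emb linopD(3)[OF sl(1)] U_Sch fun_eq_iff mult.assoc mult.left_commute[of _ t])
  qed
  finally show ?thesis
   unfolding mu_emb[OF t] .
 qed
 have "(\<forall>a\<in>AG. cj s a = Uop (mu smul chi (lft f) a)) \<longleftrightarrow>
   (\<forall>p. \<forall>\<Phi>\<in>Sch. s (U p \<Phi>) = (\<lambda>x. chi (fq f p) * U (f p) (s \<Phi>) x))"
 proof
  assume L: "\<forall>a\<in>AG. cj s a = Uop (mu smul chi (lft f) a)"
  have one: "(1::'r) * 1 = 1"
   by simp
  have "(emb p, 1) \<in> AG" for p
   unfolding A_carrier using one by blast
  then show "\<forall>p. \<forall>\<Phi>\<in>Sch. s (U p \<Phi>) = (\<lambda>x. chi (fq f p) * U (f p) (s \<Phi>) x)"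
   using L iff[OF one] by blast
 next
  assume R: "\<forall>p. \<forall>\<Phi>\<in>Sch. s (U p \<Phi>) = (\<lambda>x. chi (fq f p) * U (f p) (s \<Phi>) x)"
  show "\<forall>a\<in>AG. cj s a = Uop (mu smul chi (lft f) a)"
  proof
   fix a assume "a \<in> AG"
   then obtain p t d where p: "t * d = 1" "a = (emb p, t)"
    unfolding A_carrier by (elim exE conjE)
   show "cj s a = Uop (mu smul chi (lft f) a)"
    unfolding p(2) iff[OF p(1)] using R by blast
  qed
 qed
 then show ?thesis
  unfolding implements_def using s by (simp add: Aut_carrier)
qed

abbreviation MG :: "(('x \<times> ('x \<Rightarrow> 'f) \<Rightarrow> 'x \<times> ('x \<Rightarrow> 'f)) \<times> (('x \<Rightarrow> 'r) \<Rightarrow> 'x \<Rightarrow> 'r)) monoid"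
 where "MG \<equiv> Mp absv smul chi"

text \<open>The normalizer condition comes for free from the intertwining relation, because
  \<open>mu\<close> permutes the Heisenberg group; injectivity of the operators makes the value of
  \<open>pi0\<close> unambiguous.\<close>

lemma Mp_carrier_lft:
 assumes f: "symp f"
 shows "(lft f, s) \<in> carrier MG \<longleftrightarrow> implements f s \<and> s \<in> extensional Sch"
proof -
 interpret G: group Aut
  by (rule group_Aut)
 let ?mu = "mu smul chi (lft f)"
 have UA: "Uop ` AG \<subseteq> carrier Aut"
  using U_op_Aut by (auto simp: A_carrier)
 have conj: "s <#\<^bsub>Aut\<^esub> (Uop ` AG) #>\<^bsub>Aut\<^esub> inv\<^bsub>Aut\<^esub> s
   = cj s ` AG" for s
  unfolding l_coset_def r_coset_def by auto
 have norm: "s \<in> carrier (BB0_group absv smul chi) \<longleftrightarrow>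
   s \<in> carrier Aut \<and> cj s ` AG = Uop ` AG" for s
  unfolding BB0_group_def normalizer_def stabilizer_def using UA conj by simp
 have mem: "(lft f, s) \<in> carrier MG \<longleftrightarrow>
   s \<in> carrier (BB0_group absv smul chi) \<and> ?mu = pi0 absv smul chi s"
  using lft_Sp[OF f] by (simp add: Mp_def)
 show ?thesis
 proof
  assume "(lft f, s) \<in> carrier MG"
  then have s: "s \<in> carrier Aut" "cj s ` AG = Uop ` AG"
   "?mu = pi0 absv smul chi s"
   unfolding mem norm by blast+
  have "implements f s"
   unfolding implements_iff_conj[OF s(1)]
  proof
   fix a assume a: "a \<in> AG"
   have "?mu a = inv_into AG Uop (cj s a)"
    unfolding s(3) pi0_def using a by simp
   moreover have "cj s a \<in> Uop ` AG"
    using s(2) a by blast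
   ultimately show "cj s a = Uop (?mu a)"
    by (simp add: f_inv_into_f)
  qed
  then show "implements f s \<and> s \<in> extensional Sch"
   using s(1) by (simp add: Aut_carrier)
 next
  assume "implements f s \<and> s \<in> extensional Sch"
  then have i: "implements f s" and s: "s \<in> carrier Aut"
   using implementsD(1,2)[of f s] by (simp_all add: Aut_carrier)
  have c: "cj s a = Uop (?mu a)" if "a \<in> AG" for a
   using i that unfolding implements_iff_conj[OF s] by blast
  have muA: "?mu a \<in> AG" if "a \<in> AG" for a
   using mu_A_carrier[OF f] that by blast
  have "cj s ` AG = Uop ` ?mu ` AG"
   unfolding image_image by (rule image_cong[OF refl c])
  then have "s \<in> carrier (BB0_group absv smul chi)"
   unfolding norm mu_A_carrier[OF f] using s by blast
  moreover have "?mu = pi0 absv smul chi s"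
  proof (rule extensionalityI[of _ AG])
   show "?mu \<in> extensional AG" "pi0 absv smul chi s \<in> extensional AG"
    by (simp_all add: mu_def pi0_def)
   fix a assume a: "a \<in> AG"
   have "pi0 absv smul chi s a = inv_into AG Uop (Uop (?mu a))"
    unfolding pi0_def using a c[OF a] by simp
   also have "\<dots> = ?mu a"
    by (rule inv_into_f_f[OF U_op_inj muA[OF a]])
   finally show "?mu a = pi0 absv smul chi s a" ..
  qed
  ultimately show "(lft f, s) \<in> carrier MG"
   unfolding mem by blast
 qed
qed

definition to_Mp :: "('x \<times> 'x \<Rightarrow> 'x \<times> 'x) \<times> (('x \<Rightarrow> 'r) \<Rightarrow> 'x \<Rightarrow> 'r) \<Rightarrow>
  ('x \<times> ('x \<Rightarrow> 'f) \<Rightarrow> 'x \<times> ('x \<Rightarrow> 'f)) \<times> (('x \<Rightarrow> 'r) \<Rightarrow> 'x \<Rightarrow> 'r)"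
 where "to_Mp m = (lft (fst m), snd m)"

lemma to_Mp_image: "to_Mp ` carrier mpg = carrier MG"
proof (intro equalityI subsetI)
 fix m assume "m \<in> to_Mp ` carrier mpg"
 then obtain m' where m': "m = to_Mp m'" "m' \<in> carrier mpg"
  by (rule imageE)
 obtain f T where "m' = (f, T)"
  by (cases m')
 with m' have "m = to_Mp (f, T)" "(f, T) \<in> carrier mpg"
  by simp_all
 then show "m \<in> carrier MG"
  by (simp add: to_Mp_def Mp_carrier_lft mpg_carrier)
next
 fix m assume m: "m \<in> carrier MG"
 then have "fst m \<in> carrier (Sp smul)"
  by (auto simp: Mp_def)
 then obtain f where f: "symp f" "fst m = lft f"
  using Sp_lft by blast
 have "m = to_Mp (f, snd m)"
  by (simp add: to_Mp_def prod_eq_iff f(2))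
 moreover have "m = (lft f, snd m)"
  using f(2) by (intro prod_eqI) simp_all
 then have "(lft f, snd m) \<in> carrier MG"
  using m by (rule subst)
 then have "(f, snd m) \<in> carrier mpg"
  unfolding Mp_carrier_lft[OF f(1)] mpg_carrier using f(1) by blast
 ultimately show "m \<in> to_Mp ` carrier mpg"
  by (rule image_eqI)
qed

lemma to_Mp_inj:
 assumes "to_Mp a = to_Mp b"
 shows "a = b"
proof -
 have "lft (fst a) = lft (fst b)" "snd a = snd b"
  using assms unfolding to_Mp_def prod.inject by blast+
 then show ?thesis
  by (intro prod_eqI lft_inject)
qed

lemma lft_hom: "lft \<circ> fst \<in> hom mpg (Sp smul)"
proof (rule homI)
 fix a b assume ab: "a \<in> carrier mpg" "b \<in> carrier mpg"
 then have s: "symp (fst a)" "symp (fst b)"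
  by (cases a; cases b; simp add: mpg_carrier)+
 then show "(lft \<circ> fst) a \<in> carrier (Sp smul)"
  by (simp add: lft_Sp)
 have "fst (a \<otimes>\<^bsub>mpg\<^esub> b) = fst a \<circ> fst b"
  by (cases a; cases b; simp add: mpg_mult)
 then show "(lft \<circ> fst) (a \<otimes>\<^bsub>mpg\<^esub> b) = (lft \<circ> fst) a \<otimes>\<^bsub>Sp smul\<^esub> (lft \<circ> fst) b"
  using Sp_simps(1)[OF lft_Bij[OF sympD(3)[OF s(1)]] lft_Bij[OF sympD(3)[OF s(2)]]]
  by (simp only: comp_apply lft_comp)
qed

lemma to_Mp_hom: "to_Mp \<in> hom mpg MG"
proof (rule homI)
 fix a b assume ab: "a \<in> carrier mpg" "b \<in> carrier mpg"
 show "to_Mp a \<in> carrier MG"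
  using ab(1) to_Mp_image by blast
 have "snd m \<in> carrier Aut" if "m \<in> carrier mpg" for m
  using that implementsD(1,2)[of "fst m" "snd m"] mpg_carrier[of "fst m" "snd m"] by (simp add: Aut_carrier)
 then have "snd a \<in> carrier Aut" "snd b \<in> carrier Aut"
  using ab by blast+
 then have "snd a \<otimes>\<^bsub>Aut\<^esub> snd b = compose Sch (snd a) (snd b)"
  by (rule Aut_mult)
 moreover have "snd (a \<otimes>\<^bsub>mpg\<^esub> b) = compose Sch (snd a) (snd b)"
  by (cases a; cases b; simp add: mpg_mult)
 moreover have "lft (fst (a \<otimes>\<^bsub>mpg\<^esub> b)) = lft (fst a) \<otimes>\<^bsub>Sp smul\<^esub> lft (fst b)"
  using hom_mult[OF lft_hom ab] by simp
 ultimately show "to_Mp (a \<otimes>\<^bsub>mpg\<^esub> b) = to_Mp a \<otimes>\<^bsub>MG\<^esub> to_Mp b"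
  by (simp add: to_Mp_def Mp_def DirProd_def BB0_group_def)
qed

text \<open>Obtained as a homomorphic image of \<open>mpg\<close>; surjectivity is the existence of
  lifts.\<close>

lemma group_Sp: "group (Sp smul)"
proof -
 have "(lft \<circ> fst) ` carrier mpg = carrier (Sp smul)"
 proof (intro equalityI subsetI)
  fix \<sigma> assume "\<sigma> \<in> (lft \<circ> fst) ` carrier mpg"
  then show "\<sigma> \<in> carrier (Sp smul)"
   using hom_in_carrier[OF lft_hom] by blast
 next
  fix \<sigma> assume "\<sigma> \<in> carrier (Sp smul)"
  then obtain f where f: "symp f" "\<sigma> = lft f"
   using Sp_lft by blast
  then obtain T where "(f, T) \<in> carrier mpg"
   using Lam_lift by blast
  then show "\<sigma> \<in> (lft \<circ> fst) ` carrier mpg"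
   by (rule image_eqI[rotated]) (simp add: f(2))
 qed
 moreover have "(lft \<circ> fst) \<one>\<^bsub>mpg\<^esub> = \<one>\<^bsub>Sp smul\<^esub>"
  by (simp add: mpg_one lft_id Sp_simps)
 ultimately show ?thesis
  using group.hom_imp_img_group[OF group_mpg lft_hom] by simp
qed

lemma to_Mp_one: "to_Mp \<one>\<^bsub>mpg\<^esub> = \<one>\<^bsub>MG\<^esub>"
 by (simp add: to_Mp_def mpg_one lft_id Mp_def DirProd_def Sp_simps BB0_group_def Aut_Schwartz_def
   BijGroup_def Schwartz_space_eq)

lemma group_Mp: "group MG"
 using group.hom_imp_img_group[OF group_mpg to_Mp_hom] unfolding to_Mp_image to_Mp_one by simp

section \<open>The twofold cover and its exact sequence\<close>

definition Mp2 :: "(('x \<times> ('x \<Rightarrow> 'f) \<Rightarrow> 'x \<times> ('x \<Rightarrow> 'f)) \<times> (('x \<Rightarrow> 'r) \<Rightarrow> 'x \<Rightarrow> 'r)) set"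
 where "Mp2 = to_Mp ` {m \<in> carrier mpg. Lam m = 1}"

abbreviation MG2 :: "(('x \<times> ('x \<Rightarrow> 'f) \<Rightarrow> 'x \<times> ('x \<Rightarrow> 'f)) \<times> (('x \<Rightarrow> 'r) \<Rightarrow> 'x \<Rightarrow> 'r)) monoid"
 where "MG2 \<equiv> MG\<lparr>carrier := Mp2\<rparr>"

lemma Mp2_iff: "(lft f, T) \<in> Mp2 \<longleftrightarrow> (f, T) \<in> carrier mpg \<and> Lam (f, T) = 1"
proof
 assume "(lft f, T) \<in> Mp2"
 then obtain m where m: "(lft f, T) = to_Mp m" "m \<in> carrier mpg" "Lam m = 1"
  unfolding Mp2_def by blast
 then have "to_Mp (f, T) = to_Mp m"
  by (simp add: to_Mp_def)
 from to_Mp_inj[OF this] show "(f, T) \<in> carrier mpg \<and> Lam (f, T) = 1"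
  using m by simp
next
 assume "(f, T) \<in> carrier mpg \<and> Lam (f, T) = 1"
 then show "(lft f, T) \<in> Mp2"
  unfolding Mp2_def by (intro image_eqI[of _ _ "(f, T)"]) (simp_all add: to_Mp_def)
qed

lemma subgroup_Mp2: "subgroup Mp2 MG"
proof -
 interpret G: group mpg
  by (rule group_mpg)
 have one: "Lam \<one>\<^bsub>mpg\<^esub> = 1"
  using Lam_scalar(2)[of 1 1] by (simp add: mpg_one)
 have "subgroup {m \<in> carrier mpg. Lam m = 1} mpg"
 proof (rule G.subgroupI)
  show "{m \<in> carrier mpg. Lam m = 1} \<noteq> {}"
   using one G.one_closed by blast
  show "inv\<^bsub>mpg\<^esub> m \<in> {m \<in> carrier mpg. Lam m = 1}" if "m \<in> {m \<in> carrier mpg. Lam m = 1}" for m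
   using that Lam_mult[of m "inv\<^bsub>mpg\<^esub> m"] one by simp
 qed (auto simp: Lam_mult)
 moreover have "group_hom mpg MG to_Mp"
  by (simp add: group_hom_def group_hom_axioms_def group_mpg group_Mp to_Mp_hom)
 ultimately show ?thesis
  unfolding Mp2_def by (rule group_hom.subgroup_img_is_subgroup[rotated])
qed

lemma Mp2_simps:
 "carrier MG2 = Mp2"
 "\<one>\<^bsub>MG2\<^esub> = \<one>\<^bsub>MG\<^esub>"
 "a \<otimes>\<^bsub>MG2\<^esub> b = a \<otimes>\<^bsub>MG\<^esub> b"
 by simp_all

lemma fst_hom: "Mp_proj \<in> hom MG2 (Sp smul)"
proof (rule homI)
 fix a b assume "a \<in> carrier MG2"
 then have "a \<in> carrier MG"
  using subgroup.subset[OF subgroup_Mp2] by auto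
 then show "Mp_proj a \<in> carrier (Sp smul)"
  by (auto simp: Mp_def Mp_proj_def)
 show "Mp_proj (a \<otimes>\<^bsub>MG2\<^esub> b) = Mp_proj a \<otimes>\<^bsub>Sp smul\<^esub> Mp_proj b"
  by (cases a; cases b; simp add: Mp_def Mp_proj_def DirProd_def)
qed

lemma Mp_incl_eq: "Mp_incl absv smul c = to_Mp (id, \<lambda>\<Phi>\<in>Sch. \<lambda>x. c * \<Phi> x)"
 by (simp add: Mp_incl_def to_Mp_def lft_id Schwartz_space_eq)

lemma Mp_incl_Mp2:
 assumes "c \<in> {1, - 1 :: 'r}"
 shows "Mp_incl absv smul c \<in> Mp2"
proof -
 have "c * c = 1"
  using assms by auto
 then show ?thesis
  unfolding Mp_incl_eq Mp2_def using Lam_scalar[of c c] by (intro imageI) (simp add: power2_eq_square)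
qed

lemma short_exact_Mp2:
 "short_exact sign_group MG2 (Sp smul) (Mp_incl absv smul) Mp_proj"
 unfolding short_exact_def
proof (intro conjI)
 show "group (sign_group :: 'r monoid)" "group (Sp smul)"
  by (rule group_sign_group, rule group_Sp)
 show "group MG2"
  by (rule group.subgroup_imp_group[OF group_Mp subgroup_Mp2])
 have sq: "c * c = 1" if "c \<in> carrier sign_group" for c :: 'r
  using that by (auto simp: sign_group_simps)
 show "Mp_incl absv smul \<in> mon sign_group MG2"
  unfolding mon_def
 proof (intro CollectI conjI homI inj_onI)
  fix c e :: 'r assume ce: "c \<in> carrier sign_group" "e \<in> carrier sign_group"
  show "Mp_incl absv smul c \<in> carrier MG2"
   using ce(1) Mp_incl_Mp2 by (simp add: sign_group_simps)
  have "(id, \<lambda>\<Phi>\<in>Sch. \<lambda>x. c * \<Phi> x) \<otimes>\<^bsub>mpg\<^esub> (id, \<lambda>\<Phi>\<in>Sch. \<lambda>x. e * \<Phi> x) = (id, \<lambda>\<Phi>\<in>Sch. \<lambda>x. c * e * \<Phi> x)"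
   unfolding mpg_mult by (auto simp: compose_def scale_Sch mult.assoc fun_eq_iff)
  then show "Mp_incl absv smul (c \<otimes>\<^bsub>sign_group\<^esub> e)
    = Mp_incl absv smul c \<otimes>\<^bsub>MG2\<^esub> Mp_incl absv smul e"
   unfolding Mp2_simps Mp_incl_eq sign_group_simps
   using hom_mult[OF to_Mp_hom Lam_scalar(1)[OF sq[OF ce(1)]] Lam_scalar(1)[OF sq[OF ce(2)]]] by simp
 next
  fix c e :: 'r assume "Mp_incl absv smul c = Mp_incl absv smul e"
  then have "(\<lambda>\<Phi>\<in>Sch. \<lambda>x. c * \<Phi> x) = (\<lambda>\<Phi>\<in>Sch. \<lambda>x :: 'x. e * \<Phi> x)"
   unfolding Mp_incl_eq to_Mp_def by simp
  from fun_cong[OF fun_cong[OF this, of "ind 0"], of 0] show "c = e"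
   by (simp add: ind_Sch) (simp add: ind_def)
 qed
 have "\<sigma> \<in> Mp_proj ` Mp2" if \<sigma>: "\<sigma> \<in> carrier (Sp smul)" for \<sigma>
 proof -
  obtain f where f: "symp f" "\<sigma> = lft f"
   using Sp_lft[OF \<sigma>] by blast
  obtain T where "(lft f, T) \<in> Mp2"
   using Lam_lift[OF f(1)] Mp2_iff by blast
  then show ?thesis
   by (rule image_eqI[rotated]) (simp add: Mp_proj_def f(2))
 qed
 then show "Mp_proj \<in> epi MG2 (Sp smul)"
  unfolding epi_def using fst_hom by (auto simp: hom_def)
 show "Mp_incl absv smul ` carrier (sign_group :: 'r monoid)
   = kernel MG2 (Sp smul) Mp_proj"
 proof (intro equalityI subsetI)
  fix m assume "m \<in> Mp_incl absv smul ` carrier (sign_group :: 'r monoid)"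
  then obtain c where c: "c \<in> {1, - 1 :: 'r}" "m = Mp_incl absv smul c"
   unfolding sign_group_simps by (elim imageE)
  then show "m \<in> kernel MG2 (Sp smul) Mp_proj"
   using Mp_incl_Mp2[OF c(1)] by (simp add: kernel_def Mp_proj_def Mp_incl_def Sp_simps)
 next
  fix m assume "m \<in> kernel MG2 (Sp smul) Mp_proj"
  then have m: "m \<in> Mp2" "fst m = lft id"
   by (simp_all add: kernel_def Mp_proj_def Sp_simps lft_id)
  obtain T where T: "m = (lft id, T)"
   using m(2) by (cases m) simp
  have T': "(id, T) \<in> carrier mpg" "Lam (id, T) = 1"
   using m(1) unfolding T Mp2_iff by simp_all
  then have i: "implements id T" "T \<in> extensional Sch"
   by (simp_all add: mpg_carrier)
  \<comment> \<open>Implementing the identity means commuting with all \<open>U p\<close>, so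
    \<open>T\<close> is a scalar, and \<open>Lam\<close> of a scalar is its square.\<close>
  obtain c d where c: "c * d = 1" "\<forall>\<Phi>\<in>Sch. T \<Phi> = (\<lambda>x. c * \<Phi> x)"
   using implements_unique[OF i(1) implements_id] by (elim exE conjE)
  have Tc: "T = (\<lambda>\<Phi>\<in>Sch. \<lambda>x. c * \<Phi> x)"
   by (rule extensionalityI[OF i(2)]) (simp_all add: c(2))
  have "c\<^sup>2 = 1"
   using T'(2) Lam_scalar(2)[OF c(1)] unfolding Tc by simp
  then have "c \<in> {1, - 1}"
   by (simp add: power2_eq_1_iff)
  moreover have "m = Mp_incl absv smul c"
   unfolding T Tc Mp_incl_eq to_Mp_def by simp
  ultimately show "m \<in> Mp_incl absv smul ` carrier sign_group"
   unfolding sign_group_simps by (rule image_eqI[rotated])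
 qed
qed

lemma not_splits_Mp2:
 assumes "0 < n"
 shows "\<not> splits MG2 (Sp smul) Mp_proj"
proof
 assume "splits MG2 (Sp smul) Mp_proj"
 then obtain h where h: "h \<in> hom (Sp smul) MG2"
  "\<And>\<sigma>. \<sigma> \<in> carrier (Sp smul) \<Longrightarrow> Mp_proj (h \<sigma>) = \<sigma>"
  unfolding splits_def by blast
 define k where "k f = snd (h (lft f))" for f
 have hk: "h (lft f) = to_Mp (f, k f)" "(f, k f) \<in> carrier mpg \<and> Lam (f, k f) = 1" if f: "symp f" for f
 proof -
  have "fst (h (lft f)) = lft f"
   using h(2)[OF lft_Sp[OF f]] by (simp add: Mp_proj_def)
  then show e: "h (lft f) = to_Mp (f, k f)"
   by (simp add: to_Mp_def k_def prod_eq_iff)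
  have "h (lft f) \<in> Mp2"
   using hom_in_carrier[OF h(1) lft_Sp[OF f]] by simp
  then show "(f, k f) \<in> carrier mpg \<and> Lam (f, k f) = 1"
   unfolding e to_Mp_def by (simp add: Mp2_iff)
 qed
 show False
 proof (rule no_section[OF assms hk(2)])
  fix f g assume fg: "symp f" "symp g"
  have "lft (f \<circ> g) = lft f \<otimes>\<^bsub>Sp smul\<^esub> lft g"
   using Sp_simps(1)[OF lft_Bij[OF sympD(3)[OF fg(1)]] lft_Bij[OF sympD(3)[OF fg(2)]]] by (simp add: lft_comp)
  then have "to_Mp (f \<circ> g, k (f \<circ> g)) = to_Mp (f, k f) \<otimes>\<^bsub>MG\<^esub> to_Mp (g, k g)"
   using hom_mult[OF h(1) lft_Sp[OF fg(1)] lft_Sp[OF fg(2)]] hk(1)[OF fg(1)] hk(1)[OF fg(2)]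
    hk(1)[OF symp_comp[OF fg]] by simp
  also have "\<dots> = to_Mp ((f, k f) \<otimes>\<^bsub>mpg\<^esub> (g, k g))"
   using hom_mult[OF to_Mp_hom, of "(f, k f)" "(g, k g)"] hk(2)[OF fg(1)] hk(2)[OF fg(2)] by simp
  finally show "k (f \<circ> g) = compose Sch (k f) (k g)"
   unfolding mpg_mult by (auto dest: to_Mp_inj)
 qed
qed

end

lemma two_neq_0_if_CHAR:
 assumes "CHAR('a::idom) \<noteq> 2"
 shows "(2::'a) \<noteq> 0"
proof
 assume "(2::'a) = 0"
 then have "CHAR('a) dvd 2"
  using of_nat_eq_0_iff_char_dvd[of 2, where ?'a = 'a] by simp
 then have "CHAR('a) = 1 \<or> CHAR('a) = 2"
  using two_is_prime_nat by (auto simp: prime_nat_iff)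
 then show False
  using assms CHAR_not_1[where ?'a = 'a] by auto
qed

lemma exists_coordinates:
 fixes smul :: "'f::field \<Rightarrow> 'x::ab_group_add \<Rightarrow> 'x"
 assumes "finite_dimensional_vector_space smul B"
 shows "\<exists>n co bv. coordinates smul n co bv"
proof -
 interpret V: finite_dimensional_vector_space smul B
  by (rule assms)
 obtain bv where bv: "bij_betw bv {0..<card B} B"
  using ex_bij_betw_nat_finite[OF V.finite_Basis] by (elim exE)
 have span: "x \<in> V.span B" for x
  by (simp add: V.span_Basis)
 let ?co = "\<lambda>i x. V.representation B x (bv i)"
 have "coordinates smul (card B) ?co bv"
 proof
  fix i x y c
  show "?co i (x + y) = ?co i x + ?co i y"
   by (simp add: V.representation_add[OF V.independent_Basis span span])
  show "?co i (smul c x) = c * ?co i x"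
   by (simp add: V.representation_scale[OF V.independent_Basis span])
 next
  fix i j assume ij: "i < card B" "j < card B"
  then have "bv j \<in> B" "bv i = bv j \<longleftrightarrow> i = j"
   using bv by (auto simp: bij_betw_def inj_on_eq_iff)
  then show "?co i (bv j) = (if i = j then 1 else 0)"
   by (auto simp: V.representation_basis[OF V.independent_Basis])
 next
  fix x
  have "x = (\<Sum>b\<in>B. smul (V.representation B x b) b)"
   using V.sum_representation_eq[OF V.independent_Basis span V.finite_Basis order_refl] by simp
  also have "\<dots> = (\<Sum>i<card B. smul (?co i x) (bv i))"
   using bv by (intro sum.reindex_bij_betw[symmetric]) (simp add: lessThan_atLeast0)
  finally show "x = (\<Sum>i<card B. smul (?co i x) (bv i))" .
 qed
 then show ?thesis
  by blast
qed

theorem mainTheorem1: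
  fixes absv :: "'f::field \<Rightarrow> real"
    and smul :: "'f \<Rightarrow> 'x::ab_group_add \<Rightarrow> 'x"
    and chi :: "'f \<Rightarrow> 'r::idom"
    and p q :: nat
  assumes "nonarch_local_field absv"
    and "CHAR('f) \<noteq> 2"
    and "p = ring_characteristic (residue_field absv)"
    and "q = card (carrier (residue_field absv))"
    and "(of_nat p :: 'r) \<in> carrier unit_group"
    and "\<exists>s::'r. s ^ 2 = of_nat q"
    and "smooth_character absv chi"
    and "\<exists>x. chi x \<noteq> 1"
    and "\<exists>B. finite_dimensional_vector_space smul B"
    and "\<exists>x::'x. x \<noteq> 0"
    and "CHAR('r) \<noteq> 2"
  shows "\<exists>Mp2. subgroup Mp2 (Mp absv smul chi) \<and>
    short_exact sign_group (Mp absv smul chi \<lparr>carrier := Mp2\<rparr>) (Sp smul)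
      (Mp_incl absv smul) Mp_proj \<and>
    \<not> splits (Mp absv smul chi \<lparr>carrier := Mp2\<rparr>) (Sp smul) Mp_proj"
proof -
 interpret nonarch_local_field absv
  by (rule assms(1))
 obtain n co bv where "coordinates smul n co bv"
  using assms(9) exists_coordinates by blast
 then interpret coordinates smul n co bv .
 obtain d where "of_nat p * d = (1::'r)"
  using assms(5) unfolding unit_group_iff by (elim exE)
 then obtain iq where iq: "of_nat resq * iq = (1::'r)"
  using resq_unit unfolding assms(3) by blast
 have chi: "\<And>x y. chi (x + y) = chi x * chi y" "chi 0 \<in> carrier unit_group"
  "openin (field_topology absv) {x. chi x = 1}"
  using assms(7) by (simp_all add: smooth_character_def)
 \<comment> \<open>Additivity makes \<open>chi 0\<close> idempotent, and an idempotent unit is 1;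
   hence the open kernel contains a fractional ideal.\<close>
 have "chi 0 * chi 0 = chi 0"
  using chi(1)[of 0 0] by simp
 then have "chi 0 = 1"
  using chi(2) unfolding unit_group_iff by (metis mult.assoc mult.commute mult_1_right)
 then have "0 \<in> {x. chi x = 1}"
  by simp
 with chi(3) obtain k where "\<And>y. y - 0 \<in> fideal k \<Longrightarrow> y \<in> {x. chi x = 1}"
  by (rule openin_field_fideal) blast
 then have "\<forall>x\<in>fideal k. chi x = 1"
  by simp
 then have "weil absv chi iq smul n co bv"
  using two_neq_0_if_CHAR[OF assms(2)] two_neq_0_if_CHAR[OF assms(11)] iq chi(1) assms(8)
  by unfold_locales blast+
 then interpret weil absv chi iq smul n co bv .
 \<comment> \<open>A nonzero space has a coordinate, along which the failure of multiplicativity of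
   the Gauss sums can be observed.\<close>
 have "0 < n"
 proof (rule ccontr)
  assume "\<not> 0 < n"
  then have "x = 0" for x :: 'x
   by (intro co_eqI) simp
  then show False
   using assms(10) by blast
 qed
 then show ?thesis
  using subgroup_Mp2 short_exact_Mp2 not_splits_Mp2 by blast
qed

end
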